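(* Let $d\ge2$, $k\ge1$, and let $T\subset\mathbb R^d$ be a $d$-simplex with barycentric refinement $T^{\rm R}$. All sums in the definition (see context) of $\Sigma_{k,\phi}^{\operatorname{div}}(T^{\rm R};\mathbb S)$ are direct sums. The space $\Sigma_{k,\phi}^{\operatorname{div}}(T^{\rm R};\mathbb S)$ is a finite-dimensional subspace of $H(\operatorname{div},T;\mathbb S)$, and $$\dim\Sigma_{k,\phi}^{\operatorname{div}}(T^{\rm R};\mathbb S)=d(d+1)\binom{k+d-1}{d-1}+\tfrac12d(d+1)\binom{k+d-2}{d-1}+\tfrac12d(d+1)(k-1)\binom{k+d-2}{d-2}+\tfrac12d(d+1)^2\binom{k+d-2}{d}=\tfrac12(d+1)\binom{k+d-1}{k}\big((d+1)k+d\big).$$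
   Context: $\mathbb S$: real symmetric $d\times d$ matrices; $\operatorname{sym}\boldsymbol\tau=(\boldsymbol\tau+\boldsymbol\tau^{\intercal})/2$; $\mathbb S(V)=\operatorname{sym}(V\otimes V)$ for a subspace $V\subseteq\mathbb R^d$. $H(\operatorname{div},D;\mathbb S)=\{\boldsymbol\tau\in L^2(D;\mathbb S):\operatorname{div}\boldsymbol\tau\in L^2(D;\mathbb R^d)\}$ (row-wise divergence), $H_0(\operatorname{div},D;\mathbb S)$ is its subspace with $\boldsymbol\tau\boldsymbol n|_{\partial D}=0$. Split. $T$ has vertices $\texttt v_0,\dots,\texttt v_d$ and barycenter $\texttt v_c$; $T_i$ is the simplex obtained from $T$ by replacing $\texttt v_i$ by $\texttt v_c$; $T^{\rm R}=\{T_0,\dots,T_d\}$. $\Delta_\ell(\cdot)$ denotes the set of $\ell$-dimensional subsimplices; $\Delta_\ell(\mathring T^{\rm R})=\Delta_\ell(T^{\rm R})\setminus\Delta_\ell(T)$ are those containing $\texttt v_c$. Subsimplices are identified with subsets of $\{0,\dots,d,c\}$. For $f\in\Delta_\ell(T)$, $f^*=\{0,\dots,d\}\setminus f$, and $f(0)$ is a fixed (say the first) vertex of $f$. $\boldsymbol n_F$ is a fixed unit normal of a $(d-1)$-face $F$. $\boldsymbol t_{i,j}=\texttt v_j-\texttt v_i$ for $i,j\in\{0,\dots,d,c\}$. $\mathscr T^f$ is the tangent space of $f$, $\mathscr N^f$ its orthogonal complement, $\mathscr N^f(\mathbb S)=\mathbb S(\mathscr N^f)\oplus\operatorname{sym}(\mathscr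 T^f\otimes\mathscr N^f)$. The interior $(d-1)$-faces are $F_{ij}=T_i\cap T_j$, $0\le i<j\le d$. Bubbles. $\lambda_i^{\rm R}$ ($i\in\{0,\dots,d,c\}$) is the continuous piecewise linear function on $T^{\rm R}$ with $\lambda_i^{\rm R}(\texttt v_j)=\delta_{ij}$; $b_f^{\rm R}=\prod_{i\in f}\lambda_i^{\rm R}$. $\mathbb P_r(f)$ is the space of polynomials of degree $\le r$ on $f$, $\{0\}$ if $r<0$, and $\mathbb R$ if $f$ is a vertex and $r\ge0$; its elements are extended to $T$ as homogeneous polynomials of degree $r$ in $\lambda_i^{\rm R}$, $i\in f$. For $f\in\Delta_\ell(T^{\rm R})$ and a space $V^f$ of tensors (constant or piecewise constant), $\mathbb B_kV^f=b_f^{\rm R}\,\mathbb P_{k-\ell-1}(f)\otimes V^f$. Enrichment. For $f\in\Delta_\ell(T)$ and $i,j\in f^*$, $\boldsymbol\phi^f_{ij}=\chi_{T_i}\operatorname{sym}(\boldsymbol t_{f(0),c}\otimes\boldsymbol t_{f(0),j})-\chi_{T_j}\operatorname{sym}(\boldsymbol t_{f(0),c}\otimes\boldsymbol t_{f(0),i})$, and $\Phi^f(\mathbb S)=\operatorname{span}\{\boldsymbol\phi^f_{ij}:i,j\in f^*,i<j\}$ (so $\Phi^F(\mathbb S)=\{0\}$ for $F\in\Delta_{d-1}(T)$). Interior tangential-normal functions. For an interior face $F=T_i\cap T_j$ and $f\in\Delta_\ell(F)$, $\mathbb B_k\operatorname{sym}(\mathscr T^f\otimes\mathscr N^F)$ is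 the span of the functions supported on $T_i\cup T_j$ and equal on $T_m$, $m\in\{i,j\}$, to $b_f^{\rm R}\,p\,\operatorname{sym}(\boldsymbol t\otimes\hat{\boldsymbol n}^m)$, with $p\in\mathbb P_{k-\ell-1}(f)$, $\boldsymbol t\in\mathscr T^f$, where $\hat{\boldsymbol n}^m\in\mathscr N^f$ is determined by $\hat{\boldsymbol n}^m\cdot\boldsymbol n_F=1$ and $\hat{\boldsymbol n}^m\cdot\boldsymbol n_{F'}=0$ for all other $(d-1)$-faces $F'\supseteq f$ of $T_m$. Element bubbles. $\mathbb B_k(\operatorname{div},T_i;\mathbb S)=H_0(\operatorname{div},T_i;\mathbb S)\cap\mathbb P_k(T_i;\mathbb S)$, extended by zero to $T$. Space. $$\Sigma_{k,\phi}^{\operatorname{div}}(T^{\rm R};\mathbb S)=\sum_{\ell=0}^{d-1}\Big[\sum_{f\in\Delta_\ell(T)}\big(\mathbb B_k\mathscr N^f(\mathbb S)+\mathbb B_k\Phi^f(\mathbb S)\big)+\sum_{f\in\Delta_\ell(\mathring T^{\rm R})}\mathbb B_k\mathbb S(\mathscr N^f)\Big]+\sum_{F\in\Delta_{d-1}(\mathring T^{\rm R})}\sum_{\ell=0}^{d-1}\sum_{f\in\Delta_\ell(F)}\mathbb B_k\operatorname{sym}(\mathscr T^f\otimes\mathscr N^F)+\sum_{i=0}^d\mathbb B_k(\operatorname{div},T_i;\mathbb S).$$ *)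

theory Defs
  imports "HOL-Analysis.Analysis" "HOL-Library.Set_Algebras"
begin

section \<open>Functions modulo null sets\<close>

text \<open>
  The spaces below consist of elements of \<open>L\<^sup>2\<close>, i.e. of classes of functions that agree almost
  everywhere.  A function on a subdomain is identified with its extension by zero.
\<close>

quotient_type (overloaded) ('a, 'b) ae_fun =
  "'a::euclidean_space \<Rightarrow> 'b::real_vector" / "\<lambda>f g. AE x in lebesgue. f x = g x"
  morphisms rep_ae abs_ae
proof (rule equivpI)
  show "reflp (\<lambda>f g :: 'a \<Rightarrow> 'b. AE x in lebesgue. f x = g x)"
    by (rule reflpI) simp
  show "symp (\<lambda>f g :: 'a \<Rightarrow> 'b. AE x in lebesgue. f x = g x)"
    by (rule sympI) (auto elim: eventually_mono)
  show "transp (\<lambda>f g :: 'a \<Rightarrow> 'b. AE x in lebesgue. f x = g x)"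
    by (rule transpI) (auto elim: eventually_elim2)
qed

instantiation ae_fun :: (euclidean_space, real_vector) real_vector
begin

lift_definition zero_ae_fun :: "('a, 'b) ae_fun" is "\<lambda>_. 0" .

lift_definition plus_ae_fun :: "('a, 'b) ae_fun \<Rightarrow> ('a, 'b) ae_fun \<Rightarrow> ('a, 'b) ae_fun"
  is "\<lambda>f g x. f x + g x"
  by (auto elim: eventually_elim2)

lift_definition uminus_ae_fun :: "('a, 'b) ae_fun \<Rightarrow> ('a, 'b) ae_fun" is "\<lambda>f x. - f x"
  by (auto elim: eventually_mono)

lift_definition minus_ae_fun :: "('a, 'b) ae_fun \<Rightarrow> ('a, 'b) ae_fun \<Rightarrow> ('a, 'b) ae_fun"
  is "\<lambda>f g x. f x - g x"
  by (auto elim: eventually_elim2)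

lift_definition scaleR_ae_fun :: "real \<Rightarrow> ('a, 'b) ae_fun \<Rightarrow> ('a, 'b) ae_fun"
  is "\<lambda>r f x. r *\<^sub>R f x"
  by (auto elim: eventually_mono)

instance
  by standard (transfer; simp add: algebra_simps)+

end


section \<open>The space H(div) of symmetric tensors\<close>

definition L2_on :: "(real^'n) set \<Rightarrow> (real^'n \<Rightarrow> 'b::euclidean_space) \<Rightarrow> bool" where
  "L2_on D f \<longleftrightarrow>
     f \<in> borel_measurable (lebesgue_on D) \<and> integrable (lebesgue_on D) (\<lambda>x. (norm (f x))\<^sup>2)"

primrec C_diff :: "nat \<Rightarrow> (real^'n \<Rightarrow> 'b::real_normed_vector) \<Rightarrow> bool" where
  "C_diff 0 f \<longleftrightarrow> continuous_on UNIV f"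
| "C_diff (Suc m) f \<longleftrightarrow>
     (\<forall>x. f differentiable (at x)) \<and> (\<forall>e. C_diff m (\<lambda>x. frechet_derivative f (at x) e))"

definition C_infty :: "(real^'n \<Rightarrow> 'b::real_normed_vector) \<Rightarrow> bool" where
  "C_infty f \<longleftrightarrow> (\<forall>m. C_diff m f)"

text \<open>
  The row-wise divergence \<open>w\<^sub>i = \<Sum>\<^sub>j \<partial>\<^sub>j \<tau>\<^sub>i\<^sub>j\<close> in the sense of distributions on the interior of \<open>D\<close>.
  The entry \<open>(i, j)\<close> of the Jacobian of \<open>\<phi>\<close> is \<open>\<partial>\<^sub>j \<phi>\<^sub>i\<close>, and the inner product of matrices is
  the Frobenius product.
\<close>

definition is_weak_div ::
    "(real^'n) set \<Rightarrow> (real^'n \<Rightarrow> real^'n^'n) \<Rightarrow> (real^'n \<Rightarrow> real^'n) \<Rightarrow> bool" where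
  "is_weak_div D \<tau> w \<longleftrightarrow>
     (\<forall>\<phi> :: real^'n \<Rightarrow> real^'n.
        C_infty \<phi> \<and> compact (closure {x. \<phi> x \<noteq> 0}) \<and> closure {x. \<phi> x \<noteq> 0} \<subseteq> interior D \<longrightarrow>
        (\<integral>x. w x \<bullet> \<phi> x \<partial>lebesgue_on D) = - (\<integral>x. \<tau> x \<bullet> jacobian \<phi> (at x) \<partial>lebesgue_on D))"

text \<open>
  The normal trace \<open>\<tau> n\<close> on \<open>\<partial>D\<close> of a field in \<open>H(div, D)\<close> is the functional
  \<open>\<phi> \<mapsto> \<integral>\<^sub>D \<tau> : \<nabla>\<phi> + \<integral>\<^sub>D div \<tau> \<cdot> \<phi>\<close> given by Green's formula; test functions smooth up to the
  boundary are dense in \<open>H\<^sup>1(D)\<close> for the Lipschitz domains considered here.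
\<close>

definition normal_trace_zero ::
    "(real^'n) set \<Rightarrow> (real^'n \<Rightarrow> real^'n^'n) \<Rightarrow> (real^'n \<Rightarrow> real^'n) \<Rightarrow> bool" where
  "normal_trace_zero D \<tau> w \<longleftrightarrow>
     (\<forall>\<phi> :: real^'n \<Rightarrow> real^'n. C_infty \<phi> \<longrightarrow>
        (\<integral>x. \<tau> x \<bullet> jacobian \<phi> (at x) \<partial>lebesgue_on D) + (\<integral>x. w x \<bullet> \<phi> x \<partial>lebesgue_on D) = 0)"

definition L2_sym :: "(real^'n) set \<Rightarrow> (real^'n \<Rightarrow> real^'n^'n) set" where
  "L2_sym D = {\<tau>. L2_on D \<tau> \<and> (\<forall>x\<in>D. transpose (\<tau> x) = \<tau> x) \<and> (\<forall>x. x \<notin> D \<longrightarrow> \<tau> x = 0)}"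

definition Hdiv :: "(real^'n) set \<Rightarrow> (real^'n, real^'n^'n) ae_fun set" where
  "Hdiv D = {abs_ae \<tau> | \<tau>. \<tau> \<in> L2_sym D \<and> (\<exists>w. L2_on D w \<and> is_weak_div D \<tau> w)}"

definition Hdiv0 :: "(real^'n) set \<Rightarrow> (real^'n, real^'n^'n) ae_fun set" where
  "Hdiv0 D = {abs_ae \<tau> | \<tau>.
     \<tau> \<in> L2_sym D \<and> (\<exists>w. L2_on D w \<and> is_weak_div D \<tau> w \<and> normal_trace_zero D \<tau> w)}"


section \<open>The barycentric refinement\<close>

text \<open>
  Subsimplices are finite sets of indices.  The vertices of the simplex have the indices
  \<open>0, \<dots>, d\<close>, where \<open>d = CARD('n)\<close>, and the index \<open>d + 1\<close> plays the role of \<open>c\<close>.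
\<close>

definition vertex :: "(nat \<Rightarrow> real^'n) \<Rightarrow> nat \<Rightarrow> real^'n" where
  "vertex v i =
     (if i = CARD('n) + 1 then (1 / real (CARD('n) + 1)) *\<^sub>R (\<Sum>j\<le>CARD('n). v j) else v i)"

definition edge_vec :: "(nat \<Rightarrow> real^'n) \<Rightarrow> nat \<Rightarrow> nat \<Rightarrow> real^'n" where
  "edge_vec v i j = vertex v j - vertex v i"

definition cell_idx :: "nat \<Rightarrow> nat \<Rightarrow> nat set" where
  "cell_idx d i = {..d+1} - {i}"

definition cell :: "(nat \<Rightarrow> real^'n) \<Rightarrow> nat \<Rightarrow> (real^'n) set" where
  "cell v i = convex hull (vertex v ` cell_idx (CARD('n)) i)"

definition subsimp :: "nat \<Rightarrow> nat set \<Rightarrow> nat set set" where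
  "subsimp l f = {e. e \<subseteq> f \<and> card e = l + 1}"

definition split_subsimp :: "nat \<Rightarrow> nat \<Rightarrow> nat set set" where
  "split_subsimp d l = (\<Union>i\<le>d. subsimp l (cell_idx d i))"

definition interior_subsimp :: "nat \<Rightarrow> nat \<Rightarrow> nat set set" where
  "interior_subsimp d l = split_subsimp d l - subsimp l {..d}"

definition tangent :: "(nat \<Rightarrow> real^'n) \<Rightarrow> nat set \<Rightarrow> (real^'n) set" where
  "tangent v f = span {edge_vec v i j | i j. i \<in> f \<and> j \<in> f}"

definition normal_comp :: "(nat \<Rightarrow> real^'n) \<Rightarrow> nat set \<Rightarrow> (real^'n) set" where
  "normal_comp v f = orthogonal_comp (tangent v f)"


section \<open>Constant tensors\<close>

definition sym_tensor :: "real^'n \<Rightarrow> real^'n \<Rightarrow> real^'n^'n" where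
  "sym_tensor a b = (1/2) *\<^sub>R ((\<chi> i j. a $ i * b $ j) + transpose (\<chi> i j. a $ i * b $ j))"

definition sym_space :: "(real^'n) set \<Rightarrow> (real^'n) set \<Rightarrow> (real^'n^'n) set" where
  "sym_space V W = span {sym_tensor a b | a b. a \<in> V \<and> b \<in> W}"

definition normal_tensors :: "(nat \<Rightarrow> real^'n) \<Rightarrow> nat set \<Rightarrow> (real^'n^'n) set" where
  "normal_tensors v f =
     sym_space (normal_comp v f) (normal_comp v f) + sym_space (tangent v f) (normal_comp v f)"


section \<open>Bubble spaces\<close>

definition hat :: "(nat \<Rightarrow> real^'n) \<Rightarrow> nat \<Rightarrow> real^'n \<Rightarrow> real" where
  "hat v i = (THE g.
     continuous_on (convex hull (v ` {..CARD('n)})) g \<and>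
     (\<forall>m\<le>CARD('n). \<exists>a b. \<forall>x\<in>cell v m. g x = a \<bullet> x + b) \<and>
     (\<forall>j\<le>CARD('n)+1. g (vertex v j) = (if j = i then 1 else 0)) \<and>
     (\<forall>x. x \<notin> convex hull (v ` {..CARD('n)}) \<longrightarrow> g x = 0))"

definition bub :: "(nat \<Rightarrow> real^'n) \<Rightarrow> nat set \<Rightarrow> real^'n \<Rightarrow> real" where
  "bub v f x = (\<Prod>i\<in>f. hat v i x)"

text \<open>
  The extension to the whole simplex of polynomials of degree at most \<open>r\<close> on \<open>f\<close>, as homogeneous
  polynomials of degree \<open>r\<close> in the hat functions of the vertices of \<open>f\<close>.  For \<open>r < 0\<close> there are no
  exponents \<open>\<alpha>\<close>, and the space is zero.
\<close>

definition face_poly :: "(nat \<Rightarrow> real^'n) \<Rightarrow> int \<Rightarrow> nat set \<Rightarrow> (real^'n \<Rightarrow> real) set" where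
  "face_poly v r f = {p. \<exists>a. p = (\<lambda>x.
     \<Sum>\<alpha>\<in>{\<alpha>. (\<forall>i. i \<notin> f \<longrightarrow> \<alpha> i = 0) \<and> int (\<Sum>i\<in>f. \<alpha> i) = r}. a \<alpha> * (\<Prod>i\<in>f. hat v i x ^ \<alpha> i))}"

text \<open>For \<open>f\<close> of dimension \<open>l\<close>, the degree \<open>k - l - 1\<close> is \<open>k - card f\<close>.\<close>

definition bubble :: "(nat \<Rightarrow> real^'n) \<Rightarrow> nat \<Rightarrow> nat set \<Rightarrow> (real^'n \<Rightarrow> real^'n^'n) set \<Rightarrow>
    (real^'n, real^'n^'n) ae_fun set" where
  "bubble v k f V = span {abs_ae (\<lambda>x. (bub v f x * p x) *\<^sub>R A x) | p A.
     p \<in> face_poly v (int k - int (card f)) f \<and> A \<in> V}"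

definition const_fields :: "(real^'n^'n) set \<Rightarrow> (real^'n \<Rightarrow> real^'n^'n) set" where
  "const_fields V = {\<lambda>_. A | A. A \<in> V}"

text \<open>The argument \<open>z\<close> selects the vertex \<open>f(0) = z f\<close> of \<open>f\<close>.\<close>

definition enrich_fun :: "(nat \<Rightarrow> real^'n) \<Rightarrow> (nat set \<Rightarrow> nat) \<Rightarrow> nat set \<Rightarrow> nat \<Rightarrow> nat \<Rightarrow>
    real^'n \<Rightarrow> real^'n^'n" where
  "enrich_fun v z f i j x =
     indicat_real (cell v i) x *\<^sub>R
       sym_tensor (edge_vec v (z f) (CARD('n) + 1)) (edge_vec v (z f) j) -
     indicat_real (cell v j) x *\<^sub>R
       sym_tensor (edge_vec v (z f) (CARD('n) + 1)) (edge_vec v (z f) i)"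

definition enrich_space :: "(nat \<Rightarrow> real^'n) \<Rightarrow> (nat set \<Rightarrow> nat) \<Rightarrow> nat set \<Rightarrow>
    (real^'n \<Rightarrow> real^'n^'n) set" where
  "enrich_space v z f = {\<tau>. \<exists>a. \<tau> = (\<lambda>x.
     \<Sum>(i, j)\<in>{(i, j). i \<in> {..CARD('n)} - f \<and> j \<in> {..CARD('n)} - f \<and> i < j}.
       a i j *\<^sub>R enrich_fun v z f i j x)}"

text \<open>The vector \<open>n\<close>-hat on the cell with index \<open>m\<close>; \<open>nu F\<close> is the fixed unit normal of \<open>F\<close>.\<close>

definition nhat :: "(nat \<Rightarrow> real^'n) \<Rightarrow> (nat set \<Rightarrow> real^'n) \<Rightarrow> nat set \<Rightarrow> nat set \<Rightarrow> nat \<Rightarrow> real^'n"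
  where
  "nhat v nu F f m = (THE h.
     h \<in> normal_comp v f \<and> h \<bullet> nu F = 1 \<and>
     (\<forall>F'\<in>subsimp (CARD('n) - 1) (cell_idx (CARD('n)) m). f \<subseteq> F' \<and> F' \<noteq> F \<longrightarrow> h \<bullet> nu F' = 0))"

text \<open>For an interior face \<open>F\<close>, exactly two cells \<open>m\<close> contain \<open>F\<close>.\<close>

definition tn_bubble :: "(nat \<Rightarrow> real^'n) \<Rightarrow> (nat set \<Rightarrow> real^'n) \<Rightarrow> nat \<Rightarrow> nat set \<Rightarrow> nat set \<Rightarrow>
    (real^'n, real^'n^'n) ae_fun set" where
  "tn_bubble v nu k F f = span {abs_ae (\<lambda>x.
       \<Sum>m\<in>{m. m \<le> CARD('n) \<and> F \<subseteq> cell_idx (CARD('n)) m}.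
         (indicat_real (cell v m) x * bub v f x * p x) *\<^sub>R sym_tensor t (nhat v nu F f m)) | p t.
     p \<in> face_poly v (int k - int (card f)) f \<and> t \<in> tangent v f}"

definition poly_le :: "nat \<Rightarrow> (real^'n \<Rightarrow> real) set" where
  "poly_le k = {p. \<exists>a. p = (\<lambda>x.
     \<Sum>\<alpha>\<in>{\<alpha> :: 'n \<Rightarrow> nat. (\<Sum>j\<in>UNIV. \<alpha> j) \<le> k}. a \<alpha> * (\<Prod>j\<in>UNIV. (x $ j) ^ \<alpha> j))}"

definition poly_sym :: "(nat \<Rightarrow> real^'n) \<Rightarrow> nat \<Rightarrow> nat \<Rightarrow> (real^'n, real^'n^'n) ae_fun set" where
  "poly_sym v k i = {abs_ae (\<lambda>x. indicat_real (cell v i) x *\<^sub>R \<tau> x) | \<tau>.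
     (\<forall>x. transpose (\<tau> x) = \<tau> x) \<and> (\<forall>a b. (\<lambda>x. \<tau> x $ a $ b) \<in> poly_le k)}"

definition div_bubble :: "(nat \<Rightarrow> real^'n) \<Rightarrow> nat \<Rightarrow> nat \<Rightarrow> (real^'n, real^'n^'n) ae_fun set" where
  "div_bubble v k i = Hdiv0 (cell v i) \<inter> poly_sym v k i"


section \<open>The space and its summands\<close>

text \<open>Sums of subspaces are the pointwise sums of sets of \<^theory>\<open>HOL-Library.Set_Algebras\<close>.\<close>

definition Sigma_div :: "(nat \<Rightarrow> real^'n) \<Rightarrow> (nat set \<Rightarrow> real^'n) \<Rightarrow> (nat set \<Rightarrow> nat) \<Rightarrow> nat \<Rightarrow>
    (real^'n, real^'n^'n) ae_fun set" where
  "Sigma_div v nu z k = (let d = CARD('n) in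
     (\<Sum>l\<in>{0..d-1}.
        (\<Sum>f\<in>subsimp l {..d}.
           bubble v k f (const_fields (normal_tensors v f)) + bubble v k f (enrich_space v z f)) +
        (\<Sum>f\<in>interior_subsimp d l.
           bubble v k f (const_fields (sym_space (normal_comp v f) (normal_comp v f))))) +
     (\<Sum>F\<in>interior_subsimp d (d-1). \<Sum>l\<in>{0..d-1}. \<Sum>f\<in>subsimp l F. tn_bubble v nu k F f) +
     (\<Sum>i\<in>{0..d}. div_bubble v k i))"

datatype summand =
    NormalTensors "nat set"
  | Enrichment "nat set"
  | InteriorNormal "nat set"
  | InteriorTN "nat set" "nat set"
  | ElementBubble nat

definition summands :: "nat \<Rightarrow> summand set" where
  "summands d =
     (\<Union>l\<in>{0..d-1}. NormalTensors ` subsimp l {..d}) \<union>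
     (\<Union>l\<in>{0..d-1}. Enrichment ` subsimp l {..d}) \<union>
     (\<Union>l\<in>{0..d-1}. InteriorNormal ` interior_subsimp d l) \<union>
     (\<Union>F\<in>interior_subsimp d (d-1). \<Union>l\<in>{0..d-1}. InteriorTN F ` subsimp l F) \<union>
     ElementBubble ` {0..d}"

primrec summand_space :: "(nat \<Rightarrow> real^'n) \<Rightarrow> (nat set \<Rightarrow> real^'n) \<Rightarrow> (nat set \<Rightarrow> nat) \<Rightarrow> nat \<Rightarrow>
    summand \<Rightarrow> (real^'n, real^'n^'n) ae_fun set" where
  "summand_space v nu z k (NormalTensors f) = bubble v k f (const_fields (normal_tensors v f))"
| "summand_space v nu z k (Enrichment f) = bubble v k f (enrich_space v z f)"
| "summand_space v nu z k (InteriorNormal f) =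
     bubble v k f (const_fields (sym_space (normal_comp v f) (normal_comp v f)))"
| "summand_space v nu z k (InteriorTN F f) = tn_bubble v nu k F f"
| "summand_space v nu z k (ElementBubble i) = div_bubble v k i"

text \<open>The (finite) sum of the subspaces \<open>W a\<close>, \<open>a \<in> I\<close>, is direct.\<close>

definition direct_sum :: "'i set \<Rightarrow> ('i \<Rightarrow> 'a::comm_monoid_add set) \<Rightarrow> bool" where
  "direct_sum I W \<longleftrightarrow>
     (\<forall>w. (\<forall>a\<in>I. w a \<in> W a) \<and> (\<Sum>a\<in>I. w a) = 0 \<longrightarrow> (\<forall>a\<in>I. w a = 0))"

lemma subsimp_disjoint: "l \<noteq> l' \<Longrightarrow> subsimp l f \<inter> subsimp l' f' = {}"
  by (auto simp: subsimp_def)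

lemma finite_subsimp: "finite f \<Longrightarrow> finite (subsimp l f)"
  by (auto simp: subsimp_def)

lemma finite_interior_subsimp: "finite (interior_subsimp d l)"
  by (auto simp: interior_subsimp_def split_subsimp_def cell_idx_def intro!: finite_subsimp)

lemma interior_subsimp_disjoint: "l \<noteq> l' \<Longrightarrow> interior_subsimp d l \<inter> interior_subsimp d l' = {}"
  by (auto simp: interior_subsimp_def split_subsimp_def subsimp_def)

lemma finite_interior_face: "F \<in> interior_subsimp d l \<Longrightarrow> finite F"
  by (auto simp: interior_subsimp_def split_subsimp_def subsimp_def cell_idx_def
      intro: finite_subset)

lemma sum_UN_image:
  assumes "finite L" "inj C" "\<And>l. l \<in> L \<Longrightarrow> finite (A l)"
    and "\<And>l l'. l \<noteq> l' \<Longrightarrow> A l \<inter> A l' = {}"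
  shows "sum S (\<Union>l\<in>L. C ` A l) = (\<Sum>l\<in>L. \<Sum>f\<in>A l. S (C f))"
proof -
  have "sum S (\<Union>l\<in>L. C ` A l) = (\<Sum>l\<in>L. sum S (C ` A l))"
    using assms(1,3,4) by (intro sum.UNION_disjoint) (auto simp: inj_eq[OF assms(2)], use assms(4) in blast)
  also have "\<dots> = (\<Sum>l\<in>L. \<Sum>f\<in>A l. S (C f))"
    using assms(2) by (simp add: sum.reindex inj_on_subset)
  finally show ?thesis .
qed

text \<open>The space is the sum of the family whose directness is asserted in the theorem.\<close>

lemma Sigma_div_eq_sum:
  fixes v :: "nat \<Rightarrow> real^'n"
  shows "Sigma_div v nu z k = (\<Sum>a\<in>summands (CARD('n)). summand_space v nu z k a)"
proof -
  let ?d = "CARD('n)" and ?S = "summand_space v nu z k"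
  let ?L = "{0..?d-1}"
  let ?A = "\<Union>l\<in>?L. NormalTensors ` subsimp l {..?d}"
  let ?B = "\<Union>l\<in>?L. Enrichment ` subsimp l {..?d}"
  let ?C = "\<Union>l\<in>?L. InteriorNormal ` interior_subsimp ?d l"
  let ?E = "\<Union>F\<in>interior_subsimp ?d (?d-1). \<Union>l\<in>?L. InteriorTN F ` subsimp l F"
  let ?G = "ElementBubble ` {0..?d}"
  have fin: "finite ?A" "finite ?B" "finite ?C" "finite ?E" "finite ?G"
    by (auto simp: finite_interior_subsimp intro!: finite_subsimp dest: finite_interior_face)
  have sum_Un: "sum ?S (X \<union> Y) = sum ?S X + sum ?S Y"
    if "finite X" "finite Y" "X \<inter> Y = {}" for X Y
    using that by (rule sum.union_disjoint)
  have "sum ?S (summands ?d) = sum ?S (?A \<union> ?B \<union> ?C \<union> ?E) + sum ?S ?G"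
    unfolding summands_def using fin by (intro sum_Un) auto
  also have "sum ?S (?A \<union> ?B \<union> ?C \<union> ?E) = sum ?S (?A \<union> ?B \<union> ?C) + sum ?S ?E"
    using fin by (intro sum_Un) blast+
  also have "sum ?S (?A \<union> ?B \<union> ?C) = sum ?S (?A \<union> ?B) + sum ?S ?C"
    using fin by (intro sum_Un) blast+
  also have "sum ?S (?A \<union> ?B) = sum ?S ?A + sum ?S ?B"
    using fin by (intro sum_Un) blast+
  finally have "sum ?S (summands ?d) =
      sum ?S ?A + sum ?S ?B + sum ?S ?C + sum ?S ?E + sum ?S ?G" .
  moreover have "sum ?S ?A = (\<Sum>l\<in>?L. \<Sum>f\<in>subsimp l {..?d}. ?S (NormalTensors f))"
    using subsimp_disjoint by (intro sum_UN_image) (simp_all add: inj_def finite_subsimp)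
  moreover have "sum ?S ?B = (\<Sum>l\<in>?L. \<Sum>f\<in>subsimp l {..?d}. ?S (Enrichment f))"
    using subsimp_disjoint by (intro sum_UN_image) (simp_all add: inj_def finite_subsimp)
  moreover have "sum ?S ?C = (\<Sum>l\<in>?L. \<Sum>f\<in>interior_subsimp ?d l. ?S (InteriorNormal f))"
    using interior_subsimp_disjoint by (intro sum_UN_image) (simp_all add: inj_def finite_interior_subsimp)
  moreover have "sum ?S (\<Union>l\<in>?L. InteriorTN F ` subsimp l F) =
      (\<Sum>l\<in>?L. \<Sum>f\<in>subsimp l F. ?S (InteriorTN F f))" if "finite F" for F
    using subsimp_disjoint that by (intro sum_UN_image) (simp_all add: inj_def finite_subsimp)
  moreover have "sum ?S ?E = (\<Sum>F\<in>interior_subsimp ?d (?d-1).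
      sum ?S (\<Union>l\<in>?L. InteriorTN F ` subsimp l F))"
    by (subst sum.UNION_disjoint)
      (auto simp: finite_interior_subsimp intro!: finite_subsimp dest: finite_interior_face)
  moreover have "sum ?S ?G = (\<Sum>i\<in>{0..?d}. ?S (ElementBubble i))"
    by (simp add: sum.reindex inj_on_def)
  ultimately show ?thesis
    by (simp add: Sigma_div_def Let_def sum.distrib finite_interior_face add_ac)
qed

end

theory Submission
  imports Defs
begin

text \<open>
  On the cell \<open>T\<^sub>i\<close> a field of degree \<open>k\<close> has unique Bernstein coefficients \<open>C i \<alpha>\<close>, and each summand consists of
  the fields whose coefficients satisfy linear conditions involving only the face \<open>f = supp \<alpha>\<close>.  Directness and
  dimension can thus be checked one \<open>\<alpha>\<close> at a time.  For a face \<open>f\<close> of \<open>T\<close>, testing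
  the coefficients on \<open>T\<^sub>p\<close> with \<open>(g\<^sub>p, g\<^sub>p)\<close>, where \<open>g\<^sub>p\<close> is the barycentric gradient of a vertex \<open>p\<close> outside \<open>f\<close>,
  gives the diagonal of the normal tensor, since \<open>\<phi>\<^sup>f\<close> and the interior tangential-normal functions vanish there;
  testing on \<open>T\<^sub>p\<close> with \<open>(g\<^sub>q, g\<^sub>q)\<close> then gives the enrichment, and the remaining normal and mixed pairs separate the
  rest.  As \<open>k - 1 choose l\<close> exponents have a given support of
  dimension \<open>l\<close>, Vandermonde's identity sums up the local dimensions.

  Membership in \<open>H(div)\<close> needs no surface integrals: for a tensor \<open>sym (a \<otimes> b)\<close> with edge vectors \<open>a\<close>, \<open>b\<close>, Green's
  formula only involves integrals of derivatives along edges, which vanish by translation invariance whenever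
  the integrand vanishes where lines parallel to the edge leave the cell.  The bubble space
  of a cell consists of the fields with \<open>C \<alpha>\<close> in \<open>sym (\<T>\<^sup>f \<otimes> \<T>\<^sup>f)\<close>, \<open>f = supp \<alpha>\<close>; that these conditions are necessary
  follows from test functions concentrating on a facet.
\<close>

section \<open>Smooth functions and integrals of derivatives\<close>

text \<open>A normal tensor at a face \<open>f\<close> of the simplex takes the same value on every
  cell that contains \<open>f\<close>, whereas the enrichment and the tangential-normal functions
  change from cell to cell. What a test shows about it on one cell, where the competitors are
  invisible, therefore holds on all the others. This fixes the order of the separation: on the cell
  \<open>p\<close> each enrichment tensor has a factor towards a vertex other than \<open>p\<close>,
  which the gradient of \<open>p\<close> does not see, so the diagonal comes first; only with the
  diagonal gone does the gradient of \<open>q\<close>, on the same cell, isolate the coefficient of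
  the pair \<open>p\<close>, \<open>q\<close>.

  The cellwise divergence of a piecewise polynomial is always square integrable. Membership in
  H(div) thus means that the fluxes through the interior faces cancel, and each flux is written as
  the volume integral that Green's formula assigns to it. Classes of functions only give equality
  almost everywhere; coefficients are recovered on the open cells, where continuity turns it into
  equality everywhere.\<close>

lemma C_diff_SucD: "C_diff (Suc m) f \<Longrightarrow> C_diff m f"
proof (induction m arbitrary: f)
  case 0
  then show ?case
    by (auto intro!: continuous_at_imp_continuous_on differentiable_imp_continuous_within)
next
  case (Suc m)
  then show ?case by simp
qed

text \<open>\<open>C_diff\<close> speaks about \<open>frechet_derivative\<close>; this form lets the
  closure rules supply an explicit derivative and recurse on its values.\<close>

lemma C_diff_derivI:
  assumes "\<And>x. (f has_derivative f' x) (at x)" "\<And>e. C_diff m (\<lambda>x. f' x e)"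
  shows "C_diff (Suc m) f"
proof -
  have "frechet_derivative f (at x) = f' x" for x
    using frechet_derivative_at[OF assms(1)] by simp
  then show ?thesis using assms by (auto simp: differentiable_def)
qed

lemma C_diff_const: "C_diff m (\<lambda>x. c)"
proof (induction m arbitrary: c)
  case (Suc m)
  show ?case by (rule C_diff_derivI[where f' = "\<lambda>x e. 0"]) (use Suc in auto)
qed simp

lemma C_diff_bounded_linear: "bounded_linear h \<Longrightarrow> C_diff m h"
proof (cases m)
  case 0
  assume "bounded_linear h"
  then show ?thesis using 0 by (simp add: linear_continuous_on)
next
  case (Suc k)
  assume "bounded_linear h"
  then show ?thesis unfolding Suc
    by (intro C_diff_derivI[where f' = "\<lambda>x. h"] bounded_linear_imp_has_derivative C_diff_const)
qed

lemma C_diff_has_derivative: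
  assumes "C_diff (Suc m) f" shows "(f has_derivative frechet_derivative f (at x)) (at x)"
  using assms by (simp add: frechet_derivative_works)

lemma C_diff_add: "C_diff m f \<Longrightarrow> C_diff m g \<Longrightarrow> C_diff m (\<lambda>x. f x + g x)"
proof (induction m arbitrary: f g)
  case 0
  then show ?case by (simp add: continuous_on_add)
next
  case (Suc m)
  show ?case
    by (rule C_diff_derivI[OF has_derivative_add[OF C_diff_has_derivative[OF Suc.prems(1)]
          C_diff_has_derivative[OF Suc.prems(2)]]])
      (use Suc in auto)
qed

text \<open>One proof for products, scalar multiples and inner products. The product rule brings
  back \<open>f\<close> and \<open>g\<close> themselves, hence the descent by
  \<open>C_diff_SucD\<close>.\<close>

lemma C_diff_bilinear:
  assumes "bounded_bilinear pr"
  shows "C_diff m f \<Longrightarrow> C_diff m g \<Longrightarrow> C_diff m (\<lambda>x. pr (f x) (g x))"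
proof (induction m arbitrary: f g)
  case 0
  then show ?case using bounded_bilinear.continuous_on[OF assms] by simp
next
  case (Suc m)
  show ?case
    by (rule C_diff_derivI[OF bounded_bilinear.FDERIV[OF assms
            C_diff_has_derivative[OF Suc.prems(1)] C_diff_has_derivative[OF Suc.prems(2)]]])
      (use Suc Suc.prems[THEN C_diff_SucD] in \<open>auto intro!: C_diff_add\<close>)
qed

lemma C_diff_exp:
  fixes f :: "real^'n \<Rightarrow> real"
  shows "C_diff m f \<Longrightarrow> C_diff m (\<lambda>x. exp (f x))"
proof (induction m arbitrary: f)
  case 0
  then show ?case by (simp add: continuous_on_exp)
next
  case (Suc m)
  show ?case
    by (rule C_diff_derivI[OF has_derivative_exp[OF C_diff_has_derivative[OF Suc.prems(1)]]])
      (use Suc C_diff_SucD[OF Suc.prems] in \<open>auto intro!: C_diff_bilinear[OF bounded_bilinear_mult]\<close>)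
qed

lemma C_infty_const [simp]: "C_infty (\<lambda>x. c)"
  by (simp add: C_infty_def C_diff_const)

lemma C_infty_bounded_linear: "bounded_linear h \<Longrightarrow> C_infty h"
  by (simp add: C_infty_def C_diff_bounded_linear)

lemma C_infty_add: "C_infty f \<Longrightarrow> C_infty g \<Longrightarrow> C_infty (\<lambda>x. f x + g x)"
  by (simp add: C_infty_def C_diff_add)

lemma C_infty_mult:
  fixes f g :: "real^'n \<Rightarrow> real"
  shows "C_infty f \<Longrightarrow> C_infty g \<Longrightarrow> C_infty (\<lambda>x. f x * g x)"
  by (simp add: C_infty_def C_diff_bilinear[OF bounded_bilinear_mult])

lemma C_infty_scaleR: "C_infty f \<Longrightarrow> C_infty g \<Longrightarrow> C_infty (\<lambda>x. f x *\<^sub>R g x)"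
  by (simp add: C_infty_def C_diff_bilinear[OF bounded_bilinear_scaleR])

lemma C_infty_inner: "C_infty f \<Longrightarrow> C_infty g \<Longrightarrow> C_infty (\<lambda>x. f x \<bullet> g x)"
  by (simp add: C_infty_def C_diff_bilinear[OF bounded_bilinear_inner])

lemma C_infty_exp:
  fixes f :: "real^'n \<Rightarrow> real"
  shows "C_infty f \<Longrightarrow> C_infty (\<lambda>x. exp (f x))"
  by (simp add: C_infty_def C_diff_exp)

lemma C_infty_uminus:
  fixes f :: "real^'n \<Rightarrow> real"
  shows "C_infty f \<Longrightarrow> C_infty (\<lambda>x. - f x)"
  using C_infty_mult[of "\<lambda>_. -1" f] by simp

lemma C_infty_diff:
  fixes f g :: "real^'n \<Rightarrow> real"
  shows "C_infty f \<Longrightarrow> C_infty g \<Longrightarrow> C_infty (\<lambda>x. f x - g x)"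
  using C_infty_add[of f "\<lambda>x. - g x"] C_infty_uminus[of g] by simp

lemma C_infty_affine: "C_infty (\<lambda>x. g \<bullet> x + b)"
  by (intro C_infty_add C_infty_bounded_linear bounded_linear_inner_right C_infty_const)

lemma C_infty_sum: "(\<And>i. i \<in> I \<Longrightarrow> C_infty (f i)) \<Longrightarrow> C_infty (\<lambda>x. \<Sum>i\<in>I. f i x)"
  by (induction I rule: infinite_finite_induct) (auto intro: C_infty_add)

lemma C_infty_power:
  fixes f :: "real^'n \<Rightarrow> real"
  shows "C_infty f \<Longrightarrow> C_infty (\<lambda>x. f x ^ k)"
  by (induction k) (auto intro: C_infty_mult)

lemma C_infty_prod:
  fixes f :: "'i \<Rightarrow> real^'n \<Rightarrow> real"
  shows "(\<And>i. i \<in> I \<Longrightarrow> C_infty (f i)) \<Longrightarrow> C_infty (\<lambda>x. \<Prod>i\<in>I. f i x)"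
  by (induction I rule: infinite_finite_induct) (auto intro: C_infty_mult)

abbreviation dd :: "(real^'n \<Rightarrow> 'b::real_normed_vector) \<Rightarrow> real^'n \<Rightarrow> real^'n \<Rightarrow> 'b" where
  "dd f e x \<equiv> frechet_derivative f (at x) e"

lemma C_infty_dd: "C_infty f \<Longrightarrow> C_infty (dd f e)"
  unfolding C_infty_def using C_diff.simps(2) by metis

lemma C_infty_has_derivative:
  "C_infty f \<Longrightarrow> (f has_derivative frechet_derivative f (at x)) (at x within S)"
  unfolding C_infty_def
  by (rule has_derivative_at_withinI, rule C_diff_has_derivative[where m = 0]) blast

lemma C_infty_continuous_on: "C_infty f \<Longrightarrow> continuous_on S f"
  unfolding C_infty_def using C_diff.simps(1) continuous_on_subset by blast

lemma dd_eqI: "(f has_derivative f') (at x) \<Longrightarrow> dd f e x = f' e"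
  using frechet_derivative_at by metis

lemma C_infty_linear_dd: "C_infty f \<Longrightarrow> linear (\<lambda>e. dd f e x)"
  using C_infty_has_derivative has_derivative_linear by blast

lemma dd_add: "C_infty f \<Longrightarrow> C_infty g \<Longrightarrow> dd (\<lambda>x. f x + g x) e x = dd f e x + dd g e x"
  by (rule dd_eqI) (intro has_derivative_add C_infty_has_derivative)

lemma dd_mult:
  fixes f g :: "real^'n \<Rightarrow> real"
  shows "C_infty f \<Longrightarrow> C_infty g \<Longrightarrow> dd (\<lambda>x. f x * g x) e x = f x * dd g e x + dd f e x * g x"
  by (rule dd_eqI) (intro has_derivative_mult C_infty_has_derivative)

lemma dd_scaleR:
  shows "C_infty f \<Longrightarrow> C_infty g \<Longrightarrow>
    dd (\<lambda>x. f x *\<^sub>R g x) e x = f x *\<^sub>R dd g e x + dd f e x *\<^sub>R g x"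
  by (rule dd_eqI) (intro has_derivative_scaleR C_infty_has_derivative)

lemma dd_inner_left: "C_infty f \<Longrightarrow> dd (\<lambda>x. f x \<bullet> a) e x = dd f e x \<bullet> a"
  by (rule dd_eqI) (intro has_derivative_inner_left C_infty_has_derivative)

lemma dd_exp:
  fixes f :: "real^'n \<Rightarrow> real"
  shows "C_infty f \<Longrightarrow> dd (\<lambda>x. exp (f x)) e x = exp (f x) * dd f e x"
  by (rule dd_eqI) (rule has_derivative_exp[OF C_infty_has_derivative, THEN has_derivative_eq_rhs], auto)

lemma dd_const [simp]: "dd (\<lambda>x. c) e x = 0"
  by (rule dd_eqI) simp

lemma dd_affine [simp]: "dd (\<lambda>x. g \<bullet> x + b) e x = g \<bullet> e"
  by (rule dd_eqI) (auto intro!: derivative_eq_intros)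

section \<open>Integrals of directional derivatives over compact sets\<close>

lemma integrable_continuous_compact:
  fixes f :: "'a::euclidean_space \<Rightarrow> 'b::{banach, second_countable_topology}"
  assumes "compact K" "continuous_on K f"
  shows "integrable lebesgue (\<lambda>x. indicator K x *\<^sub>R f x)"
proof -
  have "integrable lborel (\<lambda>x. indicator K x *\<^sub>R f x)"
    using assms by (rule borel_integrable_compact)
  then show ?thesis using integrable_completion by (metis borel_measurable_integrable)
qed

lemma measurable_continuous_compact:
  fixes f :: "'a::euclidean_space \<Rightarrow> 'b::real_normed_vector"
  assumes "compact K" "continuous_on K f"
  shows "(\<lambda>x. indicator K x *\<^sub>R f x) \<in> borel_measurable borel"
  using assms by (intro borel_measurable_continuous_on_indicator) (auto simp: compact_imp_closed)

text \<open>The difference quotients of \<open>g\<close>, extended by zero, have integral zero by translation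
  invariance, and they converge dominatedly to the derivative.\<close>

lemma integral_derivative_zero:
  fixes g g' :: "'a::euclidean_space \<Rightarrow> real"
  assumes K: "compact K" and g: "continuous_on K g"
    and g': "(\<lambda>x. indicator K x * g' x) \<in> borel_measurable lebesgue"
    and L: "L \<ge> 0"
    and inside: "\<And>x h. x \<in> K \<Longrightarrow> x + h *\<^sub>R t \<in> K \<Longrightarrow> \<bar>g (x + h *\<^sub>R t) - g x\<bar> \<le> L * \<bar>h\<bar>"
    and exit: "\<And>x h. x \<in> K \<Longrightarrow> x + h *\<^sub>R t \<notin> K \<Longrightarrow> \<bar>g x\<bar> \<le> L * \<bar>h\<bar>"
    and U: "open U" "U \<subseteq> K" "negligible (K - U)"
    and deriv: "\<And>x. x \<in> U \<Longrightarrow> ((\<lambda>h. g (x + h *\<^sub>R t)) has_real_derivative g' x) (at 0)"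
  shows "(\<integral>x. indicator K x * g' x \<partial>lebesgue) = 0"
proof -
  define G where "G = (\<lambda>x. indicator K x * g x)"
  define h where "h = (\<lambda>n. 1 / real (Suc n))"
  define D where "D = (\<lambda>n x. (G (x + h n *\<^sub>R t) - G x) / h n)"
  have h: "h n > 0" "h n \<le> 1" for n by (auto simp: h_def)
  have h0: "h \<longlonglongrightarrow> 0" unfolding h_def by (rule LIMSEQ_Suc[OF lim_1_over_n])
  \<comment> \<open>The zero extension is Lipschitz along \<open>t\<close>: by \<open>exit\<close>
    the jump on leaving \<open>K\<close> is small, and a step into \<open>K\<close> is a step out of
    \<open>K\<close> read backwards.\<close>
  have Gb: "\<bar>G (x + a *\<^sub>R t) - G x\<bar> \<le> L * \<bar>a\<bar>" for x a
  proof -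
    consider "x \<in> K" "x + a *\<^sub>R t \<in> K" | "x \<in> K" "x + a *\<^sub>R t \<notin> K" | "x \<notin> K" "x + a *\<^sub>R t \<in> K"
      | "x \<notin> K" "x + a *\<^sub>R t \<notin> K" by blast
    then show ?thesis
    proof cases
      case 3
      then show ?thesis using exit[of "x + a *\<^sub>R t" "-a"] by (simp add: G_def)
    qed (use inside exit L in \<open>auto simp: G_def\<close>)
  qed
  have Gm: "G \<in> borel_measurable borel"
    using measurable_continuous_compact[OF K g] by (simp add: G_def)
  have Gint: "integrable lborel G"
    using borel_integrable_compact[OF K g] by (simp add: G_def)
  have shift: "integrable lborel (\<lambda>x. G (x + c))" "(\<integral>x. G (x + c) \<partial>lborel) = (\<integral>x. G x \<partial>lborel)" for c
  proof -
    have "integrable (distr lborel borel ((+) c)) G" using Gint by (simp add: lborel_distr_plus)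
    then have "integrable lborel (\<lambda>x. G (c + x))"
      by (subst (asm) integrable_distr_eq) (use Gm in auto)
    then show "integrable lborel (\<lambda>x. G (x + c))" by (simp add: add.commute)
    have "(\<integral>x. G x \<partial>lborel) = (\<integral>x. G x \<partial>distr lborel borel ((+) c))" by (simp add: lborel_distr_plus)
    also have "\<dots> = (\<integral>x. G (c + x) \<partial>lborel)" using Gm by (intro integral_distr) auto
    finally show "(\<integral>x. G (x + c) \<partial>lborel) = (\<integral>x. G x \<partial>lborel)" by (simp add: add.commute)
  qed
  have Dm: "D n \<in> borel_measurable borel" for n
    unfolding D_def using Gm by measurable
  have D0: "(\<integral>x. D n x \<partial>lebesgue) = 0" for n
  proof -
    have "(\<integral>x. D n x \<partial>lebesgue) = (\<integral>x. D n x \<partial>lborel)"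
      using Dm by (intro integral_completion) simp
    also have "\<dots> = 0"
      unfolding D_def using shift Gint by (simp add: integral_diff)
    finally show ?thesis .
  qed
  obtain B where B: "\<And>x. x \<in> K \<Longrightarrow> norm x \<le> B"
    using compact_imp_bounded[OF K] bounded_iff by metis
  \<comment> \<open>Since \<open>h n \<le> 1\<close>, the points \<open>x\<close> and
    \<open>x + h n *\<^sub>R t\<close> both avoid \<open>K\<close> when \<open>x\<close> lies
    outside this ball, so a multiple of its indicator dominates all quotients.\<close>
  define R where "R = B + norm t"
  have Dbound: "norm (D n x) \<le> L * indicator (cball 0 R) x" for n x
  proof -
    have le: "norm (D n x) \<le> L"
      using Gb[of x "h n"] h[of n] by (simp add: D_def pos_divide_le_eq)
    show ?thesis
    proof (cases "x \<in> cball 0 R")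
      case False
      then have "norm x > R" by simp
      have "x \<notin> K" using B[of x] \<open>norm x > R\<close> norm_ge_zero[of t] unfolding R_def by linarith
      moreover have "x + h n *\<^sub>R t \<notin> K"
      proof
        assume "x + h n *\<^sub>R t \<in> K"
        then have "norm (x + h n *\<^sub>R t) \<le> B" using B by blast
        moreover have "norm x \<le> norm (x + h n *\<^sub>R t) + norm (h n *\<^sub>R t)"
          using norm_triangle_ineq4[of "x + h n *\<^sub>R t" "h n *\<^sub>R t"] by simp
        moreover have "norm (h n *\<^sub>R t) \<le> norm t"
          using h[of n] by (simp add: mult_left_le_one_le)
        ultimately show False using \<open>norm x > R\<close> by (simp add: R_def)
      qed
      ultimately show ?thesis using L by (simp add: D_def G_def)
    qed (use le in auto)
  qed
  have lim: "AE x in lebesgue. (\<lambda>n. D n x) \<longlonglongrightarrow> indicator K x * g' x"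
  proof -
    have "AE x in lebesgue. x \<notin> K - U"
      using U(3) unfolding negligible_iff_null_sets by (rule AE_not_in)
    then show ?thesis
    proof eventually_elim
      case (elim x)
      have tend: "(\<lambda>n. x + h n *\<^sub>R t) \<longlonglongrightarrow> x"
        using tendsto_add[OF tendsto_const tendsto_scaleR[OF h0 tendsto_const], of x t] by simp
      show ?case
      proof (cases "x \<in> K")
        case True
        then have "x \<in> U" using elim by auto
        have ev: "\<forall>\<^sub>F n in sequentially. x + h n *\<^sub>R t \<in> U"
          using tend \<open>open U\<close> \<open>x \<in> U\<close> by (rule topological_tendstoD)
        have "((\<lambda>a. (g (x + (0 + a) *\<^sub>R t) - g (x + 0 *\<^sub>R t)) / a) \<longlongrightarrow> g' x) (at 0)"
          using deriv[OF \<open>x \<in> U\<close>] unfolding has_field_derivative_def DERIV_def[symmetric]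
          by (simp add: DERIV_def has_field_derivative_def[symmetric])
        moreover have "filterlim h (at 0) sequentially"
          using h0 h(1) by (auto simp: filterlim_at intro!: always_eventually) (metis less_irrefl)
        ultimately have "(\<lambda>n. (g (x + (0 + h n) *\<^sub>R t) - g (x + 0 *\<^sub>R t)) / h n) \<longlonglongrightarrow> g' x"
          by (rule filterlim_compose)
        moreover have "\<forall>\<^sub>F n in sequentially.
            (g (x + (0 + h n) *\<^sub>R t) - g (x + 0 *\<^sub>R t)) / h n = D n x"
          using ev by eventually_elim (use True U in \<open>auto simp: D_def G_def\<close>)
        ultimately show ?thesis using True by (simp add: tendsto_cong)
      next
        case False
        have "\<forall>\<^sub>F n in sequentially. x + h n *\<^sub>R t \<in> - K"
          by (rule topological_tendstoD[OF tend]) (use K False in \<open>auto simp: compact_imp_closed\<close>)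
        then have "\<forall>\<^sub>F n in sequentially. 0 = D n x"
          by eventually_elim (use False in \<open>auto simp: D_def G_def\<close>)
        then have "(\<lambda>n. D n x) \<longlonglongrightarrow> 0"
          using tendsto_cong tendsto_const by fast
        then show ?thesis using False by simp
      qed
    qed
  qed
  have "(\<lambda>n. \<integral>x. D n x \<partial>lebesgue) \<longlonglongrightarrow> (\<integral>x. indicator K x * g' x \<partial>lebesgue)"
  proof (rule integral_dominated_convergence)
    show "integrable lebesgue (\<lambda>x::'a. L * indicator (cball 0 R) x)"
      using emeasure_lborel_cball_finite[of "0::'a" R]
      by (intro integrable_mult_right integrable_real_indicator) auto
    show "D n \<in> borel_measurable lebesgue" for n using Dm by (intro measurable_completion) simp
  qed (use g' lim Dbound in auto)
  then show ?thesis using D0 LIMSEQ_unique by (simp add: LIMSEQ_const_iff)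
qed

section \<open>Direct sums and symmetric tensors\<close>

lemma subspace_sum_set:
  fixes W :: "'i \<Rightarrow> 'a::real_vector set"
  assumes "finite I" "\<And>i. i \<in> I \<Longrightarrow> subspace (W i)"
  shows "subspace (sum W I)"
  using assms
proof (induction I rule: finite_induct)
  case empty
  then show ?case by (simp add: subspace_def set_zero)
next
  case (insert i I)
  have "subspace {x + y |x y. x \<in> W i \<and> y \<in> sum W I}"
    using insert by (intro subspace_sums) auto
  moreover have "W i + sum W I = {x + y |x y. x \<in> W i \<and> y \<in> sum W I}"
    by (auto simp: set_plus_def)
  ultimately show ?case using insert by simp
qed

text \<open>Directness makes the union of bases of the summands disjoint and independent. Finite
  spanning sets appear in hypothesis and conclusion because the ambient space of classes of
  functions is infinite-dimensional, where \<open>dim\<close> alone does not show that a subspace is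
  finite-dimensional.\<close>

lemma direct_sum_dim:
  fixes W :: "'i \<Rightarrow> 'a::real_vector set"
  assumes I: "finite I" and dir: "direct_sum I W"
    and sub: "\<And>i. i \<in> I \<Longrightarrow> subspace (W i)"
    and fin: "\<And>i. i \<in> I \<Longrightarrow> \<exists>B. finite B \<and> W i = span B"
  shows "\<exists>B. finite B \<and> sum W I = span B" "dim (sum W I) = (\<Sum>i\<in>I. dim (W i))"
proof -
  have "\<exists>B. finite B \<and> independent B \<and> span B = W i" if "i \<in> I" for i
  proof -
    obtain B0 where B0: "finite B0" "W i = span B0" using fin[OF \<open>i \<in> I\<close>] by blast
    obtain B where B: "B \<subseteq> B0" "independent B" "B0 \<subseteq> span B"
      using maximal_independent_subset[of B0] by blast
    have "span B = span B0" using B by (metis span_mono span_span subset_antisym)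
    then show ?thesis using B B0 finite_subset by metis
  qed
  then obtain B where B: "\<And>i. i \<in> I \<Longrightarrow> finite (B i)" "\<And>i. i \<in> I \<Longrightarrow> independent (B i)"
      "\<And>i. i \<in> I \<Longrightarrow> span (B i) = W i" by metis
  have BW: "B i \<subseteq> W i" if "i \<in> I" for i using B(3)[OF that] span_superset by blast
  have disj: "B i \<inter> B j = {}" if "i \<in> I" "j \<in> I" "i \<noteq> j" for i j
  proof (rule ccontr)
    assume "B i \<inter> B j \<noteq> {}"
    then obtain x where x: "x \<in> B i" "x \<in> B j" by blast
    \<comment> \<open>A common basis vector would give the nontrivial relation
      \<open>x + (- x) = 0\<close> between two summands.\<close>
    define w where "w = (\<lambda>a. if a = i then x else if a = j then - x else 0)"
    have "(\<Sum>a\<in>I. w a) = (\<Sum>a\<in>{i, j}. w a)"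
      using that I by (intro sum.mono_neutral_right) (auto simp: w_def)
    also have "\<dots> = 0" using that by (simp add: w_def)
    finally have "(\<Sum>a\<in>I. w a) = 0" .
    moreover have "\<forall>a\<in>I. w a \<in> W a"
      using x BW that sub by (auto simp: w_def subspace_0 intro!: subspace_neg)
    ultimately have "w i = 0" using dir that unfolding direct_sum_def by blast
    then have "x = 0" by (simp add: w_def)
    then show False using x B(2)[OF that(1)] dependent_zero by blast
  qed
  let ?U = "\<Union>i\<in>I. B i"
  have finU: "finite ?U" using I B by blast
  have indU: "independent ?U"
  proof
    assume "dependent ?U"
    then obtain u v where u: "v \<in> ?U" "u v \<noteq> 0" "(\<Sum>v\<in>?U. u v *\<^sub>R v) = 0"
      using dependent_finite[OF finU] by blast
    have "(\<Sum>v\<in>?U. u v *\<^sub>R v) = (\<Sum>i\<in>I. \<Sum>v\<in>B i. u v *\<^sub>R v)"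
      using I B disj by (intro sum.UNION_disjoint) auto
    moreover have "(\<Sum>v\<in>B i. u v *\<^sub>R v) \<in> W i" if "i \<in> I" for i
      using BW[OF that] sub[OF that] by (intro subspace_sum subspace_scale) auto
    ultimately have *: "\<forall>i\<in>I. (\<Sum>v\<in>B i. u v *\<^sub>R v) = 0"
      using dir u(3) unfolding direct_sum_def by (auto dest!: spec[of _ "\<lambda>i. \<Sum>v\<in>B i. u v *\<^sub>R v"])
    obtain i where i: "i \<in> I" "v \<in> B i" using u by blast
    then have "dependent (B i)"
      using dependent_finite[OF B(1)[OF i(1)]] * u(2) by blast
    then show False using B i by blast
  qed
  have eq: "sum W I = span ?U"
  proof
    have "W i \<subseteq> span ?U" if "i \<in> I" for i
      using B(3)[OF that] that by (metis UN_upper span_mono)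
    then show "sum W I \<subseteq> span ?U"
      unfolding set_sum_alt[OF I] by (auto intro!: span_sum)
    have "x \<in> sum W I" if "i \<in> I" "x \<in> W i" for i x
    proof -
      have "x = (\<Sum>a\<in>I. if a = i then x else 0)" using that I by simp
      then show ?thesis
        unfolding set_sum_alt[OF I] mem_Collect_eq
        by (rule exI[of _ "\<lambda>a. if a = i then x else 0", OF conjI]) (use that sub subspace_0 in auto)
    qed
    then have "?U \<subseteq> sum W I" using BW by blast
    then show "span ?U \<subseteq> sum W I"
      using subspace_sum_set[OF I sub] by (rule span_minimal)
  qed
  show "\<exists>B. finite B \<and> sum W I = span B" using eq finU by blast
  have "dim (sum W I) = card ?U" unfolding eq using indU by (rule dim_span_eq_card_independent)
  also have "\<dots> = (\<Sum>i\<in>I. card (B i))" using I B disj by (intro card_UN_disjoint) auto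
  also have "\<dots> = (\<Sum>i\<in>I. dim (W i))"
    using B by (intro sum.cong) (auto simp: dim_span_eq_card_independent[symmetric])
  finally show "dim (sum W I) = (\<Sum>i\<in>I. dim (W i))" .
qed

text \<open>Every summand is brought to this shape: parameters from Euclidean subspaces, one for
  each exponent (for the enrichment, for each exponent and pair of vertices), mapped linearly into
  the classes of functions. Joint injectivity \<open>inj\<close> carries the Euclidean dimensions
  over.\<close>

lemma dim_linear_family:
  fixes L :: "'j \<Rightarrow> 'e::euclidean_space \<Rightarrow> 'a::real_vector"
  assumes J: "finite J" and lin: "\<And>j. j \<in> J \<Longrightarrow> linear (L j)"
    and X: "\<And>j. j \<in> J \<Longrightarrow> subspace (X j)"
    and inj: "\<And>x. (\<And>j. j \<in> J \<Longrightarrow> x j \<in> X j) \<Longrightarrow> (\<Sum>j\<in>J. L j (x j)) = 0 \<Longrightarrow> \<forall>j\<in>J. x j = 0"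
    and W: "W = {\<Sum>j\<in>J. L j (x j) |x. \<forall>j\<in>J. x j \<in> X j}"
  shows "subspace W" "\<exists>B. finite B \<and> W = span B" "dim W = (\<Sum>j\<in>J. dim (X j))"
proof -
  let ?V = "\<lambda>j. L j ` X j"
  \<comment> \<open>Joint injectivity, applied to a family with a single nonzero entry, makes each
    \<open>L j\<close> injective on \<open>X j\<close>.\<close>
  have injL: "x = y" if "j \<in> J" "x \<in> X j" "y \<in> X j" "L j x = L j y" for j x y
  proof -
    have "(\<Sum>i\<in>J. L i (if i = j then x - y else 0)) = (\<Sum>i\<in>J. if i = j then L j (x - y) else 0)"
      using lin by (intro sum.cong) (auto simp: linear_0)
    also have "\<dots> = 0" using J that lin by (simp add: linear_diff)
    finally have "\<forall>i\<in>J. (if i = j then x - y else 0) = 0"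
      using X that by (intro inj) (auto simp: subspace_0 subspace_diff)
    then show ?thesis using that by auto
  qed
  have Wsum: "W = sum ?V J"
    unfolding W set_sum_alt[OF J]
  proof (intro set_eqI iffI)
    fix w assume "w \<in> {\<Sum>j\<in>J. L j (x j) |x. \<forall>j\<in>J. x j \<in> X j}"
    then obtain x where "w = (\<Sum>j\<in>J. L j (x j))" "\<forall>j\<in>J. x j \<in> X j" by blast
    then show "w \<in> {sum s J |s. \<forall>i\<in>J. s i \<in> ?V i}"
      by (intro CollectI exI[of _ "\<lambda>j. L j (x j)"]) auto
  next
    fix w assume "w \<in> {sum s J |s. \<forall>i\<in>J. s i \<in> ?V i}"
    then obtain s where s: "w = sum s J" "\<forall>i\<in>J. s i \<in> ?V i" by blast
    then have "\<forall>i\<in>J. \<exists>x. x \<in> X i \<and> s i = L i x" by blast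
    then obtain x where "\<forall>i\<in>J. x i \<in> X i \<and> s i = L i (x i)" by metis
    then show "w \<in> {\<Sum>j\<in>J. L j (x j) |x. \<forall>j\<in>J. x j \<in> X j}"
      using s by (intro CollectI exI[of _ x]) auto
  qed
  have subV: "subspace (?V j)" if "j \<in> J" for j
    using that lin X by (intro linear_subspace_image) auto
  have dir: "direct_sum J ?V"
    unfolding direct_sum_def
  proof (intro allI impI)
    fix w assume w: "(\<forall>a\<in>J. w a \<in> ?V a) \<and> sum w J = 0"
    then have "\<forall>a\<in>J. \<exists>x. x \<in> X a \<and> w a = L a x" by blast
    then obtain x where x: "\<forall>a\<in>J. x a \<in> X a \<and> w a = L a (x a)" by metis
    have "(\<Sum>j\<in>J. L j (x j)) = sum w J" using x by (intro sum.cong) auto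
    then have "\<forall>j\<in>J. x j = 0" using w x by (intro inj) auto
    then show "\<forall>a\<in>J. w a = 0" using x lin by (auto simp: linear_0)
  qed
  have fd: "(\<exists>B. finite B \<and> ?V j = span B) \<and> dim (?V j) = dim (X j)" if j: "j \<in> J" for j
  proof -
    obtain B where B: "B \<subseteq> X j" "independent B" "X j \<subseteq> span B" "card B = dim (X j)"
      using basis_exists by blast
    have sp: "span B = X j" using B X[OF j] by (metis span_minimal subset_antisym)
    have fin: "finite B" using B by (simp add: independent_imp_finite)
    have eq: "?V j = span (L j ` B)" using linear_span_image[OF lin[OF j]] sp by metis
    have inj: "inj_on (L j) (span B)" unfolding sp using injL[OF j] by (intro inj_onI) blast
    have "independent (L j ` B)"
      using lin[OF j] B(2) inj by (rule linear_independent_injective_image)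
    then have "dim (?V j) = card (L j ` B)" unfolding eq by (rule dim_span_eq_card_independent)
    also have "\<dots> = card B" using inj_on_subset[OF inj span_superset] by (intro card_image)
    finally show ?thesis using eq fin B(4) by auto
  qed
  show "subspace W" unfolding Wsum using J subV by (rule subspace_sum_set)
  show "\<exists>B. finite B \<and> W = span B" "dim W = (\<Sum>j\<in>J. dim (X j))"
    unfolding Wsum using direct_sum_dim[OF J dir subV] fd by auto
qed

section \<open>Symmetrised tensor products and the dimensions of their spans\<close>

lemma sym_tensor_nth: "sym_tensor a b $ i $ j = (a $ i * b $ j + a $ j * b $ i) / 2"
  by (simp add: sym_tensor_def transpose_def)

lemma sym_tensor_commute: "sym_tensor a b = sym_tensor b a"
  by (simp add: vec_eq_iff sym_tensor_nth)

lemma transpose_sym_tensor [simp]: "transpose (sym_tensor a b) = sym_tensor a b"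
  by (simp add: vec_eq_iff sym_tensor_nth transpose_def)

lemma linear_sym_tensor_right: "linear (sym_tensor a)"
  by (rule linearI) (simp_all add: vec_eq_iff sym_tensor_nth algebra_simps add_divide_distrib)

lemma linear_sym_tensor_left: "linear (\<lambda>a. sym_tensor a b)"
  using linear_sym_tensor_right[of b] by (simp add: sym_tensor_commute[of _ b])

lemma sym_tensor_zero [simp]: "sym_tensor 0 b = 0" "sym_tensor a 0 = 0"
  by (simp_all add: vec_eq_iff sym_tensor_nth)

lemma sym_tensor_mult_vec:
  "sym_tensor a b *v g = (1/2) *\<^sub>R ((b \<bullet> g) *\<^sub>R a + (a \<bullet> g) *\<^sub>R b)"
proof -
  have "(\<Sum>j\<in>UNIV. sym_tensor a b $ i $ j * g $ j) = a $ i / 2 * (b \<bullet> g) + b $ i / 2 * (a \<bullet> g)" for i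
  proof -
    have "(\<Sum>j\<in>UNIV. sym_tensor a b $ i $ j * g $ j) =
        (\<Sum>j\<in>UNIV. a $ i / 2 * (b $ j * g $ j) + b $ i / 2 * (a $ j * g $ j))"
      by (intro sum.cong) (auto simp: sym_tensor_nth field_simps)
    then show ?thesis by (simp only: sum.distrib sum_distrib_left[symmetric] inner_vec_def inner_real_def)
  qed
  then show ?thesis by (simp add: vec_eq_iff matrix_vector_mult_def field_simps)
qed

lemma inner_sym_tensor_mult_vec:
  "u \<bullet> (sym_tensor a b *v w) = ((u \<bullet> a) * (b \<bullet> w) + (u \<bullet> b) * (a \<bullet> w)) / 2"
  by (simp add: sym_tensor_mult_vec inner_add_right algebra_simps)

text \<open>With a Jacobian in place of \<open>matrix f\<close>, two directional derivatives are
  left, along \<open>a\<close> and along \<open>b\<close>; Green's formula thereby reduces to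
  integrals of such derivatives.\<close>

lemma inner_sym_tensor_matrix:
  assumes "linear f"
  shows "sym_tensor a b \<bullet> matrix f = (a \<bullet> f b + b \<bullet> f a) / 2"
proof -
  have f: "f x = matrix f *v x" for x using assms by simp
  have *: "a \<bullet> f b = (\<Sum>i\<in>UNIV. \<Sum>j\<in>UNIV. a $ i * b $ j * matrix f $ i $ j)" for a b
    by (simp add: f[of b] inner_vec_def matrix_vector_mult_def sum_distrib_left mult_ac)
  have "sym_tensor a b \<bullet> matrix f =
      (\<Sum>i\<in>UNIV. \<Sum>j\<in>UNIV. (a $ i * b $ j * matrix f $ i $ j + b $ i * a $ j * matrix f $ i $ j) / 2)"
    unfolding inner_vec_def inner_real_def sym_tensor_nth
    by (intro sum.cong refl) (simp add: algebra_simps)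
  then show ?thesis by (simp add: * sum.distrib sum_divide_distrib[symmetric])
qed

lemma inner_sym_tensor:
  "sym_tensor a b \<bullet> sym_tensor c e = ((a \<bullet> c) * (b \<bullet> e) + (a \<bullet> e) * (b \<bullet> c)) / 2"
proof -
  have "sym_tensor a b \<bullet> sym_tensor c e = sym_tensor a b \<bullet> matrix ((*v) (sym_tensor c e))"
    by simp
  also have "\<dots> = (a \<bullet> (sym_tensor c e *v b) + b \<bullet> (sym_tensor c e *v a)) / 2"
    by (rule inner_sym_tensor_matrix) simp
  finally show ?thesis by (simp add: inner_sym_tensor_mult_vec inner_commute field_simps)
qed

text \<open>Bilinearity, used one argument at a time: a claim about two spans only has to be checked
  on generators, which below are edges or basis vectors.\<close>

lemma sym_tensor_span_closed:
  assumes S: "subspace S" and gen: "\<And>x y. x \<in> A \<Longrightarrow> y \<in> B \<Longrightarrow> sym_tensor x y \<in> S"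
    and "a \<in> span A" "b \<in> span B"
  shows "sym_tensor a b \<in> S"
proof -
  have 1: "sym_tensor x b \<in> S" if "x \<in> A" for x
    using \<open>b \<in> span B\<close>
  proof (induction rule: span_induct)
    case base
    show ?case using linear_subspace_linear_preimage[OF linear_sym_tensor_right S, of x] .
  qed (use gen that in auto)
  show ?thesis
    using \<open>a \<in> span A\<close>
  proof (induction rule: span_induct)
    case base
    show ?case using linear_subspace_linear_preimage[OF linear_sym_tensor_left S, of b] .
  qed (use 1 in auto)
qed

lemma sym_tensor_in_sym_space: "a \<in> V \<Longrightarrow> b \<in> W \<Longrightarrow> sym_tensor a b \<in> sym_space V W"
  unfolding sym_space_def by (rule span_base) blast

lemma subspace_sym_space: "subspace (sym_space V W)"
  by (simp add: sym_space_def)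

text \<open>For an orthonormal family these tensors are pairwise orthogonal, with squared norm 1 on
  the diagonal and 1/2 off it; \<open>p \<le> q\<close> keeps one order of each pair.\<close>

lemma dim_sym_family:
  fixes e :: "nat \<Rightarrow> real^'n"
  assumes e: "\<And>p q. p \<in> I \<Longrightarrow> q \<in> I \<Longrightarrow> e p \<bullet> e q = (if p = q then 1 else 0)"
    and P: "finite P" "\<And>p q. (p, q) \<in> P \<Longrightarrow> p \<le> q \<and> p \<in> I \<and> q \<in> I"
  shows "dim (span ((\<lambda>(p, q). sym_tensor (e p) (e q)) ` P)) = card P"
proof -
  let ?f = "\<lambda>(p, q). sym_tensor (e p) (e q)"
  have ip: "?f x \<bullet> ?f y = (if x = y then (if fst x = snd x then 1 else 1/2) else 0)"
    if "x \<in> P" "y \<in> P" for x y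
  proof -
    obtain p q p' q' where xy: "x = (p, q)" "y = (p', q')" by force
    have "p \<le> q" "p \<in> I" "q \<in> I" "p' \<le> q'" "p' \<in> I" "q' \<in> I" using that P(2) xy by blast+
    then show ?thesis by (auto simp: xy inner_sym_tensor e)
  qed
  have ne: "?f x \<noteq> 0" if "x \<in> P" for x using ip[OF that that] by (auto split: if_splits)
  have inj: "inj_on ?f P"
  proof (rule inj_onI)
    fix x y assume "x \<in> P" "y \<in> P" "?f x = ?f y"
    then have "?f x \<bullet> ?f y \<noteq> 0" using ne[of x] by simp
    then show "x = y" using ip[OF \<open>x \<in> P\<close> \<open>y \<in> P\<close>] by presburger
  qed
  have "independent (?f ` P)"
  proof (rule pairwise_orthogonal_independent)
    show "pairwise orthogonal (?f ` P)"
      unfolding pairwise_def orthogonal_def using ip by fastforce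
    show "0 \<notin> ?f ` P"
    proof
      assume "0 \<in> ?f ` P"
      then obtain x where x: "0 = ?f x" "x \<in> P" by (rule imageE)
      show False by (rule notE[OF ne[OF x(2)] x(1)[symmetric]])
    qed
  qed
  from dim_span_eq_card_independent[OF this] show ?thesis using inj by (simp only: card_image)
qed

text \<open>Counted by the larger index \<open>q\<close>, for which \<open>p\<close> has
  \<open>q + 1\<close> values. The factor 2 keeps the formula free of division in the natural
  numbers.\<close>

lemma card_normal_pairs:
  "2 * card {(p, q). p \<le> q \<and> l \<le> q \<and> q < l + m} = 2 * l * m + m * (m + 1 :: nat)"
proof -
  have eq: "{(p, q). p \<le> q \<and> l \<le> q \<and> q < l + m} = (\<lambda>(q, p). (p, q)) ` (SIGMA q:{l..<l+m}. {..q})"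
    by force
  have "card {(p, q). p \<le> q \<and> l \<le> q \<and> q < l + m} = card (SIGMA q:{l..<l+m}. {..q})"
    unfolding eq by (intro card_image) (auto simp: inj_on_def)
  also have "\<dots> = (\<Sum>q\<in>{l..<l+m}. q + 1)" by simp
  also have "2 * \<dots> = 2 * l * m + m * (m + 1)" by (induction m) auto
  finally show ?thesis by simp
qed

lemma orthonormal_enumeration:
  fixes V :: "'a::euclidean_space set"
  assumes "subspace V"
  obtains e where "\<And>p q. p < dim V \<Longrightarrow> q < dim V \<Longrightarrow> e p \<bullet> e q = (if p = q then 1 else 0)"
    and "\<And>p. p < dim V \<Longrightarrow> e p \<in> V" and "span (e ` {..<dim V}) = V"
proof -
  obtain B where B: "B \<subseteq> V" "pairwise orthogonal B" "\<And>x. x \<in> B \<Longrightarrow> norm x = 1"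
      "independent B" "card B = dim V" "span B = V"
    using orthonormal_basis_subspace[OF assms] by blast
  have "finite B" using B(4) by (rule independent_imp_finite)
  then obtain e where e: "bij_betw e {0..<card B} B" using ex_bij_betw_nat_finite by blast
  have im: "e ` {..<dim V} = B" using e by (simp add: B bij_betw_def lessThan_atLeast0)
  show thesis
  proof (rule that[of e])
    show "e p \<bullet> e q = (if p = q then 1 else 0)" if pq: "p < dim V" "q < dim V" for p q
    proof (cases "p = q")
      case True
      have "e p \<in> B" using im pq by blast
      then show ?thesis using B(3) True by (simp add: dot_square_norm)
    next
      case False
      have "e p \<in> B" "e q \<in> B" "e p \<noteq> e q"
        using im pq e False by (auto simp: bij_betw_def inj_on_def B(5))
      then show ?thesis using B(2) False by (simp add: pairwise_def orthogonal_def)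
    qed
  qed (use im B in auto)
qed

lemma dim_normal_sym:
  fixes U V :: "(real^'n) set"
  assumes U: "subspace U" and V: "subspace V" and orth: "\<And>u v. u \<in> U \<Longrightarrow> v \<in> V \<Longrightarrow> u \<bullet> v = 0"
  shows "2 * dim (sym_space V V + sym_space U V) = 2 * dim U * dim V + dim V * (dim V + 1)"
proof -
  let ?l = "dim U" and ?m = "dim V"
  obtain a where a: "\<And>p q. p < ?l \<Longrightarrow> q < ?l \<Longrightarrow> a p \<bullet> a q = (if p = q then 1 else 0)"
    "\<And>p. p < ?l \<Longrightarrow> a p \<in> U" "span (a ` {..<?l}) = U" using orthonormal_enumeration[OF U] by blast
  obtain b where b: "\<And>p q. p < ?m \<Longrightarrow> q < ?m \<Longrightarrow> b p \<bullet> b q = (if p = q then 1 else 0)"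
    "\<And>p. p < ?m \<Longrightarrow> b p \<in> V" "span (b ` {..<?m}) = V" using orthonormal_enumeration[OF V] by blast
  \<comment> \<open>Basis vectors of \<open>U\<close> come first, so the pairs
    \<open>p \<le> q\<close> with \<open>?l \<le> q\<close> are exactly the products with a factor
    in \<open>V\<close>, each listed once.\<close>
  define e where "e = (\<lambda>p. if p < ?l then a p else b (p - ?l))"
  let ?P = "{(p, q). p \<le> q \<and> ?l \<le> q \<and> q < ?l + ?m}"
  let ?S = "span ((\<lambda>(p, q). sym_tensor (e p) (e q)) ` ?P)"
  have ab: "a p \<bullet> b q = 0" "b q \<bullet> a p = 0" if "p < ?l" "q < ?m" for p q
    using orth[OF a(2)[OF that(1)] b(2)[OF that(2)]] by (simp_all add: inner_commute)
  have e: "e p \<bullet> e q = (if p = q then 1 else 0)" if "p \<in> {..<?l+?m}" "q \<in> {..<?l+?m}" for p q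
    using that a(1) b(1) ab by (auto simp: e_def)
  have "finite ?P" by (rule finite_subset[of _ "{..<?l+?m} \<times> {..<?l+?m}"]) auto
  then have dimS: "dim ?S = card ?P" by (intro dim_sym_family[where I = "{..<?l+?m}", OF e]) auto
  have bb: "sym_tensor x y \<in> ?S" if x: "x \<in> b ` {..<?m}" and y: "y \<in> b ` {..<?m}" for x y
  proof -
    obtain p q where pq: "x = b p" "y = b q" "p < ?m" "q < ?m" using x y by blast
    show ?thesis
    proof (cases "p \<le> q")
      case True
      then have "sym_tensor x y = (\<lambda>(p, q). sym_tensor (e p) (e q)) (p + ?l, q + ?l)"
        using pq by (simp add: e_def)
      then show ?thesis using True pq by (intro span_base image_eqI[where x = "(p + ?l, q + ?l)"]) auto
    next
      case False
      then have "sym_tensor x y = (\<lambda>(p, q). sym_tensor (e p) (e q)) (q + ?l, p + ?l)"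
        using pq by (simp add: e_def sym_tensor_commute)
      then show ?thesis using False pq by (intro span_base image_eqI[where x = "(q + ?l, p + ?l)"]) auto
    qed
  qed
  have ab: "sym_tensor x y \<in> ?S" if x: "x \<in> a ` {..<?l}" and y: "y \<in> b ` {..<?m}" for x y
  proof -
    obtain p q where pq: "x = a p" "y = b q" "p < ?l" "q < ?m" using x y by blast
    have "sym_tensor x y = (\<lambda>(p, q). sym_tensor (e p) (e q)) (p, q + ?l)"
      using pq by (simp add: e_def)
    then show ?thesis using pq by (intro span_base image_eqI[where x = "(p, q + ?l)"]) auto
  qed
  have VV: "sym_space V V \<subseteq> ?S"
    unfolding sym_space_def
  proof (rule span_minimal)
    show "{sym_tensor x y |x y. x \<in> V \<and> y \<in> V} \<subseteq> ?S"
      using sym_tensor_span_closed[OF _ bb] b(3) by auto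
  qed simp
  have UV: "sym_space U V \<subseteq> ?S"
    unfolding sym_space_def
  proof (rule span_minimal)
    show "{sym_tensor x y |x y. x \<in> U \<and> y \<in> V} \<subseteq> ?S"
      using sym_tensor_span_closed[OF _ ab] a(3) b(3) by auto
  qed simp
  have "subspace {x + y |x y. x \<in> sym_space V V \<and> y \<in> sym_space U V}"
    by (intro subspace_sums subspace_sym_space)
  moreover have sumeq: "sym_space V V + sym_space U V = {x + y |x y. x \<in> sym_space V V \<and> y \<in> sym_space U V}"
    by (auto simp: set_plus_def)
  ultimately have sub: "subspace (sym_space V V + sym_space U V)" by simp
  have "sym_space V V + sym_space U V = ?S"
  proof
    show "sym_space V V + sym_space U V \<subseteq> ?S"
      using VV UV by (auto simp: sumeq intro!: span_add)
    show "?S \<subseteq> sym_space V V + sym_space U V"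
    proof (rule span_minimal[OF _ sub], clarify)
      fix p q assume pq: "p \<le> q" "?l \<le> q" "q < ?l + ?m"
      have q: "e q \<in> V" using pq b(2)[of "q - ?l"] by (simp add: e_def)
      show "sym_tensor (e p) (e q) \<in> sym_space V V + sym_space U V"
      proof (cases "p < ?l")
        case True
        then have "sym_tensor (e p) (e q) \<in> sym_space U V"
          using q a(2) by (intro sym_tensor_in_sym_space) (auto simp: e_def)
        then show ?thesis using set_plus_intro[OF subspace_0[OF subspace_sym_space]] by fastforce
      next
        case False
        then have "sym_tensor (e p) (e q) \<in> sym_space V V"
          using q b(2)[of "p - ?l"] pq by (intro sym_tensor_in_sym_space) (auto simp: e_def)
        then show ?thesis using set_plus_intro[OF _ subspace_0[OF subspace_sym_space]] by fastforce
      qed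
    qed
  qed
  then show ?thesis using dimS card_normal_pairs by simp
qed

text \<open>The special case \<open>U = {0}\<close> of the count above.\<close>

lemma dim_sym_space:
  fixes V :: "(real^'n) set"
  assumes V: "subspace V"
  shows "2 * dim (sym_space V V) = dim V * (dim V + 1)"
proof -
  have "{sym_tensor a b |a b. a \<in> {0} \<and> b \<in> V} = {0}" using subspace_0[OF V] by auto
  then have "sym_space {0} V = {0}" unfolding sym_space_def by (simp add: span_insert_0)
  then have "sym_space V V + sym_space {0} V = sym_space V V" by (simp add: set_plus_def)
  then show ?thesis using dim_normal_sym[of "{0}" V] V by simp
qed

section \<open>Exponents and binomial sums\<close>

text \<open>The support is exactly \<open>f\<close>, since multiplication by the bubble of
  \<open>f\<close> makes every exponent on \<open>f\<close> positive. Every exponent thus belongs to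
  a single face, which decouples the faces.\<close>

definition expo :: "nat \<Rightarrow> nat set \<Rightarrow> (nat \<Rightarrow> nat) set" where
  "expo k f = {\<alpha>. (\<forall>i. \<alpha> i \<noteq> 0 \<longleftrightarrow> i \<in> f) \<and> sum \<alpha> f = k}"

lemma expo_singleton: "k \<ge> 1 \<Longrightarrow> expo k {x} = {(\<lambda>_. 0)(x := k)}"
  by (auto simp: expo_def fun_eq_iff split: if_splits)

text \<open>The exponent \<open>a\<close> of the new vertex stays below \<open>k\<close> because
  \<open>f\<close> is nonempty and takes at least one unit.\<close>

lemma expo_insert_bij:
  assumes f: "finite f" "x \<notin> f" "f \<noteq> {}"
  shows "bij_betw (\<lambda>(a, \<alpha>). \<alpha>(x := a)) (SIGMA a:{1..<k}. expo (k - a) f) (expo k (insert x f))"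
proof (rule bij_betw_byWitness[where f' = "\<lambda>\<alpha>. (\<alpha> x, \<alpha>(x := 0))"])
  have upd: "sum (\<alpha>(x := a)) f = sum \<alpha> f" for \<alpha> :: "nat \<Rightarrow> nat" and a
    using f by (intro sum.cong) auto
  show "\<forall>p\<in>SIGMA a:{1..<k}. expo (k - a) f.
      (\<lambda>\<alpha>. (\<alpha> x, \<alpha>(x := 0))) ((\<lambda>(a, \<alpha>). \<alpha>(x := a)) p) = p"
    using f by (auto simp: expo_def fun_eq_iff)
  show "\<forall>\<alpha>\<in>expo k (insert x f). (\<lambda>(a, \<alpha>). \<alpha>(x := a)) ((\<lambda>\<alpha>. (\<alpha> x, \<alpha>(x := 0))) \<alpha>) = \<alpha>"
    by auto
  show "(\<lambda>(a, \<alpha>). \<alpha>(x := a)) ` (SIGMA a:{1..<k}. expo (k - a) f) \<subseteq> expo k (insert x f)"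
  proof clarify
    fix a \<alpha> assume a: "a \<in> {1..<k}" and "\<alpha> \<in> expo (k - a) f"
    then have \<alpha>: "\<And>i. \<alpha> i \<noteq> 0 \<longleftrightarrow> i \<in> f" "sum \<alpha> f = k - a" by (auto simp: expo_def)
    have "sum (\<alpha>(x := a)) (insert x f) = a + sum (\<alpha>(x := a)) f" using f by simp
    also have "\<dots> = k" using a \<alpha>(2) by (simp only: upd) simp
    finally have "sum (\<alpha>(x := a)) (insert x f) = k" .
    moreover have "(\<alpha>(x := a)) i \<noteq> 0 \<longleftrightarrow> i \<in> insert x f" for i using a \<alpha>(1)[of i] by auto
    ultimately show "\<alpha>(x := a) \<in> expo k (insert x f)" unfolding expo_def by blast
  qed
  show "(\<lambda>\<alpha>. (\<alpha> x, \<alpha>(x := 0))) ` expo k (insert x f) \<subseteq> (SIGMA a:{1..<k}. expo (k - a) f)"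
  proof clarify
    fix \<alpha> assume "\<alpha> \<in> expo k (insert x f)"
    then have \<alpha>: "\<And>i. \<alpha> i \<noteq> 0 \<longleftrightarrow> i \<in> insert x f" "\<alpha> x + sum \<alpha> f = k"
      using f by (auto simp: expo_def)
    have "\<alpha> x \<noteq> 0" using \<alpha>(1) by blast
    moreover obtain y where "y \<in> f" using f by blast
    then have "\<alpha> y \<noteq> 0" "\<alpha> y \<le> sum \<alpha> f" using \<alpha>(1) f by (auto intro: member_le_sum)
    ultimately have "\<alpha> x \<in> {1..<k}" using \<alpha>(2) by auto
    moreover have "sum (\<alpha>(x := 0)) f = k - \<alpha> x" using \<alpha>(2) by (simp only: upd)
    moreover have "(\<alpha>(x := 0)) i \<noteq> 0 \<longleftrightarrow> i \<in> f" for i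
      using \<alpha>(1)[of i] f by auto
    ultimately show "\<alpha> x \<in> {1..<k} \<and> \<alpha>(x := 0) \<in> expo (k - \<alpha> x) f"
      by (simp add: expo_def del: fun_upd_apply)
  qed
qed

text \<open>These are the compositions of \<open>k\<close> into \<open>card f\<close> positive
  parts. Splitting off one part gives a sum of binomials with fixed lower index (the hockey-stick
  identity).\<close>

lemma finite_card_expo:
  assumes "finite f" "f \<noteq> {}" "k \<ge> 1"
  shows "finite (expo k f) \<and> card (expo k f) = (k - 1) choose (card f - 1)"
  using assms
proof (induction f arbitrary: k rule: finite_ne_induct)
  case (singleton x)
  then show ?case by (simp add: expo_singleton)
next
  case (insert x f)
  note bij = expo_insert_bij[OF insert(1,3,2), of k]
  have IH: "finite (expo (k - a) f)" "card (expo (k - a) f) = (k - a - 1) choose (card f - 1)"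
    if "a \<in> {1..<k}" for a using insert.IH[of "k - a"] that by auto
  have "finite (SIGMA a:{1..<k}. expo (k - a) f)" using IH(1) by (intro finite_SigmaI) auto
  then have fin: "finite (expo k (insert x f))" using bij bij_betw_finite by blast
  obtain n where n: "card f = Suc n" using insert(1,2) by (metis card_eq_0_iff not0_implies_Suc)
  obtain m where m: "k = Suc m" using insert(5) by (metis One_nat_def Suc_le_D)
  have "card (expo k (insert x f)) = card (SIGMA a:{1..<k}. expo (k - a) f)"
    using bij_betw_same_card[OF bij] by simp
  also have "\<dots> = (\<Sum>a\<in>{1..<k}. (k - a - 1) choose n)"
    using IH n by (subst card_SigmaI) auto
  also have "\<dots> = (\<Sum>b\<in>{..<m}. b choose n)"
    by (rule sum.reindex_bij_witness[where i = "\<lambda>b. m - b" and j = "\<lambda>a. m - a"]) (auto simp: m)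
  also have "\<dots> = m choose Suc n"
  proof (cases m)
    case (Suc j)
    then show ?thesis using sum_choose_upper[of n j] by (simp add: lessThan_Suc_atMost)
  qed simp
  finally show ?case using fin n m insert(1,3) by simp
qed

section \<open>Vandermonde sums and the dimension count\<close>

lemma vandermonde_diag: "(\<Sum>l\<le>n. (a choose l) * (n choose l)) = (a + n) choose n"
proof -
  have "(\<Sum>l\<le>n. (a choose l) * (n choose l)) = (\<Sum>l\<le>n. (a choose l) * (n choose (n - l)))"
    by (intro sum.cong refl) (auto simp: binomial_symmetric[symmetric])
  then show ?thesis by (simp add: vandermonde)
qed

lemma vandermonde_shift: "(\<Sum>l\<le>Suc n. (a choose l) * (Suc n choose Suc l)) = (a + Suc n) choose n"
proof -
  have "(\<Sum>l\<le>Suc n. (a choose l) * (Suc n choose Suc l)) = (\<Sum>l\<le>n. (a choose l) * (Suc n choose Suc l))"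
    by simp
  also have "\<dots> = (\<Sum>l\<le>n. (a choose l) * (Suc n choose (n - l)))"
  proof (intro sum.cong refl)
    fix l assume "l \<in> {..n}"
    then show "(a choose l) * (Suc n choose Suc l) = (a choose l) * (Suc n choose (n - l))"
      using binomial_symmetric[of "Suc l" "Suc n"] by simp
  qed
  also have "\<dots> = (a + Suc n) choose n" by (rule vandermonde)
  finally show ?thesis .
qed

lemma vandermonde_shift_weighted:
  "(\<Sum>l\<le>Suc n. (a choose l) * (Suc l * (Suc n choose Suc l))) = Suc n * ((a + n) choose n)"
proof -
  have "(\<Sum>l\<le>Suc n. (a choose l) * (Suc l * (Suc n choose Suc l))) =
      (\<Sum>l\<le>Suc n. Suc n * ((a choose l) * (n choose l)))"
    by (intro sum.cong refl) (simp only: Suc_times_binomial mult_ac)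
  also have "\<dots> = Suc n * (\<Sum>l\<le>n. (a choose l) * (n choose l))"
    by (simp add: sum_distrib_left)
  finally show ?thesis by (simp only: vandermonde_diag)
qed

lemma vandermonde_weighted:
  "(\<Sum>l\<le>Suc n. (a choose l) * (l * (Suc n choose l))) = Suc n * ((a + n) choose Suc n)"
proof -
  have "(\<Sum>l\<le>Suc n. (a choose l) * (l * (Suc n choose l))) =
      (\<Sum>l\<le>Suc n. Suc n * ((a choose l) * (n choose (Suc n - l))))"
  proof (intro sum.cong refl)
    fix l assume l: "l \<in> {..Suc n}"
    show "(a choose l) * (l * (Suc n choose l)) = Suc n * ((a choose l) * (n choose (Suc n - l)))"
    proof (cases l)
      case (Suc j)
      then have "n choose j = n choose (Suc n - l)" using l binomial_symmetric[of j n] by simp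
      then have "l * (Suc n choose l) = Suc n * (n choose (Suc n - l))"
        using Suc_times_binomial[of j n] Suc by (simp only:)
      then show ?thesis by (simp only: mult.left_commute)
    qed simp
  qed
  then show ?thesis by (simp add: sum_distrib_left[symmetric] vandermonde del: sum.atMost_Suc mult_Suc)
qed

text \<open>Each term is a number of \<open>l\<close>-faces times a local dimension: normal tensors,
  enrichment (pairs of the \<open>m\<close> vertices outside the face), interior normal tensors,
  tangential-normal functions (on \<open>d (d + 1) / 2\<close> interior facets), and tangential
  tensors on \<open>d + 1\<close> cells. The absorption identities \<open>R1\<close> to
  \<open>R3\<close> trade the factors \<open>m\<close> and \<open>m + 1\<close> for binomials with
  upper index \<open>d\<close>, which the Vandermonde sums can handle.\<close>

lemma dim_count_term:
  fixes d l :: nat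
  assumes d: "d \<ge> 1" and l: "l \<le> d"
  defines "m \<equiv> real d - real l" and "X \<equiv> real (d choose l)" and "Y \<equiv> real (d choose Suc l)"
  shows "real (Suc d choose Suc l) * (m * (m + 1) / 2 + real l * m)
      + real (Suc d choose Suc l) * (m * (m - 1) / 2)
      + real (Suc d choose l) * (m * (m + 1) / 2)
      + real d * (real d + 1) / 2 * (Y * real l)
      + (real d + 1) * (real (Suc d choose Suc l) * (real l * (real l + 1) / 2))
    = real d * (real d + 1) / 2 * ((real l + 1) * Y + Y + real l * X + X)"
proof -
  have R1: "(real l + 1) * Y = m * X"
  proof -
    have "Suc l * (d choose Suc l) = (d - l) * (d choose l)"
      using d Suc_times_binomial[of l "d - 1"] binomial_absorb_comp[of d l] by (cases d) auto
    then have "real (Suc l * (d choose Suc l)) = real ((d - l) * (d choose l))" by simp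
    then show ?thesis using l by (simp add: m_def X_def Y_def of_nat_diff algebra_simps)
  qed
  have R2: "real (Suc d choose Suc l) * m = (real d + 1) * Y"
  proof -
    have "(d - l) * (Suc d choose Suc l) = Suc d * (d choose Suc l)"
      using binomial_absorb_comp[of "Suc d" "Suc l"] by simp
    then have "real (d - l) * real (Suc d choose Suc l) = real (Suc d) * real (d choose Suc l)"
      by (metis of_nat_mult)
    moreover have "real (d - l) = m" using l by (simp add: m_def of_nat_diff)
    ultimately show ?thesis by (simp add: Y_def mult.commute add.commute)
  qed
  have R3: "real (Suc d choose l) * (m + 1) = (real d + 1) * X"
  proof -
    have "(Suc d - l) * (Suc d choose l) = Suc d * (d choose l)"
      using binomial_absorb_comp[of "Suc d" "l"] by simp
    then have "real (Suc d - l) * real (Suc d choose l) = real (Suc d) * real (d choose l)"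
      by (metis of_nat_mult)
    moreover have "real (Suc d - l) = m + 1" using l by (simp add: m_def of_nat_diff)
    ultimately show ?thesis by (simp add: X_def mult.commute add.commute)
  qed
  have R4: "real (Suc d choose Suc l) = X + Y" by (simp add: X_def Y_def)
  have ml: "m + real l = real d" by (simp add: m_def)
  have t1: "real (Suc d choose Suc l) * (m * (m + 1) / 2 + real l * m)
      + real (Suc d choose Suc l) * (m * (m - 1) / 2) = (real d + 1) * Y * real d"
  proof -
    have "real (Suc d choose Suc l) * (m * (m + 1) / 2 + real l * m)
      + real (Suc d choose Suc l) * (m * (m - 1) / 2) = real (Suc d choose Suc l) * m * (m + real l)"
      by (simp add: field_simps)
    then show ?thesis unfolding R2 ml .
  qed
  have t2: "real (Suc d choose l) * (m * (m + 1) / 2) = (real d + 1) * X * m / 2"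
    unfolding R3[symmetric] by (simp add: field_simps)
  have t4: "(real d + 1) * (real (Suc d choose Suc l) * (real l * (real l + 1) / 2)) =
     (real d + 1) / 2 * (X * real l * (real l + 1) + real l * (m * X))"
    unfolding R4 R1[symmetric] by (simp add: field_simps)
  have *: "real d * ((real l + 1) * X) = X * m + X * real l * (real l + 1) + real l * (m * X)"
    unfolding ml[symmetric] by (simp add: algebra_simps)
  have "real (Suc d choose Suc l) * (m * (m + 1) / 2 + real l * m)
      + real (Suc d choose Suc l) * (m * (m - 1) / 2)
      + real (Suc d choose l) * (m * (m + 1) / 2)
      + real d * (real d + 1) / 2 * (Y * real l)
      + (real d + 1) * (real (Suc d choose Suc l) * (real l * (real l + 1) / 2))
    = (real d + 1) / 2 * (2 * real d * Y + real d * (Y * real l)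
      + (X * m + X * real l * (real l + 1) + real l * (m * X)))"
    unfolding t1 t2 t4 by (simp add: field_simps)
  also have "\<dots> = real d * (real d + 1) / 2 * ((real l + 1) * Y + Y + real l * X + X)"
    unfolding *[symmetric] by (simp add: field_simps)
  finally show ?thesis .
qed

text \<open>With \<open>\<kappa> = k - 1\<close> and \<open>D = d - 1\<close>, all binomials reduce
  to three neighbours in row \<open>\<kappa> + D\<close> of Pascal's triangle; the first two claims,
  instances of absorption, relate these neighbours to each other.\<close>

lemma dim_formula_relations:
  fixes D \<kappa> :: nat
  assumes "D \<ge> 1"
  shows "real (Suc D) * real ((\<kappa> + D) choose Suc D) = real \<kappa> * real ((\<kappa> + D) choose D)"
    and "real D * real ((\<kappa> + D) choose D) = (real \<kappa> + 1) * real ((\<kappa> + D) choose (D - 1))"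
    and "real (Suc (\<kappa> + D) choose D) = real ((\<kappa> + D) choose D) + real ((\<kappa> + D) choose (D - 1))"
    and "real (Suc (\<kappa> + D) choose Suc D) = real ((\<kappa> + D) choose D) + real ((\<kappa> + D) choose Suc D)"
    and "real (Suc (\<kappa> + D) choose Suc \<kappa>) = real ((\<kappa> + D) choose D) + real ((\<kappa> + D) choose (D - 1))"
proof -
  have r: "Suc j * (n choose Suc j) = (n - j) * (n choose j)" for j n :: nat
    using Suc_times_binomial[of j "n - 1"] binomial_absorb_comp[of n j] by (cases n) auto
  have "real (Suc D * ((\<kappa> + D) choose Suc D)) = real (\<kappa> * ((\<kappa> + D) choose D))"
    using r[of D "\<kappa> + D"] by simp
  then show "real (Suc D) * real ((\<kappa> + D) choose Suc D) = real \<kappa> * real ((\<kappa> + D) choose D)"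
    by (simp only: of_nat_mult)
  obtain E where E: "D = Suc E" using assms by (metis One_nat_def Suc_le_D)
  have "real (D * ((\<kappa> + D) choose D)) = real (Suc \<kappa> * ((\<kappa> + D) choose (D - 1)))"
    using r[of E "\<kappa> + D"] E by (simp del: binomial_Suc_Suc mult_Suc)
  then show "real D * real ((\<kappa> + D) choose D) = (real \<kappa> + 1) * real ((\<kappa> + D) choose (D - 1))"
    by (simp only: of_nat_mult of_nat_Suc add.commute)
  show 3: "real (Suc (\<kappa> + D) choose D) = real ((\<kappa> + D) choose D) + real ((\<kappa> + D) choose (D - 1))"
    using E by simp
  show "real (Suc (\<kappa> + D) choose Suc D) = real ((\<kappa> + D) choose D) + real ((\<kappa> + D) choose Suc D)"
    by simp
  have "Suc (\<kappa> + D) choose Suc \<kappa> = Suc (\<kappa> + D) choose D"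
    using binomial_symmetric[of "Suc \<kappa>" "Suc (\<kappa> + D)"] by simp
  then show "real (Suc (\<kappa> + D) choose Suc \<kappa>) = real ((\<kappa> + D) choose D) + real ((\<kappa> + D) choose (D - 1))"
    using 3 by simp
qed

lemma dim_count_sum:
  fixes d k :: nat
  assumes d: "d \<ge> 2" and k: "k \<ge> 1"
  shows "(\<Sum>l\<in>{0..d-1}. real (Suc d choose Suc l) * (real ((k - 1) choose l) * ((real d - real l) * (real d - real l + 1) / 2 + real l * (real d - real l))))
    + (\<Sum>l\<in>{0..d-1}. real (Suc d choose Suc l) * (real ((k - 1) choose l) * ((real d - real l) * (real d - real l - 1) / 2)))
    + (\<Sum>l\<in>{0..d-1}. real (Suc d choose l) * (real ((k - 1) choose l) * ((real d - real l) * (real d - real l + 1) / 2)))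
    + real d * (real d + 1) / 2 * (\<Sum>l\<in>{0..d-1}. real (d choose Suc l) * (real ((k - 1) choose l) * real l))
    + (real d + 1) * (\<Sum>l\<in>{0..d}. real (Suc d choose Suc l) * (real ((k - 1) choose l) * (real l * (real l + 1) / 2)))
    = real d * (real d + 1) * real ((k + d - 1) choose (d - 1))
        + 1/2 * real d * (real d + 1) * real ((k + d - 2) choose (d - 1))
        + 1/2 * real d * (real d + 1) * (real k - 1) * real ((k + d - 2) choose (d - 2))
        + 1/2 * real d * (real d + 1)^2 * real ((k + d - 2) choose d)" (is "?S = ?F")
proof -
  obtain D where D: "d = Suc D" "D \<ge> 1" using d by (cases d) auto
  obtain \<kappa> where \<kappa>: "k = Suc \<kappa>" using k by (cases k) auto
  let ?a = "real ((\<kappa> + D) choose D)" and ?b = "real ((\<kappa> + D) choose Suc D)"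
  let ?c = "real ((\<kappa> + D) choose (D - 1))"
  \<comment> \<open>Only the element bubbles have a term with \<open>l = d\<close>. The other four
    summands vanish there, by the factor \<open>d - l\<close> or by
    \<open>d choose Suc d = 0\<close>, so all sums may run over the same range.\<close>
  have ext: "(\<Sum>l\<in>{0..d-1}. g l) = (\<Sum>l\<le>d. g l)" if "g d = 0" for g :: "nat \<Rightarrow> real"
    using that D by (simp add: atLeast0AtMost)
  define K where "K = (\<lambda>l. real ((k - 1) choose l))"
  have "?S = (\<Sum>l\<le>d. real (Suc d choose Suc l) * (real ((k - 1) choose l) * ((real d - real l) * (real d - real l + 1) / 2 + real l * (real d - real l))))
    + (\<Sum>l\<le>d. real (Suc d choose Suc l) * (real ((k - 1) choose l) * ((real d - real l) * (real d - real l - 1) / 2)))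
    + (\<Sum>l\<le>d. real (Suc d choose l) * (real ((k - 1) choose l) * ((real d - real l) * (real d - real l + 1) / 2)))
    + real d * (real d + 1) / 2 * (\<Sum>l\<le>d. real (d choose Suc l) * (real ((k - 1) choose l) * real l))
    + (real d + 1) * (\<Sum>l\<le>d. real (Suc d choose Suc l) * (real ((k - 1) choose l) * (real l * (real l + 1) / 2)))"
    by (intro arg_cong2[where f = "(+)"] arg_cong2[where f = "(*)"] refl ext) (auto simp: atLeast0AtMost)
  also have "\<dots> = (\<Sum>l\<le>d. K l * (real (Suc d choose Suc l) * ((real d - real l) * (real d - real l + 1) / 2 + real l * (real d - real l))
      + real (Suc d choose Suc l) * ((real d - real l) * (real d - real l - 1) / 2)
      + real (Suc d choose l) * ((real d - real l) * (real d - real l + 1) / 2)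
      + real d * (real d + 1) / 2 * (real (d choose Suc l) * real l)
      + (real d + 1) * (real (Suc d choose Suc l) * (real l * (real l + 1) / 2))))"
    unfolding sum_distrib_left sum.distrib[symmetric]
    by (intro sum.cong refl) (simp add: K_def field_simps del: binomial_Suc_Suc)
  also have "\<dots> = (\<Sum>l\<le>d. K l * (real d * (real d + 1) / 2 * ((real l + 1) * real (d choose Suc l) + real (d choose Suc l) + real l * real (d choose l) + real (d choose l))))"
    using d by (intro sum.cong refl, subst dim_count_term) auto
  also have "\<dots> = real d * (real d + 1) / 2 * (
      real (\<Sum>l\<le>d. ((k - 1) choose l) * (Suc l * (d choose Suc l)))
      + real (\<Sum>l\<le>d. ((k - 1) choose l) * (d choose Suc l))
      + real (\<Sum>l\<le>d. ((k - 1) choose l) * (l * (d choose l)))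
      + real (\<Sum>l\<le>d. ((k - 1) choose l) * (d choose l)))"
    unfolding of_nat_sum of_nat_mult K_def[symmetric] sum_distrib_left distrib_left sum.distrib[symmetric]
    by (intro sum.cong refl) (simp add: K_def field_simps)
  also have "\<dots> = real d * (real d + 1) / 2 * (real d * ?a + (?a + ?c) + real d * ?b + (?a + ?b))"
    unfolding D(1) \<kappa> vandermonde_shift_weighted vandermonde_shift vandermonde_weighted vandermonde_diag
      diff_Suc_1 of_nat_mult add_Suc_right dim_formula_relations(3,4)[OF D(2)] by simp
  \<comment> \<open>The last bracket is zero by absorption; it converts part of the coefficient of
    \<open>?a\<close> into the multiples of \<open>?c\<close> that the stated form has.\<close>
  also have "\<dots> = real d * (real d + 1) * (?a + ?c) + 1/2 * real d * (real d + 1) * ?a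
      + 1/2 * real d * (real d + 1) * real \<kappa> * ?c + 1/2 * real d * (real d + 1)^2 * ?b
      + real d * (real d + 1) / 2 * (real D * ?a - (real \<kappa> + 1) * ?c)"
    by (simp add: D(1) field_simps power2_eq_square)
  also have "\<dots> = real d * (real d + 1) * (?a + ?c) + 1/2 * real d * (real d + 1) * ?a
      + 1/2 * real d * (real d + 1) * real \<kappa> * ?c + 1/2 * real d * (real d + 1)^2 * ?b"
    using dim_formula_relations(2)[OF D(2), of \<kappa>] by simp
  also have "\<dots> = ?F"
    using dim_formula_relations(3)[OF D(2), of \<kappa>] by (simp add: D \<kappa> numeral_2_eq_2)
  finally show ?thesis .
qed

text \<open>Both forms are linear in three neighbouring binomials, and their difference is a
  combination of the two absorption identities.\<close>

lemma dim_formula_eq: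
  fixes d k :: nat
  assumes d: "d \<ge> 2" and k: "k \<ge> 1"
  shows "real d * (real d + 1) * real ((k + d - 1) choose (d - 1))
        + 1/2 * real d * (real d + 1) * real ((k + d - 2) choose (d - 1))
        + 1/2 * real d * (real d + 1) * (real k - 1) * real ((k + d - 2) choose (d - 2))
        + 1/2 * real d * (real d + 1)^2 * real ((k + d - 2) choose d)
      = 1/2 * (real d + 1) * real ((k + d - 1) choose k) * ((real d + 1) * real k + real d)"
    (is "?F = ?G")
proof -
  obtain D where D: "d = Suc D" "D \<ge> 1" using d by (cases d) auto
  obtain \<kappa> where \<kappa>: "k = Suc \<kappa>" using k by (cases k) auto
  define a b c where abc: "a = real ((\<kappa> + D) choose D)" "b = real ((\<kappa> + D) choose Suc D)"
    "c = real ((\<kappa> + D) choose (D - 1))"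
  note rel = dim_formula_relations[OF D(2), of \<kappa>, folded abc]
  have F: "?F = real d * (real d + 1) * (a + c) + 1/2 * real d * (real d + 1) * a
      + 1/2 * real d * (real d + 1) * real \<kappa> * c + 1/2 * real d * (real d + 1)^2 * b"
    using rel(3) by (simp add: D \<kappa> numeral_2_eq_2 abc)
  have G: "?G = 1/2 * (real d + 1) * (a + c) * ((real d + 1) * (real \<kappa> + 1) + real d)"
    using rel(5) by (simp add: D \<kappa> algebra_simps del: binomial_Suc_Suc)
  have "?F - ?G = 1/2 * (real d + 1) * (real D * a - (real \<kappa> + 1) * c)
      + 1/2 * (real d + 1)^2 * (real (Suc D) * b - real \<kappa> * a)"
    unfolding F G by (simp add: D(1) field_simps power2_eq_square)
  also have "\<dots> = 0" using rel(1,2) by simp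
  finally show ?thesis by simp
qed

section \<open>Geometry of the split\<close>

text \<open>The three properties characterise barycentric coordinates; general affine functions are
  allowed because the lemma serves the whole simplex and each cell.\<close>

lemma convex_hull_coords:
  fixes w :: "'i \<Rightarrow> 'a::euclidean_space"
  assumes J: "finite J" and sum1: "\<And>x. (\<Sum>j\<in>J. g j \<bullet> x + h j) = (1::real)"
    and rep: "\<And>x. (\<Sum>j\<in>J. (g j \<bullet> x + h j) *\<^sub>R w j) = x"
    and delta: "\<And>j m. j \<in> J \<Longrightarrow> m \<in> J \<Longrightarrow> g j \<bullet> w m + h j = (if j = m then 1 else 0)"
  shows "convex hull (w ` J) = {x. \<forall>j\<in>J. g j \<bullet> x + h j \<ge> 0}"
proof
  have "- h j \<le> g j \<bullet> x \<longleftrightarrow> 0 \<le> g j \<bullet> x + h j" for j x by linarith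
  then have "{x. \<forall>j\<in>J. g j \<bullet> x + h j \<ge> 0} = (\<Inter>j\<in>J. {x. g j \<bullet> x \<ge> - h j})" by auto
  then have "convex {x. \<forall>j\<in>J. g j \<bullet> x + h j \<ge> 0}"
    by (simp add: convex_INT convex_halfspace_ge)
  then show "convex hull (w ` J) \<subseteq> {x. \<forall>j\<in>J. g j \<bullet> x + h j \<ge> 0}"
    by (intro hull_minimal) (auto simp: delta)
  show "{x. \<forall>j\<in>J. g j \<bullet> x + h j \<ge> 0} \<subseteq> convex hull (w ` J)"
  proof clarify
    fix x assume x: "\<forall>j\<in>J. g j \<bullet> x + h j \<ge> 0"
    have "(\<Sum>j\<in>J. (g j \<bullet> x + h j) *\<^sub>R w j) \<in> convex hull (w ` J)"
      using J x sum1 by (intro convex_sum convex_convex_hull) (auto intro: hull_inc)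
    then show "x \<in> convex hull (w ` J)" by (simp add: rep)
  qed
qed

locale simplex =
  fixes v :: "nat \<Rightarrow> real^'n" and d :: nat
  assumes d_eq: "d = CARD('n)"
    and inj_v: "inj_on v {..d}"
    and affine_indep: "\<not> affine_dependent (v ` {..d})"
begin

lemma d_pos: "d \<ge> 1" using d_eq by (simp add: Suc_le_eq)

lemma independent_edges:
  assumes "j \<le> d"
  shows "independent ((\<lambda>x. - v j + x) ` (v ` {..d} - {v j}))"
  using affine_indep affine_dependent_iff_dependent2[of "v j" "v ` {..d}"] assms by blast

lemma ex_bary:
  assumes j: "j \<le> d"
  shows "\<exists>p. \<forall>m\<le>d. fst p \<bullet> v m + snd p = (if m = j then 1 else 0)"
proof -
  obtain f :: "real^'n \<Rightarrow> real" where f: "linear f"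
      "\<forall>x\<in>(\<lambda>x. - v j + x) ` (v ` {..d} - {v j}). f x = -1"
    using linear_independent_extend[OF independent_edges[OF j], of "\<lambda>_. -1"] by blast
  \<comment> \<open>The Riesz representative of \<open>f\<close>; the constant
    \<open>1 - g \<bullet> v j\<close> then makes the affine function 1 at \<open>v j\<close> and 0
    at the other vertices.\<close>
  define g where "g = adjoint f 1"
  have g: "g \<bullet> x = f x" for x using adjoint_works[OF f(1), of x 1] by (simp add: g_def inner_commute)
  have "g \<bullet> v m + (1 - g \<bullet> v j) = (if m = j then 1 else 0)" if "m \<le> d" for m
  proof (cases "m = j")
    case False
    then have "v m \<in> v ` {..d} - {v j}" using that j inj_v by (auto simp: inj_on_def)
    then have "f (- v j + v m) = -1" using f(2) by blast
    then show ?thesis using False by (simp add: g[symmetric] inner_diff_right algebra_simps inner_add_right)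
  qed simp
  then show ?thesis by (intro exI[of _ "(g, 1 - g \<bullet> v j)"]) simp
qed

text \<open>The functions \<open>mu j\<close>, with gradients \<open>gm j\<close>, are the barycentric coordinates of \<open>T\<close>.  All of them equal
  \<open>1 / (d + 1)\<close> at the barycenter; hence the barycentric coordinates of the cell \<open>i\<close> are the functions \<open>cl i j\<close>
  below, with gradients \<open>cg i j\<close>.\<close>

definition bary :: "nat \<Rightarrow> (real^'n) \<times> real" where
  "bary j = (SOME p. \<forall>m\<le>d. fst p \<bullet> v m + snd p = (if m = j then 1 else 0))"

definition gm :: "nat \<Rightarrow> real^'n" where "gm j = fst (bary j)"

definition mu :: "nat \<Rightarrow> real^'n \<Rightarrow> real" where "mu j x = gm j \<bullet> x + snd (bary j)"

lemma mu_vertex: "j \<le> d \<Longrightarrow> m \<le> d \<Longrightarrow> mu j (v m) = (if m = j then 1 else 0)"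
  using someI_ex[OF ex_bary] unfolding mu_def gm_def bary_def by blast

text \<open>The \<open>d\<close> edge vectors at \<open>v 0\<close> are independent and hence span
  the space, so a gradient orthogonal to all of them is zero.\<close>

lemma affine_zero:
  assumes "\<And>m. m \<le> d \<Longrightarrow> g \<bullet> v m + h = (0::real)"
  shows "g = 0" "h = 0"
proof -
  let ?B = "(\<lambda>x. - v 0 + x) ` (v ` {..d} - {v 0})"
  have "card ?B = card (v ` {..d} - {v 0})" by (rule card_image) auto
  also have "\<dots> = card (v ` {..d}) - 1" by (rule card_Diff_singleton) auto
  also have "card (v ` {..d}) = Suc d" by (simp add: card_image inj_v)
  finally have "dim ?B = DIM(real^'n)"
    using dim_eq_card_independent[OF independent_edges[of 0]] by (simp add: d_eq)
  then have "span ?B = UNIV" by (simp only: dim_eq_full)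
  moreover have "orthogonal g y" if "y \<in> ?B" for y
  proof -
    from that obtain m where m: "m \<le> d" "y = - v 0 + v m" by blast
    then show ?thesis using assms[of m] assms[of 0] by (simp add: orthogonal_def inner_diff_right inner_add_right)
  qed
  ultimately have "orthogonal g g" using orthogonal_to_span[of g ?B g] by blast
  then show "g = 0" by (simp add: orthogonal_def)
  then show "h = 0" using assms[of 0] by simp
qed

lemma affine_eq:
  assumes "\<And>m. m \<le> d \<Longrightarrow> g \<bullet> v m + h = g' \<bullet> v m + (h'::real)"
  shows "g = g'" "h = h'"
  using affine_zero[of "g - g'" "h - h'"] assms by (auto simp: inner_diff_left algebra_simps)

lemma sum_mu_aux: "(\<Sum>j\<le>d. a j * mu j x) = (\<Sum>j\<le>d. a j *\<^sub>R gm j) \<bullet> x + (\<Sum>j\<le>d. a j * snd (bary j))"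
  by (simp add: mu_def inner_sum_left algebra_simps sum.distrib)

lemma sum_mu_vertex: "m \<le> d \<Longrightarrow> (\<Sum>j\<le>d. a j * mu j (v m)) = a m"
proof -
  assume m: "m \<le> d"
  have "(\<Sum>j\<le>d. a j * mu j (v m)) = (\<Sum>j\<le>d. if m = j then a j else 0)"
    using m by (intro sum.cong) (auto simp: mu_vertex)
  then show ?thesis using m by simp
qed

lemma sum_mu: "(\<Sum>j\<le>d. mu j x) = 1"
proof -
  have eq: "(\<Sum>j\<le>d. 1 *\<^sub>R gm j) \<bullet> v m + (\<Sum>j\<le>d. 1 * snd (bary j)) = 0 \<bullet> v m + 1" if "m \<le> d" for m
    using sum_mu_vertex[OF that, of "\<lambda>_. 1"] unfolding sum_mu_aux by simp
  show ?thesis using affine_eq[OF eq] sum_mu_aux[of "\<lambda>_. 1" x] by simp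
qed

lemma sum_mu_scaleR: "(\<Sum>j\<le>d. mu j x *\<^sub>R v j) = x"
proof (rule vector_eq_ldot[THEN iffD1, rule_format])
  fix e
  have eq: "(\<Sum>j\<le>d. (e \<bullet> v j) *\<^sub>R gm j) \<bullet> v m + (\<Sum>j\<le>d. (e \<bullet> v j) * snd (bary j)) = e \<bullet> v m + 0" if "m \<le> d" for m
    using sum_mu_vertex[OF that, of "\<lambda>j. e \<bullet> v j"] by (simp add: sum_mu_aux)
  show "e \<bullet> (\<Sum>j\<le>d. mu j x *\<^sub>R v j) = e \<bullet> x"
    using affine_eq[OF eq] sum_mu_aux[of "\<lambda>j. e \<bullet> v j" x] by (simp add: inner_sum_right mult.commute)
qed

lemma vertex_le: "j \<le> d \<Longrightarrow> vertex v j = v j"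
  by (simp add: vertex_def d_eq)

lemma vertex_center: "vertex v (Suc d) = (1 / (real d + 1)) *\<^sub>R (\<Sum>j\<le>d. v j)"
  by (simp add: vertex_def d_eq add.commute)

lemma mu_add: "mu j (x + e) = mu j x + gm j \<bullet> e"
  by (simp add: mu_def inner_add_right)

lemma mu_center: "j \<le> d \<Longrightarrow> mu j (vertex v (Suc d)) = 1 / (real d + 1)"
proof -
  assume j: "j \<le> d"
  have "(\<Sum>m\<le>d. mu j (v m)) = (\<Sum>m\<le>d. if m = j then 1 else 0)"
    using j by (intro sum.cong) (auto simp: mu_vertex)
  also have "\<dots> = 1" using j by simp
  finally have "gm j \<bullet> (\<Sum>m\<le>d. v m) + (real d + 1) * snd (bary j) = 1"
    by (simp add: mu_def sum.distrib inner_sum_right algebra_simps)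
  then show ?thesis by (simp add: mu_def vertex_center field_simps)
qed

abbreviation J :: "nat \<Rightarrow> nat set" where "J i \<equiv> cell_idx d i"

definition cg :: "nat \<Rightarrow> nat \<Rightarrow> real^'n" where
  "cg i j = (if j = Suc d then (real d + 1) *\<^sub>R gm i else gm j - gm i)"

text \<open>Obtained from the barycentric representation of \<open>x\<close> in the simplex by
  moving the weight \<open>mu i x\<close> from every vertex to the center, which thereby collects
  \<open>(d + 1) * mu i x\<close>. At \<open>j = i\<close> the formula gives 0, the value on this
  cell of the hat function of \<open>v i\<close>.\<close>

definition cl :: "nat \<Rightarrow> nat \<Rightarrow> real^'n \<Rightarrow> real" where
  "cl i j x = (if j = Suc d then (real d + 1) * mu i x else mu j x - mu i x)"

lemma J_eq: "i \<le> d \<Longrightarrow> J i = insert (Suc d) ({..d} - {i})"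
  by (auto simp: cell_idx_def)

lemma finite_J [simp]: "finite (J i)" by (simp add: cell_idx_def)

lemma card_J: "i \<le> d \<Longrightarrow> card (J i) = d + 1"
  by (simp add: cell_idx_def)

lemma cl_affine: "\<exists>b. \<forall>x. cl i j x = cg i j \<bullet> x + b"
  by (rule exI[of _ "if j = Suc d then (real d + 1) * snd (bary i) else snd (bary j) - snd (bary i)"])
    (simp add: cl_def cg_def mu_def inner_diff_left algebra_simps)

lemma cl_add: "cl i j (x + e) = cl i j x + cg i j \<bullet> e"
  using cl_affine[of i j] by (auto simp: inner_add_right)

lemma sum_J: "i \<le> d \<Longrightarrow> (\<Sum>j\<in>J i. F j) = F (Suc d) + (\<Sum>j\<in>{..d} - {i}. F j)"
  for F :: "nat \<Rightarrow> 'b::comm_monoid_add"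
  by (simp add: J_eq)

lemma sum_cl: "i \<le> d \<Longrightarrow> (\<Sum>j\<in>J i. cl i j x) = 1"
proof -
  assume i: "i \<le> d"
  have "(\<Sum>j\<in>{..d} - {i}. cl i j x) = (\<Sum>j\<in>{..d} - {i}. mu j x - mu i x)"
    by (intro sum.cong) (auto simp: cl_def)
  also have "\<dots> = (\<Sum>j\<le>d. mu j x - mu i x)"
    using i by (intro sum.mono_neutral_left) auto
  also have "\<dots> = 1 - (real d + 1) * mu i x" by (simp add: sum_subtractf sum_mu)
  finally show ?thesis using i by (simp add: sum_J cl_def)
qed

lemma sum_cl_vertex: "i \<le> d \<Longrightarrow> (\<Sum>j\<in>J i. cl i j x *\<^sub>R vertex v j) = x"
proof -
  assume i: "i \<le> d"
  have "(\<Sum>j\<in>{..d} - {i}. cl i j x *\<^sub>R vertex v j) = (\<Sum>j\<in>{..d} - {i}. (mu j x - mu i x) *\<^sub>R v j)"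
    by (intro sum.cong) (auto simp: cl_def vertex_le)
  also have "\<dots> = (\<Sum>j\<le>d. (mu j x - mu i x) *\<^sub>R v j)"
    using i by (intro sum.mono_neutral_left) auto
  also have "\<dots> = x - mu i x *\<^sub>R (\<Sum>j\<le>d. v j)"
    by (simp add: scaleR_diff_left sum_subtractf sum_mu_scaleR scaleR_sum_right)
  finally show ?thesis using i by (simp add: sum_J cl_def vertex_center)
qed

lemma cl_vertex: "i \<le> d \<Longrightarrow> j \<in> J i \<Longrightarrow> m \<in> J i \<Longrightarrow> cl i j (vertex v m) = (if j = m then 1 else 0)"
  by (auto simp: J_eq cl_def vertex_le mu_vertex mu_center)

lemma sum_cg: "i \<le> d \<Longrightarrow> (\<Sum>j\<in>J i. cg i j) = 0"
proof -
  assume i: "i \<le> d"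
  have "(\<Sum>j\<in>J i. cl i j e) = (\<Sum>j\<in>J i. cl i j 0) + (\<Sum>j\<in>J i. cg i j) \<bullet> e" for e
    using cl_add[of i _ 0 e] by (simp add: inner_sum_left sum.distrib)
  then have "(\<Sum>j\<in>J i. cg i j) \<bullet> e = 0" for e using i by (simp add: sum_cl)
  then show ?thesis by (metis inner_eq_zero_iff)
qed

lemma sum_cg_vertex: "i \<le> d \<Longrightarrow> (\<Sum>j\<in>J i. (cg i j \<bullet> e) *\<^sub>R vertex v j) = e"
proof -
  assume i: "i \<le> d"
  have "(\<Sum>j\<in>J i. cl i j e *\<^sub>R vertex v j) = (\<Sum>j\<in>J i. cl i j 0 *\<^sub>R vertex v j) + (\<Sum>j\<in>J i. (cg i j \<bullet> e) *\<^sub>R vertex v j)"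
    using cl_add[of i _ 0 e] by (simp add: scaleR_add_left sum.distrib)
  then show ?thesis using i by (simp add: sum_cl_vertex)
qed

text \<open>The gradients sum to zero, so in \<open>sum_cg_vertex\<close> the vertices may be
  replaced by edges from a common origin \<open>s\<close>. The expansion is later applied to edges
  that leave the cell.\<close>

lemma sum_cg_edge: "i \<le> d \<Longrightarrow> (\<Sum>j\<in>J i. (cg i j \<bullet> e) *\<^sub>R edge_vec v s j) = e"
proof -
  assume i: "i \<le> d"
  have "(\<Sum>j\<in>J i. (cg i j \<bullet> e) *\<^sub>R edge_vec v s j) =
    (\<Sum>j\<in>J i. (cg i j \<bullet> e) *\<^sub>R vertex v j) - ((\<Sum>j\<in>J i. cg i j) \<bullet> e) *\<^sub>R vertex v s"
    by (simp add: edge_vec_def scaleR_diff_right sum_subtractf scaleR_sum_left inner_sum_left)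
  then show ?thesis using i by (simp add: sum_cg_vertex sum_cg)
qed

lemma cg_edge:
  assumes "i \<le> d" "j \<in> J i" "a \<in> J i" "b \<in> J i"
  shows "cg i j \<bullet> edge_vec v a b = (if j = b then 1 else 0) - (if j = a then 1 else 0)"
proof -
  have "cl i j (vertex v b) = cl i j (vertex v a) + cg i j \<bullet> edge_vec v a b"
    using cl_add[of i j "vertex v a" "edge_vec v a b"] by (simp add: edge_vec_def)
  then show ?thesis using assms by (simp add: cl_vertex)
qed

lemma cg_nonzero: "i \<le> d \<Longrightarrow> j \<in> J i \<Longrightarrow> cg i j \<noteq> 0"
proof
  assume i: "i \<le> d" and j: "j \<in> J i" and 0: "cg i j = 0"
  have "card (J i - {j}) = d" using i j by (simp add: card_J)
  then obtain a where "a \<in> J i" "a \<noteq> j" using d_pos by (metis Diff_iff card.empty equals0I insertI1 not_one_le_zero)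
  then show False using cg_edge[of i j a j] i j 0 by simp
qed

section \<open>The simplex, its cells and the hat functions\<close>

definition T where "T = convex hull (v ` {..d})"

lemma mem_T: "x \<in> T \<longleftrightarrow> (\<forall>j\<le>d. mu j x \<ge> 0)"
proof -
  have "T = {x. \<forall>j\<in>{..d}. gm j \<bullet> x + snd (bary j) \<ge> 0}"
    unfolding T_def
    by (rule convex_hull_coords) (auto simp: mu_def[symmetric] sum_mu sum_mu_scaleR mu_vertex)
  then show ?thesis by (auto simp: mu_def)
qed

lemma mem_cell: "i \<le> d \<Longrightarrow> x \<in> cell v i \<longleftrightarrow> (\<forall>j\<in>J i. cl i j x \<ge> 0)"
proof -
  assume i: "i \<le> d"
  obtain b where b: "\<And>j x. cl i j x = cg i j \<bullet> x + b j" using cl_affine[of i] by metis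
  have "cell v i = {x. \<forall>j\<in>J i. cg i j \<bullet> x + b j \<ge> 0}"
    unfolding cell_def d_eq[symmetric]
    by (rule convex_hull_coords)
      (use i in \<open>auto simp: b[symmetric] sum_cl sum_cl_vertex cl_vertex\<close>)
  then show ?thesis by (auto simp: b)
qed

text \<open>The cell \<open>i\<close> is the part of the simplex where \<open>mu i\<close> is the
  smallest coordinate, which yields both the covering by cells and the disjointness of their
  interiors.\<close>

lemma mem_cell': "i \<le> d \<Longrightarrow> x \<in> cell v i \<longleftrightarrow> mu i x \<ge> 0 \<and> (\<forall>j\<le>d. mu i x \<le> mu j x)"
  by (auto simp: mem_cell J_eq cl_def zero_le_mult_iff)

lemma cell_subset_T: "i \<le> d \<Longrightarrow> cell v i \<subseteq> T"
  by (auto simp: mem_cell' mem_T) (meson order_trans)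

lemma T_eq_UN: "T = (\<Union>i\<le>d. cell v i)"
proof
  show "T \<subseteq> (\<Union>i\<le>d. cell v i)"
  proof
    fix x assume x: "x \<in> T"
    obtain i where "i \<le> d" "\<And>j. j \<le> d \<Longrightarrow> mu i x \<le> mu j x"
      using ex_min_if_finite[of "(\<lambda>j. mu j x) ` {..d}"] by (force simp: not_less)
    then show "x \<in> (\<Union>i\<le>d. cell v i)" using x by (auto simp: mem_cell' mem_T)
  qed
qed (use cell_subset_T in auto)

lemma compact_T: "compact T" unfolding T_def by (simp add: finite_imp_compact_convex_hull)
lemma convex_T: "convex T" unfolding T_def by (rule convex_convex_hull)
lemma compact_cell: "compact (cell v i)"
  unfolding cell_def by (simp add: finite_imp_compact_convex_hull cell_idx_def)
lemma convex_cell: "convex (cell v i)" unfolding cell_def by (rule convex_convex_hull)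

text \<open>On these sets exactly one cell is active, so they are where classes modulo null sets are
  evaluated.\<close>

definition ocell :: "nat \<Rightarrow> (real^'n) set" where
  "ocell i = {x. \<forall>j\<in>J i. cl i j x > 0}"

lemma continuous_cl: "continuous_on S (cl i j)"
proof -
  obtain b where "cl i j = (\<lambda>x. cg i j \<bullet> x + b)" using cl_affine[of i j] by auto
  then show ?thesis by (auto intro!: continuous_intros)
qed

lemma open_ocell: "open (ocell i)"
proof -
  have "ocell i = (\<Inter>j\<in>J i. {x. cl i j x > 0})" by (auto simp: ocell_def)
  then show ?thesis by (auto intro!: open_INT open_Collect_less continuous_cl continuous_on_const)
qed

lemma ocell_subset: "i \<le> d \<Longrightarrow> ocell i \<subseteq> cell v i"
  by (auto simp: ocell_def mem_cell less_imp_le)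

lemma negligible_cell_ocell: "i \<le> d \<Longrightarrow> negligible (cell v i - ocell i)"
proof -
  assume i: "i \<le> d"
  have "negligible {x. cl i j x = 0}" if "j \<in> J i" for j
  proof -
    obtain b where "\<And>x. cl i j x = cg i j \<bullet> x + b" using cl_affine[of i j] by auto
    then have "{x. cl i j x = 0} = {x. cg i j \<bullet> x = - b}" by auto
    then show ?thesis using cg_nonzero[OF i that] negligible_hyperplane by auto
  qed
  then have "negligible (\<Union>j\<in>J i. {x. cl i j x = 0})" by (intro negligible_Union) auto
  moreover have "cell v i - ocell i \<subseteq> (\<Union>j\<in>J i. {x. cl i j x = 0})"
    using i by (auto simp: mem_cell ocell_def less_le)
  ultimately show ?thesis by (rule negligible_subset)
qed

lemma ocell_disjoint: "i \<le> d \<Longrightarrow> m \<le> d \<Longrightarrow> x \<in> ocell i \<Longrightarrow> x \<in> cell v m \<Longrightarrow> m = i"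
proof (rule ccontr)
  assume h: "i \<le> d" "m \<le> d" "x \<in> ocell i" "x \<in> cell v m" "m \<noteq> i"
  then have "cl i m x > 0" by (auto simp: ocell_def J_eq)
  moreover have "mu m x \<le> mu i x" using h by (auto simp: mem_cell')
  ultimately show False using h by (simp add: cl_def)
qed

text \<open>Realises prescribed weights as coordinates of a point; polynomial identities in the
  coordinates can then be tested with arbitrary positive arguments.\<close>

lemma cl_of_weights:
  assumes i: "i \<le> d" and y: "(\<Sum>j\<in>J i. y j) = 1" and j: "j \<in> J i"
  shows "cl i j (\<Sum>m\<in>J i. y m *\<^sub>R vertex v m) = y j"
proof -
  obtain b where b: "\<And>x. cl i j x = cg i j \<bullet> x + b" using cl_affine[of i j] by auto
  have "cl i j (\<Sum>m\<in>J i. y m *\<^sub>R vertex v m) = (\<Sum>m\<in>J i. y m * (cg i j \<bullet> vertex v m)) + (\<Sum>m\<in>J i. y m) * b"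
    by (simp add: b inner_sum_right y)
  also have "\<dots> = (\<Sum>m\<in>J i. y m * cl i j (vertex v m))"
    by (simp add: b distrib_left sum_distrib_right sum.distrib)
  also have "\<dots> = (\<Sum>m\<in>J i. if j = m then y m else 0)"
    using i j by (intro sum.cong) (auto simp: cl_vertex)
  finally show ?thesis using j by simp
qed

text \<open>On the cell \<open>i\<close> the minimum is \<open>mu i\<close>, so that \<open>hatf j\<close> is \<open>cl i j\<close> there.\<close>

definition hatf :: "nat \<Rightarrow> real^'n \<Rightarrow> real" where
  "hatf j x = (if x \<in> T then if j = Suc d then (real d + 1) * Min ((\<lambda>m. mu m x) ` {..d})
     else mu j x - Min ((\<lambda>m. mu m x) ` {..d}) else 0)"

lemma Min_mu_cell: "i \<le> d \<Longrightarrow> x \<in> cell v i \<Longrightarrow> Min ((\<lambda>m. mu m x) ` {..d}) = mu i x"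
  by (rule Min_eqI) (auto simp: mem_cell')

lemma hatf_cell: "i \<le> d \<Longrightarrow> x \<in> cell v i \<Longrightarrow> hatf j x = cl i j x"
  using cell_subset_T by (auto simp: hatf_def cl_def Min_mu_cell)

lemma cl_same: "i \<le> d \<Longrightarrow> cl i i x = 0" by (simp add: cl_def)

text \<open>The index that attains the minimum at one point bounds the minimum at the other, so the
  Lipschitz constant of the coordinates survives.\<close>

lemma Min_mu_lipschitz:
  assumes L: "\<And>j. j \<le> d \<Longrightarrow> norm (gm j) \<le> L"
  shows "\<bar>Min ((\<lambda>m. mu m x) ` {..d}) - Min ((\<lambda>m. mu m y) ` {..d})\<bar> \<le> L * norm (x - y)"
proof -
  have le: "Min ((\<lambda>m. mu m x) ` {..d}) - Min ((\<lambda>m. mu m y) ` {..d}) \<le> L * norm (x - y)" for x y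
  proof -
    have "Min ((\<lambda>m. mu m y) ` {..d}) \<in> (\<lambda>m. mu m y) ` {..d}" by (intro Min_in) auto
    then obtain j where j: "Min ((\<lambda>m. mu m y) ` {..d}) = mu j y" "j \<in> {..d}" by (rule imageE)
    have "Min ((\<lambda>m. mu m x) ` {..d}) \<le> mu j x" using j by (intro Min_le) auto
    moreover have "mu j x - mu j y = gm j \<bullet> (x - y)" by (simp add: mu_def inner_diff_right)
    moreover have "gm j \<bullet> (x - y) \<le> norm (gm j) * norm (x - y)" by (rule norm_cauchy_schwarz)
    moreover have "norm (gm j) * norm (x - y) \<le> L * norm (x - y)"
      using L[of j] j by (intro mult_right_mono) auto
    ultimately show ?thesis using j by linarith
  qed
  show ?thesis using le[of x y] le[of y x] by (auto simp: norm_minus_commute abs_le_iff)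
qed

lemma hatf_lipschitz:
  assumes j: "j \<le> Suc d"
  shows "\<exists>L. L-lipschitz_on T (hatf j)"
proof -
  obtain L0 where L0: "\<And>j. j \<le> d \<Longrightarrow> norm (gm j) \<le> L0"
    using finite_imp_bounded[of "gm ` {..d}"] by (auto simp: bounded_iff)
  have "0 \<le> L0" using L0[of 0] norm_ge_zero[of "gm 0"] by linarith
  note mn = Min_mu_lipschitz[of L0, OF L0]
  show ?thesis
  proof (cases "j = Suc d")
    case True
    have "((real d + 1) * L0)-lipschitz_on T (hatf j)"
    proof (rule lipschitz_onI)
      fix x y assume "x \<in> T" "y \<in> T"
      then have "dist (hatf j x) (hatf j y) = (real d + 1) *
         \<bar>Min ((\<lambda>m. mu m x) ` {..d}) - Min ((\<lambda>m. mu m y) ` {..d})\<bar>"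
        using True by (simp add: hatf_def dist_real_def right_diff_distrib[symmetric] abs_mult)
      also have "\<dots> \<le> (real d + 1) * (L0 * norm (x - y))" using mn by (intro mult_left_mono) auto
      finally show "dist (hatf j x) (hatf j y) \<le> (real d + 1) * L0 * dist x y"
        by (simp add: dist_norm mult.assoc)
    qed (use \<open>0 \<le> L0\<close> in auto)
    then show ?thesis by blast
  next
    case False
    then have jd: "j \<le> d" using j by simp
    have "(2 * L0)-lipschitz_on T (hatf j)"
    proof (rule lipschitz_onI)
      fix x y assume xy: "x \<in> T" "y \<in> T"
      have "\<bar>mu j x - mu j y\<bar> = \<bar>gm j \<bullet> (x - y)\<bar>" by (simp add: mu_def inner_diff_right)
      also have "\<dots> \<le> norm (gm j) * norm (x - y)" by (rule Cauchy_Schwarz_ineq2)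
      also have "\<dots> \<le> L0 * norm (x - y)" using L0[OF jd] by (intro mult_right_mono) auto
      finally have "\<bar>mu j x - mu j y\<bar> \<le> L0 * norm (x - y)" .
      then show "dist (hatf j x) (hatf j y) \<le> 2 * L0 * dist x y"
        using mn[of x y] xy False by (simp add: hatf_def dist_real_def dist_norm)
    qed (use \<open>0 \<le> L0\<close> in auto)
    then show ?thesis by blast
  qed
qed

lemma vertex_in_cell: "i \<le> d \<Longrightarrow> j \<in> J i \<Longrightarrow> vertex v j \<in> cell v i"
  unfolding cell_def d_eq[symmetric] by (auto intro: hull_inc)

text \<open>\<open>hat\<close> is a definite description, so uniqueness has to be shown as well: a
  function that is affine on a cell is interpolated by the \<open>cl\<close> from its vertex
  values.\<close>

lemma hat_eq: "j \<le> Suc d \<Longrightarrow> hat v j = hatf j"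
proof -
  assume j: "j \<le> Suc d"
  let ?P = "\<lambda>g. continuous_on T g \<and>
     (\<forall>m\<le>d. \<exists>a b. \<forall>x\<in>cell v m. g x = a \<bullet> x + b) \<and>
     (\<forall>m\<le>d+1. g (vertex v m) = (if m = j then 1 else 0)) \<and>
     (\<forall>x. x \<notin> T \<longrightarrow> g x = 0)"
  \<comment> \<open>A cell that contains the vertex \<open>m\<close> and on which
    \<open>hatf j\<close> takes known vertex values: either it has the vertex \<open>j\<close> too,
    or it is the cell \<open>j\<close>, where the formula gives \<open>cl j j = 0\<close>.\<close>
  have vert: "\<exists>i\<le>d. m \<in> J i \<and> j \<in> J i \<or> m \<in> J i \<and> j = i" if "m \<le> Suc d" for m
  proof (cases "j = Suc d \<or> m = j")
    case True
    obtain i where "i \<le> d" "i \<noteq> m" using d_pos by (metis le0 zero_neq_one)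
    then show ?thesis using True that by (auto simp: cell_idx_def)
  next
    case False
    then show ?thesis using that j by (intro exI[of _ j]) (auto simp: cell_idx_def)
  qed
  have P: "?P (hatf j)"
  proof (intro conjI allI impI)
    show "continuous_on T (hatf j)"
      using hatf_lipschitz[OF j] lipschitz_on_continuous_on by blast
    show "\<exists>a b. \<forall>x\<in>cell v m. hatf j x = a \<bullet> x + b" if "m \<le> d" for m
      using that cl_affine[of m j] hatf_cell[of m] by metis
    show "hatf j (vertex v m) = (if m = j then 1 else 0)" if "m \<le> d + 1" for m
    proof -
      from that have "m \<le> Suc d" by simp
      from vert[OF this] obtain i where i: "i \<le> d" "m \<in> J i" "j \<in> J i \<or> j = i" by blast
      have "hatf j (vertex v m) = cl i j (vertex v m)" using hatf_cell vertex_in_cell i by blast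
      then show ?thesis using i by (auto simp: cl_vertex cl_same cell_idx_def)
    qed
    show "hatf j x = 0" if "x \<notin> T" for x
      using that by (simp add: hatf_def)
  qed
  have uniq: "g = hatf j" if g: "?P g" for g
  proof
    fix x
    show "g x = hatf j x"
    proof (cases "x \<in> T")
      case True
      then obtain m where m: "m \<le> d" "x \<in> cell v m" by (auto simp: T_eq_UN)
      have rep: "G x = (\<Sum>i\<in>J m. cl m i x * G (vertex v i))"
        if "\<exists>a b. \<forall>x\<in>cell v m. G x = a \<bullet> x + b" for G :: "real^'n \<Rightarrow> real"
      proof -
        from that obtain a b where ab: "\<And>x. x \<in> cell v m \<Longrightarrow> G x = a \<bullet> x + b" by blast
        have "(\<Sum>i\<in>J m. cl m i x * G (vertex v i)) = (\<Sum>i\<in>J m. cl m i x * (a \<bullet> vertex v i + b))"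
          using ab vertex_in_cell m by (intro sum.cong) auto
        also have "\<dots> = a \<bullet> (\<Sum>i\<in>J m. cl m i x *\<^sub>R vertex v i) + (\<Sum>i\<in>J m. cl m i x) * b"
          by (simp add: distrib_left sum.distrib inner_sum_right sum_distrib_right)
        finally show ?thesis using ab m by (simp add: sum_cl sum_cl_vertex)
      qed
      have "(\<Sum>i\<in>J m. cl m i x * g (vertex v i)) = (\<Sum>i\<in>J m. cl m i x * hatf j (vertex v i))"
        using g P by (intro sum.cong) (auto simp: cell_idx_def)
      then show ?thesis using rep[of g] rep[of "hatf j"] g P m by metis
    qed (use g in \<open>auto simp: hatf_def\<close>)
  qed
  show ?thesis
    unfolding hat_def d_eq[symmetric] T_def[symmetric] by (rule the_equality) (rule P, rule uniq)
qed

lemma hat_cell: "i \<le> d \<Longrightarrow> x \<in> cell v i \<Longrightarrow> j \<le> Suc d \<Longrightarrow> hat v j x = cl i j x"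
  by (simp add: hat_eq hatf_cell)

lemma hat_outside: "x \<notin> T \<Longrightarrow> j \<le> Suc d \<Longrightarrow> hat v j x = 0"
  by (simp add: hat_eq hatf_def)

end

section \<open>Integrals of derivatives along edges\<close>

lemma C_infty_line_derivative:
  fixes p :: "real^'n \<Rightarrow> real"
  assumes "C_infty p"
  shows "((\<lambda>h. p (x + h *\<^sub>R t)) has_real_derivative dd p t x) (at 0)"
proof -
  have 1: "((\<lambda>h::real. x + h *\<^sub>R t) has_derivative (\<lambda>h. h *\<^sub>R t)) (at 0)"
    by (auto intro!: derivative_eq_intros)
  have "((\<lambda>h::real. p (x + h *\<^sub>R t)) has_derivative (\<lambda>h. dd p (h *\<^sub>R t) x)) (at 0)"
    using has_derivative_compose[OF 1, of p "frechet_derivative p (at x)"] C_infty_has_derivative[OF assms]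
    by simp
  moreover have "(\<lambda>h. dd p (h *\<^sub>R t) x) = (\<lambda>h. h * dd p t x)"
    using linear_scale[OF C_infty_linear_dd[OF assms]] by auto
  ultimately show ?thesis by (simp add: has_field_derivative_def mult.commute[of _ "dd p t x"] mult_commute_abs)
qed

lemma dd_constant_direction:
  fixes p :: "real^'n \<Rightarrow> real"
  assumes "C_infty p" "\<And>h. p (x + h *\<^sub>R t) = p x"
  shows "dd p t x = 0"
  using C_infty_line_derivative[OF assms(1), of x t] assms(2) DERIV_unique[OF _ DERIV_const] by simp

lemma C_infty_lipschitz:
  fixes p :: "real^'n \<Rightarrow> 'b::real_normed_vector"
  assumes p: "C_infty p" and K: "compact K" "convex K"
  shows "\<exists>L. L-lipschitz_on K p"
proof -
  have "\<exists>B. \<forall>x\<in>K. norm (dd p b x) \<le> B" for b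
    using compact_imp_bounded[OF compact_continuous_image[OF C_infty_continuous_on[OF C_infty_dd[OF p]] K(1)]]
    by (auto simp: bounded_iff)
  then obtain B where B: "\<And>b x. x \<in> K \<Longrightarrow> norm (dd p b x) \<le> B b" by metis
  let ?L = "\<Sum>b\<in>Basis. \<bar>B b\<bar>"
  have "?L-lipschitz_on K p"
  proof (rule bounded_derivative_imp_lipschitz)
    show "(p has_derivative frechet_derivative p (at x)) (at x within K)" for x
      by (rule C_infty_has_derivative[OF p])
    show "onorm (frechet_derivative p (at x)) \<le> ?L" if "x \<in> K" for x
    proof -
      have "bounded_linear (frechet_derivative p (at x))"
        using C_infty_linear_dd[OF p, of x] by (simp add: linear_conv_bounded_linear)
      then have "onorm (frechet_derivative p (at x)) \<le> (\<Sum>b\<in>Basis. norm (dd p b x))"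
        by (rule onorm_componentwise)
      also have "\<dots> \<le> ?L" using B[OF that] by (intro sum_mono) (metis abs_ge_self order_trans)
      finally show ?thesis .
    qed
  qed (use K in \<open>auto intro: sum_nonneg\<close>)
  then show ?thesis by blast
qed

text \<open>Products need bounds on the factors, which compactness provides. Hat functions are not
  smooth, so the derivative bound of \<open>C_infty_lipschitz\<close> does not reach their
  products.\<close>

lemma lipschitz_on_mult_compact:
  fixes f g :: "'a::metric_space \<Rightarrow> real"
  assumes "\<exists>L. L-lipschitz_on K f" "\<exists>L. L-lipschitz_on K g" "compact K"
  shows "\<exists>L. L-lipschitz_on K (\<lambda>x. f x * g x)"
proof -
  obtain L M where L: "L-lipschitz_on K f" and M: "M-lipschitz_on K g" using assms by blast
  have bd: "\<exists>B\<ge>0. \<forall>x\<in>K. \<bar>h x\<bar> \<le> B" if "C-lipschitz_on K h" for C and h :: "'a \<Rightarrow> real"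
  proof -
    have "bounded (h ` K)"
      using compact_imp_bounded compact_continuous_image lipschitz_on_continuous_on[OF that] assms(3) by blast
    then obtain B where "\<forall>x\<in>K. \<bar>h x\<bar> \<le> B" by (auto simp: bounded_iff)
    then show ?thesis by (intro exI[of _ "\<bar>B\<bar>"]) force
  qed
  obtain A where A: "A \<ge> 0" "\<And>x. x \<in> K \<Longrightarrow> \<bar>f x\<bar> \<le> A" using bd[OF L] by blast
  obtain B where B: "B \<ge> 0" "\<And>x. x \<in> K \<Longrightarrow> \<bar>g x\<bar> \<le> B" using bd[OF M] by blast
  have "(A * M + B * L)-lipschitz_on K (\<lambda>x. f x * g x)"
  proof (rule lipschitz_onI)
    fix x y assume xy: "x \<in> K" "y \<in> K"
    have "f x * g x - f y * g y = f x * (g x - g y) + g y * (f x - f y)" by (simp add: algebra_simps)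
    then have "\<bar>f x * g x - f y * g y\<bar> \<le> \<bar>f x\<bar> * \<bar>g x - g y\<bar> + \<bar>g y\<bar> * \<bar>f x - f y\<bar>"
      by (metis abs_mult abs_triangle_ineq)
    also have "\<dots> \<le> A * (M * dist x y) + B * (L * dist x y)"
      using A B xy lipschitz_onD[OF L xy] lipschitz_onD[OF M xy]
      by (intro add_mono mult_mono) (auto simp: dist_real_def)
    finally show "dist (f x * g x) (f y * g y) \<le> (A * M + B * L) * dist x y"
      by (simp add: dist_real_def algebra_simps)
  qed (use A B lipschitz_on_nonneg[OF L] lipschitz_on_nonneg[OF M] in auto)
  then show ?thesis by blast
qed

lemma lipschitz_on_prod_compact:
  fixes f :: "'i \<Rightarrow> 'a::metric_space \<Rightarrow> real"
  assumes "compact K" "\<And>i. i \<in> I \<Longrightarrow> \<exists>L. L-lipschitz_on K (f i)"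
  shows "\<exists>L. L-lipschitz_on K (\<lambda>x. \<Prod>i\<in>I. f i x)"
  using assms(2)
proof (induction I rule: infinite_finite_induct)
  case (insert i I)
  have "\<exists>L. L-lipschitz_on K (\<lambda>x. f i x * (\<Prod>i\<in>I. f i x))"
    using insert assms(1) by (intro lipschitz_on_mult_compact) auto
  then show ?case using insert by simp
qed (auto intro!: exI[of _ 0] lipschitz_on_constant)

lemma lipschitz_on_power_compact:
  fixes f :: "'a::metric_space \<Rightarrow> real"
  assumes "compact K" "\<exists>L. L-lipschitz_on K f"
  shows "\<exists>L. L-lipschitz_on K (\<lambda>x. f x ^ n)"
  using lipschitz_on_prod_compact[of K "{..<n}" "\<lambda>_. f"] assms by simp

section \<open>Integrals along edges over a cell and over the simplex\<close>

context simplex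
begin

lemma C_infty_cl: "C_infty (cl i j)"
proof -
  obtain b where "cl i j = (\<lambda>x. cg i j \<bullet> x + b)" using cl_affine[of i j] by auto
  then show ?thesis using C_infty_affine by simp
qed

lemma dd_cl: "dd (cl i j) e x = cg i j \<bullet> e"
proof -
  obtain b where "cl i j = (\<lambda>x. cg i j \<bullet> x + b)" using cl_affine[of i j] by auto
  then show ?thesis by simp
qed

lemma cl_add_scaleR: "cl i j (x + h *\<^sub>R e) = cl i j x + h * (cg i j \<bullet> e)"
  by (simp add: cl_add)

text \<open>A step along the edge from \<open>a\<close> to \<open>b\<close> changes only the
  coordinates of \<open>a\<close> and \<open>b\<close>, so the line leaves the cell through the
  facet opposite one of them, and that coordinate gives the exit time.\<close>

lemma cell_edge_exit:
  assumes i: "i \<le> d" and ab: "a \<in> J i" "b \<in> J i" "a \<noteq> b"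
    and x: "x \<in> cell v i" "x + h *\<^sub>R edge_vec v a b \<notin> cell v i"
  shows "\<exists>s. \<bar>s\<bar> \<le> \<bar>h\<bar> \<and> x + s *\<^sub>R edge_vec v a b \<in> cell v i \<and>
    (cl i a (x + s *\<^sub>R edge_vec v a b) = 0 \<or> cl i b (x + s *\<^sub>R edge_vec v a b) = 0)"
proof -
  let ?t = "edge_vec v a b"
  have cl: "cl i j (x + s *\<^sub>R ?t) = cl i j x + s * ((if j = b then 1 else 0) - (if j = a then 1 else 0))"
    if "j \<in> J i" for j s using that cg_edge[OF i that ab(1,2)] by (simp add: cl_add_scaleR)
  have nn: "cl i j x \<ge> 0" if "j \<in> J i" for j using x(1) i that by (simp add: mem_cell)
  obtain j where j: "j \<in> J i" "cl i j (x + h *\<^sub>R ?t) < 0" using x(2) i by (auto simp: mem_cell not_le)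
  show ?thesis
  proof (cases "h > 0")
    case True
    have "j = a" using j cl[OF j(1), of h] nn[OF j(1)] True by (auto split: if_splits)
    then have "cl i a x < h" using j cl[OF j(1), of h] ab by simp
    moreover have "x + cl i a x *\<^sub>R ?t \<in> cell v i" using i nn ab by (auto simp: mem_cell cl)
    moreover have "cl i a (x + cl i a x *\<^sub>R ?t) = 0" using ab by (simp add: cl)
    ultimately show ?thesis using nn[OF ab(1)] by (intro exI[of _ "cl i a x"]) auto
  next
    case False
    have "j = b" using j cl[OF j(1), of h] nn[OF j(1)] False
      by (auto split: if_splits simp: not_less)
    then have "cl i b x < - h" using j cl[OF j(1), of h] ab by simp
    moreover have "x + (- cl i b x) *\<^sub>R ?t \<in> cell v i"
      unfolding mem_cell[OF i]
    proof
      fix k assume k: "k \<in> J i"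
      show "0 \<le> cl i k (x + (- cl i b x) *\<^sub>R ?t)"
        unfolding cl[OF k] using nn[OF k] nn[OF ab(2)] by auto
    qed
    moreover have "cl i b (x + (- cl i b x) *\<^sub>R ?t) = 0" using ab unfolding cl[OF ab(2)] by simp
    ultimately show ?thesis using nn[OF ab(2)] by (intro exI[of _ "- cl i b x"]) auto
  qed
qed

text \<open>The divergence theorem for a constant direction: the edge is parallel to all facets
  except those opposite \<open>a\<close> and \<open>b\<close>, and on these two \<open>p\<close>
  vanishes.\<close>

lemma cell_edge_integral:
  assumes i: "i \<le> d" and ab: "a \<in> J i" "b \<in> J i" "a \<noteq> b" and p: "C_infty p"
    and pa: "\<And>x. x \<in> cell v i \<Longrightarrow> cl i a x = 0 \<Longrightarrow> p x = 0"
    and pb: "\<And>x. x \<in> cell v i \<Longrightarrow> cl i b x = 0 \<Longrightarrow> p x = 0"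
  shows "(\<integral>x. indicat_real (cell v i) x * dd p (edge_vec v a b) x \<partial>lebesgue) = 0"
proof -
  let ?t = "edge_vec v a b"
  obtain L where L: "L-lipschitz_on (cell v i) p"
    using C_infty_lipschitz[OF p compact_cell convex_cell] by blast
  have lip: "\<bar>p (x + h *\<^sub>R ?t) - p x\<bar> \<le> L * norm ?t * \<bar>h\<bar>"
    if "x \<in> cell v i" "x + h *\<^sub>R ?t \<in> cell v i" for x h
    using lipschitz_onD[OF L that(2,1)] by (simp add: dist_real_def dist_norm mult_ac)
  show ?thesis
  proof (rule integral_derivative_zero[where g = p and L = "L * norm ?t" and t = ?t and U = "ocell i"])
    show "(\<lambda>x. indicat_real (cell v i) x * dd p ?t x) \<in> borel_measurable lebesgue"
      using measurable_continuous_compact[OF compact_cell C_infty_continuous_on[OF C_infty_dd[OF p, of ?t]]]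
      by (intro measurable_completion) simp
    show "\<bar>p x\<bar> \<le> L * norm ?t * \<bar>h\<bar>" if x: "x \<in> cell v i" "x + h *\<^sub>R ?t \<notin> cell v i" for x h
    proof -
      obtain s where s: "\<bar>s\<bar> \<le> \<bar>h\<bar>" "x + s *\<^sub>R ?t \<in> cell v i"
          "cl i a (x + s *\<^sub>R ?t) = 0 \<or> cl i b (x + s *\<^sub>R ?t) = 0"
        using cell_edge_exit[OF i ab x] by blast
      have "p (x + s *\<^sub>R ?t) = 0" using s pa pb by blast
      then have "\<bar>p x\<bar> \<le> L * norm ?t * \<bar>s\<bar>" using lip[OF x(1) s(2)] by simp
      also have "\<dots> \<le> L * norm ?t * \<bar>h\<bar>" using s(1) lipschitz_on_nonneg[OF L] by (intro mult_left_mono) auto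
      finally show ?thesis .
    qed
    show "((\<lambda>h. p (x + h *\<^sub>R ?t)) has_real_derivative dd p ?t x) (at 0)" for x
      by (rule C_infty_line_derivative[OF p])
  qed (use i p lip lipschitz_on_nonneg[OF L] compact_cell open_ocell ocell_subset negligible_cell_ocell
        C_infty_continuous_on in auto)
qed

lemma integrable_cell:
  fixes f :: "real^'n \<Rightarrow> 'b::{banach, second_countable_topology}"
  assumes "continuous_on (cell v i) f"
  shows "integrable lebesgue (\<lambda>x. indicator (cell v i) x *\<^sub>R f x)"
  using integrable_continuous_compact[OF compact_cell assms] .

lemma integrable_cell_real:
  fixes f :: "real^'n \<Rightarrow> real"
  assumes "continuous_on (cell v i) f"
  shows "integrable lebesgue (\<lambda>x. indicator (cell v i) x * f x)"
  using integrable_cell[OF assms] by simp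

text \<open>The function \<open>q\<close> is continuous and smooth on each cell. By continuity the
  contributions of the interior faces cancel, and on the boundary of the simplex \<open>q\<close>
  vanishes.\<close>

lemma T_integral:
  assumes p: "\<And>i. i \<le> d \<Longrightarrow> C_infty (p i)" and L: "L-lipschitz_on T q"
    and eq: "\<And>i x. i \<le> d \<Longrightarrow> x \<in> cell v i \<Longrightarrow> q x = p i x"
    and front: "\<And>x. x \<in> frontier T \<Longrightarrow> q x = 0"
  shows "(\<Sum>i\<le>d. \<integral>x. indicat_real (cell v i) x * dd (p i) t x \<partial>lebesgue) = 0"
proof -
  define g' where "g' = (\<lambda>x. \<Sum>i\<le>d. indicat_real (cell v i) x * dd (p i) t x)"
  have int: "integrable lebesgue (\<lambda>x. indicat_real (cell v i) x * dd (p i) t x)" if "i \<le> d" for i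
    using that p by (intro integrable_cell_real C_infty_continuous_on C_infty_dd) auto
  have lip: "\<bar>q (x + h *\<^sub>R t) - q x\<bar> \<le> L * norm t * \<bar>h\<bar>"
    if "x \<in> T" "x + h *\<^sub>R t \<in> T" for x h
    using lipschitz_onD[OF L that(2,1)] by (simp add: dist_real_def dist_norm mult_ac)
  have gT: "indicat_real T x * g' x = g' x" for x
  proof (cases "x \<in> T")
    case False
    then have "x \<notin> cell v i" if "i \<le> d" for i using cell_subset_T[OF that] by blast
    then have "g' x = 0" unfolding g'_def by (intro sum.neutral) auto
    then show ?thesis by simp
  qed simp
  have "(\<integral>x. indicat_real T x * g' x \<partial>lebesgue) = 0"
  proof (rule integral_derivative_zero[where g = q and L = "L * norm t" and t = t and U = "\<Union>i\<le>d. ocell i"])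
    show "continuous_on T q" using L by (rule lipschitz_on_continuous_on)
    show "(\<lambda>x. indicat_real T x * g' x) \<in> borel_measurable lebesgue"
      unfolding gT unfolding g'_def using int by (intro borel_measurable_sum) (auto dest: borel_measurable_integrable)
    show "\<bar>q x\<bar> \<le> L * norm t * \<bar>h\<bar>" if x: "x \<in> T" "x + h *\<^sub>R t \<notin> T" for x h
    proof -
      \<comment> \<open>The segment leaves the simplex through its boundary, where \<open>q\<close>
        vanishes; the Lipschitz bound is applied only up to that point.\<close>
      have "closed_segment x (x + h *\<^sub>R t) \<inter> frontier T \<noteq> {}"
        using x by (intro connected_Int_frontier connected_segment) auto
      then obtain y where y: "y \<in> closed_segment x (x + h *\<^sub>R t)" "y \<in> frontier T" by blast
      then obtain u where u: "0 \<le> u" "u \<le> 1" "y = (1 - u) *\<^sub>R x + u *\<^sub>R (x + h *\<^sub>R t)"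
        by (auto simp: closed_segment_def)
      have yx: "y = x + (u * h) *\<^sub>R t" unfolding u(3) by (simp add: algebra_simps)
      have yT: "y \<in> T" using y(2) compact_T by (simp add: frontier_def compact_imp_closed)
      have "\<bar>q x\<bar> \<le> L * norm t * \<bar>u * h\<bar>" using lip[of x "u * h"] x(1) yT front[OF y(2)] yx by simp
      also have "\<dots> \<le> L * norm t * \<bar>h\<bar>"
        using u lipschitz_on_nonneg[OF L]
        by (intro mult_left_mono) (auto simp: abs_mult mult_left_le_one_le)
      finally show ?thesis .
    qed
    show "((\<lambda>h. q (x + h *\<^sub>R t)) has_real_derivative g' x) (at 0)" if "x \<in> (\<Union>i\<le>d. ocell i)" for x
    proof -
      from that obtain i where i: "i \<le> d" "x \<in> ocell i" by blast
      have "x \<in> cell v i" using i ocell_subset by blast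
      then have "g' x = (\<Sum>m\<le>d. if m = i then dd (p i) t x else 0)"
        unfolding g'_def using i ocell_disjoint
        by (intro sum.cong refl) (auto simp: indicator_def)
      then have g': "g' x = dd (p i) t x" using i by simp
      let ?S = "(\<lambda>h. x + h *\<^sub>R t) -` ocell i"
      have "open ?S" by (intro continuous_open_vimage open_ocell) (auto intro!: continuous_intros)
      moreover have "0 \<in> ?S" using i by simp
      moreover have "\<And>h. h \<in> ?S \<Longrightarrow> p i (x + h *\<^sub>R t) = q (x + h *\<^sub>R t)"
        using eq[OF i(1)] ocell_subset[OF i(1)] by auto
      ultimately show ?thesis
        unfolding g'
        by (rule has_field_derivative_transform_within_open[OF C_infty_line_derivative[OF p[OF i(1)]]])
    qed
    have "T - (\<Union>i\<le>d. ocell i) \<subseteq> (\<Union>i\<le>d. cell v i - ocell i)" by (auto simp: T_eq_UN)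
    moreover have "negligible (\<Union>i\<le>d. cell v i - ocell i)"
      by (intro negligible_Union) (auto intro: negligible_cell_ocell)
    ultimately show "negligible (T - (\<Union>i\<le>d. ocell i))" by (rule negligible_subset[rotated])
    show "(\<Union>i\<le>d. ocell i) \<subseteq> T" using ocell_subset cell_subset_T by blast
  qed (use lip lipschitz_on_nonneg[OF L] compact_T open_ocell in auto)
  then show ?thesis unfolding gT unfolding g'_def using int by (subst (asm) Bochner_Integration.integral_sum) auto
qed

lemma cl_le_1: "i \<le> d \<Longrightarrow> x \<in> cell v i \<Longrightarrow> j \<in> J i \<Longrightarrow> cl i j x \<le> 1"
  using sum_cl[of i x] member_le_sum[of j "J i" "\<lambda>j. cl i j x"] by (auto simp: mem_cell)

text \<open>The factors \<open>1 - (1 - cl i r x) ^ n\<close> vanish on the facet opposite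
  \<open>r\<close>, lie between 0 and 1 on the cell, and tend to 1 in its interior.\<close>

lemma cutoff_limit:
  assumes i: "i \<le> d" and R: "R \<subseteq> J i" and g: "continuous_on (cell v i) g"
  shows "(\<lambda>n. \<integral>x. indicat_real (cell v i) x * ((\<Prod>r\<in>R. 1 - (1 - cl i r x) ^ n) * g x) \<partial>lebesgue)
    \<longlonglongrightarrow> (\<integral>x. indicat_real (cell v i) x * g x \<partial>lebesgue)"
proof (rule integral_dominated_convergence)
  let ?\<eta> = "\<lambda>n x. \<Prod>r\<in>R. 1 - (1 - cl i r x) ^ n"
  show "integrable lebesgue (\<lambda>x. norm (indicat_real (cell v i) x * g x))"
    using integrable_cell_real[OF g] by (rule integrable_norm)
  show "(\<lambda>x. indicat_real (cell v i) x * g x) \<in> borel_measurable lebesgue"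
    using integrable_cell_real[OF g] by (rule borel_measurable_integrable)
  show "(\<lambda>x. indicat_real (cell v i) x * (?\<eta> n x * g x)) \<in> borel_measurable lebesgue" for n
    by (rule borel_measurable_integrable, rule integrable_cell_real) (intro continuous_intros continuous_cl g)
  show "AE x in lebesgue. norm (indicat_real (cell v i) x * (?\<eta> n x * g x)) \<le> norm (indicat_real (cell v i) x * g x)" for n
  proof (rule AE_I2)
    fix x
    have "\<bar>?\<eta> n x\<bar> \<le> 1" if x: "x \<in> cell v i"
    proof -
      have "0 \<le> (1 - cl i r x) ^ n \<and> (1 - cl i r x) ^ n \<le> 1" if "r \<in> R" for r
        using that R x i cl_le_1[OF i x, of r] by (auto simp: mem_cell intro!: power_le_one)
      then have "0 \<le> ?\<eta> n x" "?\<eta> n x \<le> 1" by (auto intro!: prod_nonneg prod_le_1)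
      then show ?thesis by simp
    qed
    then show "norm (indicat_real (cell v i) x * (?\<eta> n x * g x)) \<le> norm (indicat_real (cell v i) x * g x)"
      by (auto simp: indicator_def abs_mult mult_left_le_one_le)
  qed
  have "AE x in lebesgue. x \<notin> cell v i - ocell i"
    using negligible_cell_ocell[OF i] unfolding negligible_iff_null_sets by (rule AE_not_in)
  then show "AE x in lebesgue. (\<lambda>n. indicat_real (cell v i) x * (?\<eta> n x * g x)) \<longlonglongrightarrow> indicat_real (cell v i) x * g x"
  proof eventually_elim
    case (elim x)
    show ?case
    proof (cases "x \<in> cell v i")
      case True
      then have x: "x \<in> ocell i" using elim by simp
      have "(\<lambda>n. 1 - (1 - cl i r x) ^ n) \<longlonglongrightarrow> 1 - 0" if "r \<in> R" for r
        using x that R cl_le_1[OF i True, of r]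
        by (intro tendsto_diff tendsto_const LIMSEQ_power_zero) (auto simp: ocell_def)
      then have "(\<lambda>n. ?\<eta> n x) \<longlonglongrightarrow> (\<Prod>r\<in>R. 1)" by (intro tendsto_prod) auto
      then have "(\<lambda>n. ?\<eta> n x * g x) \<longlonglongrightarrow> g x" using tendsto_mult_right[of _ 1 _ "g x"] by simp
      then show ?thesis using True by simp
    qed simp
  qed
qed

lemma edge_vec_self [simp]: "edge_vec v s s = 0" by (simp add: edge_vec_def)

text \<open>Both sides are fluxes through \<open>T\<^sub>i \<inter> T\<^sub>j\<close>.  After multiplication by a cutoff that vanishes on all
  other faces and is constant along both edges, they agree because the product is continuous.\<close>

lemma interior_flux:
  assumes i: "i \<le> d" and j: "j \<le> d" and ij: "i \<noteq> j" and s: "s \<in> J i" "s \<in> J j"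
    and p: "\<And>m. m \<le> d \<Longrightarrow> C_infty (p m)" and L: "\<exists>L. L-lipschitz_on T q"
    and eq: "\<And>m x. m \<le> d \<Longrightarrow> x \<in> cell v m \<Longrightarrow> q x = p m x"
    and front: "\<And>x. x \<in> frontier T \<Longrightarrow> q x = 0"
    and zero: "\<And>m x. m \<le> d \<Longrightarrow> x \<in> cell v m \<Longrightarrow> cl m s x = 0 \<Longrightarrow> q x = 0"
  shows "(\<integral>x. indicat_real (cell v i) x * dd (p i) (edge_vec v s j) x \<partial>lebesgue) =
    (\<integral>x. indicat_real (cell v j) x * dd (p j) (edge_vec v s i) x \<partial>lebesgue)"
proof -
  \<comment> \<open>The vertices of the common facet other than \<open>s\<close>; opposite
    \<open>s\<close> the function \<open>q\<close> vanishes by itself.\<close>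
  define R where "R = {..Suc d} - {i, j, s}"
  define \<eta> where "\<eta> = (\<lambda>n m x. \<Prod>r\<in>R. 1 - (1 - cl m r x) ^ n)"
  define P where "P = (\<lambda>n m x. if m \<in> {i, j} then \<eta> n m x * p m x else 0)"
  define Q where "Q = (\<lambda>n x. (\<Prod>r\<in>R. 1 - (1 - hatf r x) ^ n) * q x)"
  have RJ: "R \<subseteq> J i" "R \<subseteq> J j" by (auto simp: R_def cell_idx_def)
  have \<eta>C: "C_infty (\<eta> n m)" for n m
    unfolding \<eta>_def by (intro C_infty_prod C_infty_diff C_infty_const C_infty_power C_infty_cl)
  have PC: "C_infty (P n m)" if "m \<le> d" for n m
    unfolding P_def using p[OF that] \<eta>C by (cases "m \<in> {i, j}") (auto intro: C_infty_mult)
  have "\<exists>L. L-lipschitz_on T (Q n)" for n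
  proof -
    have "\<exists>L. L-lipschitz_on T (\<lambda>x. 1 - (1 - hatf r x) ^ n)" if r: "r \<in> R" for r
    proof -
      have cst: "\<exists>L. L-lipschitz_on T (\<lambda>x. 1::real)" using lipschitz_on_constant by blast
      obtain L1 where "L1-lipschitz_on T (hatf r)" using hatf_lipschitz[of r] r by (auto simp: R_def)
      from lipschitz_on_diff[OF lipschitz_on_constant this, of 1]
      have "\<exists>L. L-lipschitz_on T (\<lambda>x. 1 - hatf r x)" by blast
      then obtain L2 where "L2-lipschitz_on T (\<lambda>x. (1 - hatf r x) ^ n)"
        using lipschitz_on_power_compact[OF compact_T] by blast
      from lipschitz_on_diff[OF lipschitz_on_constant this, of 1] show ?thesis by blast
    qed
    then show ?thesis
      unfolding Q_def using L compact_T by (intro lipschitz_on_mult_compact lipschitz_on_prod_compact) auto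
  qed
  then obtain LQ where LQ: "\<And>n. (LQ n)-lipschitz_on T (Q n)" by metis
  have QP: "Q n x = P n m x" if m: "m \<le> d" "x \<in> cell v m" and n: "n > 0" for n m x
  proof -
    have \<eta>: "(\<Prod>r\<in>R. 1 - (1 - hatf r x) ^ n) = \<eta> n m x"
      unfolding \<eta>_def using m by (intro prod.cong) (auto simp: hatf_cell)
    \<comment> \<open>On a third cell \<open>Q n\<close> vanishes: either \<open>q\<close> does, for
      \<open>m = s\<close>, or the cutoff factor of \<open>m\<close> does, because
      \<open>cl m m\<close> is zero.\<close>
    consider "m \<in> {i, j}" | "m \<notin> {i, j}" "m = s" | "m \<in> R" using m by (auto simp: R_def)
    then show ?thesis
    proof cases
      case 1
      then show ?thesis using eq[OF m] by (simp add: Q_def P_def \<eta>)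
    next
      case 2
      then have "q x = 0" using zero[OF m] cl_same[OF m(1)] by simp
      then show ?thesis using 2 by (simp add: Q_def P_def)
    next
      case 3
      then have "\<eta> n m x = 0" using m cl_same[of m x] by (auto simp: \<eta>_def R_def intro!: bexI[of _ m])
      then show ?thesis unfolding Q_def \<eta> using 3 by (auto simp: P_def R_def)
    qed
  qed
  have step: "(\<integral>x. indicat_real (cell v i) x * dd (P n i) (edge_vec v s j) x \<partial>lebesgue) =
    (\<integral>x. indicat_real (cell v j) x * dd (P n j) (edge_vec v s i) x \<partial>lebesgue)" if n: "n > 0" for n
  proof -
    let ?t = "edge_vec v s i"
    have "(\<Sum>m\<le>d. \<integral>x. indicat_real (cell v m) x * dd (P n m) ?t x \<partial>lebesgue) = 0"
      using PC LQ QP n front by (intro T_integral[where q = "Q n" and L = "LQ n"]) (auto simp: Q_def)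
    moreover have "(\<Sum>m\<le>d. \<integral>x. indicat_real (cell v m) x * dd (P n m) ?t x \<partial>lebesgue) =
       (\<Sum>m\<in>{i, j}. \<integral>x. indicat_real (cell v m) x * dd (P n m) ?t x \<partial>lebesgue)"
    proof (rule sum.mono_neutral_right)
      have "P n m = (\<lambda>x. 0)" if "m \<notin> {i, j}" for m using that by (auto simp: P_def)
      then show "\<forall>m\<in>{..d} - {i, j}. (\<integral>x. indicat_real (cell v m) x * dd (P n m) ?t x \<partial>lebesgue) = 0"
        by auto
    qed (use i j in auto)
    ultimately have sum0: "(\<integral>x. indicat_real (cell v i) x * dd (P n i) ?t x \<partial>lebesgue) +
        (\<integral>x. indicat_real (cell v j) x * dd (P n j) ?t x \<partial>lebesgue) = 0"
      using ij by simp
    \<comment> \<open>The vertex \<open>v i\<close> lies outside the cell \<open>i\<close>, beyond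
      the common facet, and \<open>cl i j\<close> continues to the value -1 there. Modulo edges of
      the common facet, the edge from \<open>s\<close> to \<open>i\<close> is therefore the negative
      of the edge from \<open>s\<close> to \<open>j\<close>.\<close>
    have cj: "cg i j \<bullet> ?t = -1"
    proof -
      have "cl i j (vertex v i) = cl i j (vertex v s) + cg i j \<bullet> ?t"
        using cl_add[of i j "vertex v s" ?t] by (simp add: edge_vec_def)
      moreover have "cl i j (vertex v i) = -1" using i j ij by (simp add: cl_def vertex_le mu_vertex)
      moreover have "j \<noteq> s" using s by (auto simp: cell_idx_def)
      then have "cl i j (vertex v s) = 0" using cl_vertex[OF i _ s(1), of j] ij j by (simp add: cell_idx_def)
      ultimately show ?thesis by simp
    qed
    have Ji: "J i = insert j (insert s R)" "j \<notin> insert s R" "s \<notin> R"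
      using i j ij s by (auto simp: R_def cell_idx_def)
    have finR: "finite R" by (simp add: R_def)
    have t: "?t = - edge_vec v s j + (\<Sum>r\<in>R. (cg i r \<bullet> ?t) *\<^sub>R edge_vec v s r)"
      using sum_cg_edge[OF i, of ?t s] cj Ji finR by simp
    have ddt: "dd (P n i) ?t x = - dd (P n i) (edge_vec v s j) x + (\<Sum>r\<in>R. (cg i r \<bullet> ?t) * dd (P n i) (edge_vec v s r) x)" for x
    proof -
      interpret F: linear "\<lambda>e. dd (P n i) e x" using C_infty_linear_dd PC i by blast
      show ?thesis by (subst t) (simp add: F.diff F.add F.neg F.sum F.scale)
    qed
    \<comment> \<open>Edges inside the common facet carry no flux: the cutoff vanishes opposite
      \<open>r\<close> and \<open>q\<close> opposite \<open>s\<close>.\<close>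
    have zeroR: "(\<integral>x. indicat_real (cell v i) x * dd (P n i) (edge_vec v s r) x \<partial>lebesgue) = 0" if r: "r \<in> R" for r
    proof (rule cell_edge_integral[OF i s(1) _ _ PC[OF i]])
      show "r \<in> J i" "s \<noteq> r" using r RJ by (auto simp: R_def)
      show "P n i x = 0" if "x \<in> cell v i" "cl i s x = 0" for x
        using that zero[OF i] eq[OF i] by (simp add: P_def)
      show "P n i x = 0" if "x \<in> cell v i" "cl i r x = 0" for x
      proof -
        have "\<eta> n i x = 0" using that r n finR by (auto simp: \<eta>_def intro!: bexI[of _ r])
        then show ?thesis by (simp add: P_def)
      qed
    qed
    have int: "integrable lebesgue (\<lambda>x. indicat_real (cell v i) x * dd (P n i) e x)" for e
      by (intro integrable_cell_real C_infty_continuous_on C_infty_dd PC i)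
    have "(\<integral>x. indicat_real (cell v i) x * dd (P n i) ?t x \<partial>lebesgue) =
      (\<integral>x. - (indicat_real (cell v i) x * dd (P n i) (edge_vec v s j) x)
        + (\<Sum>r\<in>R. (cg i r \<bullet> ?t) * (indicat_real (cell v i) x * dd (P n i) (edge_vec v s r) x)) \<partial>lebesgue)"
      unfolding ddt by (simp add: right_diff_distrib sum_distrib_left mult_ac)
    also have "\<dots> = - (\<integral>x. indicat_real (cell v i) x * dd (P n i) (edge_vec v s j) x \<partial>lebesgue) +
       (\<Sum>r\<in>R. (cg i r \<bullet> ?t) * (\<integral>x. indicat_real (cell v i) x * dd (P n i) (edge_vec v s r) x \<partial>lebesgue))"
      using int by (simp add: integral_add integral_sum integrable_sum)
    also have "\<dots> = - (\<integral>x. indicat_real (cell v i) x * dd (P n i) (edge_vec v s j) x \<partial>lebesgue)"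
      using zeroR by simp
    finally show ?thesis using sum0 by simp
  qed
  \<comment> \<open>A step from \<open>s\<close> towards the far vertex changes only the coordinates
    of these two, neither of which enters the cutoff. The derivative thus passes to
    \<open>p\<close>, and the cutoff remains as a bounded factor that disappears in the
    limit.\<close>
  have ddP: "dd (P n a) (edge_vec v s b) x = \<eta> n a x * dd (p a) (edge_vec v s b) x"
    if "(a, b) = (i, j) \<or> (a, b) = (j, i)" for n a b x
  proof -
    have a: "a \<le> d" "s \<in> J a" "b \<in> J a" "R \<subseteq> J a" "a \<in> {i, j}"
      using that i j ij s RJ by (auto simp: cell_idx_def)
    have "P n a = (\<lambda>x. \<eta> n a x * p a x)" using a by (auto simp: P_def)
    moreover have "dd (\<eta> n a) (edge_vec v s b) x = 0"
    proof (rule dd_constant_direction[OF \<eta>C])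
      have "cg a r \<bullet> edge_vec v s b = 0" if "r \<in> R" for r
        using cg_edge[OF a(1) _ a(2,3), of r] that a(4) \<open>(a, b) = (i, j) \<or> (a, b) = (j, i)\<close>
        by (auto simp: R_def)
      then show "\<eta> n a (x + h *\<^sub>R edge_vec v s b) = \<eta> n a x" for h
        unfolding \<eta>_def by (intro prod.cong) (auto simp: cl_add_scaleR)
    qed
    ultimately show ?thesis using dd_mult[OF \<eta>C p[OF a(1)]] by simp
  qed
  have lim: "(\<lambda>n. \<integral>x. indicat_real (cell v a) x * dd (P (Suc n) a) (edge_vec v s b) x \<partial>lebesgue)
     \<longlonglongrightarrow> (\<integral>x. indicat_real (cell v a) x * dd (p a) (edge_vec v s b) x \<partial>lebesgue)"
    if ab: "(a, b) = (i, j) \<or> (a, b) = (j, i)" for a b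
  proof -
    have a: "a \<le> d" "R \<subseteq> J a" using ab i j RJ by auto
    show ?thesis
      unfolding ddP[OF ab] \<eta>_def
      by (rule LIMSEQ_Suc, rule cutoff_limit[OF a]) (intro C_infty_continuous_on C_infty_dd p a)
  qed
  show ?thesis
    by (rule LIMSEQ_unique[OF lim[of i j]]) (use lim[of j i] step in auto)
qed

end

section \<open>Bernstein coefficients\<close>

text \<open>Induction on the variables: for fixed values of the others, a polynomial in one variable
  has infinitely many zeros, so its coefficients vanish. Positive arguments are what interior points
  of a cell provide.\<close>

lemma monomials_independent:
  fixes a :: "(nat \<Rightarrow> nat) \<Rightarrow> real"
  assumes "finite I" "finite A" "\<And>\<alpha> j. \<alpha> \<in> A \<Longrightarrow> j \<notin> I \<Longrightarrow> \<alpha> j = 0"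
    and "\<And>y. (\<forall>j\<in>I. y j > 0) \<Longrightarrow> (\<Sum>\<alpha>\<in>A. a \<alpha> * (\<Prod>j\<in>I. y j ^ \<alpha> j)) = 0"
    and "\<alpha> \<in> A"
  shows "a \<alpha> = 0"
  using assms
proof (induction I arbitrary: A a \<alpha> rule: finite_induct)
  case empty
  then have "\<beta> = (\<lambda>_. 0)" if "\<beta> \<in> A" for \<beta> using that by auto
  then have "A = {\<alpha>}" using empty.prems by blast
  then show ?case using empty.prems by simp
next
  case (insert j I)
  define N where "N = Max ((\<lambda>\<alpha>. \<alpha> j) ` A)"
  have N: "\<beta> j \<le> N" if "\<beta> \<in> A" for \<beta> using that insert.prems(1) by (auto simp: N_def)
  define n where "n = \<alpha> j"
  let ?An = "{\<beta>\<in>A. \<beta> j = n}"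
  have coeff: "(\<Sum>\<beta>\<in>?An. a \<beta> * (\<Prod>i\<in>I. y i ^ \<beta> i)) = 0" if y: "\<forall>i\<in>I. y i > 0" for y
  proof -
    define c where "c = (\<lambda>m. \<Sum>\<beta>\<in>{\<beta>\<in>A. \<beta> j = m}. a \<beta> * (\<Prod>i\<in>I. y i ^ \<beta> i))"
    have "(\<Sum>m\<le>N. c m * t ^ m) = 0" if t: "t > 0" for t
    proof -
      have "(\<Sum>m\<le>N. c m * t ^ m) = (\<Sum>m\<le>N. \<Sum>\<beta>\<in>{\<beta>\<in>A. \<beta> j = m}. a \<beta> * (t ^ \<beta> j * (\<Prod>i\<in>I. y i ^ \<beta> i)))"
        unfolding c_def sum_distrib_right by (intro sum.cong refl) auto
      also have "\<dots> = (\<Sum>\<beta>\<in>A. a \<beta> * (t ^ \<beta> j * (\<Prod>i\<in>I. y i ^ \<beta> i)))"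
        using N insert.prems(1) by (intro sum.group) auto
      also have "\<dots> = (\<Sum>\<beta>\<in>A. a \<beta> * (\<Prod>i\<in>insert j I. (y(j := t)) i ^ \<beta> i))"
      proof (intro sum.cong refl)
        fix \<beta>
        have "(\<Prod>i\<in>I. (y(j := t)) i ^ \<beta> i) = (\<Prod>i\<in>I. y i ^ \<beta> i)"
          using insert.hyps by (intro prod.cong) auto
        then show "a \<beta> * (t ^ \<beta> j * (\<Prod>i\<in>I. y i ^ \<beta> i)) = a \<beta> * (\<Prod>i\<in>insert j I. (y(j := t)) i ^ \<beta> i)"
          using insert.hyps by simp
      qed
      also have "\<dots> = 0" using insert.prems(3)[of "y(j := t)"] y t by auto
      finally show ?thesis .
    qed
    then have "{0<..} \<subseteq> {t. (\<Sum>m\<le>N. c m * t ^ m) = 0}" by auto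
    then have "infinite {t. (\<Sum>m\<le>N. c m * t ^ m) = 0}" using infinite_Ioi finite_subset by blast
    then have "\<forall>m\<le>N. c m = 0" using polyfun_finite_roots[of c N] by blast
    then have "c n = 0" using N[OF insert.prems(4)] by (simp add: n_def)
    then show ?thesis by (simp add: c_def)
  qed
  \<comment> \<open>All exponents in \<open>?An\<close> agree at \<open>j\<close>, so resetting this
    entry to 0 loses nothing and makes the induction hypothesis applicable.\<close>
  have inj: "inj_on (\<lambda>\<beta>. \<beta>(j := 0)) ?An"
  proof (rule inj_onI)
    fix \<beta> \<gamma> assume "\<beta> \<in> ?An" "\<gamma> \<in> ?An" "\<beta>(j := 0) = \<gamma>(j := 0)"
    then have "(\<beta>(j := 0))(j := n) = (\<gamma>(j := 0))(j := n)" "\<beta> j = n" "\<gamma> j = n" by auto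
    then show "\<beta> = \<gamma>" by (metis fun_upd_triv fun_upd_upd)
  qed
  have "a ((\<alpha>(j := 0))(j := n)) = 0"
  proof (rule insert.IH[where A = "(\<lambda>\<beta>. \<beta>(j := 0)) ` ?An" and a = "\<lambda>\<beta>. a (\<beta>(j := n))"
        and \<alpha> = "\<alpha>(j := 0)"])
    fix y :: "nat \<Rightarrow> real" assume y: "\<forall>i\<in>I. y i > 0"
    have "(\<Sum>\<beta>\<in>(\<lambda>\<beta>. \<beta>(j := 0)) ` ?An. a (\<beta>(j := n)) * (\<Prod>i\<in>I. y i ^ \<beta> i)) =
      (\<Sum>\<beta>\<in>?An. a (\<beta>(j := n)) * (\<Prod>i\<in>I. y i ^ (\<beta>(j := 0)) i))"
      using inj by (simp add: sum.reindex)
    also have "\<dots> = (\<Sum>\<beta>\<in>?An. a \<beta> * (\<Prod>i\<in>I. y i ^ \<beta> i))"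
    proof (intro sum.cong refl)
      fix \<beta> assume "\<beta> \<in> ?An"
      then have "\<beta>(j := n) = \<beta>" by auto
      moreover have "(\<Prod>i\<in>I. y i ^ (\<beta>(j := 0)) i) = (\<Prod>i\<in>I. y i ^ \<beta> i)"
        using insert.hyps by (intro prod.cong) auto
      ultimately show "a (\<beta>(j := n)) * (\<Prod>i\<in>I. y i ^ (\<beta>(j := 0)) i) = a \<beta> * (\<Prod>i\<in>I. y i ^ \<beta> i)" by simp
    qed
    finally show "(\<Sum>\<beta>\<in>(\<lambda>\<beta>. \<beta>(j := 0)) ` ?An. a (\<beta>(j := n)) * (\<Prod>i\<in>I. y i ^ \<beta> i)) = 0"
      using coeff[OF y] by simp
  next
    show "\<alpha>(j := 0) \<in> (\<lambda>\<beta>. \<beta>(j := 0)) ` ?An"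
      using insert.prems by (intro imageI) (auto simp: n_def)
  qed (use insert.prems in auto)
  then show ?case by (simp add: n_def)
qed

text \<open>Used in both directions of the change of basis between coordinate monomials and
  Bernstein monomials; \<open>S\<close> is a family of polynomial spaces indexed by degree.\<close>

lemma prod_power_in_graded:
  fixes y :: "'i \<Rightarrow> 'x \<Rightarrow> real"
  assumes I: "finite I" and one: "(\<lambda>x. 1) \<in> S 0"
    and step: "\<And>j p r. j \<in> I \<Longrightarrow> p \<in> S r \<Longrightarrow> (\<lambda>x. y j x * p x) \<in> S (Suc r)"
  shows "sum \<alpha> I = r \<Longrightarrow> (\<lambda>x. \<Prod>j\<in>I. y j x ^ \<alpha> j) \<in> S r"
proof (induction r arbitrary: \<alpha>)
  case 0
  then have "(\<lambda>x. \<Prod>j\<in>I. y j x ^ \<alpha> j) = (\<lambda>x. 1)" using I by (auto intro!: ext prod.neutral)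
  then show ?case using one by simp
next
  case (Suc r)
  then obtain j where j: "j \<in> I" "\<alpha> j \<noteq> 0" by (metis sum.neutral nat.distinct(1))
  let ?\<beta> = "\<alpha>(j := \<alpha> j - 1)"
  have "sum ?\<beta> (I - {j}) = sum \<alpha> (I - {j})" by (intro sum.cong) auto
  then have "sum ?\<beta> I = r" using Suc.prems I j by (simp add: sum.remove[of I j])
  then have "(\<lambda>x. y j x * (\<Prod>i\<in>I. y i x ^ ?\<beta> i)) \<in> S (Suc r)" using j(1) Suc.IH by (intro step) auto
  moreover have "y j x * (\<Prod>i\<in>I. y i x ^ ?\<beta> i) = (\<Prod>j\<in>I. y j x ^ \<alpha> j)" for x
  proof -
    have "(\<Prod>i\<in>I - {j}. y i x ^ ?\<beta> i) = (\<Prod>i\<in>I - {j}. y i x ^ \<alpha> i)" by (intro prod.cong) auto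
    moreover have "y j x * y j x ^ (\<alpha> j - 1) = y j x ^ \<alpha> j" using j(2) by (simp add: power_eq_if)
    ultimately show ?thesis using I j(1) by (simp add: prod.remove[of I j] mult.assoc[symmetric])
  qed
  ultimately show ?case by simp
qed

text \<open>The shape shared by \<open>poly_le\<close> and by the Bernstein form on a cell, so that
  closure properties are proved once.\<close>

definition comb_space :: "'i set \<Rightarrow> ('i \<Rightarrow> 'x \<Rightarrow> real) \<Rightarrow> ('x \<Rightarrow> real) set" where
  "comb_space I m = {p. \<exists>a. p = (\<lambda>x. \<Sum>\<alpha>\<in>I. a \<alpha> * m \<alpha> x)}"

lemma comb_space_base: "finite I \<Longrightarrow> \<alpha> \<in> I \<Longrightarrow> m \<alpha> \<in> comb_space I m"
  unfolding comb_space_def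
  by (intro CollectI exI[of _ "\<lambda>\<beta>. if \<beta> = \<alpha> then 1 else 0"])
    (simp add: if_distrib[of "\<lambda>t. t * _"] cong: if_cong)

lemma comb_space_add: "p \<in> comb_space I m \<Longrightarrow> q \<in> comb_space I m \<Longrightarrow> (\<lambda>x. p x + q x) \<in> comb_space I m"
proof -
  assume "p \<in> comb_space I m" "q \<in> comb_space I m"
  then obtain a b where "p = (\<lambda>x. \<Sum>\<alpha>\<in>I. a \<alpha> * m \<alpha> x)" "q = (\<lambda>x. \<Sum>\<alpha>\<in>I. b \<alpha> * m \<alpha> x)"
    by (auto simp: comb_space_def)
  then show ?thesis
    unfolding comb_space_def
    by (intro CollectI exI[of _ "\<lambda>\<alpha>. a \<alpha> + b \<alpha>"]) (simp add: sum.distrib distrib_right)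
qed

lemma comb_space_cmult: "p \<in> comb_space I m \<Longrightarrow> (\<lambda>x. c * p x) \<in> comb_space I m"
proof -
  assume "p \<in> comb_space I m"
  then obtain a where "p = (\<lambda>x. \<Sum>\<alpha>\<in>I. a \<alpha> * m \<alpha> x)" by (auto simp: comb_space_def)
  then show ?thesis
    unfolding comb_space_def
    by (intro CollectI exI[of _ "\<lambda>\<alpha>. c * a \<alpha>"]) (simp add: sum_distrib_left mult.assoc)
qed

lemma comb_space_sum: "(\<And>s. s \<in> S \<Longrightarrow> p s \<in> comb_space I m) \<Longrightarrow> (\<lambda>x. \<Sum>s\<in>S. p s x) \<in> comb_space I m"
proof (induction S rule: infinite_finite_induct)
  case (insert s S)
  then show ?case using comb_space_add[of "p s" I m] by simp
qed (simp_all add: comb_space_def exI[of _ "\<lambda>_. 0"])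

lemma poly_le_eq: "poly_le k = comb_space {\<alpha> :: 'n::finite \<Rightarrow> nat. (\<Sum>j\<in>UNIV. \<alpha> j) \<le> k} (\<lambda>\<alpha> x. \<Prod>j\<in>UNIV. (x $ j) ^ \<alpha> j)"
  by (simp add: poly_le_def comb_space_def)

lemma finite_exponents_le: "finite {\<alpha> :: 'n::finite \<Rightarrow> nat. (\<Sum>j\<in>UNIV. \<alpha> j) \<le> k}"
proof (rule finite_subset)
  show "{\<alpha>. (\<Sum>j\<in>UNIV. \<alpha> j) \<le> k} \<subseteq> {f. \<forall>x. (x \<in> (UNIV :: 'n set) \<longrightarrow> f x \<in> {..k}) \<and> (x \<notin> (UNIV :: 'n set) \<longrightarrow> f x = 0)}"
    by (auto intro: order_trans[OF member_le_sum[of _ UNIV]])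
qed (rule finite_set_of_finite_funs, auto)

lemma poly_le_coord:
  fixes m :: "'n::finite"
  shows "p \<in> poly_le r \<Longrightarrow> (\<lambda>x. x $ m * p x) \<in> poly_le (Suc r)"
proof -
  assume "p \<in> poly_le r"
  then obtain a where p: "p = (\<lambda>x. \<Sum>\<alpha>\<in>{\<alpha>. (\<Sum>j\<in>UNIV. \<alpha> j) \<le> r}. a \<alpha> * (\<Prod>j\<in>UNIV. (x $ j) ^ \<alpha> j))"
    by (auto simp: poly_le_def)
  have "(\<lambda>x. a \<alpha> * (x $ m * (\<Prod>j\<in>UNIV. (x $ j) ^ \<alpha> j))) \<in> poly_le (Suc r)" if \<alpha>: "(\<Sum>j\<in>UNIV. \<alpha> j) \<le> r" for \<alpha> :: "'n \<Rightarrow> nat"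
  proof -
    let ?\<beta> = "\<alpha>(m := Suc (\<alpha> m))"
    have "sum ?\<beta> (UNIV - {m}) = sum \<alpha> (UNIV - {m})" by (intro sum.cong) auto
    then have "(\<Sum>j\<in>UNIV. ?\<beta> j) \<le> Suc r"
      using \<alpha> by (simp add: sum.remove[of UNIV m])
    then have "(\<lambda>x. \<Prod>j\<in>UNIV. (x $ j) ^ ?\<beta> j) \<in> poly_le (Suc r)"
      unfolding poly_le_eq by (intro comb_space_base finite_exponents_le) auto
    moreover have "(\<Prod>j\<in>UNIV. (x $ j) ^ ?\<beta> j) = x $ m * (\<Prod>j\<in>UNIV. (x $ j) ^ \<alpha> j)" for x :: "real^'n"
    proof -
      have "(\<Prod>j\<in>UNIV - {m}. (x $ j) ^ ?\<beta> j) = (\<Prod>j\<in>UNIV - {m}. (x $ j) ^ \<alpha> j)" by (intro prod.cong) auto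
      then show ?thesis by (simp add: prod.remove[of UNIV m])
    qed
    ultimately show ?thesis unfolding poly_le_eq by (intro comb_space_cmult) simp
  qed
  then have "(\<lambda>x. \<Sum>\<alpha>\<in>{\<alpha>. (\<Sum>j\<in>UNIV. \<alpha> j) \<le> r}. a \<alpha> * (x $ m * (\<Prod>j\<in>UNIV. (x $ j) ^ \<alpha> j))) \<in> poly_le (Suc r)"
    unfolding poly_le_eq by (intro comb_space_sum) auto
  then show ?thesis by (simp add: p sum_distrib_left mult.left_commute)
qed

lemma poly_le_mono: "p \<in> poly_le r \<Longrightarrow> r \<le> k \<Longrightarrow> p \<in> poly_le k"
proof -
  assume "p \<in> poly_le r" and rk: "r \<le> k"
  then obtain a where p: "p = (\<lambda>x. \<Sum>\<alpha>\<in>{\<alpha>. (\<Sum>j\<in>UNIV. \<alpha> j) \<le> r}. a \<alpha> * (\<Prod>j\<in>UNIV. (x $ j) ^ \<alpha> j))"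
    by (auto simp: poly_le_def)
  show ?thesis
    unfolding p poly_le_eq using rk
    by (intro comb_space_sum comb_space_cmult comb_space_base finite_exponents_le) auto
qed

lemma poly_le_one: "(\<lambda>x. 1) \<in> poly_le 0"
proof -
  have "(\<lambda>x :: real^'n. \<Prod>j\<in>UNIV. (x $ j) ^ (\<lambda>_. 0) j) \<in> poly_le 0"
    unfolding poly_le_eq by (intro comb_space_base finite_exponents_le) auto
  then show ?thesis by simp
qed

lemma poly_le_affine: "p \<in> poly_le r \<Longrightarrow> (\<lambda>x. (g \<bullet> x + b) * p x) \<in> poly_le (Suc r)"
proof -
  assume p: "p \<in> poly_le r"
  have "(\<lambda>x. (\<Sum>m\<in>UNIV. g $ m * (x $ m * p x)) + b * p x) \<in> poly_le (Suc r)"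
    using poly_le_coord[OF p] poly_le_mono[OF p, of "Suc r"] unfolding poly_le_eq
    by (intro comb_space_add comb_space_sum comb_space_cmult) auto
  then show ?thesis by (simp add: inner_vec_def distrib_right sum_distrib_right mult.assoc)
qed

context simplex
begin

text \<open>Homogeneous exponents: as the coordinates of a cell sum to 1, monomials of degree
  exactly \<open>k\<close> already give every polynomial of degree at most \<open>k\<close>, and
  uniquely.\<close>

definition Exp :: "nat \<Rightarrow> nat \<Rightarrow> (nat \<Rightarrow> nat) set" where
  "Exp k i = {\<alpha>. (\<forall>j. j \<notin> J i \<longrightarrow> \<alpha> j = 0) \<and> sum \<alpha> (J i) = k}"

lemma finite_Exp [simp]: "finite (Exp k i)"
proof (rule finite_subset)
  show "Exp k i \<subseteq> {f. \<forall>x. (x \<in> J i \<longrightarrow> f x \<in> {..k}) \<and> (x \<notin> J i \<longrightarrow> f x = 0)}"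
    by (auto simp: Exp_def intro: member_le_sum)
qed (rule finite_set_of_finite_funs, auto)

text \<open>A Bernstein polynomial of the cell without its multinomial factor.\<close>

definition mono :: "nat \<Rightarrow> (nat \<Rightarrow> nat) \<Rightarrow> real^'n \<Rightarrow> real" where
  "mono i \<alpha> x = (\<Prod>j\<in>J i. cl i j x ^ \<alpha> j)"

lemma C_infty_mono: "C_infty (mono i \<alpha>)"
  unfolding mono_def by (intro C_infty_prod C_infty_power C_infty_cl)

lemma mono_zero: "j \<in> J i \<Longrightarrow> \<alpha> j \<noteq> 0 \<Longrightarrow> cl i j x = 0 \<Longrightarrow> mono i \<alpha> x = 0"
  unfolding mono_def by (auto intro!: prod_zero)

text \<open>By homogeneity, the value at the point with weights \<open>y j / s\<close> is the
  polynomial at \<open>y\<close> divided by \<open>s ^ k\<close>, which reduces the claim to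
  independence of monomials at positive arguments.\<close>

lemma bernstein_unique:
  assumes i: "i \<le> d" and zero: "\<And>x. x \<in> ocell i \<Longrightarrow> (\<Sum>\<alpha>\<in>Exp k i. a \<alpha> * mono i \<alpha> x) = 0" and \<alpha>: "\<alpha> \<in> Exp k i"
  shows "a \<alpha> = 0"
proof (rule monomials_independent[where I = "J i" and A = "Exp k i" and a = a and \<alpha> = \<alpha>])
  fix y :: "nat \<Rightarrow> real" assume y: "\<forall>j\<in>J i. y j > 0"
  define s where "s = (\<Sum>j\<in>J i. y j)"
  have "J i \<noteq> {}" using card_J[OF i] by auto
  then have s: "s > 0" unfolding s_def using y by (intro sum_pos) auto
  define x where "x = (\<Sum>m\<in>J i. (y m / s) *\<^sub>R vertex v m)"
  have cl: "cl i j x = y j / s" if "j \<in> J i" for j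
    unfolding x_def using s that by (intro cl_of_weights i) (simp_all add: sum_divide_distrib[symmetric] s_def)
  then have "x \<in> ocell i" using y s by (auto simp: ocell_def)
  then have "0 = (\<Sum>\<alpha>\<in>Exp k i. a \<alpha> * mono i \<alpha> x)" using zero by simp
  also have "\<dots> = (\<Sum>\<alpha>\<in>Exp k i. (a \<alpha> * (\<Prod>j\<in>J i. y j ^ \<alpha> j)) / s ^ k)"
  proof (intro sum.cong refl)
    fix \<alpha> assume "\<alpha> \<in> Exp k i"
    then have "(\<Prod>j\<in>J i. s ^ \<alpha> j) = s ^ k" by (simp add: power_sum[symmetric] Exp_def)
    moreover have "mono i \<alpha> x = (\<Prod>j\<in>J i. y j ^ \<alpha> j / s ^ \<alpha> j)"
      unfolding mono_def by (intro prod.cong) (auto simp: cl power_divide)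
    ultimately show "a \<alpha> * mono i \<alpha> x = (a \<alpha> * (\<Prod>j\<in>J i. y j ^ \<alpha> j)) / s ^ k"
      by (simp add: prod_dividef)
  qed
  finally show "(\<Sum>\<alpha>\<in>Exp k i. a \<alpha> * (\<Prod>j\<in>J i. y j ^ \<alpha> j)) = 0"
    using s by (simp add: sum_divide_distrib[symmetric])
next
  show "finite (J i)" "finite (Exp k i)" by simp_all
  show "\<beta> j = 0" if "\<beta> \<in> Exp k i" "j \<notin> J i" for \<beta> j using that by (auto simp: Exp_def)
qed fact

lemma bernstein_cl: "j \<in> J i \<Longrightarrow> p \<in> comb_space (Exp r i) (mono i) \<Longrightarrow>
    (\<lambda>x. cl i j x * p x) \<in> comb_space (Exp (Suc r) i) (mono i)"
proof -
  assume j: "j \<in> J i" and "p \<in> comb_space (Exp r i) (mono i)"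
  then obtain a where p: "p = (\<lambda>x. \<Sum>\<alpha>\<in>Exp r i. a \<alpha> * mono i \<alpha> x)" by (auto simp: comb_space_def)
  have "(\<lambda>x. a \<alpha> * (cl i j x * mono i \<alpha> x)) \<in> comb_space (Exp (Suc r) i) (mono i)" if \<alpha>: "\<alpha> \<in> Exp r i" for \<alpha>
  proof -
    let ?\<beta> = "\<alpha>(j := Suc (\<alpha> j))"
    have "sum ?\<beta> (J i - {j}) = sum \<alpha> (J i - {j})" by (intro sum.cong) auto
    then have "?\<beta> \<in> Exp (Suc r) i"
      using \<alpha> j by (auto simp: Exp_def sum.remove[of "J i" j])
    then have "mono i ?\<beta> \<in> comb_space (Exp (Suc r) i) (mono i)" by (rule comb_space_base[OF finite_Exp])
    moreover have "mono i ?\<beta> = (\<lambda>x. cl i j x * mono i \<alpha> x)"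
    proof
      fix x
      have "(\<Prod>m\<in>J i - {j}. cl i m x ^ ?\<beta> m) = (\<Prod>m\<in>J i - {j}. cl i m x ^ \<alpha> m)" by (intro prod.cong) auto
      then show "mono i ?\<beta> x = cl i j x * mono i \<alpha> x"
        using j by (simp add: mono_def prod.remove[of "J i" j])
    qed
    ultimately show ?thesis by (simp add: comb_space_cmult)
  qed
  then have "(\<lambda>x. \<Sum>\<alpha>\<in>Exp r i. a \<alpha> * (cl i j x * mono i \<alpha> x)) \<in> comb_space (Exp (Suc r) i) (mono i)"
    by (intro comb_space_sum) auto
  then show ?thesis by (simp add: p sum_distrib_left mult.left_commute)
qed

text \<open>Degree elevation: multiply by the sum of the coordinates, which is 1.\<close>

lemma bernstein_Suc: "i \<le> d \<Longrightarrow> p \<in> comb_space (Exp r i) (mono i) \<Longrightarrow> p \<in> comb_space (Exp (Suc r) i) (mono i)"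
proof -
  assume i: "i \<le> d" and p: "p \<in> comb_space (Exp r i) (mono i)"
  have "(\<lambda>x. \<Sum>j\<in>J i. cl i j x * p x) \<in> comb_space (Exp (Suc r) i) (mono i)"
    using p by (intro comb_space_sum bernstein_cl)
  then show ?thesis using i by (simp add: sum_distrib_right[symmetric] sum_cl)
qed

lemma bernstein_coord: "i \<le> d \<Longrightarrow> p \<in> comb_space (Exp r i) (mono i) \<Longrightarrow> (\<lambda>x. x $ m * p x) \<in> comb_space (Exp (Suc r) i) (mono i)"
proof -
  assume i: "i \<le> d" and p: "p \<in> comb_space (Exp r i) (mono i)"
  have "(\<lambda>x. \<Sum>j\<in>J i. vertex v j $ m * (cl i j x * p x)) \<in> comb_space (Exp (Suc r) i) (mono i)"
    using p by (intro comb_space_sum comb_space_cmult bernstein_cl)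
  moreover have "x $ m * p x = (\<Sum>j\<in>J i. vertex v j $ m * (cl i j x * p x))" for x
  proof -
    have "x $ m = (\<Sum>j\<in>J i. cl i j x * vertex v j $ m)"
      using arg_cong[OF sum_cl_vertex[OF i, of x], of "\<lambda>y. y $ m"] by simp
    then have "x $ m * p x = (\<Sum>j\<in>J i. cl i j x * vertex v j $ m) * p x" by (rule arg_cong)
    then show ?thesis unfolding sum_distrib_right by (simp add: mult_ac)
  qed
  ultimately show ?thesis by (simp only:)
qed

lemma poly_le_bernstein:
  assumes i: "i \<le> d"
  shows "poly_le k = comb_space (Exp k i) (mono i)"
proof
  have 1: "(\<lambda>x. \<Prod>m\<in>UNIV. (x $ m) ^ \<beta> m) \<in> comb_space (Exp r i) (mono i)"
    if "sum \<beta> UNIV = r" for \<beta> :: "'n \<Rightarrow> nat" and r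
  proof (rule prod_power_in_graded[where S = "\<lambda>r. comb_space (Exp r i) (mono i)" and y = "\<lambda>m x. x $ m"])
    have "mono i (\<lambda>_. 0) \<in> comb_space (Exp 0 i) (mono i)" by (intro comb_space_base finite_Exp) (auto simp: Exp_def)
    moreover have "mono i (\<lambda>_. 0) = (\<lambda>x. 1)" by (simp add: mono_def fun_eq_iff)
    ultimately show "(\<lambda>x. 1) \<in> comb_space (Exp 0 i) (mono i)" by simp
  qed (use that bernstein_coord[OF i] in auto)
  have 2: "p \<in> comb_space (Exp (r + m) i) (mono i)" if "p \<in> comb_space (Exp r i) (mono i)" for p r m
    using that by (induction m) (auto intro: bernstein_Suc[OF i])
  have "(\<lambda>x. \<Prod>m\<in>UNIV. (x $ m) ^ \<beta> m) \<in> comb_space (Exp k i) (mono i)"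
    if "sum \<beta> UNIV \<le> k" for \<beta> :: "'n \<Rightarrow> nat"
    using 2[OF 1[OF refl], of \<beta> "k - sum \<beta> UNIV"] that by simp
  then show "poly_le k \<subseteq> comb_space (Exp k i) (mono i)"
    unfolding poly_le_def by (auto intro!: comb_space_sum comb_space_cmult)
  have "mono i \<alpha> \<in> poly_le k" if "\<alpha> \<in> Exp k i" for \<alpha>
    unfolding mono_def
  proof (rule prod_power_in_graded[where S = poly_le])
    show "(\<lambda>x. cl i j x * p x) \<in> poly_le (Suc r)" if "p \<in> poly_le r" for j p r
      using poly_le_affine[OF that] cl_affine[of i j] by auto
  qed (use that in \<open>auto simp: Exp_def poly_le_one\<close>)
  then show "comb_space (Exp k i) (mono i) \<subseteq> poly_le k"
    unfolding poly_le_eq by (auto simp: comb_space_def[of "Exp k i"] intro!: comb_space_sum comb_space_cmult)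
qed

text \<open>The field with Bernstein coefficients \<open>C i \<alpha>\<close> on the cell
  \<open>i\<close>. On common faces several cells contribute, which only concerns a null
  set.\<close>

definition fld :: "nat \<Rightarrow> (nat \<Rightarrow> (nat \<Rightarrow> nat) \<Rightarrow> real^'n^'n) \<Rightarrow> real^'n \<Rightarrow> real^'n^'n" where
  "fld k C x = (\<Sum>i\<le>d. \<Sum>\<alpha>\<in>Exp k i. (indicat_real (cell v i) x * mono i \<alpha> x) *\<^sub>R C i \<alpha>)"

text \<open>A linear map whose kernel, by \<open>Psi_eq_0\<close>, is trivial on the exponents in
  \<open>Exp k i\<close>; it carries directness and dimension from families of coefficients to
  classes of functions.\<close>

definition Psi :: "nat \<Rightarrow> (nat \<Rightarrow> (nat \<Rightarrow> nat) \<Rightarrow> real^'n^'n) \<Rightarrow> (real^'n, real^'n^'n) ae_fun" where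
  "Psi k C = abs_ae (fld k C)"

lemma fld_ocell:
  assumes i: "i \<le> d" "x \<in> ocell i"
  shows "fld k C x = (\<Sum>\<alpha>\<in>Exp k i. mono i \<alpha> x *\<^sub>R C i \<alpha>)"
proof -
  have x: "x \<in> cell v i" using i ocell_subset by blast
  have "fld k C x = (\<Sum>m\<le>d. if m = i then \<Sum>\<alpha>\<in>Exp k i. mono i \<alpha> x *\<^sub>R C i \<alpha> else 0)"
    unfolding fld_def
  proof (intro sum.cong refl)
    fix m assume "m \<in> {..d}"
    then have "x \<in> cell v m \<longleftrightarrow> m = i" using x ocell_disjoint[OF i(1) _ i(2)] by auto
    then show "(\<Sum>\<alpha>\<in>Exp k m. (indicat_real (cell v m) x * mono m \<alpha> x) *\<^sub>R C m \<alpha>) =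
        (if m = i then \<Sum>\<alpha>\<in>Exp k i. mono i \<alpha> x *\<^sub>R C i \<alpha> else 0)"
      using x by (cases "m = i") auto
  qed
  then show ?thesis using i by simp
qed

lemma fld_outside: "x \<notin> T \<Longrightarrow> fld k C x = 0"
proof -
  assume x: "x \<notin> T"
  have "x \<notin> cell v i" if "i \<le> d" for i using x cell_subset_T[OF that] by blast
  then show ?thesis unfolding fld_def by (intro sum.neutral) auto
qed

lemma AE_ocell: "AE x in lebesgue. x \<notin> T \<or> (\<exists>i\<le>d. x \<in> ocell i)"
proof -
  have "negligible (\<Union>i\<le>d. cell v i - ocell i)"
    by (intro negligible_Union) (auto intro: negligible_cell_ocell)
  then have "AE x in lebesgue. x \<notin> (\<Union>i\<le>d. cell v i - ocell i)"
    unfolding negligible_iff_null_sets by (rule AE_not_in)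
  then show ?thesis by eventually_elim (auto simp: T_eq_UN)
qed

lemma abs_ae_eq_iff: "abs_ae f = abs_ae g \<longleftrightarrow> (AE x in lebesgue. f x = g x)"
  by (rule ae_fun.abs_eq_iff)

lemma abs_ae_eq_PsiI:
  assumes "\<And>i x. i \<le> d \<Longrightarrow> x \<in> ocell i \<Longrightarrow> g x = (\<Sum>\<alpha>\<in>Exp k i. mono i \<alpha> x *\<^sub>R C i \<alpha>)"
    and "\<And>x. x \<notin> T \<Longrightarrow> g x = 0"
  shows "abs_ae g = Psi k C"
  unfolding Psi_def abs_ae_eq_iff using AE_ocell
  by eventually_elim (use assms fld_ocell fld_outside in metis)

lemma abs_ae_add: "abs_ae f + abs_ae g = abs_ae (\<lambda>x. f x + g x)"
  by (rule plus_ae_fun.abs_eq)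

lemma abs_ae_scaleR: "r *\<^sub>R abs_ae f = abs_ae (\<lambda>x. r *\<^sub>R f x)"
  by (rule scaleR_ae_fun.abs_eq)

lemma abs_ae_zero: "abs_ae (\<lambda>_. 0) = 0"
  by (rule zero_ae_fun.abs_eq[symmetric])

lemma Psi_add: "Psi k C + Psi k D = Psi k (\<lambda>i \<alpha>. C i \<alpha> + D i \<alpha>)"
  unfolding Psi_def abs_ae_add
  by (rule arg_cong[where f = abs_ae]) (simp add: fun_eq_iff fld_def scaleR_add_right sum.distrib)

lemma Psi_scaleR: "r *\<^sub>R Psi k C = Psi k (\<lambda>i \<alpha>. r *\<^sub>R C i \<alpha>)"
  unfolding Psi_def abs_ae_scaleR
  by (rule arg_cong[where f = abs_ae]) (simp add: fun_eq_iff fld_def scaleR_sum_right mult_ac)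

lemma Psi_zero: "Psi k (\<lambda>i \<alpha>. 0) = 0"
  unfolding Psi_def abs_ae_zero[symmetric]
  by (rule arg_cong[where f = abs_ae]) (simp add: fun_eq_iff fld_def)

lemma Psi_sum: "(\<Sum>s\<in>S. Psi k (C s)) = Psi k (\<lambda>i \<alpha>. \<Sum>s\<in>S. C s i \<alpha>)"
  by (induction S rule: infinite_finite_induct) (auto simp: Psi_zero Psi_add)

lemma Psi_cong: "(\<And>i \<alpha>. i \<le> d \<Longrightarrow> \<alpha> \<in> Exp k i \<Longrightarrow> C i \<alpha> = D i \<alpha>) \<Longrightarrow> Psi k C = Psi k D"
proof -
  assume "\<And>i \<alpha>. i \<le> d \<Longrightarrow> \<alpha> \<in> Exp k i \<Longrightarrow> C i \<alpha> = D i \<alpha>"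
  then have "fld k C = fld k D" by (intro ext) (auto simp: fld_def intro!: sum.cong)
  then show ?thesis by (simp add: Psi_def)
qed

text \<open>A nonempty open set is not negligible, so a continuous function cannot be nonzero at a
  point of the open cell and zero almost everywhere on it.\<close>

lemma AE_zero_ocell:
  fixes F :: "real^'n \<Rightarrow> 'b::real_normed_vector"
  assumes "continuous_on UNIV F" "AE x in lebesgue. x \<in> ocell i \<longrightarrow> F x = 0" "x \<in> ocell i"
  shows "F x = 0"
proof (rule ccontr)
  assume "F x \<noteq> 0"
  let ?U = "ocell i \<inter> F -` (- {0})"
  have op: "open ?U" using assms(1) by (intro open_Int open_ocell open_vimage) auto
  have "AE x in lebesgue. x \<notin> ?U" using assms(2) by eventually_elim auto
  then have "negligible ?U"
    using op by (simp add: negligible_iff_null_sets AE_iff_null_sets borel_open)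
  then show False using op open_not_negligible[of ?U] assms(3) \<open>F x \<noteq> 0\<close> by blast
qed

lemma Psi_eq_0:
  assumes "Psi k C = 0" and i: "i \<le> d" and \<alpha>: "\<alpha> \<in> Exp k i"
  shows "C i \<alpha> = 0"
proof -
  let ?F = "\<lambda>x. \<Sum>\<alpha>\<in>Exp k i. mono i \<alpha> x *\<^sub>R C i \<alpha>"
  have "AE x in lebesgue. fld k C x = 0"
    using assms(1) unfolding Psi_def abs_ae_zero[symmetric] abs_ae_eq_iff .
  then have ae: "AE x in lebesgue. x \<in> ocell i \<longrightarrow> ?F x = 0"
    by eventually_elim (use fld_ocell[OF i] in auto)
  have cont: "continuous_on UNIV ?F"
    by (intro continuous_intros C_infty_continuous_on C_infty_mono)
  have "C i \<alpha> $ a $ b = 0" for a b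
  proof (rule bernstein_unique[OF i _ \<alpha>])
    fix x assume "x \<in> ocell i"
    then have "?F x $ a $ b = 0" using AE_zero_ocell[OF cont ae] by simp
    then show "(\<Sum>\<alpha>\<in>Exp k i. C i \<alpha> $ a $ b * mono i \<alpha> x) = 0" by (simp add: mult.commute)
  qed
  then show ?thesis by (simp add: vec_eq_iff)
qed

lemma expo_Exp: "i \<le> d \<Longrightarrow> f \<subseteq> J i \<Longrightarrow> expo k f \<subseteq> Exp k i"
proof
  fix \<alpha> assume i: "i \<le> d" and f: "f \<subseteq> J i" and "\<alpha> \<in> expo k f"
  then have \<alpha>: "\<And>j. \<alpha> j \<noteq> 0 \<longleftrightarrow> j \<in> f" "sum \<alpha> f = k" by (auto simp: expo_def)
  have "sum \<alpha> (J i) = sum \<alpha> f" using f \<alpha>(1) by (intro sum.mono_neutral_right) auto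
  then show "\<alpha> \<in> Exp k i" using \<alpha> f unfolding Exp_def by auto
qed

text \<open>With \<open>expo_Exp\<close>, the exponents on a cell are sorted by their supports,
  which are sets of vertices of that cell.\<close>

lemma Exp_expo: "\<alpha> \<in> Exp k i \<Longrightarrow> \<alpha> \<in> expo k {j. \<alpha> j \<noteq> 0} \<and> {j. \<alpha> j \<noteq> 0} \<subseteq> J i"
proof -
  assume \<alpha>: "\<alpha> \<in> Exp k i"
  then have sub: "{j. \<alpha> j \<noteq> 0} \<subseteq> J i" by (auto simp: Exp_def)
  then have "sum \<alpha> {j. \<alpha> j \<noteq> 0} = sum \<alpha> (J i)" by (intro sum.mono_neutral_left) auto
  then show ?thesis using \<alpha> sub by (auto simp: expo_def Exp_def)
qed

end

section \<open>The weak divergence\<close>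

text \<open>The product rule for a scalar factor with gradient \<open>g\<close> contributes such a
  rank-one matrix to a Jacobian.\<close>

lemma inner_matrix_rank_one: "A \<bullet> matrix (\<lambda>e. (g \<bullet> e) *\<^sub>R u) = u \<bullet> (A *v g)"
  for A :: "real^'n^'n"
  by (simp add: inner_vec_def matrix_def matrix_vector_mult_def sum_distrib_left axis_def
      if_distrib[of "\<lambda>t. _ * t"] cong: if_cong) (simp add: mult_ac)

lemma matrix_eq_bilinear:
  fixes A B :: "real^'n^'n"
  assumes "\<And>x y. x \<bullet> (A *v y) = x \<bullet> (B *v y)"
  shows "A = B"
  using assms by (metis matrix_eq vector_eq_ldot)

lemma inner_symmetric_matrix:
  fixes A :: "real^'n^'n"
  assumes "transpose A = A"
  shows "x \<bullet> (A *v y) = y \<bullet> (A *v x)"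
  by (metis assms dot_lmul_matrix inner_commute transpose_matrix_vector)

definition grad :: "(real^'n \<Rightarrow> real) \<Rightarrow> real^'n \<Rightarrow> real^'n" where
  "grad q x = (\<chi> i. dd q (axis i 1) x)"

lemma grad_inner: "C_infty q \<Longrightarrow> grad q x \<bullet> e = dd q e x"
proof -
  assume "C_infty q"
  then interpret F: linear "\<lambda>e. dd q e x" by (rule C_infty_linear_dd)
  have "dd q e x = dd q (\<Sum>i\<in>UNIV. e $ i *\<^sub>R axis i 1) x"
    by (simp add: basis_expansion scalar_mult_eq_scaleR[symmetric])
  also have "\<dots> = (\<Sum>i\<in>UNIV. e $ i * dd q (axis i 1) x)" by (simp add: F.sum F.scale)
  finally show ?thesis by (simp add: grad_def inner_vec_def mult.commute)
qed

lemma continuous_on_grad: "C_infty q \<Longrightarrow> continuous_on S (grad q)"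
  unfolding grad_def by (intro continuous_on_vec_lambda C_infty_continuous_on C_infty_dd)

lemma continuous_on_jacobian:
  fixes \<phi> :: "real^'n \<Rightarrow> real^'n"
  shows "C_infty \<phi> \<Longrightarrow> continuous_on S (\<lambda>x. jacobian \<phi> (at x))"
  unfolding jacobian_def matrix_def
  by (intro continuous_on_vec_lambda continuous_intros C_infty_continuous_on C_infty_dd)

lemma continuous_on_matrix_vector_mult:
  fixes A :: "real^'n^'n"
  shows "continuous_on S f \<Longrightarrow> continuous_on S (\<lambda>x. A *v f x)"
  using bounded_linear.continuous_on[OF matrix_vector_mul_bounded_linear] by blast

context simplex
begin

text \<open>The integral of \<open>mono i \<alpha>\<close> times
  \<open>(A n) \<bullet> \<phi>\<close> over the boundary of the cell with outer normal
  \<open>n\<close>, expressed by Green's formula as an integral over the cell.\<close>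

definition flux :: "nat \<Rightarrow> (nat \<Rightarrow> nat) \<Rightarrow> real^'n^'n \<Rightarrow> (real^'n \<Rightarrow> real^'n) \<Rightarrow> real" where
  "flux i \<alpha> A \<phi> = (\<integral>x. indicat_real (cell v i) x *
     (mono i \<alpha> x * (A \<bullet> jacobian \<phi> (at x)) + (A *v grad (mono i \<alpha>) x) \<bullet> \<phi> x) \<partial>lebesgue)"

lemma integrable_flux:
  fixes \<phi> :: "real^'n \<Rightarrow> real^'n"
  assumes "C_infty \<phi>"
  shows "integrable lebesgue (\<lambda>x. indicat_real (cell v i) x *
     (mono i \<alpha> x * (A \<bullet> jacobian \<phi> (at x)) + (A *v grad (mono i \<alpha>) x) \<bullet> \<phi> x))"
proof -
  have 1: "continuous_on (cell v i) (\<lambda>x. jacobian \<phi> (at x))" using assms by (rule continuous_on_jacobian)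
  have 2: "continuous_on (cell v i) (\<lambda>x. A *v grad (mono i \<alpha>) x)"
    by (rule continuous_on_matrix_vector_mult[OF continuous_on_grad[OF C_infty_mono]])
  show ?thesis
    by (rule integrable_cell_real)
      (intro continuous_on_add continuous_on_mult continuous_on_inner continuous_on_const 1 2
        C_infty_continuous_on[OF C_infty_mono] C_infty_continuous_on[OF assms])
qed

lemma linear_flux:
  assumes "C_infty \<phi>"
  shows "linear (\<lambda>A. flux i \<alpha> A \<phi>)"
proof (rule linearI)
  note int = integrable_flux[OF assms, of i \<alpha>]
  fix A B :: "real^'n^'n" and r :: real
  have "flux i \<alpha> (A + B) \<phi> = (\<integral>x. indicat_real (cell v i) x *
     (mono i \<alpha> x * (A \<bullet> jacobian \<phi> (at x)) + (A *v grad (mono i \<alpha>) x) \<bullet> \<phi> x) + indicat_real (cell v i) x *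
     (mono i \<alpha> x * (B \<bullet> jacobian \<phi> (at x)) + (B *v grad (mono i \<alpha>) x) \<bullet> \<phi> x) \<partial>lebesgue)"
    unfolding flux_def by (intro Bochner_Integration.integral_cong refl)
      (simp add: inner_add_left matrix_vector_mult_add_rdistrib algebra_simps)
  then show "flux i \<alpha> (A + B) \<phi> = flux i \<alpha> A \<phi> + flux i \<alpha> B \<phi>"
    unfolding flux_def using int by simp
  have "flux i \<alpha> (r *\<^sub>R A) \<phi> = (\<integral>x. r * (indicat_real (cell v i) x *
     (mono i \<alpha> x * (A \<bullet> jacobian \<phi> (at x)) + (A *v grad (mono i \<alpha>) x) \<bullet> \<phi> x)) \<partial>lebesgue)"
    unfolding flux_def by (intro Bochner_Integration.integral_cong refl)
      (simp add: scaleR_matrix_vector_assoc[symmetric] algebra_simps)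
  then show "flux i \<alpha> (r *\<^sub>R A) \<phi> = r *\<^sub>R flux i \<alpha> A \<phi>"
    unfolding flux_def by simp
qed

text \<open>The product rule merges both terms of the flux into derivatives of scalar functions
  along \<open>a\<close> and \<open>b\<close>; for edge vectors the edge integrals then
  apply.\<close>

lemma flux_sym_tensor:
  assumes \<phi>: "C_infty \<phi>"
  shows "flux i \<alpha> (sym_tensor a b) \<phi> =
    ((\<integral>x. indicat_real (cell v i) x * dd (\<lambda>x. mono i \<alpha> x * (\<phi> x \<bullet> a)) b x \<partial>lebesgue) +
     (\<integral>x. indicat_real (cell v i) x * dd (\<lambda>x. mono i \<alpha> x * (\<phi> x \<bullet> b)) a x \<partial>lebesgue)) / 2"
proof -
  have C: "C_infty (\<lambda>x. \<phi> x \<bullet> a)" for a using \<phi> by (intro C_infty_inner C_infty_const)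
  have int: "integrable lebesgue (\<lambda>x. indicat_real (cell v i) x * dd (\<lambda>x. mono i \<alpha> x * (\<phi> x \<bullet> a)) b x)" for a b
    by (intro integrable_cell_real C_infty_continuous_on C_infty_dd C_infty_mult C C_infty_mono)
  have dd: "dd (\<lambda>x. mono i \<alpha> x * (\<phi> x \<bullet> a)) b x = mono i \<alpha> x * (dd \<phi> b x \<bullet> a) + (grad (mono i \<alpha>) x \<bullet> b) * (\<phi> x \<bullet> a)" for a b x
    by (simp add: dd_mult[OF C_infty_mono C] dd_inner_left[OF \<phi>] grad_inner[OF C_infty_mono])
  have "mono i \<alpha> x * (sym_tensor a b \<bullet> jacobian \<phi> (at x)) + (sym_tensor a b *v grad (mono i \<alpha>) x) \<bullet> \<phi> x =
    (dd (\<lambda>x. mono i \<alpha> x * (\<phi> x \<bullet> a)) b x + dd (\<lambda>x. mono i \<alpha> x * (\<phi> x \<bullet> b)) a x) / 2" for x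
    unfolding jacobian_def inner_sym_tensor_matrix[OF C_infty_linear_dd[OF \<phi>]] dd
    by (simp add: sym_tensor_mult_vec inner_add_left inner_add_right inner_commute field_simps)
  then have "flux i \<alpha> (sym_tensor a b) \<phi> = (\<integral>x. (indicat_real (cell v i) x * dd (\<lambda>x. mono i \<alpha> x * (\<phi> x \<bullet> a)) b x +
     indicat_real (cell v i) x * dd (\<lambda>x. mono i \<alpha> x * (\<phi> x \<bullet> b)) a x) / 2 \<partial>lebesgue)"
    unfolding flux_def by (simp add: distrib_left add_divide_distrib)
  then show ?thesis using int by simp
qed

text \<open>The monomial vanishes on the facet opposite every vertex of its support. For an endpoint
  outside the support the test function has to vanish on that facet instead.\<close>

lemma flux_edge_zero:
  assumes \<phi>: "C_infty \<phi>" and i: "i \<le> d" and pq: "p \<in> J i" "q \<in> J i"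
    and zp: "\<alpha> p \<noteq> 0" and zq: "\<alpha> q \<noteq> 0 \<or> (\<forall>x\<in>cell v i. cl i q x = 0 \<longrightarrow> \<phi> x = 0)"
  shows "(\<integral>x. indicat_real (cell v i) x * dd (\<lambda>x. mono i \<alpha> x * (\<phi> x \<bullet> a)) (edge_vec v p q) x \<partial>lebesgue) = 0"
proof (cases "p = q")
  case True
  have "C_infty (\<lambda>x. mono i \<alpha> x * (\<phi> x \<bullet> a))"
    using \<phi> by (intro C_infty_mult C_infty_inner C_infty_const C_infty_mono)
  from linear_0[OF C_infty_linear_dd[OF this]] show ?thesis using True by simp
next
  case False
  show ?thesis
  proof (rule cell_edge_integral[OF i pq False])
    show "C_infty (\<lambda>x. mono i \<alpha> x * (\<phi> x \<bullet> a))"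
      using \<phi> by (intro C_infty_mult C_infty_inner C_infty_const C_infty_mono)
  qed (use zp zq mono_zero pq in auto)
qed

text \<open>Edges between vertices of \<open>f\<close> span its tangent space, and lines parallel to
  them cross only facets on which the monomial vanishes. The test function is an arbitrary smooth
  one, so these tensors have zero normal trace on the whole boundary of the cell.\<close>

lemma flux_tangent_zero:
  assumes \<phi>: "C_infty \<phi>" and i: "i \<le> d" and f: "f \<subseteq> J i" and \<alpha>: "\<And>j. j \<in> f \<Longrightarrow> \<alpha> j \<noteq> 0"
    and A: "A \<in> sym_space (tangent v f) (tangent v f)"
  shows "flux i \<alpha> A \<phi> = 0"
proof -
  let ?E = "{edge_vec v p q |p q. p \<in> f \<and> q \<in> f}"
  let ?S = "{A. flux i \<alpha> A \<phi> = 0}"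
  have S: "subspace ?S" by (rule linear_subspace_kernel[OF linear_flux[OF \<phi>]])
  have "sym_tensor a b \<in> ?S" if "a \<in> span ?E" "b \<in> span ?E" for a b
  proof (rule sym_tensor_span_closed[OF S _ that])
    fix x y assume "x \<in> ?E" "y \<in> ?E"
    then obtain p q p' q' where "x = edge_vec v p q" "y = edge_vec v p' q'" "p \<in> f" "q \<in> f" "p' \<in> f" "q' \<in> f"
      by blast
    then show "sym_tensor x y \<in> ?S"
      using f \<alpha> by (simp add: flux_sym_tensor[OF \<phi>] flux_edge_zero[OF \<phi> i] subset_iff)
  qed
  then have "sym_space (tangent v f) (tangent v f) \<subseteq> ?S"
    unfolding sym_space_def tangent_def by (intro span_minimal S) blast
  then show ?thesis using A by blast
qed

definition hmono :: "nat set \<Rightarrow> (nat \<Rightarrow> nat) \<Rightarrow> real^'n \<Rightarrow> real" where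
  "hmono f \<alpha> x = (\<Prod>j\<in>f. hat v j x ^ \<alpha> j)"

text \<open>The hat function of \<open>v i\<close> vanishes on the opposite cell \<open>i\<close>;
  for \<open>i\<close> outside \<open>f\<close> the product of hat functions is the Bernstein
  monomial with the same exponents.\<close>

lemma hmono_cell:
  assumes i: "i \<le> d" "x \<in> cell v i" and f: "f \<subseteq> {..Suc d}" and \<alpha>: "\<alpha> \<in> expo k f"
  shows "hmono f \<alpha> x = (if i \<in> f then 0 else mono i \<alpha> x)"
proof -
  have eq: "hmono f \<alpha> x = (\<Prod>j\<in>f. cl i j x ^ \<alpha> j)"
    unfolding hmono_def using i f by (intro prod.cong) (auto simp: hat_cell)
  have "finite f" using f finite_subset by blast
  show ?thesis
  proof (cases "i \<in> f")
    case True
    then show ?thesis unfolding eq using \<open>finite f\<close> \<alpha> cl_same[OF i(1)]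
      by (auto simp: expo_def intro!: prod_zero bexI[of _ i])
  next
    case False
    then have "f \<subseteq> J i" using f by (auto simp: cell_idx_def)
    then have "mono i \<alpha> x = (\<Prod>j\<in>f. cl i j x ^ \<alpha> j)"
      unfolding mono_def using \<alpha> by (intro prod.mono_neutral_right) (auto simp: expo_def)
    then show ?thesis using False eq by simp
  qed
qed

lemma hmono_lipschitz:
  assumes \<phi>: "C_infty \<phi>" and f: "f \<subseteq> {..Suc d}"
  shows "\<exists>L. L-lipschitz_on T (\<lambda>x. hmono f \<alpha> x * (\<phi> x \<bullet> a))"
  unfolding hmono_def
proof (intro lipschitz_on_mult_compact lipschitz_on_prod_compact lipschitz_on_power_compact compact_T)
  show "\<exists>L. L-lipschitz_on T (hat v j)" if "j \<in> f" for j
    using that f hatf_lipschitz[of j] hat_eq[of j] by auto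
  show "\<exists>L. L-lipschitz_on T (\<lambda>x. \<phi> x \<bullet> a)"
    using \<phi> by (intro C_infty_lipschitz compact_T convex_T C_infty_inner C_infty_const)
qed

lemma gm_nonzero: "i \<le> d \<Longrightarrow> gm i \<noteq> 0"
proof
  assume i: "i \<le> d" and 0: "gm i = 0"
  obtain j where "j \<le> d" "j \<noteq> i" using d_pos by (metis le0 zero_neq_one)
  then show False using mu_vertex[OF i i] mu_vertex[OF i, of j] 0 by (simp add: mu_def)
qed

lemma mu_zero_frontier:
  assumes i: "i \<le> d" and x: "x \<in> T" "mu i x = 0"
  shows "x \<in> frontier T"
proof -
  have "x \<notin> interior T"
  proof
    assume "x \<in> interior T"
    then obtain e where e: "e > 0" "cball x e \<subseteq> T" by (auto simp: mem_interior_cball)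
    \<comment> \<open>A step of length \<open>e\<close> against the gradient stays in the ball and
      makes \<open>mu i\<close> negative.\<close>
    define y where "y = x + (- e / norm (gm i)) *\<^sub>R gm i"
    have "dist x y = e" using gm_nonzero[OF i] e(1) by (simp add: y_def dist_norm)
    then have "mu i y \<ge> 0" using e(2) i by (auto simp: subset_iff mem_T)
    moreover have "mu i y = (- e / norm (gm i)) * (gm i \<bullet> gm i)"
      unfolding y_def mu_add using x(2) by simp
    moreover have "\<dots> < 0" using gm_nonzero[OF i] e(1) by (intro mult_neg_pos) auto
    ultimately show False by simp
  qed
  then show ?thesis using x(1) closure_subset by (auto simp: frontier_def)
qed

lemma cl_center_frontier: "i \<le> d \<Longrightarrow> x \<in> cell v i \<Longrightarrow> cl i (Suc d) x = 0 \<Longrightarrow> x \<in> frontier T"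
  using mu_zero_frontier cell_subset_T by (auto simp: cl_def)

text \<open>The same tensor on all cells multiplies the continuous function
  \<open>hmono f \<alpha>\<close>, so no jump occurs across interior faces; the boundary terms
  vanish with the test function.\<close>

lemma flux_constant_zero:
  assumes \<phi>: "C_infty \<phi>" "\<And>x. x \<in> frontier T \<Longrightarrow> \<phi> x = 0"
    and f: "f \<subseteq> {..Suc d}" and \<alpha>: "\<alpha> \<in> expo k f" and A: "A \<in> sym_space UNIV UNIV"
  shows "(\<Sum>i\<in>{..d} - f. flux i \<alpha> A \<phi>) = 0"
proof -
  have one: "(\<Sum>i\<in>{..d} - f. \<integral>x. indicat_real (cell v i) x * dd (\<lambda>x. mono i \<alpha> x * (\<phi> x \<bullet> a)) b x \<partial>lebesgue) = 0" for a b
  proof -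
    define p where "p = (\<lambda>i x. if i \<in> f then 0 else mono i \<alpha> x * (\<phi> x \<bullet> a))"
    obtain L where L: "L-lipschitz_on T (\<lambda>x. hmono f \<alpha> x * (\<phi> x \<bullet> a))"
      using hmono_lipschitz[OF \<phi>(1) f] by blast
    have "(\<Sum>i\<le>d. \<integral>x. indicat_real (cell v i) x * dd (p i) b x \<partial>lebesgue) = 0"
    proof (rule T_integral[OF _ L])
      show "C_infty (p i)" for i
        unfolding p_def using \<phi> by (cases "i \<in> f") (auto intro!: C_infty_mult C_infty_mono C_infty_inner)
    qed (use \<phi>(2) hmono_cell[OF _ _ f \<alpha>] in \<open>auto simp: p_def\<close>)
    moreover have "(\<Sum>i\<le>d. \<integral>x. indicat_real (cell v i) x * dd (p i) b x \<partial>lebesgue) =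
       (\<Sum>i\<in>{..d} - f. \<integral>x. indicat_real (cell v i) x * dd (p i) b x \<partial>lebesgue)"
      by (intro sum.mono_neutral_right) (auto simp: p_def)
    moreover have "p i = (\<lambda>x. mono i \<alpha> x * (\<phi> x \<bullet> a))" if "i \<notin> f" for i using that by (simp add: p_def)
    ultimately show ?thesis by simp
  qed
  let ?S = "{A. (\<Sum>i\<in>{..d} - f. flux i \<alpha> A \<phi>) = 0}"
  have lin: "linear (\<lambda>A. \<Sum>i\<in>{..d} - f. flux i \<alpha> A \<phi>)"
    using linear_flux[OF \<phi>(1)] by (intro linear_compose_sum) auto
  have "sym_space UNIV UNIV \<subseteq> ?S"
    unfolding sym_space_def
  proof (rule span_minimal)
    show "subspace ?S" by (rule linear_subspace_kernel[OF lin])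
    show "{sym_tensor a b |a b. a \<in> UNIV \<and> b \<in> UNIV} \<subseteq> ?S"
      using one by (auto simp: flux_sym_tensor[OF \<phi>(1)] sum_divide_distrib[symmetric] sum.distrib)
  qed
  then show ?thesis using A by blast
qed

text \<open>Serves the enrichment, with \<open>a\<close> the edge to the center, and the
  tangential-normal functions, with \<open>a\<close> tangent to \<open>f\<close>. Derivatives along
  \<open>a\<close> drop out on either cell: the monomial vanishes opposite the vertices of
  \<open>f\<close>, and the facet opposite the center lies on the boundary of the simplex, where
  \<open>\<phi>\<close> vanishes. The other half of each flux is compared by
  \<open>interior_flux\<close>.\<close>

lemma flux_pair:
  assumes \<phi>: "C_infty \<phi>" "\<And>x. x \<in> frontier T \<Longrightarrow> \<phi> x = 0"
    and f: "f \<subseteq> {..Suc d}" and \<alpha>: "\<alpha> \<in> expo k f" and s: "s \<in> f"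
    and i: "i \<le> d" "i \<notin> f" and j: "j \<le> d" "j \<notin> f" and ij: "i \<noteq> j"
    and a: "a \<in> span {edge_vec v s r |r. r \<in> insert (Suc d) f}"
  shows "flux i \<alpha> (sym_tensor a (edge_vec v s j)) \<phi> = flux j \<alpha> (sym_tensor a (edge_vec v s i)) \<phi>"
proof -
  have \<alpha>0: "\<alpha> r \<noteq> 0 \<longleftrightarrow> r \<in> f" for r using \<alpha> by (simp add: expo_def)
  have fJ: "f \<subseteq> J i" "f \<subseteq> J j" "Suc d \<in> J i" "Suc d \<in> J j" using f i j by (auto simp: cell_idx_def)
  have gen: "flux i \<alpha> (sym_tensor a (edge_vec v s j)) \<phi> = flux j \<alpha> (sym_tensor a (edge_vec v s i)) \<phi>"
    if ar: "a = edge_vec v s r" and r: "r \<in> insert (Suc d) f" for a r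
  proof -
    have zero: "(\<integral>x. indicat_real (cell v m) x * dd (\<lambda>x. mono m \<alpha> x * (\<phi> x \<bullet> b)) a x \<partial>lebesgue) = 0"
      if m: "m \<in> {i, j}" for m b
      unfolding ar
    proof (rule flux_edge_zero[OF \<phi>(1)])
      show "\<alpha> r \<noteq> 0 \<or> (\<forall>x\<in>cell v m. cl m r x = 0 \<longrightarrow> \<phi> x = 0)"
        using r \<alpha>0 \<phi>(2) cl_center_frontier m i j by auto
    qed (use m i j fJ s r \<alpha>0 in auto)
    define p where "p = (\<lambda>m x. if m \<in> f then 0 else mono m \<alpha> x * (\<phi> x \<bullet> a))"
    have "(\<integral>x. indicat_real (cell v i) x * dd (p i) (edge_vec v s j) x \<partial>lebesgue) =
        (\<integral>x. indicat_real (cell v j) x * dd (p j) (edge_vec v s i) x \<partial>lebesgue)"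
    proof (rule interior_flux[OF i(1) j(1) ij _ _ _ hmono_lipschitz[OF \<phi>(1) f, of \<alpha> a]])
      show "C_infty (p m)" for m
        unfolding p_def using \<phi> by (cases "m \<in> f") (auto intro!: C_infty_mult C_infty_mono C_infty_inner)
      show "hmono f \<alpha> x * (\<phi> x \<bullet> a) = 0" if m: "m \<le> d" "x \<in> cell v m" "cl m s x = 0" for m x
      proof (cases "m \<in> f")
        case False
        then have "s \<in> J m" using f s by (auto simp: cell_idx_def)
        then show ?thesis using m False hmono_cell[OF m(1,2) f \<alpha>] mono_zero[of s m \<alpha> x] s \<alpha>0 by simp
      qed (use hmono_cell[OF m(1,2) f \<alpha>] in simp)
    qed (use \<phi>(2) hmono_cell[OF _ _ f \<alpha>] fJ s in \<open>auto simp: p_def\<close>)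
    moreover have "p m = (\<lambda>x. mono m \<alpha> x * (\<phi> x \<bullet> a))" if "m \<in> {i, j}" for m
      using that i j by (auto simp: p_def)
    ultimately show ?thesis by (simp add: flux_sym_tensor[OF \<phi>(1)] zero)
  qed
  let ?D = "\<lambda>a. flux i \<alpha> (sym_tensor a (edge_vec v s j)) \<phi> - flux j \<alpha> (sym_tensor a (edge_vec v s i)) \<phi>"
  have "linear ?D"
    using linear_compose[OF linear_sym_tensor_left linear_flux[OF \<phi>(1)], unfolded o_def]
    by (intro linear_compose_sub)
  then have "subspace {a. ?D a = 0}" by (rule linear_subspace_kernel)
  then have "span {edge_vec v s r |r. r \<in> insert (Suc d) f} \<subseteq> {a. ?D a = 0}"
    by (rule span_minimal[rotated]) (use gen in auto)
  then show ?thesis using a by auto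
qed

section \<open>The cellwise divergence and Green's formula\<close>

definition divf :: "nat \<Rightarrow> (nat \<Rightarrow> (nat \<Rightarrow> nat) \<Rightarrow> real^'n^'n) \<Rightarrow> real^'n \<Rightarrow> real^'n" where
  "divf k C x = (\<Sum>i\<le>d. \<Sum>\<alpha>\<in>Exp k i. indicat_real (cell v i) x *\<^sub>R (C i \<alpha> *v grad (mono i \<alpha>) x))"

lemma L2_on_piecewise:
  fixes g :: "nat \<Rightarrow> (nat \<Rightarrow> nat) \<Rightarrow> real^'n \<Rightarrow> 'b::euclidean_space"
  assumes D: "compact D" and g: "\<And>i \<alpha>. continuous_on UNIV (g i \<alpha>)"
  shows "L2_on D (\<lambda>x. \<Sum>i\<le>d. \<Sum>\<alpha>\<in>Exp k i. indicat_real (cell v i) x *\<^sub>R g i \<alpha> x)" (is "L2_on D ?F")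
proof -
  have m: "?F \<in> borel_measurable lebesgue"
    using integrable_cell[OF continuous_on_subset[OF g]] by (intro borel_measurable_sum) (auto intro: borel_measurable_integrable)
  have "\<exists>B. \<forall>x. norm (indicat_real (cell v i) x *\<^sub>R g i \<alpha> x) \<le> B" for i \<alpha>
  proof -
    obtain B where "\<And>x. x \<in> cell v i \<Longrightarrow> norm (g i \<alpha> x) \<le> B"
      using compact_imp_bounded[OF compact_continuous_image[OF continuous_on_subset[OF g] compact_cell], of i i \<alpha>]
      by (auto simp: bounded_iff)
    then show ?thesis by (intro exI[of _ "\<bar>B\<bar>"]) (force simp: indicator_def)
  qed
  then obtain B where B: "\<And>i \<alpha> x. norm (indicat_real (cell v i) x *\<^sub>R g i \<alpha> x) \<le> B i \<alpha>" by metis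
  let ?B = "\<Sum>i\<le>d. \<Sum>\<alpha>\<in>Exp k i. B i \<alpha>"
  have bound: "norm (?F x) \<le> ?B" for x by (intro sum_norm_le B)
  have mD: "?F \<in> borel_measurable (lebesgue_on D)" using m by (rule measurable_restrict_space1)
  have "finite_measure (lebesgue_on D)"
    using D by (intro finite_measure_lebesgue_on lmeasurable_compact)
  then have "integrable (lebesgue_on D) (\<lambda>x. (norm (?F x))\<^sup>2)"
    using mD bound by (intro finite_measure.integrable_const_bound[where B = "?B\<^sup>2"])
      (auto intro!: AE_I2 power_mono borel_measurable_power borel_measurable_norm)
  then show ?thesis using mD by (simp add: L2_on_def)
qed

lemma L2_on_fld: "compact D \<Longrightarrow> L2_on D (fld k C)"
  using L2_on_piecewise[of D "\<lambda>i \<alpha> x. mono i \<alpha> x *\<^sub>R C i \<alpha>" k]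
  by (simp add: fld_def[abs_def] continuous_intros C_infty_continuous_on C_infty_mono)

lemma L2_on_divf: "compact D \<Longrightarrow> L2_on D (divf k C)"
  unfolding divf_def[abs_def]
  by (rule L2_on_piecewise) (assumption, intro continuous_on_matrix_vector_mult continuous_on_grad C_infty_mono)

lemma fld_supported:
  assumes "\<And>i \<alpha>. i \<le> d \<Longrightarrow> \<alpha> \<in> Exp k i \<Longrightarrow> C i \<alpha> \<noteq> 0 \<Longrightarrow> cell v i \<subseteq> D" and "x \<notin> D"
  shows "fld k C x = 0" "divf k C x = 0"
proof -
  have z: "C i \<alpha> = 0 \<or> x \<notin> cell v i" if "i \<le> d" "\<alpha> \<in> Exp k i" for i \<alpha> using assms that by blast
  show "fld k C x = 0" unfolding fld_def by (intro sum.neutral ballI) (use z in force)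
  show "divf k C x = 0" unfolding divf_def by (intro sum.neutral ballI) (use z in force)
qed

text \<open>The defect of Green's formula is the total flux through the cell boundaries. The set
  \<open>D\<close> is the whole simplex for H(div) and a single cell for the element
  bubbles.\<close>

lemma green_fld:
  assumes \<phi>: "C_infty \<phi>" and D: "compact D"
    and supp: "\<And>i \<alpha>. i \<le> d \<Longrightarrow> \<alpha> \<in> Exp k i \<Longrightarrow> C i \<alpha> \<noteq> 0 \<Longrightarrow> cell v i \<subseteq> D"
  shows "(\<integral>x. fld k C x \<bullet> jacobian \<phi> (at x) \<partial>lebesgue_on D) + (\<integral>x. divf k C x \<bullet> \<phi> x \<partial>lebesgue_on D) =
    (\<Sum>i\<le>d. \<Sum>\<alpha>\<in>Exp k i. flux i \<alpha> (C i \<alpha>) \<phi>)"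
proof -
  have DL: "D \<inter> space lebesgue \<in> sets lebesgue" using D by (simp add: lmeasurable_compact fmeasurableD)
  have i1: "integrable lebesgue (\<lambda>x. indicat_real (cell v i) x * (mono i \<alpha> x * (C i \<alpha> \<bullet> jacobian \<phi> (at x))))" for i \<alpha>
    by (intro integrable_cell_real continuous_on_mult continuous_on_inner continuous_on_const
      continuous_on_jacobian C_infty_continuous_on[OF C_infty_mono] \<phi>)
  have i2: "integrable lebesgue (\<lambda>x. indicat_real (cell v i) x * ((C i \<alpha> *v grad (mono i \<alpha>) x) \<bullet> \<phi> x))" for i \<alpha>
    by (intro integrable_cell_real continuous_on_inner continuous_on_grad
      continuous_on_matrix_vector_mult C_infty_continuous_on[OF \<phi>] C_infty_mono)
  have "(\<integral>x. fld k C x \<bullet> jacobian \<phi> (at x) \<partial>lebesgue_on D) = (\<integral>x. indicator D x *\<^sub>R (fld k C x \<bullet> jacobian \<phi> (at x)) \<partial>lebesgue)"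
    by (rule integral_restrict_space[OF DL])
  also have "\<dots> = (\<integral>x. (\<Sum>i\<le>d. \<Sum>\<alpha>\<in>Exp k i. indicat_real (cell v i) x * (mono i \<alpha> x * (C i \<alpha> \<bullet> jacobian \<phi> (at x)))) \<partial>lebesgue)"
  proof (intro Bochner_Integration.integral_cong refl)
    fix x
    have "indicator D x *\<^sub>R (fld k C x \<bullet> jacobian \<phi> (at x)) = fld k C x \<bullet> jacobian \<phi> (at x)"
      using fld_supported(1)[of k C D x, OF supp] by (cases "x \<in> D") auto
    then show "indicator D x *\<^sub>R (fld k C x \<bullet> jacobian \<phi> (at x)) =
      (\<Sum>i\<le>d. \<Sum>\<alpha>\<in>Exp k i. indicat_real (cell v i) x * (mono i \<alpha> x * (C i \<alpha> \<bullet> jacobian \<phi> (at x))))"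
      by (simp add: fld_def inner_sum_left mult.assoc)
  qed
  also have "\<dots> = (\<Sum>i\<le>d. \<Sum>\<alpha>\<in>Exp k i. \<integral>x. indicat_real (cell v i) x * (mono i \<alpha> x * (C i \<alpha> \<bullet> jacobian \<phi> (at x))) \<partial>lebesgue)"
    by (subst Bochner_Integration.integral_sum) (intro Bochner_Integration.integrable_sum i1,
      intro sum.cong refl Bochner_Integration.integral_sum i1)
  finally have A: "(\<integral>x. fld k C x \<bullet> jacobian \<phi> (at x) \<partial>lebesgue_on D) = \<dots>" .
  have "(\<integral>x. divf k C x \<bullet> \<phi> x \<partial>lebesgue_on D) = (\<integral>x. indicator D x *\<^sub>R (divf k C x \<bullet> \<phi> x) \<partial>lebesgue)"
    by (rule integral_restrict_space[OF DL])
  also have "\<dots> = (\<integral>x. (\<Sum>i\<le>d. \<Sum>\<alpha>\<in>Exp k i. indicat_real (cell v i) x * ((C i \<alpha> *v grad (mono i \<alpha>) x) \<bullet> \<phi> x)) \<partial>lebesgue)"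
  proof (intro Bochner_Integration.integral_cong refl)
    fix x
    have "indicator D x *\<^sub>R (divf k C x \<bullet> \<phi> x) = divf k C x \<bullet> \<phi> x"
      using fld_supported(2)[of k C D x, OF supp] by (cases "x \<in> D") auto
    then show "indicator D x *\<^sub>R (divf k C x \<bullet> \<phi> x) =
      (\<Sum>i\<le>d. \<Sum>\<alpha>\<in>Exp k i. indicat_real (cell v i) x * ((C i \<alpha> *v grad (mono i \<alpha>) x) \<bullet> \<phi> x))"
      by (simp add: divf_def inner_sum_left)
  qed
  also have "\<dots> = (\<Sum>i\<le>d. \<Sum>\<alpha>\<in>Exp k i. \<integral>x. indicat_real (cell v i) x * ((C i \<alpha> *v grad (mono i \<alpha>) x) \<bullet> \<phi> x) \<partial>lebesgue)"
    by (subst Bochner_Integration.integral_sum) (intro Bochner_Integration.integrable_sum i2,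
      intro sum.cong refl Bochner_Integration.integral_sum i2)
  finally have B: "(\<integral>x. divf k C x \<bullet> \<phi> x \<partial>lebesgue_on D) = \<dots>" .
  show ?thesis
    unfolding A B sum.distrib[symmetric] flux_def distrib_left
    using i1 i2 by (intro sum.cong refl) (simp add: Bochner_Integration.integral_add)
qed

text \<open>Cancellation of the total flux against the tests in \<open>\<Phi>\<close>. With tests
  that vanish on the boundary of the simplex it gives a weak divergence; with all smooth tests, for
  coefficients on a single cell, it gives zero normal trace as well.\<close>

definition weakly_div_free_flux :: "(real^'n \<Rightarrow> real^'n) set \<Rightarrow> nat \<Rightarrow> (nat \<Rightarrow> (nat \<Rightarrow> nat) \<Rightarrow> real^'n^'n) \<Rightarrow> bool" where
  "weakly_div_free_flux \<Phi> k C \<longleftrightarrow> (\<forall>\<phi>\<in>\<Phi>. (\<Sum>i\<le>d. \<Sum>\<alpha>\<in>Exp k i. flux i \<alpha> (C i \<alpha>) \<phi>) = 0)"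

text \<open>A class that contains the compactly supported tests of the weak divergence: vanishing on
  the boundary is the property on which the flux lemmas rely.\<close>

abbreviation interior_tests :: "(real^'n \<Rightarrow> real^'n) set" where
  "interior_tests \<equiv> {\<phi>. C_infty \<phi> \<and> (\<forall>x\<in>frontier T. \<phi> x = 0)}"

lemma fld_L2_sym:
  assumes "compact D" "\<And>i \<alpha>. i \<le> d \<Longrightarrow> \<alpha> \<in> Exp k i \<Longrightarrow> C i \<alpha> \<noteq> 0 \<Longrightarrow> cell v i \<subseteq> D"
    and "\<And>i \<alpha>. i \<le> d \<Longrightarrow> \<alpha> \<in> Exp k i \<Longrightarrow> transpose (C i \<alpha>) = C i \<alpha>"
  shows "fld k C \<in> L2_sym D"
proof -
  have "C i \<alpha> $ a $ b = C i \<alpha> $ b $ a" if "i \<le> d" "\<alpha> \<in> Exp k i" for i \<alpha> a b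
    using arg_cong[OF assms(3)[OF that], of "\<lambda>M. M $ b $ a"] by (simp add: transpose_def)
  then have "transpose (fld k C x) = fld k C x" for x
    by (auto simp: vec_eq_iff transpose_def fld_def intro!: sum.cong)
  then show ?thesis
    using L2_on_fld[OF assms(1)] fld_supported(1)[of k C D, OF assms(2)] by (auto simp: L2_sym_def)
qed

lemma Psi_in_Hdiv:
  assumes sym: "\<And>i \<alpha>. i \<le> d \<Longrightarrow> \<alpha> \<in> Exp k i \<Longrightarrow> transpose (C i \<alpha>) = C i \<alpha>"
    and w: "weakly_div_free_flux interior_tests k C"
  shows "Psi k C \<in> Hdiv T"
proof -
  have "is_weak_div T (fld k C) (divf k C)"
    unfolding is_weak_div_def
  proof (intro allI impI)
    fix \<phi> :: "real^'n \<Rightarrow> real^'n"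
    assume \<phi>: "C_infty \<phi> \<and> compact (closure {x. \<phi> x \<noteq> 0}) \<and> closure {x. \<phi> x \<noteq> 0} \<subseteq> interior T"
    have "\<phi> x = 0" if "x \<in> frontier T" for x
    proof (rule ccontr)
      assume "\<phi> x \<noteq> 0"
      then have "x \<in> closure {x. \<phi> x \<noteq> 0}" by (intro subsetD[OF closure_subset] CollectI)
      then show False using \<phi> that by (auto simp: frontier_def)
    qed
    then have "\<phi> \<in> interior_tests" using \<phi> by simp
    with w have "(\<Sum>i\<le>d. \<Sum>\<alpha>\<in>Exp k i. flux i \<alpha> (C i \<alpha>) \<phi>) = 0"
      unfolding weakly_div_free_flux_def by (rule bspec)
    moreover have "(\<integral>x. fld k C x \<bullet> jacobian \<phi> (at x) \<partial>lebesgue_on T) + (\<integral>x. divf k C x \<bullet> \<phi> x \<partial>lebesgue_on T) =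
      (\<Sum>i\<le>d. \<Sum>\<alpha>\<in>Exp k i. flux i \<alpha> (C i \<alpha>) \<phi>)"
      using \<phi> cell_subset_T by (intro green_fld compact_T) auto
    ultimately show "(\<integral>x. divf k C x \<bullet> \<phi> x \<partial>lebesgue_on T) = - (\<integral>x. fld k C x \<bullet> jacobian \<phi> (at x) \<partial>lebesgue_on T)"
      by linarith
  qed
  moreover have "fld k C \<in> L2_sym T" using sym cell_subset_T by (intro fld_L2_sym compact_T) auto
  ultimately show ?thesis
    unfolding Hdiv_def Psi_def using L2_on_divf[OF compact_T] by blast
qed

lemma Psi_in_Hdiv0:
  assumes i: "i \<le> d" and supp: "\<And>m \<alpha>. m \<noteq> i \<Longrightarrow> C m \<alpha> = 0"
    and sym: "\<And>\<alpha>. \<alpha> \<in> Exp k i \<Longrightarrow> transpose (C i \<alpha>) = C i \<alpha>"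
    and w: "weakly_div_free_flux {\<phi>. C_infty \<phi>} k C"
  shows "Psi k C \<in> Hdiv0 (cell v i)"
proof -
  have supp': "cell v m \<subseteq> cell v i" if "C m \<alpha> \<noteq> 0" for m \<alpha> using supp that by (metis order_refl)
  have sym': "transpose (C m \<alpha>) = C m \<alpha>" if "\<alpha> \<in> Exp k m" for m \<alpha>
    using sym supp that by (cases "m = i") (auto simp: transpose_def vec_eq_iff)
  have green: "(\<integral>x. fld k C x \<bullet> jacobian \<phi> (at x) \<partial>lebesgue_on (cell v i)) + (\<integral>x. divf k C x \<bullet> \<phi> x \<partial>lebesgue_on (cell v i)) = 0"
    if "C_infty \<phi>" for \<phi>
    using green_fld[OF that compact_cell, of k C i] supp' w that by (auto simp: weakly_div_free_flux_def)
  have "is_weak_div (cell v i) (fld k C) (divf k C)"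
    unfolding is_weak_div_def using green by (smt (verit))
  moreover have "normal_trace_zero (cell v i) (fld k C) (divf k C)"
    unfolding normal_trace_zero_def using green by blast
  moreover have "fld k C \<in> L2_sym (cell v i)" using sym' supp' by (intro fld_L2_sym compact_cell) auto
  ultimately show ?thesis
    unfolding Hdiv0_def Psi_def using L2_on_divf[OF compact_cell] by blast
qed

end

section \<open>Element bubbles\<close>

lemma matrix_add_scaleR:
  "matrix (\<lambda>e. a *\<^sub>R f e + g e) = a *\<^sub>R matrix f + matrix g" for f g :: "real^'n \<Rightarrow> real^'n"
  by (simp add: vec_eq_iff matrix_def)

context simplex
begin

text \<open>The expansion dual to \<open>sum_cg_edge\<close>: for a vertex \<open>s\<close> of the
  cell, the gradients \<open>cg i j\<close> with \<open>j \<noteq> s\<close> are the dual basis of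
  the edges at \<open>s\<close>.\<close>

lemma sum_edge_cg:
  assumes i: "i \<le> d" shows "(\<Sum>j\<in>J i. (x \<bullet> edge_vec v s j) *\<^sub>R cg i j) = x"
proof (rule vector_eq_ldot[THEN iffD1, rule_format])
  fix e
  have "x \<bullet> e = x \<bullet> (\<Sum>j\<in>J i. (cg i j \<bullet> e) *\<^sub>R edge_vec v s j)" using i by (simp add: sum_cg_edge)
  then show "e \<bullet> (\<Sum>j\<in>J i. (x \<bullet> edge_vec v s j) *\<^sub>R cg i j) = e \<bullet> x"
    by (simp add: inner_sum_right inner_commute mult.commute)
qed

lemma edge_in_tangent: "p \<in> f \<Longrightarrow> q \<in> f \<Longrightarrow> edge_vec v p q \<in> tangent v f"
  unfolding tangent_def by (rule span_base) blast

text \<open>In the expansion of \<open>A\<close> into products of edges from \<open>s\<close>, the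
  coefficient at \<open>p\<close>, \<open>q\<close> is
  \<open>cg i p \<bullet> (A *v cg i q)\<close>; by \<open>ker\<close> and symmetry it vanishes
  unless both vertices lie in \<open>f\<close>.\<close>

lemma kernel_imp_tangent_tensor:
  assumes i: "i \<le> d" and f: "f \<subseteq> J i" "f \<noteq> {}" and sym: "transpose A = A"
    and ker: "\<And>m. m \<in> J i - f \<Longrightarrow> A *v cg i m = 0"
  shows "A \<in> sym_space (tangent v f) (tangent v f)"
proof -
  obtain s where s: "s \<in> f" using f by blast
  define a where "a = (\<lambda>p q. cg i p \<bullet> (A *v cg i q))"
  have a_sym: "a p q = a q p" for p q unfolding a_def by (rule inner_symmetric_matrix[OF sym])
  have a0: "a p q = 0" if "p \<in> J i" "q \<in> J i" "p \<notin> f \<or> q \<notin> f" for p q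
    using ker[of q] ker[of p] a_sym[of p q] that by (auto simp: a_def)
  let ?B = "\<Sum>p\<in>J i. \<Sum>q\<in>J i. a p q *\<^sub>R sym_tensor (edge_vec v s p) (edge_vec v s q)"
  have "A = ?B"
  proof (rule matrix_eq_bilinear)
    fix x y
    let ?x = "\<lambda>p. x \<bullet> edge_vec v s p" and ?y = "\<lambda>p. y \<bullet> edge_vec v s p"
    have "x \<bullet> (A *v y) = (\<Sum>p\<in>J i. ?x p *\<^sub>R cg i p) \<bullet> (A *v (\<Sum>q\<in>J i. ?y q *\<^sub>R cg i q))"
      using i by (simp add: sum_edge_cg)
    also have "\<dots> = (\<Sum>p\<in>J i. \<Sum>q\<in>J i. ?x p * ?y q * a p q)"
      by (simp add: linear_sum[OF matrix_vector_mul_linear] linear_scale[OF matrix_vector_mul_linear]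
          inner_sum_left inner_sum_right a_def sum_distrib_left) (subst sum.swap, simp add: mult_ac)
    finally have L: "x \<bullet> (A *v y) = \<dots>" .
    have sw: "(\<Sum>p\<in>J i. \<Sum>q\<in>J i. ?x q * ?y p * a p q) = (\<Sum>p\<in>J i. \<Sum>q\<in>J i. ?x p * ?y q * a p q)"
      by (subst sum.swap) (simp add: a_sym)
    interpret M: linear "\<lambda>M. x \<bullet> (M *v y)"
      by (rule linearI) (simp_all add: matrix_vector_mult_add_rdistrib inner_add_right scaleR_matrix_vector_assoc[symmetric])
    have "x \<bullet> (?B *v y) = (\<Sum>p\<in>J i. \<Sum>q\<in>J i. a p q * (x \<bullet> (sym_tensor (edge_vec v s p) (edge_vec v s q) *v y)))"
      by (simp add: M.sum M.scale)
    also have "\<dots> = (\<Sum>p\<in>J i. \<Sum>q\<in>J i. (?x p * ?y q * a p q + ?x q * ?y p * a p q) / 2)"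
      unfolding inner_sym_tensor_mult_vec by (intro sum.cong refl) (simp add: inner_commute field_simps)
    also have "\<dots> = (\<Sum>p\<in>J i. \<Sum>q\<in>J i. ?x p * ?y q * a p q)"
      by (simp only: sum_divide_distrib[symmetric] sum.distrib sw) simp
    finally show "x \<bullet> (A *v y) = x \<bullet> (?B *v y)" using L by simp
  qed
  moreover have "?B \<in> sym_space (tangent v f) (tangent v f)"
  proof (intro subspace_sum subspace_sym_space)
    fix p q assume pq: "p \<in> J i" "q \<in> J i"
    show "a p q *\<^sub>R sym_tensor (edge_vec v s p) (edge_vec v s q) \<in> sym_space (tangent v f) (tangent v f)"
    proof (cases "p \<in> f \<and> q \<in> f")
      case True
      then show ?thesis using s
        by (intro subspace_scale subspace_sym_space sym_tensor_in_sym_space edge_in_tangent) auto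
    qed (use a0[OF pq] in \<open>simp add: subspace_0 subspace_sym_space\<close>)
  qed
  ultimately show ?thesis by simp
qed

section \<open>Zero normal trace forces kernel conditions on the coefficients\<close>

lemma integrable_on_cell:
  fixes f :: "real^'n \<Rightarrow> real"
  assumes "continuous_on (cell v i) f"
  shows "integrable (lebesgue_on (cell v i)) f"
  using integrable_cell[OF assms] compact_cell
  by (subst integrable_restrict_space) (auto simp: lmeasurable_compact fmeasurableD)

lemma AE_on_ocell: "i \<le> d \<Longrightarrow> AE x in lebesgue_on (cell v i). x \<in> ocell i"
proof -
  assume i: "i \<le> d"
  have "AE x in lebesgue. x \<notin> cell v i - ocell i"
    using negligible_cell_ocell[OF i] unfolding negligible_iff_null_sets by (rule AE_not_in)
  then show ?thesis
    using compact_cell by (subst AE_restrict_space_iff) (auto simp: lmeasurable_compact fmeasurableD elim: eventually_mono)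
qed

text \<open>With \<open>\<lambda>\<^sub>m\<close>, \<open>\<lambda>\<^sub>s\<close> barycentric coordinates of the cell and \<open>u\<close> the trace of \<open>\<tau> \<nabla>\<lambda>\<^sub>m\<close> on \<open>\<lambda>\<^sub>m = 0\<close>,
  extended constantly along the edge from \<open>s\<close> to \<open>m\<close>, the test functions \<open>exp (- n \<lambda>\<^sub>m) \<lambda>\<^sub>s u\<close>
  concentrate on the face as \<open>n\<close> grows, and the limit of Green's formula is \<open>\<integral> \<bar>u\<bar>\<^sup>2 = 0\<close>.\<close>

lemma boundary_layer:
  fixes \<tau> :: "real^'n \<Rightarrow> real^'n^'n" and u :: "real^'n \<Rightarrow> real^'n"
  assumes i: "i \<le> d" and m: "m \<in> J i" and s: "s \<in> J i" "s \<noteq> m"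
    and w: "L2_on (cell v i) w"
    and green: "\<And>\<phi>. C_infty \<phi> \<Longrightarrow>
      (\<integral>x. \<tau> x \<bullet> jacobian \<phi> (at x) \<partial>lebesgue_on (cell v i)) + (\<integral>x. w x \<bullet> \<phi> x \<partial>lebesgue_on (cell v i)) = 0"
    and \<tau>: "continuous_on (cell v i) \<tau>"
    and u: "C_infty u" and u_const: "\<And>x h. u (x + h *\<^sub>R edge_vec v s m) = u x"
    and B: "\<And>x. x \<in> cell v i \<Longrightarrow> \<bar>u x \<bullet> (\<tau> x *v cg i m) - u x \<bullet> u x\<bar> \<le> B * cl i m x"
    and x: "x \<in> ocell i"
  shows "u x = 0"
proof -
  let ?M = "lebesgue_on (cell v i)" and ?t = "edge_vec v s m"
  let ?e = "\<lambda>n x. exp (- real n * cl i m x)"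
  define N where "N = (\<lambda>x. u x \<bullet> u x)"
  define \<psi> where "\<psi> = (\<lambda>x. cl i s x *\<^sub>R u x)"
  \<comment> \<open>The error made by replacing the normal component
    \<open>\<tau> x *v cg i m\<close> with \<open>u\<close>; by \<open>B\<close> it vanishes
    linearly at the facet.\<close>
  define r where "r = (\<lambda>x. u x \<bullet> (\<tau> x *v cg i m) - u x \<bullet> u x)"
  define G where "G = (\<lambda>x. \<tau> x \<bullet> jacobian \<psi> (at x))"
  have eC: "C_infty (?e n)" for n by (intro C_infty_exp C_infty_mult C_infty_const C_infty_cl)
  have \<psi>C: "C_infty \<psi>" unfolding \<psi>_def by (intro C_infty_scaleR C_infty_cl u)
  have NC: "C_infty N" unfolding N_def by (intro C_infty_inner u)
  have cont_e: "continuous_on S (?e n)" for S n by (rule C_infty_continuous_on[OF eC])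
  have cont_N: "continuous_on S N" for S by (rule C_infty_continuous_on[OF NC])
  have cont_u: "continuous_on S u" for S by (rule C_infty_continuous_on[OF u])
  have cont_Ag: "continuous_on (cell v i) (\<lambda>x. \<tau> x *v cg i m)"
    unfolding matrix_vector_mult_def using \<tau>
    by (intro continuous_on_vec_lambda continuous_on_sum continuous_on_mult continuous_on_component continuous_on_const)
  have cont_r: "continuous_on (cell v i) r" unfolding r_def by (intro continuous_on_diff continuous_on_inner cont_u cont_Ag)
  have cont_G: "continuous_on (cell v i) G"
    unfolding G_def by (intro continuous_on_inner \<tau> continuous_on_jacobian \<psi>C)
  have dd_e: "dd (?e n) a y = - real n * (cg i m \<bullet> a) * ?e n y" for n a y
  proof -
    have C: "C_infty (\<lambda>x. - real n * cl i m x)" by (intro C_infty_mult C_infty_const C_infty_cl)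
    show ?thesis by (simp only: dd_exp[OF C] dd_mult[OF C_infty_const C_infty_cl] dd_const dd_cl) simp
  qed
  have cgm: "cg i m \<bullet> ?t = 1" "cg i s \<bullet> ?t = -1"
    using cg_edge[OF i m s(1) m] cg_edge[OF i s(1) s(1) m] s(2) by auto
  \<comment> \<open>Differentiating the exponential produces the factor \<open>real n\<close>, which
    makes the layer concentrate; the part with \<open>G\<close> stays bounded.\<close>
  have jac: "\<tau> y \<bullet> jacobian (\<lambda>x. ?e n x *\<^sub>R \<psi> x) (at y) = ?e n y * G y - real n * ?e n y * cl i s y * (N y + r y)" for n y
  proof -
    have "frechet_derivative (\<lambda>x. ?e n x *\<^sub>R \<psi> x) (at y) =
      (\<lambda>a. ?e n y *\<^sub>R dd \<psi> a y + (cg i m \<bullet> a) *\<^sub>R ((- real n * ?e n y * cl i s y) *\<^sub>R u y))"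
      by (rule ext) (simp only: dd_scaleR[OF eC \<psi>C] dd_e, simp add: \<psi>_def mult_ac)
    then have "jacobian (\<lambda>x. ?e n x *\<^sub>R \<psi> x) (at y) = ?e n y *\<^sub>R jacobian \<psi> (at y) +
        matrix (\<lambda>a. (cg i m \<bullet> a) *\<^sub>R ((- real n * ?e n y * cl i s y) *\<^sub>R u y))"
      unfolding jacobian_def by (simp only: matrix_add_scaleR)
    then show ?thesis
      by (simp only: inner_add_right inner_matrix_rank_one inner_scaleR_right inner_scaleR_left G_def N_def r_def)
        (simp add: algebra_simps)
  qed
  obtain Bp where Bp: "\<And>x. x \<in> cell v i \<Longrightarrow> norm (\<psi> x) \<le> Bp"
    using compact_imp_bounded[OF compact_continuous_image[OF C_infty_continuous_on[OF \<psi>C] compact_cell[of i]]]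
    by (auto simp: bounded_iff)
  have wm: "w \<in> borel_measurable ?M" and w2: "integrable ?M (\<lambda>x. (norm (w x))\<^sup>2)"
    using w by (auto simp: L2_on_def)
  have cellm: "cell v i \<in> sets lebesgue" using compact_cell by (simp add: lmeasurable_compact fmeasurableD)
  have meas: "f \<in> borel_measurable ?M" if "continuous_on (cell v i) f" for f :: "real^'n \<Rightarrow> real"
    using integrable_on_cell[OF that] by (rule borel_measurable_integrable)
  have \<psi>m: "\<psi> \<in> borel_measurable ?M"
    using continuous_imp_measurable_on_sets_lebesgue[OF C_infty_continuous_on[OF \<psi>C] cellm] .
  have w\<psi>: "integrable ?M (\<lambda>x. w x \<bullet> \<psi> x)"
  proof (rule Bochner_Integration.integrable_bound)
    show "integrable ?M (\<lambda>x. \<bar>Bp\<bar> * (1 + (norm (w x))\<^sup>2))"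
      using w2 integrable_on_cell[of i "\<lambda>_. 1"] by (intro integrable_mult_right Bochner_Integration.integrable_add) auto
    show "(\<lambda>x. w x \<bullet> \<psi> x) \<in> borel_measurable ?M" using wm \<psi>m by (rule borel_measurable_inner)
    show "AE x in ?M. norm (w x \<bullet> \<psi> x) \<le> norm (\<bar>Bp\<bar> * (1 + (norm (w x))\<^sup>2))"
    proof (rule AE_I2)
      fix x assume "x \<in> space ?M"
      then have x: "x \<in> cell v i" by (simp add: space_restrict_space)
      have "norm (w x \<bullet> \<psi> x) \<le> norm (w x) * norm (\<psi> x)" by (simp add: Cauchy_Schwarz_ineq2)
      also have "\<dots> \<le> (1 + (norm (w x))\<^sup>2) * \<bar>Bp\<bar>"
      proof (rule mult_mono)
        have "0 \<le> (norm (w x) - 1)\<^sup>2 + (norm (w x))\<^sup>2" by simp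
        then show "norm (w x) \<le> 1 + (norm (w x))\<^sup>2" by (simp add: power2_eq_square algebra_simps)
      qed (use Bp[OF x] in auto)
      finally show "norm (w x \<bullet> \<psi> x) \<le> norm (\<bar>Bp\<bar> * (1 + (norm (w x))\<^sup>2))" by (simp add: mult.commute abs_mult)
    qed
  qed
  have e_le: "?e n x \<le> 1" if "x \<in> cell v i" for n x using that m i by (simp add: mem_cell)
  have ew: "integrable ?M (\<lambda>x. ?e n x * (w x \<bullet> \<psi> x))" for n
  proof (rule Bochner_Integration.integrable_bound[OF w\<psi>])
    show "(\<lambda>x. ?e n x * (w x \<bullet> \<psi> x)) \<in> borel_measurable ?M"
      using meas[OF cont_e] borel_measurable_integrable[OF w\<psi>] by (rule borel_measurable_times)
    show "AE x in ?M. norm (?e n x * (w x \<bullet> \<psi> x)) \<le> norm (w x \<bullet> \<psi> x)"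
      using e_le by (intro AE_I2) (simp add: space_restrict_space abs_mult mult_left_le_one_le)
  qed
  \<comment> \<open>Green's identity after the singular term
    \<open>real n * ?e n x * cl i s x * N x\<close> has been replaced, by \<open>id2\<close>, with
    \<open>N x * (1 - ?e n x)\<close>. In this form the integrand is dominated and its limit is
    \<open>- N x\<close>.\<close>
  let ?H = "\<lambda>n x. ?e n x * G x - real n * ?e n x * cl i s x * r x - N x * (1 - ?e n x) + ?e n x * (w x \<bullet> \<psi> x)"
  have iG: "integrable ?M (\<lambda>x. ?e n x * G x - real n * ?e n x * cl i s x * (N x + r x))" for n
    by (intro integrable_on_cell continuous_on_diff continuous_on_add continuous_on_mult continuous_on_const
      cont_e cont_G continuous_cl cont_r cont_N)
  have iN: "integrable ?M (\<lambda>x. N x * (real n * ?e n x * cl i s x + ?e n x - 1))" for n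
    by (intro integrable_on_cell continuous_on_diff continuous_on_add continuous_on_mult continuous_on_const
      cont_e continuous_cl cont_N)
  have id1: "(\<integral>x. ?e n x * G x - real n * ?e n x * cl i s x * (N x + r x) \<partial>?M) + (\<integral>x. ?e n x * (w x \<bullet> \<psi> x) \<partial>?M) = 0" for n
    using green[OF C_infty_scaleR[OF eC[of n] \<psi>C]] unfolding jac by (simp add: inner_scaleR_right)
  \<comment> \<open>The integrand is, up to sign, the derivative along the edge from
    \<open>s\<close> to \<open>m\<close> of \<open>(?e n x - 1) * cl i s x * N x\<close>, where
    \<open>N\<close> is constant along the edge. This product vanishes on both facets that the edge
    crosses, which is why 1 is subtracted.\<close>
  have id2: "(\<integral>x. N x * (real n * ?e n x * cl i s x + ?e n x - 1) \<partial>?M) = 0" for n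
  proof -
    define E where "E = (\<lambda>x. ?e n x - 1)"
    let ?p = "\<lambda>x. (E x * cl i s x) * N x"
    have EC: "C_infty E" unfolding E_def by (intro C_infty_diff eC C_infty_const)
    have pC: "C_infty ?p" by (intro C_infty_mult EC C_infty_cl NC)
    have ddN: "dd N ?t y = 0" for y
      by (rule dd_constant_direction[OF NC]) (simp add: N_def u_const)
    have ddE: "dd E ?t y = - real n * ?e n y" for y
      using dd_add[OF eC[of n] C_infty_const[of "-1"], where e = ?t and x = y] unfolding dd_e by (simp add: E_def cgm)
    have "dd ?p ?t y = (E y * cl i s y) * dd N ?t y + (E y * (cg i s \<bullet> ?t) + dd E ?t y * cl i s y) * N y" for y
      by (simp only: dd_mult[OF C_infty_mult[OF EC C_infty_cl] NC] dd_mult[OF EC C_infty_cl] dd_cl)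
    then have dp: "dd ?p ?t y = - (N y * (real n * ?e n y * cl i s y + ?e n y - 1))" for y
      by (simp add: ddN ddE cgm) (simp add: E_def algebra_simps)
    have "(\<integral>x. indicat_real (cell v i) x * dd ?p ?t x \<partial>lebesgue) = 0"
      by (rule cell_edge_integral[OF i s(1) m s(2) pC]) (auto simp: E_def)
    then have "(\<integral>x. dd ?p ?t x \<partial>?M) = 0" using cellm by (subst integral_restrict_space) auto
    then show ?thesis unfolding dp by simp
  qed
  have H0: "(\<integral>x. ?H n x \<partial>?M) = 0" for n
  proof -
    have "?H n x = (?e n x * G x - real n * ?e n x * cl i s x * (N x + r x)) + ?e n x * (w x \<bullet> \<psi> x)
        + N x * (real n * ?e n x * cl i s x + ?e n x - 1)" for x by (simp add: algebra_simps)
    then have "(\<integral>x. ?H n x \<partial>?M) = (\<integral>x. ((?e n x * G x - real n * ?e n x * cl i s x * (N x + r x)) + ?e n x * (w x \<bullet> \<psi> x))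
        + N x * (real n * ?e n x * cl i s x + ?e n x - 1) \<partial>?M)" by (simp only:)
    also have "\<dots> = 0"
      by (subst Bochner_Integration.integral_add[OF Bochner_Integration.integrable_add[OF iG ew] iN],
          subst Bochner_Integration.integral_add[OF iG ew]) (simp only: id1 id2)
    finally show ?thesis .
  qed
  have "(\<lambda>n. \<integral>x. ?H n x \<partial>?M) \<longlonglongrightarrow> (\<integral>x. - N x \<partial>?M)"
  proof (rule integral_dominated_convergence)
    show "(\<lambda>x. - N x) \<in> borel_measurable ?M" by (intro meas continuous_on_minus cont_N)
    show "?H n \<in> borel_measurable ?M" for n
      by (rule borel_measurable_add[OF meas borel_measurable_integrable[OF ew]])
        (intro continuous_on_diff continuous_on_mult continuous_on_const
          cont_e cont_G continuous_cl cont_r cont_N)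
    show "integrable ?M (\<lambda>x. \<bar>G x\<bar> + \<bar>B\<bar> * cl i s x + N x + \<bar>w x \<bullet> \<psi> x\<bar>)"
      by (rule Bochner_Integration.integrable_add[OF integrable_on_cell integrable_abs[OF w\<psi>]])
        (intro continuous_on_add continuous_on_mult continuous_on_const continuous_cl cont_N cont_G continuous_on_rabs)
    \<comment> \<open>The factor \<open>real n\<close> is absorbed by \<open>cl i m x\<close>, since
      \<open>t * exp (- t) \<le> 1\<close>.\<close>
    have nx: "real n * ?e n x * \<bar>r x\<bar> \<le> \<bar>B\<bar>" if "x \<in> cell v i" for n x
    proof -
      have c: "cl i m x \<ge> 0" using that m i by (simp add: mem_cell)
      have "real n * cl i m x \<le> exp (real n * cl i m x)"
        using exp_ge_add_one_self[of "real n * cl i m x"] by linarith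
      then have le: "real n * cl i m x * ?e n x \<le> 1" by (simp add: exp_minus field_simps)
      have "\<bar>r x\<bar> \<le> B * cl i m x" using B[OF that] by (simp add: r_def)
      also have "\<dots> \<le> \<bar>B\<bar> * cl i m x" using c by (intro mult_right_mono) auto
      finally have "real n * ?e n x * \<bar>r x\<bar> \<le> real n * ?e n x * (\<bar>B\<bar> * cl i m x)"
        by (intro mult_left_mono) auto
      also have "\<dots> = \<bar>B\<bar> * (real n * cl i m x * ?e n x)" by simp
      also have "\<dots> \<le> \<bar>B\<bar>" using le by (metis abs_ge_zero mult_left_mono mult.right_neutral)
      finally show ?thesis .
    qed
    show "AE x in ?M. norm (?H n x) \<le> \<bar>G x\<bar> + \<bar>B\<bar> * cl i s x + N x + \<bar>w x \<bullet> \<psi> x\<bar>" for n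
    proof (rule AE_I2)
      fix x assume "x \<in> space ?M"
      then have x: "x \<in> cell v i" by (simp add: space_restrict_space)
      have cs: "cl i s x \<ge> 0" using x s i by (simp add: mem_cell)
      have N0: "N x \<ge> 0" by (simp add: N_def)
      have 1: "\<bar>?e n x * G x\<bar> \<le> \<bar>G x\<bar>" using e_le[OF x] by (simp add: abs_mult mult_left_le_one_le)
      have "\<bar>real n * ?e n x * cl i s x * r x\<bar> = (real n * ?e n x * \<bar>r x\<bar>) * cl i s x"
        using cs by (simp add: abs_mult)
      then have 2: "\<bar>real n * ?e n x * cl i s x * r x\<bar> \<le> \<bar>B\<bar> * cl i s x"
        using mult_right_mono[OF nx[OF x] cs] by simp
      have 3: "\<bar>N x * (1 - ?e n x)\<bar> \<le> N x" using e_le[OF x] N0 by (simp add: abs_mult mult_left_le)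
      have 4: "\<bar>?e n x * (w x \<bullet> \<psi> x)\<bar> \<le> \<bar>w x \<bullet> \<psi> x\<bar>" using e_le[OF x] by (simp add: abs_mult mult_left_le_one_le)
      show "norm (?H n x) \<le> \<bar>G x\<bar> + \<bar>B\<bar> * cl i s x + N x + \<bar>w x \<bullet> \<psi> x\<bar>"
        using 1 2 3 4 unfolding real_norm_def by linarith
    qed
    show "AE x in ?M. (\<lambda>n. ?H n x) \<longlonglongrightarrow> - N x"
      using AE_on_ocell[OF i]
    proof eventually_elim
      case (elim x)
      then have c: "cl i m x > 0" using m by (simp add: ocell_def)
      have pow: "?e n x = exp (- cl i m x) ^ n" for n by (simp add: exp_of_nat_mult[symmetric])
      have e0: "(\<lambda>n. ?e n x) \<longlonglongrightarrow> 0" unfolding pow using c by (intro LIMSEQ_power_zero) simp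
      have ne0: "(\<lambda>n. real n * ?e n x) \<longlonglongrightarrow> 0" unfolding pow using c by (intro powser_times_n_limit_0) simp
      have "(\<lambda>n. ?H n x) \<longlonglongrightarrow> 0 * G x - 0 * cl i s x * r x - N x * (1 - 0) + 0 * (w x \<bullet> \<psi> x)"
        by (intro tendsto_intros e0 ne0)
      then show ?case by simp
    qed
  qed
  then have "(\<integral>x. N x \<partial>?M) = 0" using H0 by (simp add: LIMSEQ_const_iff)
  then have "AE x in ?M. N x = 0"
    using integral_nonneg_eq_0_iff_AE[OF integrable_on_cell[OF cont_N]] by (simp add: N_def)
  then have "AE x in lebesgue. x \<in> cell v i \<longrightarrow> N x = 0"
    using cellm by (subst (asm) AE_restrict_space_iff) auto
  then have "AE x in lebesgue. x \<in> ocell i \<longrightarrow> N x = 0"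
    using ocell_subset[OF i] by (auto elim: eventually_mono)
  from AE_zero_ocell[OF cont_N this x] show ?thesis by (simp add: N_def)
qed

text \<open>The coefficients with \<open>\<alpha> m = 0\<close>, applied to \<open>cg i m\<close>,
  are the Bernstein coefficients of the trace of the normal component on the facet opposite
  \<open>m\<close>. \<open>boundary_layer\<close> shows that this trace vanishes.\<close>

lemma bernstein_normal_kernel:
  fixes C :: "(nat \<Rightarrow> nat) \<Rightarrow> real^'n^'n"
  assumes i: "i \<le> d" and m: "m \<in> J i" and w: "L2_on (cell v i) w"
    and green: "\<And>\<phi>. C_infty \<phi> \<Longrightarrow>
      (\<integral>x. (\<Sum>\<alpha>\<in>Exp k i. mono i \<alpha> x *\<^sub>R C \<alpha>) \<bullet> jacobian \<phi> (at x) \<partial>lebesgue_on (cell v i)) +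
      (\<integral>x. w x \<bullet> \<phi> x \<partial>lebesgue_on (cell v i)) = 0"
    and \<alpha>: "\<alpha> \<in> Exp k i" "\<alpha> m = 0"
  shows "C \<alpha> *v cg i m = 0"
proof -
  have "card (J i - {m}) = d" using i m by (simp add: card_J)
  then obtain s where s: "s \<in> J i" "s \<noteq> m"
    using d_pos by (metis Diff_iff card.empty equals0I insertI1 not_one_le_zero)
  define c where "c = (\<lambda>\<alpha>. C \<alpha> *v cg i m)"
  define t where "t = edge_vec v s m"
  \<comment> \<open>The coordinates of the point reached by moving parallel to the edge from
    \<open>s\<close> to \<open>m\<close> into the facet opposite \<open>m\<close>: the weight of
    \<open>m\<close> passes to \<open>s\<close>. Thus \<open>u\<close> is the trace, extended
    constantly along the edge.\<close>
  define cl' where "cl' = (\<lambda>j x. if j = m then 0 else if j = s then cl i s x + cl i m x else cl i j x)"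
  define U where "U = (\<lambda>x. \<Sum>\<alpha>\<in>Exp k i. mono i \<alpha> x *\<^sub>R c \<alpha>)"
  define u where "u = (\<lambda>x. \<Sum>\<alpha>\<in>Exp k i. (\<Prod>j\<in>J i. cl' j x ^ \<alpha> j) *\<^sub>R c \<alpha>)"
  define \<tau> where "\<tau> = (\<lambda>x. \<Sum>\<alpha>\<in>Exp k i. mono i \<alpha> x *\<^sub>R C \<alpha>)"
  have cgt: "cg i j \<bullet> t = (if j = m then 1 else 0) - (if j = s then 1 else 0)" if "j \<in> J i" for j
    unfolding t_def using cg_edge[OF i that s(1) m] .
  have cl'C: "C_infty (cl' j)" for j
  proof (cases "j = s")
    case True
    then have "cl' j = (\<lambda>x. cl i s x + cl i m x)" using s by (auto simp: cl'_def)
    then show ?thesis by (simp add: C_infty_add C_infty_cl)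
  next
    case False
    then have "cl' j = (if j = m then (\<lambda>x. 0) else cl i j)" by (auto simp: cl'_def)
    then show ?thesis by (simp add: C_infty_cl)
  qed
  have uC: "C_infty u"
    unfolding u_def by (intro C_infty_sum C_infty_scaleR C_infty_prod C_infty_power cl'C C_infty_const)
  have UC: "C_infty U"
    unfolding U_def by (intro C_infty_sum C_infty_scaleR C_infty_mono C_infty_const)
  have u_const: "u (x + h *\<^sub>R edge_vec v s m) = u x" for x h
  proof -
    have "cl' j (x + h *\<^sub>R t) = cl' j x" if "j \<in> J i" for j
      using cgt[OF that] cgt[OF m] cgt[OF s(1)] s by (simp add: cl'_def cl_add_scaleR)
    then show ?thesis unfolding u_def t_def[symmetric] by (auto intro!: sum.cong)
  qed
  define P where "P = (\<lambda>x. x + (- cl i m x) *\<^sub>R t)"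
  have clP: "cl i j (P x) = cl' j x" if "j \<in> J i" for j x
    using cgt[OF that] s unfolding P_def cl_add_scaleR by (auto simp: cl'_def)
  have uP: "u x = U (P x)" for x
    unfolding u_def U_def mono_def by (intro sum.cong refl) (simp add: clP)
  have P_cell: "P x \<in> cell v i" if x: "x \<in> cell v i" for x
    using x m s(1) unfolding mem_cell[OF i] by (auto simp: clP cl'_def)
  obtain L where L: "L-lipschitz_on (cell v i) U"
    using C_infty_lipschitz[OF UC compact_cell convex_cell] by blast
  obtain B where B: "\<And>x. x \<in> cell v i \<Longrightarrow> norm (U x) \<le> B"
    using compact_imp_bounded[OF compact_continuous_image[OF C_infty_continuous_on[OF UC] compact_cell[of i]]]
    by (auto simp: bounded_iff)
  have \<tau>U: "\<tau> x *v cg i m = U x" for x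
  proof -
    interpret M: linear "\<lambda>M. M *v cg i m"
      by (rule linearI) (simp_all add: matrix_vector_mult_add_rdistrib scaleR_matrix_vector_assoc[symmetric])
    show ?thesis by (simp add: \<tau>_def U_def c_def M.sum M.scale)
  qed
  have bound: "\<bar>u x \<bullet> (\<tau> x *v cg i m) - u x \<bullet> u x\<bar> \<le> \<bar>B\<bar> * L * norm t * cl i m x" if x: "x \<in> cell v i" for x
  proof -
    have c0: "cl i m x \<ge> 0" using x m i by (simp add: mem_cell)
    have "\<bar>u x \<bullet> (\<tau> x *v cg i m) - u x \<bullet> u x\<bar> = \<bar>u x \<bullet> (U x - U (P x))\<bar>"
      by (simp add: \<tau>U uP inner_diff_right)
    also have "\<dots> \<le> norm (u x) * norm (U x - U (P x))" by (rule Cauchy_Schwarz_ineq2)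
    also have "\<dots> \<le> \<bar>B\<bar> * (L * dist x (P x))"
      using B[OF P_cell[OF x]] lipschitz_onD[OF L x P_cell[OF x]]
      by (intro mult_mono) (auto simp: uP dist_norm)
    also have "dist x (P x) = cl i m x * norm t" using c0 by (simp add: P_def dist_norm)
    finally show ?thesis by (simp add: mult_ac)
  qed
  have green': "(\<integral>x. \<tau> x \<bullet> jacobian \<phi> (at x) \<partial>lebesgue_on (cell v i)) + (\<integral>x. w x \<bullet> \<phi> x \<partial>lebesgue_on (cell v i)) = 0"
    if "C_infty \<phi>" for \<phi> unfolding \<tau>_def by (rule green[OF that])
  have \<tau>cont: "continuous_on (cell v i) \<tau>"
    unfolding \<tau>_def by (intro continuous_on_sum continuous_on_scaleR C_infty_continuous_on[OF C_infty_mono] continuous_on_const)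
  have u0: "u x = 0" if "x \<in> ocell i" for x
    by (rule boundary_layer[OF i m s w green' \<tau>cont uC u_const bound that])
  have "c \<alpha> $ a = 0" for a
  proof (rule monomials_independent[where I = "J i - {m}" and A = "{\<alpha>\<in>Exp k i. \<alpha> m = 0}" and a = "\<lambda>\<alpha>. c \<alpha> $ a" and \<alpha> = \<alpha>])
    fix y :: "nat \<Rightarrow> real" assume y: "\<forall>j\<in>J i - {m}. y j > 0"
    define S where "S = (\<Sum>j\<in>J i - {m}. y j)"
    \<comment> \<open>Gives a point of the open cell whose projection has weights proportional to
      \<open>y\<close>: the weight of \<open>s\<close> is split equally between \<open>s\<close> and
      \<open>m\<close>.\<close>
    define y' where "y' = (\<lambda>j. if j = m \<or> j = s then y s / 2 else y j)"
    have ys: "y s > 0" using y s by blast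
    have S: "S > 0" unfolding S_def using y s by (intro sum_pos) auto
    have "(\<Sum>j\<in>J i. y' j) = y' m + (y' s + (\<Sum>j\<in>J i - {m} - {s}. y' j))"
      using m s by (simp add: sum.remove[of "J i" m] sum.remove[of "J i - {m}" s])
    also have "(\<Sum>j\<in>J i - {m} - {s}. y' j) = (\<Sum>j\<in>J i - {m} - {s}. y j)"
      by (intro sum.cong) (auto simp: y'_def)
    also have "y' m + (y' s + (\<Sum>j\<in>J i - {m} - {s}. y j)) = S"
      using s by (simp add: S_def sum.remove[of "J i - {m}" s] y'_def)
    finally have y'S: "(\<Sum>j\<in>J i. y' j) = S" .
    define x where "x = (\<Sum>m\<in>J i. (y' m / S) *\<^sub>R vertex v m)"
    have cl: "cl i j x = y' j / S" if "j \<in> J i" for j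
      unfolding x_def using S that by (intro cl_of_weights i) (simp_all add: sum_divide_distrib[symmetric] y'S)
    have "x \<in> ocell i" using y S ys by (auto simp: ocell_def cl y'_def)
    then have "u x $ a = 0" using u0 by simp
    have cl'x: "cl' j x = y j / S" if "j \<in> J i - {m}" for j
      using that cl m s S by (auto simp: cl'_def y'_def field_simps)
    have "0 = (\<Sum>\<alpha>\<in>Exp k i. (\<Prod>j\<in>J i. cl' j x ^ \<alpha> j) * c \<alpha> $ a)"
      using \<open>u x $ a = 0\<close> by (simp add: u_def)
    also have "\<dots> = (\<Sum>\<alpha>\<in>{\<alpha>\<in>Exp k i. \<alpha> m = 0}. (\<Prod>j\<in>J i. cl' j x ^ \<alpha> j) * c \<alpha> $ a)"
      using m by (intro sum.mono_neutral_right) (auto simp: cl'_def intro!: prod_zero bexI[of _ m])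
    also have "\<dots> = (\<Sum>\<alpha>\<in>{\<alpha>\<in>Exp k i. \<alpha> m = 0}. (c \<alpha> $ a * (\<Prod>j\<in>J i - {m}. y j ^ \<alpha> j)) / S ^ k)"
    proof (intro sum.cong refl)
      fix \<beta> assume \<beta>: "\<beta> \<in> {\<alpha>\<in>Exp k i. \<alpha> m = 0}"
      then have "sum \<beta> (J i - {m}) = k" using m by (auto simp: Exp_def sum.remove[of "J i" m])
      then have "(\<Prod>j\<in>J i - {m}. S ^ \<beta> j) = S ^ k" by (simp add: power_sum[symmetric])
      moreover have "(\<Prod>j\<in>J i. cl' j x ^ \<beta> j) = (\<Prod>j\<in>J i - {m}. y j ^ \<beta> j / S ^ \<beta> j)"
        using \<beta> m cl'x by (simp add: prod.remove[of "J i" m] power_divide)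
      ultimately show "(\<Prod>j\<in>J i. cl' j x ^ \<beta> j) * c \<beta> $ a = (c \<beta> $ a * (\<Prod>j\<in>J i - {m}. y j ^ \<beta> j)) / S ^ k"
        by (simp add: prod_dividef)
    qed
    finally show "(\<Sum>\<alpha>\<in>{\<alpha>\<in>Exp k i. \<alpha> m = 0}. c \<alpha> $ a * (\<Prod>j\<in>J i - {m}. y j ^ \<alpha> j)) = 0"
      using S by (simp add: sum_divide_distrib[symmetric])
  next
    show "\<beta> j = 0" if "\<beta> \<in> {\<alpha>\<in>Exp k i. \<alpha> m = 0}" "j \<notin> J i - {m}" for \<beta> j
      using that by (auto simp: Exp_def)
  qed (use \<alpha> in simp_all)
  then show ?thesis by (simp add: vec_eq_iff c_def)
qed

lemma transpose_sym_space:
  fixes A :: "real^'n^'n"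
  shows "A \<in> sym_space V W \<Longrightarrow> transpose A = A"
proof -
  have "sym_space V W \<subseteq> {A :: real^'n^'n. transpose A = A}"
    unfolding sym_space_def
  proof (rule span_minimal)
    show "subspace {A :: real^'n^'n. transpose A = A}" by (auto simp: subspace_def transpose_def vec_eq_iff)
  qed auto
  then show "A \<in> sym_space V W \<Longrightarrow> transpose A = A" by blast
qed

abbreviation supp :: "(nat \<Rightarrow> nat) \<Rightarrow> nat set" where "supp \<alpha> \<equiv> {j. \<alpha> j \<noteq> 0}"

abbreviation tangent_tensors :: "nat set \<Rightarrow> (real^'n^'n) set" where
  "tangent_tensors f \<equiv> sym_space (tangent v f) (tangent v f)"

lemma integral_lebesgue_on_cong_AE:
  fixes f g :: "real^'n \<Rightarrow> real"
  assumes "AE x in lebesgue. f x = g x" "D \<in> sets lebesgue"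
    and "f \<in> borel_measurable (lebesgue_on D)" "g \<in> borel_measurable (lebesgue_on D)"
  shows "(\<integral>x. f x \<partial>lebesgue_on D) = (\<integral>x. g x \<partial>lebesgue_on D)"
proof (rule integral_cong_AE[OF assms(3,4)])
  show "AE x in lebesgue_on D. f x = g x"
    using assms(1,2) by (subst AE_restrict_space_iff) (auto elim: eventually_mono)
qed

lemma div_bubble_eq:
  assumes i: "i \<le> d" and k: "k \<ge> 1"
  shows "div_bubble v k i =
    {Psi k (\<lambda>m \<alpha>. if m = i then C \<alpha> else 0) |C. \<forall>\<alpha>\<in>Exp k i. C \<alpha> \<in> tangent_tensors (supp \<alpha>)}"
    (is "_ = ?R")
proof
  have restr: "fld k (\<lambda>m \<alpha>. if m = i then C \<alpha> else 0) x =
      indicat_real (cell v i) x *\<^sub>R (\<Sum>\<alpha>\<in>Exp k i. mono i \<alpha> x *\<^sub>R C \<alpha>)" for C x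
  proof -
    have "fld k (\<lambda>m \<alpha>. if m = i then C \<alpha> else 0) x =
        (\<Sum>m\<le>d. if m = i then \<Sum>\<alpha>\<in>Exp k i. (indicat_real (cell v i) x * mono i \<alpha> x) *\<^sub>R C \<alpha> else 0)"
      unfolding fld_def by (intro sum.cong) auto
    then show ?thesis using i by (simp add: scaleR_sum_right)
  qed
  show "?R \<subseteq> div_bubble v k i"
  proof clarify
    fix C assume C: "\<forall>\<alpha>\<in>Exp k i. C \<alpha> \<in> tangent_tensors (supp \<alpha>)"
    let ?C = "\<lambda>m \<alpha>. if m = i then C \<alpha> else 0"
    have tr: "transpose (C \<alpha>) = C \<alpha>" if "\<alpha> \<in> Exp k i" for \<alpha> using C that transpose_sym_space by blast
    have "weakly_div_free_flux {\<phi>. C_infty \<phi>} k ?C"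
      unfolding weakly_div_free_flux_def
    proof (intro ballI sum.neutral)
      fix \<phi> m \<alpha> assume \<phi>: "\<phi> \<in> {\<phi> :: real^'n \<Rightarrow> real^'n. C_infty \<phi>}" and "m \<in> {..d}" and \<alpha>: "\<alpha> \<in> Exp k m"
      show "flux m \<alpha> (?C m \<alpha>) \<phi> = 0"
      proof (cases "m = i")
        case True
        have "flux i \<alpha> (C \<alpha>) \<phi> = 0"
          using \<phi> C \<alpha> True Exp_expo[of \<alpha> k i] by (intro flux_tangent_zero[OF _ i, of \<phi> "supp \<alpha>"]) auto
        then show ?thesis using True by simp
      next
        case False
        have "linear (\<lambda>A. flux m \<alpha> A \<phi>)" using \<phi> by (intro linear_flux) simp
        then show ?thesis using False linear_0 by auto
      qed
    qed
    then have "Psi k ?C \<in> Hdiv0 (cell v i)" using tr by (intro Psi_in_Hdiv0[OF i]) auto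
    moreover have "Psi k ?C \<in> poly_sym v k i"
      unfolding poly_sym_def
    proof (intro CollectI exI conjI allI)
      let ?\<tau> = "\<lambda>x. \<Sum>\<alpha>\<in>Exp k i. mono i \<alpha> x *\<^sub>R C \<alpha>"
      show "Psi k ?C = abs_ae (\<lambda>x. indicat_real (cell v i) x *\<^sub>R ?\<tau> x)"
        unfolding Psi_def by (rule arg_cong[where f = abs_ae]) (rule ext, rule restr)
      have "C \<alpha> $ a $ b = C \<alpha> $ b $ a" if "\<alpha> \<in> Exp k i" for \<alpha> a b
        using arg_cong[OF tr[OF that], of "\<lambda>M. M $ b $ a"] by (simp add: transpose_def)
      then show "transpose (?\<tau> x) = ?\<tau> x" for x
        by (auto simp: vec_eq_iff transpose_def intro!: sum.cong)
      have "(\<lambda>x. \<Sum>\<alpha>\<in>Exp k i. C \<alpha> $ a $ b * mono i \<alpha> x) \<in> poly_le k" for a b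
        unfolding poly_le_bernstein[OF i] by (auto simp: comb_space_def)
      then show "(\<lambda>x. ?\<tau> x $ a $ b) \<in> poly_le k" for a b by (simp add: mult.commute)
    qed
    ultimately show "Psi k ?C \<in> div_bubble v k i" by (simp add: div_bubble_def)
  qed
  show "div_bubble v k i \<subseteq> ?R"
  proof
    fix X assume "X \<in> div_bubble v k i"
    then have H: "X \<in> Hdiv0 (cell v i)" and P: "X \<in> poly_sym v k i" by (auto simp: div_bubble_def)
    from P obtain \<tau> where \<tau>: "X = abs_ae (\<lambda>x. indicat_real (cell v i) x *\<^sub>R \<tau> x)"
        "\<And>x. transpose (\<tau> x) = \<tau> x" "\<And>a b. (\<lambda>x. \<tau> x $ a $ b) \<in> poly_le k"
      unfolding poly_sym_def by blast
    have "\<forall>a b. \<exists>c. \<forall>x. \<tau> x $ a $ b = (\<Sum>\<alpha>\<in>Exp k i. c \<alpha> * mono i \<alpha> x)"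
      using \<tau>(3) unfolding poly_le_bernstein[OF i] comb_space_def by (simp add: fun_eq_iff)
    then obtain c where c: "\<And>a b x. \<tau> x $ a $ b = (\<Sum>\<alpha>\<in>Exp k i. c a b \<alpha> * mono i \<alpha> x)" by metis
    \<comment> \<open>Averaging with the transpose makes each coefficient symmetric, while the sum
      is unchanged because \<open>\<tau> x\<close> is symmetric.\<close>
    define C where "C = (\<lambda>\<alpha>. \<chi> a b. (c a b \<alpha> + c b a \<alpha>) / 2)"
    have tr: "transpose (C \<alpha>) = C \<alpha>" for \<alpha> by (simp add: C_def vec_eq_iff transpose_def add.commute)
    have \<tau>C: "\<tau> x = (\<Sum>\<alpha>\<in>Exp k i. mono i \<alpha> x *\<^sub>R C \<alpha>)" for x
    proof -
      have "\<tau> x $ a $ b = (\<tau> x $ a $ b + \<tau> x $ b $ a) / 2" for a b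
        using arg_cong[OF \<tau>(2)[of x], of "\<lambda>M. M $ a $ b"] by (simp add: transpose_def)
      also have "\<dots> a b = (\<Sum>\<alpha>\<in>Exp k i. mono i \<alpha> x * C \<alpha> $ a $ b)" for a b
        unfolding c by (simp add: C_def sum.distrib[symmetric] sum_divide_distrib algebra_simps)
      finally show ?thesis by (simp add: vec_eq_iff)
    qed
    let ?C = "\<lambda>m \<alpha>. if m = i then C \<alpha> else 0"
    have XC: "X = Psi k ?C" unfolding \<tau>(1) Psi_def
      by (rule arg_cong[where f = abs_ae]) (rule ext, simp only: restr \<tau>C)
    from H obtain \<tau>' w where \<tau>': "X = abs_ae \<tau>'" "\<tau>' \<in> L2_sym (cell v i)" "L2_on (cell v i) w"
        "normal_trace_zero (cell v i) \<tau>' w" unfolding Hdiv0_def by blast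
    have cellm: "cell v i \<in> sets lebesgue" using compact_cell by (simp add: lmeasurable_compact fmeasurableD)
    have ae: "AE x in lebesgue. \<tau>' x = indicat_real (cell v i) x *\<^sub>R \<tau> x"
      using \<tau>(1) unfolding \<tau>'(1) abs_ae_eq_iff .
    have \<tau>cont: "continuous_on S \<tau>" for S
      unfolding \<tau>C by (intro continuous_on_sum continuous_on_scaleR C_infty_continuous_on[OF C_infty_mono] continuous_on_const)
    \<comment> \<open>The representative that witnesses membership in \<open>Hdiv0\<close> agrees
      with \<open>\<tau>\<close> only almost everywhere on the cell; the identity passes to the
      polynomial.\<close>
    have green: "(\<integral>x. \<tau> x \<bullet> jacobian \<phi> (at x) \<partial>lebesgue_on (cell v i)) +
      (\<integral>x. w x \<bullet> \<phi> x \<partial>lebesgue_on (cell v i)) = 0" if \<phi>: "C_infty \<phi>" for \<phi>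
    proof -
      have Jc: "continuous_on S (\<lambda>x. jacobian \<phi> (at x))" for S using \<phi> by (rule continuous_on_jacobian)
      have Jm: "(\<lambda>x. jacobian \<phi> (at x)) \<in> borel_measurable (lebesgue_on (cell v i))"
        using Jc cellm by (rule continuous_imp_measurable_on_sets_lebesgue)
      have "(\<integral>x. \<tau>' x \<bullet> jacobian \<phi> (at x) \<partial>lebesgue_on (cell v i)) =
          (\<integral>x. (indicat_real (cell v i) x *\<^sub>R \<tau> x) \<bullet> jacobian \<phi> (at x) \<partial>lebesgue_on (cell v i))"
      proof (rule integral_lebesgue_on_cong_AE[OF _ cellm])
        show "AE x in lebesgue. \<tau>' x \<bullet> jacobian \<phi> (at x) = (indicat_real (cell v i) x *\<^sub>R \<tau> x) \<bullet> jacobian \<phi> (at x)"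
          using ae by eventually_elim simp
        show "(\<lambda>x. \<tau>' x \<bullet> jacobian \<phi> (at x)) \<in> borel_measurable (lebesgue_on (cell v i))"
          using \<tau>'(2) Jm by (intro borel_measurable_inner) (auto simp: L2_sym_def L2_on_def)
        show "(\<lambda>x. (indicat_real (cell v i) x *\<^sub>R \<tau> x) \<bullet> jacobian \<phi> (at x)) \<in> borel_measurable (lebesgue_on (cell v i))"
          by (rule borel_measurable_inner[OF measurable_restrict_space1[OF
                  borel_measurable_integrable[OF integrable_cell[OF \<tau>cont]]] Jm])
      qed
      also have "\<dots> = (\<integral>x. \<tau> x \<bullet> jacobian \<phi> (at x) \<partial>lebesgue_on (cell v i))"
        by (intro Bochner_Integration.integral_cong refl) (simp add: space_restrict_space)
      finally show ?thesis
        using \<tau>'(4)[unfolded normal_trace_zero_def, rule_format, OF \<phi>] by (simp only:)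
    qed
    have "C \<alpha> \<in> tangent_tensors (supp \<alpha>)" if \<alpha>: "\<alpha> \<in> Exp k i" for \<alpha>
    proof (rule kernel_imp_tangent_tensor[OF i _ _ tr])
      show "supp \<alpha> \<subseteq> J i" using Exp_expo[OF \<alpha>] by blast
      show "supp \<alpha> \<noteq> {}"
      proof
        assume "supp \<alpha> = {}"
        then have "sum \<alpha> (J i) = 0" by (intro sum.neutral) auto
        then show False using \<alpha> k by (simp add: Exp_def)
      qed
      show "C \<alpha> *v cg i m = 0" if "m \<in> J i - supp \<alpha>" for m
        using that by (intro bernstein_normal_kernel[OF i _ \<tau>'(3) green[unfolded \<tau>C] \<alpha>]) auto
    qed
    then show "X \<in> ?R" using XC by blast
  qed
qed

section \<open>Tangential and normal vectors\<close>

lemma subspace_tangent [simp]: "subspace (tangent v f)" by (simp add: tangent_def)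

lemma subspace_normal_comp [simp]: "subspace (normal_comp v f)"
  by (simp add: normal_comp_def subspace_orthogonal_comp)

lemma normal_comp_orthogonal: "n \<in> normal_comp v f \<Longrightarrow> t \<in> tangent v f \<Longrightarrow> n \<bullet> t = 0"
  by (auto simp: normal_comp_def orthogonal_comp_def orthogonal_def inner_commute)

lemma normal_comp_orthogonal': "n \<in> normal_comp v f \<Longrightarrow> t \<in> tangent v f \<Longrightarrow> t \<bullet> n = 0"
  using normal_comp_orthogonal by (metis inner_commute)

lemma normal_compI: "(\<And>t. t \<in> tangent v f \<Longrightarrow> n \<bullet> t = 0) \<Longrightarrow> n \<in> normal_comp v f"
  by (auto simp: normal_comp_def orthogonal_comp_def orthogonal_def inner_commute)

lemma edge_split: "edge_vec v p q = edge_vec v s q - edge_vec v s p"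
  by (simp add: edge_vec_def)

lemma tangent_eq_span: "s \<in> f \<Longrightarrow> tangent v f = span (edge_vec v s ` (f - {s}))"
proof
  assume s: "s \<in> f"
  have e: "edge_vec v s q \<in> span (edge_vec v s ` (f - {s}))" if "q \<in> f" for q
    using that by (cases "q = s") (auto intro: span_base simp: span_0)
  show "tangent v f \<subseteq> span (edge_vec v s ` (f - {s}))"
    unfolding tangent_def
  proof (rule span_minimal)
    show "{edge_vec v i j |i j. i \<in> f \<and> j \<in> f} \<subseteq> span (edge_vec v s ` (f - {s}))"
    proof clarify
      fix p q assume "p \<in> f" "q \<in> f"
      then show "edge_vec v p q \<in> span (edge_vec v s ` (f - {s}))"
        unfolding edge_split[of p q s] by (intro span_diff e)
    qed
  qed simp
  show "span (edge_vec v s ` (f - {s})) \<subseteq> tangent v f"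
    using s edge_in_tangent by (intro span_minimal) auto
qed

lemma cg_normal:
  assumes "i \<le> d" "f \<subseteq> J i" "m \<in> J i - f"
  shows "cg i m \<in> normal_comp v f"
proof (rule normal_compI)
  fix t assume "t \<in> tangent v f"
  then show "cg i m \<bullet> t = 0"
    unfolding tangent_def
  proof (induction rule: span_induct)
    case base
    show ?case by (rule subspace_hyperplane)
  next
    case (step x)
    then obtain a b where "x = edge_vec v a b" "a \<in> f" "b \<in> f" by blast
    then show ?case using cg_edge[OF assms(1), of m a b] assms by (auto simp: subset_iff)
  qed
qed

text \<open>Independence of the edges is tested with the gradients of a cell that contains the face,
  so faces of the simplex and interior faces are treated alike.\<close>

lemma dim_tangent:
  assumes i: "i \<le> d" and f: "f \<subseteq> J i" "f \<noteq> {}"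
  shows "dim (tangent v f) = card f - 1"
proof -
  obtain s where s: "s \<in> f" using f by blast
  have fin: "finite (f - {s})" using f finite_subset[OF f(1) finite_J] by simp
  have cg: "cg i r \<bullet> edge_vec v s q = (if r = q then 1 else 0)" if "r \<in> f - {s}" "q \<in> f - {s}" for r q
    using cg_edge[OF i, of r s q] that s f by (auto simp: subset_iff)
  have inj: "inj_on (edge_vec v s) (f - {s})"
  proof (rule inj_onI)
    fix r q assume rq: "r \<in> f - {s}" "q \<in> f - {s}" "edge_vec v s r = edge_vec v s q"
    then show "r = q" using cg[OF rq(1) rq(1)] cg[OF rq(1,2)] by (metis zero_neq_one)
  qed
  have "independent (edge_vec v s ` (f - {s}))"
  proof
    assume "dependent (edge_vec v s ` (f - {s}))"
    then obtain u r where u: "r \<in> f - {s}" "u (edge_vec v s r) \<noteq> 0"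
        "(\<Sum>y\<in>edge_vec v s ` (f - {s}). u y *\<^sub>R y) = 0"
      using dependent_finite[of "edge_vec v s ` (f - {s})"] fin by auto
    have "0 = cg i r \<bullet> (\<Sum>q\<in>f - {s}. u (edge_vec v s q) *\<^sub>R edge_vec v s q)"
      using u(3) inj by (simp add: sum.reindex)
    also have "\<dots> = (\<Sum>q\<in>f - {s}. if r = q then u (edge_vec v s q) else 0)"
      unfolding inner_sum_right by (intro sum.cong refl) (simp add: cg[OF u(1)])
    also have "\<dots> = u (edge_vec v s r)" using u(1) fin by simp
    finally show False using u(2) by simp
  qed
  then show ?thesis
    using inj s fin by (simp add: tangent_eq_span[OF s] dim_span_eq_card_independent card_image card_Diff_singleton del: dim_span)
qed

lemma dim_normal_comp: "dim (normal_comp v f) + dim (tangent v f) = d"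
proof -
  have "normal_comp v f = {y \<in> UNIV. \<forall>x\<in>tangent v f. orthogonal x y}"
    by (auto simp: normal_comp_def orthogonal_comp_def orthogonal_commute)
  then show ?thesis
    using dim_subspace_orthogonal_to_vectors[of "tangent v f" UNIV] by (simp add: d_eq)
qed

text \<open>In the dual expansion the coefficient of \<open>cg i j\<close> is the product with an
  edge from a vertex of \<open>f\<close>, hence zero for a normal vector when \<open>j\<close> is in
  \<open>f\<close>.\<close>

lemma normal_comp_span_cg:
  assumes "i \<le> d" "f \<subseteq> J i" "f \<noteq> {}"
  shows "normal_comp v f \<subseteq> span (cg i ` (J i - f))"
proof
  fix y assume y: "y \<in> normal_comp v f"
  obtain s where s: "s \<in> f" using assms by blast
  have "(\<Sum>j\<in>J i. (y \<bullet> edge_vec v s j) *\<^sub>R cg i j) \<in> span (cg i ` (J i - f))"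
  proof (intro span_sum)
    fix j assume "j \<in> J i"
    show "(y \<bullet> edge_vec v s j) *\<^sub>R cg i j \<in> span (cg i ` (J i - f))"
    proof (cases "j \<in> f")
      case True
      then have "y \<bullet> edge_vec v s j = 0" using normal_comp_orthogonal[OF y edge_in_tangent[OF s]] by blast
      then show ?thesis by (simp add: span_0)
    next
      case False
      then show ?thesis using \<open>j \<in> J i\<close> by (intro span_scale span_base imageI) auto
    qed
  qed
  then show "y \<in> span (cg i ` (J i - f))" using assms by (simp add: sum_edge_cg)
qed

text \<open>For a face of the simplex, gradients that do not depend on the cell span the normal
  space. This allows tests on different cells to be combined for one normal tensor.\<close>

lemma normal_comp_span_gm:
  assumes i: "i \<le> d" "i \<notin> f" and f: "f \<subseteq> {..d}" "f \<noteq> {}"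
  shows "normal_comp v f \<subseteq> span (gm ` ({..d} - f))"
proof -
  have fJ: "f \<subseteq> J i" using f i by (auto simp: cell_idx_def)
  have g: "gm p \<in> span (gm ` ({..d} - f))" if "p \<in> {..d} - f" for p using that by (intro span_base) auto
  have "cg i ` (J i - f) \<subseteq> span (gm ` ({..d} - f))"
  proof clarify
    fix j assume "j \<in> J i" "j \<notin> f"
    then show "cg i j \<in> span (gm ` ({..d} - f))"
      using i by (auto simp: cg_def J_eq intro!: span_scale span_diff g)
  qed
  then have "span (cg i ` (J i - f)) \<subseteq> span (gm ` ({..d} - f))" by (rule span_minimal) simp
  then show ?thesis using normal_comp_span_cg[OF i(1) fJ f(2)] by blast
qed

lemma gm_edge: "p \<le> d \<Longrightarrow> a \<le> d \<Longrightarrow> b \<le> d \<Longrightarrow> gm p \<bullet> edge_vec v a b = (if p = b then 1 else 0) - (if p = a then 1 else 0)"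
  using mu_add[of p "v a" "edge_vec v a b"] by (auto simp: edge_vec_def vertex_le mu_vertex)

lemma gm_edge_center: "p \<le> d \<Longrightarrow> a \<le> d \<Longrightarrow> p \<noteq> a \<Longrightarrow> gm p \<bullet> edge_vec v a (Suc d) = 1 / (real d + 1)"
  using mu_add[of p "v a" "edge_vec v a (Suc d)"] mu_center[of p] by (simp add: edge_vec_def vertex_le mu_vertex)

lemma gm_normal:
  assumes "f \<subseteq> {..d}" "p \<in> {..d} - f"
  shows "gm p \<in> normal_comp v f"
proof (rule normal_compI)
  fix t assume "t \<in> tangent v f"
  then show "gm p \<bullet> t = 0"
    unfolding tangent_def
  proof (induction rule: span_induct)
    case base
    show ?case by (rule subspace_hyperplane)
  next
    case (step x)
    then obtain a b where "x = edge_vec v a b" "a \<in> f" "b \<in> f" by blast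
    then show ?case using gm_edge[of p a b] assms by (auto simp: subset_iff)
  qed
qed

text \<open>Yields the uniqueness behind the definite description \<open>nhat\<close>.\<close>

lemma normal_comp_zero:
  assumes i: "i \<le> d" and f: "f \<subseteq> J i" "f \<noteq> {}" and h: "h \<in> normal_comp v f"
    and zero: "\<And>p. p \<in> J i - f \<Longrightarrow> cg i p \<bullet> h = 0"
  shows "h = 0"
proof -
  have "orthogonal h x" if "x \<in> cg i ` (J i - f)" for x
    using zero that by (auto simp: orthogonal_def inner_commute)
  then have "orthogonal h h" using normal_comp_span_cg[OF i f] h orthogonal_to_span by blast
  then show ?thesis by (simp add: orthogonal_def)
qed

lemma linear_form: "linear (\<lambda>M :: real^'n^'n. x \<bullet> (M *v y))"
  by (rule linearI) (simp_all add: matrix_vector_mult_add_rdistrib inner_add_right scaleR_matrix_vector_assoc[symmetric])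

lemma sym_space_induct:
  fixes A :: "real^'n^'n"
  assumes "A \<in> sym_space V W" and "\<And>a b. a \<in> V \<Longrightarrow> b \<in> W \<Longrightarrow> x \<bullet> (sym_tensor a b *v y) = 0"
  shows "x \<bullet> (A *v y) = 0"
  using assms(1) unfolding sym_space_def
proof (induction rule: span_induct)
  case base
  show ?case using linear_subspace_kernel[OF linear_form] .
qed (use assms(2) in auto)

lemma normal_tensorsE:
  assumes "A \<in> normal_tensors v f"
  obtains A1 A2 where "A = A1 + A2" "A1 \<in> sym_space (normal_comp v f) (normal_comp v f)"
    "A2 \<in> sym_space (tangent v f) (normal_comp v f)"
  using assms unfolding normal_tensors_def by (elim set_plus_elim)

lemma transpose_add: "transpose (A + B) = transpose A + transpose B" for A B :: "real^'n^'n"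
  by (simp add: transpose_def vec_eq_iff)

lemma transpose_normal_tensors: "A \<in> normal_tensors v f \<Longrightarrow> transpose A = A"
  by (elim normal_tensorsE) (simp add: transpose_add transpose_sym_space)

lemma normal_tensors_tangent:
  assumes "A \<in> normal_tensors v f" "t \<in> tangent v f" "t' \<in> tangent v f"
  shows "t \<bullet> (A *v t') = 0"
proof -
  obtain A1 A2 where A: "A = A1 + A2" "A1 \<in> sym_space (normal_comp v f) (normal_comp v f)"
    "A2 \<in> sym_space (tangent v f) (normal_comp v f)" using assms(1) by (rule normal_tensorsE)
  have "t \<bullet> (A1 *v t') = 0" "t \<bullet> (A2 *v t') = 0"
    using assms(2,3) by (auto intro!: sym_space_induct[OF A(2)] sym_space_induct[OF A(3)]
        simp: inner_sym_tensor_mult_vec normal_comp_orthogonal normal_comp_orthogonal')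
  then show ?thesis by (simp add: A(1) matrix_vector_mult_add_rdistrib inner_add_right)
qed

text \<open>A normal tensor has no tangential-tangential part, so it is determined by pairs with at
  least one normal vector, and these may be tested on the spanning set \<open>Y\<close>.\<close>

lemma normal_tensors_zero:
  assumes A: "A \<in> normal_tensors v f" and Y: "normal_comp v f \<subseteq> span Y"
    and NN: "\<And>p q. p \<in> Y \<Longrightarrow> q \<in> Y \<Longrightarrow> p \<bullet> (A *v q) = 0"
    and TN: "\<And>t q. t \<in> tangent v f \<Longrightarrow> q \<in> Y \<Longrightarrow> t \<bullet> (A *v q) = 0"
  shows "A = 0"
proof -
  note sym = inner_symmetric_matrix[OF transpose_normal_tensors[OF A]]
  have TN': "x \<bullet> (A *v y) = 0" if x: "\<And>q. q \<in> Y \<Longrightarrow> x \<bullet> (A *v q) = 0" and y: "y \<in> span Y" for x y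
    using y
  proof (induction rule: span_induct)
    case base
    have "linear (\<lambda>y. x \<bullet> (A *v y))"
      by (rule linearI) (simp_all add: matrix_vector_right_distrib inner_add_right linear_scale[OF matrix_vector_mul_linear])
    then show ?case by (rule linear_subspace_kernel)
  qed (use x in auto)
  have NN': "x \<bullet> (A *v y) = 0" if "x \<in> span Y" "y \<in> span Y" for x y
  proof (rule TN'[OF _ that(2)])
    fix q assume q: "q \<in> Y"
    have "q \<bullet> (A *v x) = 0" using NN[OF q] that(1) by (rule TN')
    then show "x \<bullet> (A *v q) = 0" by (simp only: sym[of x q])
  qed
  have "x \<bullet> (A *v y) = x \<bullet> (0 *v y)" for x y
  proof -
    have dec: "\<exists>a b. x = a + b \<and> a \<in> tangent v f \<and> b \<in> span Y" for x
    proof -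
      obtain a b where ab: "x = a + b" "a \<in> span (tangent v f)" "\<And>w. w \<in> span (tangent v f) \<Longrightarrow> orthogonal b w"
        using orthogonal_subspace_decomp_exists[of "tangent v f" x] by blast
      have "b \<in> normal_comp v f"
        using ab(3) by (intro normal_compI) (auto simp: orthogonal_def span_base)
      moreover have "a \<in> tangent v f" using ab(2) by (simp add: span_eq_iff[THEN iffD2])
      ultimately show ?thesis using ab(1) Y by blast
    qed
    obtain a b where x: "x = a + b" "a \<in> tangent v f" "b \<in> span Y" using dec by blast
    obtain a' b' where y: "y = a' + b'" "a' \<in> tangent v f" "b' \<in> span Y" using dec by blast
    have "a \<bullet> (A *v b') = 0" "a' \<bullet> (A *v b) = 0" using TN' TN x y by blast+
    then show ?thesis
      using NN'[OF x(3) y(3)] normal_tensors_tangent[OF A x(2) y(2)] sym[of b a']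
      by (simp add: x(1) y(1) matrix_vector_right_distrib inner_add_left inner_add_right)
  qed
  then show ?thesis by (rule matrix_eq_bilinear)
qed

lemma tangent_tensors_normal: "B \<in> tangent_tensors f \<Longrightarrow> q \<in> normal_comp v f \<Longrightarrow> x \<bullet> (B *v q) = 0"
  by (erule sym_space_induct) (simp add: inner_sym_tensor_mult_vec normal_comp_orthogonal')

lemma normal_sym_subset: "sym_space (normal_comp v f) (normal_comp v f) \<subseteq> normal_tensors v f"
proof
  fix A assume "A \<in> sym_space (normal_comp v f) (normal_comp v f)"
  then have "A + 0 \<in> normal_tensors v f"
    unfolding normal_tensors_def using subspace_0[OF subspace_sym_space] by (rule set_plus_intro)
  then show "A \<in> normal_tensors v f" by simp
qed

lemma normal_sym_tangent:
  "A \<in> sym_space (normal_comp v f) (normal_comp v f) \<Longrightarrow> t \<in> tangent v f \<Longrightarrow> t \<bullet> (A *v y) = 0"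
  by (erule sym_space_induct) (simp add: inner_sym_tensor_mult_vec normal_comp_orthogonal')

section \<open>Interior facets and the vectors \<open>nhat\<close>\<close>

lemma sum_edges_center: "(\<Sum>m\<le>d. edge_vec v s m) = (real d + 1) *\<^sub>R edge_vec v s (Suc d)"
  by (simp add: edge_vec_def vertex_center vertex_le sum_subtractf algebra_simps sum_constant_scaleR del: sum_constant)

text \<open>All edges from \<open>s\<close> to the vertices of the simplex add up to
  \<open>d + 1\<close> times the edge to the center. Hence the two edges that leave the facet cancel
  modulo its tangent space, and their normal components are opposite.\<close>

lemma opposite_edges_tangent:
  assumes "i \<le> d" "j \<le> d" "i \<noteq> j" "s \<in> F" and F: "F = {..Suc d} - {i, j}"
  shows "edge_vec v s i + edge_vec v s j \<in> tangent v F"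
proof -
  have "(\<Sum>m\<le>d. edge_vec v s m) = edge_vec v s i + (edge_vec v s j + (\<Sum>m\<in>{..d} - {i} - {j}. edge_vec v s m))"
    using assms by (simp add: sum.remove[of "{..d}" i] sum.remove[of "{..d} - {i}" j])
  then have "edge_vec v s i + edge_vec v s j =
      (real d + 1) *\<^sub>R edge_vec v s (Suc d) - (\<Sum>m\<in>{..d} - {i} - {j}. edge_vec v s m)"
    by (simp add: sum_edges_center[symmetric])
  moreover have "\<dots> \<in> tangent v F"
    using assms by (intro subspace_diff subspace_scale subspace_sum subspace_tangent edge_in_tangent) auto
  ultimately show ?thesis by simp
qed

lemma facets_of_cell:
  assumes "i \<le> d"
  shows "subsimp (d - 1) (J i) = {J i - {p} |p. p \<in> J i}"
proof (intro set_eqI iffI)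
  fix F assume "F \<in> subsimp (d - 1) (J i)"
  then have F: "F \<subseteq> J i" "card F = d" using d_pos by (auto simp: subsimp_def)
  have "card (J i - F) = 1" using F assms by (simp add: card_Diff_subset finite_subset card_J)
  then obtain p where "J i - F = {p}" by (rule card_1_singletonE)
  then show "F \<in> {J i - {p} |p. p \<in> J i}" using F by blast
next
  fix F assume "F \<in> {J i - {p} |p. p \<in> J i}"
  then show "F \<in> subsimp (d - 1) (J i)" using assms d_pos by (auto simp: subsimp_def card_J)
qed

text \<open>The vector is the normal part of the edge from \<open>s\<close> to the vertex
  \<open>j\<close> opposite \<open>F\<close>, scaled to product 1 with \<open>nu F\<close>: the
  other facets through \<open>f\<close> lie opposite vertices \<open>p\<close> other than
  \<open>j\<close>, and their normals, multiples of \<open>cg i p\<close>, are orthogonal to this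
  edge.\<close>

lemma nhat_form:
  assumes nu: "\<And>F. F \<in> split_subsimp d (d - 1) \<Longrightarrow> norm (nu F) = 1 \<and> nu F \<in> normal_comp v F"
    and i: "i \<le> d" and j: "j \<in> J i - f" and f: "f \<subseteq> J i" and s: "s \<in> f"
  defines "F \<equiv> J i - {j}"
  shows "edge_vec v s j \<bullet> nu F \<noteq> 0 \<and>
    (\<exists>r\<in>tangent v f. nhat v nu F f i = (1 / (edge_vec v s j \<bullet> nu F)) *\<^sub>R (edge_vec v s j - r))"
proof -
  have fne: "f \<noteq> {}" using s by blast
  have nuF: "\<exists>a. a \<noteq> 0 \<and> nu (J i - {p}) = a *\<^sub>R cg i p" if p: "p \<in> J i" for p
  proof -
    have "J i - {p} \<in> split_subsimp d (d - 1)"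
      using facets_of_cell[OF i] i p by (auto simp: split_subsimp_def)
    then have n: "norm (nu (J i - {p})) = 1" "nu (J i - {p}) \<in> normal_comp v (J i - {p})" using nu by auto
    have "card (J i - {p}) = d" using i p by (simp add: card_J)
    then have "J i - {p} \<noteq> {}" using d_pos by (metis card.empty not_one_le_zero)
    then have "nu (J i - {p}) \<in> span (cg i ` (J i - (J i - {p})))"
      using normal_comp_span_cg[OF i, of "J i - {p}"] n(2) by blast
    moreover have "J i - (J i - {p}) = {p}" using p by blast
    ultimately obtain a where "nu (J i - {p}) = a *\<^sub>R cg i p" by (auto simp: span_singleton)
    then show ?thesis using n(1) by (intro exI[of _ a]) auto
  qed
  have sJ: "s \<in> J i" "s \<noteq> j" using s f j by auto
  obtain a where a: "a \<noteq> 0" "nu F = a *\<^sub>R cg i j" using nuF[of j] j unfolding F_def by blast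
  have eF: "edge_vec v s j \<bullet> nu F = a"
    using cg_edge[OF i, of j s j] j sJ a(2) by (simp add: inner_commute)
  obtain r n where rn: "edge_vec v s j = r + n" "r \<in> span (tangent v f)" "\<And>w. w \<in> span (tangent v f) \<Longrightarrow> orthogonal n w"
    using orthogonal_subspace_decomp_exists[of "tangent v f" "edge_vec v s j"] by blast
  have r: "r \<in> tangent v f" using rn(2) by (simp add: span_eq_iff[THEN iffD2])
  have n: "n \<in> normal_comp v f"
    using rn(3) by (intro normal_compI) (auto simp: orthogonal_def span_base)
  have cgn: "cg i p \<bullet> n = (if p = j then 1 else 0)" if "p \<in> J i - f" for p
  proof -
    have "cg i p \<bullet> r = 0" using normal_comp_orthogonal[OF cg_normal[OF i f that] r] .
    then have "cg i p \<bullet> n = cg i p \<bullet> edge_vec v s j" by (simp add: rn(1) inner_add_right)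
    then show ?thesis using cg_edge[OF i, of p s j] that j sJ s by auto
  qed
  have "nhat v nu F f i = (1 / a) *\<^sub>R n"
    unfolding nhat_def d_eq[symmetric]
  proof (rule the_equality, intro conjI ballI impI)
    show "(1 / a) *\<^sub>R n \<in> normal_comp v f" using n by (intro subspace_scale) auto
    show "(1 / a) *\<^sub>R n \<bullet> nu F = 1" using cgn[of j] j a by (simp add: inner_commute)
    fix F' assume "F' \<in> subsimp (d - 1) (J i)" and F': "f \<subseteq> F' \<and> F' \<noteq> F"
    then obtain p where p: "F' = J i - {p}" "p \<in> J i" unfolding facets_of_cell[OF i] by blast
    then have "p \<noteq> j" "p \<notin> f" using F' by (auto simp: F_def)
    then show "(1 / a) *\<^sub>R n \<bullet> nu F' = 0" using cgn[of p] nuF[OF p(2)] p by (auto simp: inner_commute)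
  next
    fix h assume h: "h \<in> normal_comp v f \<and> h \<bullet> nu F = 1 \<and>
      (\<forall>F'\<in>subsimp (d - 1) (J i). f \<subseteq> F' \<and> F' \<noteq> F \<longrightarrow> h \<bullet> nu F' = 0)"
    have "h - (1 / a) *\<^sub>R n = 0"
    proof (rule normal_comp_zero[OF i f fne])
      show "h - (1 / a) *\<^sub>R n \<in> normal_comp v f" using h n by (intro subspace_diff subspace_scale) auto
      fix p assume p: "p \<in> J i - f"
      have "cg i p \<bullet> h = (if p = j then 1 / a else 0)"
      proof (cases "p = j")
        case True
        then show ?thesis using h a by (simp add: inner_commute field_simps)
      next
        case False
        have "J i - {p} \<in> subsimp (d - 1) (J i)" "f \<subseteq> J i - {p}" "J i - {p} \<noteq> F"
          using p f False j facets_of_cell[OF i] by (auto simp: F_def)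
        then have "h \<bullet> nu (J i - {p}) = 0" using h by blast
        then show ?thesis using nuF[of p] p False by (auto simp: inner_commute)
      qed
      then show "cg i p \<bullet> (h - (1 / a) *\<^sub>R n) = 0" using cgn[OF p] by (simp add: inner_diff_right)
    qed
    then show "h = (1 / a) *\<^sub>R n" by simp
  qed
  then show ?thesis using eF a(1) r rn(1) by (intro conjI bexI[of _ r]) auto
qed

end

section \<open>Coefficients of the summands\<close>

text \<open>A span of generators taken from several linear images needs only one term for each
  \<open>j\<close>; this gives the parametrisation that the dimension count expects.\<close>

lemma span_linear_family:
  fixes L :: "'j \<Rightarrow> 'e::real_vector \<Rightarrow> 'a::real_vector"
  assumes J: "finite J" and lin: "\<And>j. j \<in> J \<Longrightarrow> linear (L j)"
    and X: "\<And>j. j \<in> J \<Longrightarrow> subspace (X j)"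
  shows "span {L j t |j t. j \<in> J \<and> t \<in> X j} = {\<Sum>j\<in>J. L j (x j) |x. \<forall>j\<in>J. x j \<in> X j}" (is "span ?G = ?R")
proof
  show "span ?G \<subseteq> ?R"
  proof (rule span_minimal)
    show "?G \<subseteq> ?R"
    proof clarify
      fix j t assume j: "j \<in> J" "t \<in> X j"
      have "(\<Sum>i\<in>J. L i (if i = j then t else 0)) = (\<Sum>i\<in>J. if i = j then L j t else 0)"
        using lin by (intro sum.cong) (auto simp: linear_0)
      then have "L j t = (\<Sum>i\<in>J. L i (if i = j then t else 0))" using J j by simp
      moreover have "\<forall>i\<in>J. (if i = j then t else 0) \<in> X i" using X j by (auto simp: subspace_0)
      ultimately show "\<exists>x. L j t = (\<Sum>j\<in>J. L j (x j)) \<and> (\<forall>j\<in>J. x j \<in> X j)"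
        by (intro exI[of _ "\<lambda>i. if i = j then t else 0"] conjI)
    qed
    show "subspace ?R"
    proof (rule subspaceI)
      show "0 \<in> ?R"
        using lin X by (intro CollectI exI[of _ "\<lambda>_. 0"]) (auto simp: linear_0 subspace_0)
    next
      fix a b assume "a \<in> ?R" "b \<in> ?R"
      then obtain x y where xy: "a = (\<Sum>j\<in>J. L j (x j))" "\<forall>j\<in>J. x j \<in> X j"
        "b = (\<Sum>j\<in>J. L j (y j))" "\<forall>j\<in>J. y j \<in> X j" by blast
      have "a + b = (\<Sum>j\<in>J. L j (x j + y j))"
        unfolding xy(1,3) sum.distrib[symmetric] using lin by (intro sum.cong) (auto simp: linear_add)
      then show "a + b \<in> ?R"
        using xy X by (intro CollectI exI[of _ "\<lambda>j. x j + y j"]) (auto intro: subspace_add)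
    next
      fix c a assume "a \<in> ?R"
      then obtain x where x: "a = (\<Sum>j\<in>J. L j (x j))" "\<forall>j\<in>J. x j \<in> X j" by blast
      have "c *\<^sub>R a = (\<Sum>j\<in>J. L j (c *\<^sub>R x j))"
        unfolding x(1) scaleR_sum_right using lin by (intro sum.cong) (auto simp: linear_scale)
      then show "c *\<^sub>R a \<in> ?R"
        using x X by (intro CollectI exI[of _ "\<lambda>j. c *\<^sub>R x j"]) (auto intro: subspace_scale)
    qed
  qed
  show "?R \<subseteq> span ?G"
  proof clarify
    fix x assume "\<forall>j\<in>J. x j \<in> X j"
    then show "(\<Sum>j\<in>J. L j (x j)) \<in> span ?G" by (intro span_sum span_base) blast
  qed
qed

lemma Collect_image_pair: "{F p A |p A. P p \<and> A \<in> h ` X} = {F p (h A) |p A. P p \<and> A \<in> X}"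
  by blast

locale split_space = simplex v d for v :: "nat \<Rightarrow> real^'n" and d :: nat +
  fixes nu :: "nat set \<Rightarrow> real^'n" and z :: "nat set \<Rightarrow> nat" and k :: nat
  assumes d2: "d \<ge> 2" and k1: "k \<ge> 1"
    and nu: "\<And>F. F \<in> split_subsimp d (d - 1) \<Longrightarrow> norm (nu F) = 1 \<and> nu F \<in> normal_comp v F"
    and z: "\<And>f. f \<subseteq> {..d} \<Longrightarrow> f \<noteq> {} \<Longrightarrow> z f \<in> f"
begin

lemma finite_face: "f \<subseteq> {..Suc d} \<Longrightarrow> finite f"
  using finite_subset by blast

lemma finite_expo_face: "f \<subseteq> {..Suc d} \<Longrightarrow> f \<noteq> {} \<Longrightarrow> finite (expo k f)"
  using finite_card_expo finite_face k1 by blast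

text \<open>Multiplying by the bubble raises every exponent on \<open>f\<close> by one. Together
  with \<open>hmono_face_poly\<close> it shows that the products span the same space as the
  \<open>hmono f \<alpha>\<close> with \<open>\<alpha>\<close> in \<open>expo k f\<close>; for
  \<open>k < card f\<close> both index sets are empty.\<close>

lemma face_poly_bub:
  assumes f: "f \<subseteq> {..Suc d}" and p: "p \<in> face_poly v (int k - int (card f)) f"
  shows "\<exists>a. \<forall>x. bub v f x * p x = (\<Sum>\<alpha>\<in>expo k f. a \<alpha> * hmono f \<alpha> x)"
proof -
  let ?A = "{\<alpha>. (\<forall>i. i \<notin> f \<longrightarrow> \<alpha> i = 0) \<and> int (\<Sum>i\<in>f. \<alpha> i) = int k - int (card f)}"
  let ?dn = "\<lambda>\<alpha> i. \<alpha> i - (if i \<in> f then 1 else 0 :: nat)" and ?up = "\<lambda>\<alpha> i. \<alpha> i + (if i \<in> f then 1 else 0 :: nat)"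
  obtain b where b: "p = (\<lambda>x. \<Sum>\<alpha>\<in>?A. b \<alpha> * (\<Prod>i\<in>f. hat v i x ^ \<alpha> i))"
    using p unfolding face_poly_def by blast
  have sum_up: "(\<Sum>i\<in>f. ?up \<beta> i) = (\<Sum>i\<in>f. \<beta> i) + card f" for \<beta>
    by (simp only: sum.distrib) simp
  have "bub v f x * p x = (\<Sum>\<alpha>\<in>expo k f. b (?dn \<alpha>) * hmono f \<alpha> x)" for x
    unfolding b sum_distrib_left
  proof (rule sum.reindex_bij_witness[where i = ?dn and j = ?up])
    fix \<beta> assume \<beta>: "\<beta> \<in> ?A"
    show "?dn (?up \<beta>) = \<beta>" by auto
    have "int (\<Sum>i\<in>f. \<beta> i) = int k - int (card f)" using \<beta> by (simp only: mem_Collect_eq)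
    then have "(\<Sum>i\<in>f. \<beta> i) + card f = k" by linarith
    then have "(\<Sum>i\<in>f. ?up \<beta> i) = k" by (simp only: sum_up)
    then show "?up \<beta> \<in> expo k f" using \<beta> by (auto simp: expo_def)
    have "hmono f (?up \<beta>) x = (\<Prod>i\<in>f. hat v i x * hat v i x ^ \<beta> i)"
      unfolding hmono_def by (intro prod.cong) auto
    then show "b (?dn (?up \<beta>)) * hmono f (?up \<beta>) x = bub v f x * (b \<beta> * (\<Prod>i\<in>f. hat v i x ^ \<beta> i))"
      by (simp add: bub_def prod.distrib)
  next
    fix \<alpha> assume \<alpha>: "\<alpha> \<in> expo k f"
    then show up: "?up (?dn \<alpha>) = \<alpha>" by (auto simp: expo_def fun_eq_iff)
    have "(\<Sum>i\<in>f. ?dn \<alpha> i) + card f = k"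
      using sum_up[of "?dn \<alpha>"] unfolding up using \<alpha> by (simp add: expo_def)
    then have "int (\<Sum>i\<in>f. ?dn \<alpha> i) = int k - int (card f)" by linarith
    moreover have "\<forall>i. i \<notin> f \<longrightarrow> ?dn \<alpha> i = 0" using \<alpha> by (auto simp: expo_def)
    ultimately show "?dn \<alpha> \<in> ?A" by (intro CollectI conjI)
  qed
  then show ?thesis by (intro exI[of _ "\<lambda>\<alpha>. b (?dn \<alpha>)"] allI)
qed

lemma hmono_face_poly:
  assumes f: "f \<subseteq> {..Suc d}" and \<alpha>: "\<alpha> \<in> expo k f"
  shows "\<exists>p\<in>face_poly v (int k - int (card f)) f. \<forall>x. bub v f x * p x = hmono f \<alpha> x"
proof -
  let ?A = "{\<alpha>. (\<forall>i. i \<notin> f \<longrightarrow> \<alpha> i = 0) \<and> int (\<Sum>i\<in>f. \<alpha> i) = int k - int (card f)}"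
  define \<beta> where "\<beta> = (\<lambda>i. \<alpha> i - (if i \<in> f then 1 else 0 :: nat))"
  have fin: "finite f" using finite_face f .
  have up: "\<alpha> i = \<beta> i + 1" if "i \<in> f" for i using \<alpha> that by (auto simp: \<beta>_def expo_def)
  have "k = (\<Sum>i\<in>f. \<beta> i + 1)" using \<alpha> up by (auto simp: expo_def)
  then have "k = (\<Sum>i\<in>f. \<beta> i) + card f" by (simp only: sum.distrib) simp
  then have "int (\<Sum>i\<in>f. \<beta> i) = int k - int (card f)" by linarith
  moreover have "\<forall>i. i \<notin> f \<longrightarrow> \<beta> i = 0" using \<alpha> by (auto simp: \<beta>_def expo_def)
  ultimately have \<beta>: "\<beta> \<in> ?A" by (simp only: mem_Collect_eq)
  have finA: "finite ?A"
  proof (rule finite_subset)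
    show "?A \<subseteq> {g. \<forall>x. (x \<in> f \<longrightarrow> g x \<in> {..k}) \<and> (x \<notin> f \<longrightarrow> g x = 0)}"
    proof clarify
      fix g i assume g: "\<forall>i. i \<notin> f \<longrightarrow> g i = 0" "int (\<Sum>i\<in>f. g i) = int k - int (card f)"
      have "g i \<le> (\<Sum>i\<in>f. g i)" if "i \<in> f" using that fin by (intro member_le_sum) auto
      moreover have "(\<Sum>i\<in>f. g i) \<le> k" using g(2) by linarith
      ultimately show "(i \<in> f \<longrightarrow> g i \<in> {..k}) \<and> (i \<notin> f \<longrightarrow> g i = 0)" using g(1) by auto
    qed
  qed (rule finite_set_of_finite_funs, use fin in auto)
  define p where "p = (\<lambda>x. \<Sum>\<alpha>\<in>?A. (if \<alpha> = \<beta> then 1 else 0) * (\<Prod>i\<in>f. hat v i x ^ \<alpha> i))"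
  have "p \<in> face_poly v (int k - int (card f)) f" unfolding p_def face_poly_def
    by (rule CollectI, rule exI[of _ "\<lambda>\<alpha>. if \<alpha> = \<beta> then 1 else 0"], rule refl)
  moreover have "bub v f x * p x = hmono f \<alpha> x" for x
  proof -
    have "p x = (\<Sum>\<alpha>\<in>?A. if \<alpha> = \<beta> then \<Prod>i\<in>f. hat v i x ^ \<alpha> i else 0)"
      unfolding p_def by (intro sum.cong) auto
    also have "\<dots> = (\<Prod>i\<in>f. hat v i x ^ \<beta> i)" using finA \<beta> by (simp only: sum.delta if_True)
    finally have "bub v f x * p x = (\<Prod>i\<in>f. hat v i x * hat v i x ^ \<beta> i)" by (simp add: bub_def prod.distrib)
    also have "\<dots> = hmono f \<alpha> x" unfolding hmono_def by (intro prod.cong) (auto simp: up)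
    finally show ?thesis .
  qed
  ultimately show ?thesis by blast
qed

text \<open>A single exponent with its piecewise constant factor \<open>K\<close>; on the cells
  \<open>m \<in> f\<close> the entry is 0 because the bubble of \<open>f\<close> vanishes
  there.\<close>

definition unitC :: "nat set \<Rightarrow> (nat \<Rightarrow> nat) \<Rightarrow> (nat \<Rightarrow> real^'n^'n) \<Rightarrow> nat \<Rightarrow> (nat \<Rightarrow> nat) \<Rightarrow> real^'n^'n" where
  "unitC f \<alpha> K = (\<lambda>m \<beta>. if \<beta> = \<alpha> \<and> m \<notin> f then K m else 0)"

lemma abs_ae_eq_sum_unitC:
  assumes f: "f \<subseteq> {..Suc d}" "f \<noteq> {}" and \<alpha>: "A \<subseteq> expo k f" "finite A"
    and g: "\<And>m x. m \<le> d \<Longrightarrow> x \<in> ocell m \<Longrightarrow> g x = (\<Sum>\<alpha>\<in>A. a \<alpha> * hmono f \<alpha> x) *\<^sub>R K m"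
    and out: "\<And>x. x \<notin> T \<Longrightarrow> g x = 0"
  shows "abs_ae g = (\<Sum>\<alpha>\<in>A. a \<alpha> *\<^sub>R Psi k (unitC f \<alpha> K))"
proof -
  have "abs_ae g = Psi k (\<lambda>m \<beta>. \<Sum>\<alpha>\<in>A. a \<alpha> *\<^sub>R unitC f \<alpha> K m \<beta>)"
  proof (rule abs_ae_eq_PsiI[OF _ out])
    fix m x assume m: "m \<le> d" "x \<in> ocell m"
    then have x: "x \<in> cell v m" using ocell_subset by blast
    have "(\<Sum>\<beta>\<in>Exp k m. mono m \<beta> x *\<^sub>R (\<Sum>\<alpha>\<in>A. a \<alpha> *\<^sub>R unitC f \<alpha> K m \<beta>)) =
      (\<Sum>\<alpha>\<in>A. \<Sum>\<beta>\<in>Exp k m. mono m \<beta> x *\<^sub>R (a \<alpha> *\<^sub>R unitC f \<alpha> K m \<beta>))"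
      unfolding scaleR_sum_right by (rule sum.swap)
    also have "\<dots> = (\<Sum>\<alpha>\<in>A. (a \<alpha> * hmono f \<alpha> x) *\<^sub>R K m)"
    proof (intro sum.cong refl)
      fix \<alpha> assume "\<alpha> \<in> A"
      then have \<alpha>f: "\<alpha> \<in> expo k f" using \<alpha> by blast
      show "(\<Sum>\<beta>\<in>Exp k m. mono m \<beta> x *\<^sub>R (a \<alpha> *\<^sub>R unitC f \<alpha> K m \<beta>)) = (a \<alpha> * hmono f \<alpha> x) *\<^sub>R K m"
      proof (cases "m \<in> f")
        case True
        then show ?thesis using hmono_cell[OF m(1) x f(1) \<alpha>f] by (simp add: unitC_def)
      next
        case False
        then have "f \<subseteq> J m" using f by (auto simp: cell_idx_def)
        then have "\<alpha> \<in> Exp k m" using expo_Exp[OF m(1)] \<alpha>f by blast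
        moreover have "(\<Sum>\<beta>\<in>Exp k m. mono m \<beta> x *\<^sub>R (a \<alpha> *\<^sub>R unitC f \<alpha> K m \<beta>)) =
          (\<Sum>\<beta>\<in>Exp k m. if \<beta> = \<alpha> then mono m \<alpha> x *\<^sub>R (a \<alpha> *\<^sub>R K m) else 0)"
          using False by (intro sum.cong) (auto simp: unitC_def)
        ultimately show ?thesis using False hmono_cell[OF m(1) x f(1) \<alpha>f] by (simp add: mult.commute)
      qed
    qed
    finally show "g x = (\<Sum>\<beta>\<in>Exp k m. mono m \<beta> x *\<^sub>R (\<Sum>\<alpha>\<in>A. a \<alpha> *\<^sub>R unitC f \<alpha> K m \<beta>))"
      by (simp add: g[OF m] scaleR_sum_left)
  qed
  then show ?thesis by (simp only: Psi_scaleR Psi_sum)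
qed

text \<open>One reduction for all bubble spaces defined by a face: the parameter \<open>t\<close> is
  a tensor, a tangent vector or a family of scalars, and \<open>K t m\<close> is its tensor on the
  cell \<open>m\<close>.\<close>

lemma span_bubble:
  assumes f: "f \<subseteq> {..Suc d}" "f \<noteq> {}"
    and g: "\<And>p t m x. p \<in> face_poly v (int k - int (card f)) f \<Longrightarrow> t \<in> X \<Longrightarrow> m \<le> d \<Longrightarrow> x \<in> ocell m \<Longrightarrow>
      g p t x = (bub v f x * p x) *\<^sub>R K t m"
    and out: "\<And>p t x. x \<notin> T \<Longrightarrow> g p t x = 0"
  shows "span {abs_ae (g p t) |p t. p \<in> face_poly v (int k - int (card f)) f \<and> t \<in> X} =
    span {Psi k (unitC f \<alpha> (K t)) |\<alpha> t. \<alpha> \<in> expo k f \<and> t \<in> X}" (is "span ?G = span ?H")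
proof (rule subset_antisym; rule span_minimal; clarify?)
  fix p t assume p: "p \<in> face_poly v (int k - int (card f)) f" and t: "t \<in> X"
  obtain a where a: "\<And>x. bub v f x * p x = (\<Sum>\<alpha>\<in>expo k f. a \<alpha> * hmono f \<alpha> x)"
    using face_poly_bub[OF f(1) p] by blast
  have "abs_ae (g p t) = (\<Sum>\<alpha>\<in>expo k f. a \<alpha> *\<^sub>R Psi k (unitC f \<alpha> (K t)))"
    using g[OF p t] out finite_expo_face[OF f] by (intro abs_ae_eq_sum_unitC f) (auto simp: a)
  also have "\<dots> \<in> span ?H" using t by (intro span_sum span_scale span_base) blast
  finally show "abs_ae (g p t) \<in> span ?H" .
next
  fix \<alpha> t assume \<alpha>: "\<alpha> \<in> expo k f" and t: "t \<in> X"
  obtain p where p: "p \<in> face_poly v (int k - int (card f)) f" "\<And>x. bub v f x * p x = hmono f \<alpha> x"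
    using hmono_face_poly[OF f(1) \<alpha>] by blast
  have "abs_ae (g p t) = (\<Sum>\<alpha>\<in>{\<alpha>}. 1 *\<^sub>R Psi k (unitC f \<alpha> (K t)))"
    using g[OF p(1) t] out \<alpha> by (intro abs_ae_eq_sum_unitC f) (auto simp: p(2))
  then have "Psi k (unitC f \<alpha> (K t)) = abs_ae (g p t)" by simp
  then show "Psi k (unitC f \<alpha> (K t)) \<in> span ?G" using p(1) t by (auto intro!: span_base)
qed

lemma linear_Psi_unitC:
  assumes "\<And>m. linear (\<lambda>t. K t m)"
  shows "linear (\<lambda>t. Psi k (unitC f \<alpha> (K t)))"
proof (rule linearI)
  show "Psi k (unitC f \<alpha> (K (s + t))) = Psi k (unitC f \<alpha> (K s)) + Psi k (unitC f \<alpha> (K t))" for s t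
    unfolding Psi_add by (rule Psi_cong) (auto simp: unitC_def linear_add[OF assms])
  show "Psi k (unitC f \<alpha> (K (r *\<^sub>R t))) = r *\<^sub>R Psi k (unitC f \<alpha> (K t))" for r t
    unfolding Psi_scaleR by (rule Psi_cong) (auto simp: unitC_def linear_scale[OF assms])
qed

lemma sum_Psi_unitC:
  assumes f: "f \<subseteq> {..Suc d}" "f \<noteq> {}"
  shows "(\<Sum>\<alpha>\<in>expo k f. Psi k (unitC f \<alpha> (K \<alpha>))) =
    Psi k (\<lambda>m \<beta>. if \<beta> \<in> expo k f \<and> m \<notin> f then K \<beta> m else 0)"
  unfolding Psi_sum
proof (rule Psi_cong)
  fix m \<beta>
  have "(\<Sum>\<alpha>\<in>expo k f. unitC f \<alpha> (K \<alpha>) m \<beta>) = (\<Sum>\<alpha>\<in>expo k f. if \<alpha> = \<beta> then (if m \<notin> f then K \<beta> m else 0) else 0)"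
    by (intro sum.cong) (auto simp: unitC_def)
  then show "(\<Sum>\<alpha>\<in>expo k f. unitC f \<alpha> (K \<alpha>) m \<beta>) = (if \<beta> \<in> expo k f \<and> m \<notin> f then K \<beta> m else 0)"
    using finite_expo_face[OF f] by simp
qed

definition tn_coeff :: "nat set \<Rightarrow> nat set \<Rightarrow> real^'n \<Rightarrow> nat \<Rightarrow> real^'n^'n" where
  "tn_coeff F f t m = (if F \<subseteq> J m then sym_tensor t (nhat v nu F f m) else 0)"

definition enrich_coeff :: "nat set \<Rightarrow> nat \<Rightarrow> nat \<Rightarrow> nat \<Rightarrow> real^'n^'n" where
  "enrich_coeff f i j m =
     (if m = i then sym_tensor (edge_vec v (z f) (Suc d)) (edge_vec v (z f) j) else 0) -
     (if m = j then sym_tensor (edge_vec v (z f) (Suc d)) (edge_vec v (z f) i) else 0)"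

definition enrich_pairs :: "nat set \<Rightarrow> (nat \<times> nat) set" where
  "enrich_pairs f = {(i, j). i \<in> {..d} - f \<and> j \<in> {..d} - f \<and> i < j}"

lemma finite_enrich_pairs [simp]: "finite (enrich_pairs f)"
  by (rule finite_subset[of _ "{..d} \<times> {..d}"]) (auto simp: enrich_pairs_def)

lemma bub_outside: "f \<subseteq> {..Suc d} \<Longrightarrow> f \<noteq> {} \<Longrightarrow> x \<notin> T \<Longrightarrow> bub v f x = 0"
proof -
  assume f: "f \<subseteq> {..Suc d}" "f \<noteq> {}" and x: "x \<notin> T"
  obtain j where "j \<in> f" using f by blast
  then show ?thesis using f finite_face[OF f(1)] hat_outside[OF x, of j]
    by (auto simp: bub_def intro!: prod_zero bexI[of _ j])
qed

lemma const_bubble_family: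
  assumes f: "f \<subseteq> {..Suc d}" "f \<noteq> {}" and X: "subspace X"
  shows "bubble v k f (const_fields X) =
    {\<Sum>\<alpha>\<in>expo k f. Psi k (unitC f \<alpha> (\<lambda>m. x \<alpha>)) |x. \<forall>\<alpha>\<in>expo k f. x \<alpha> \<in> X}"
proof -
  have "{abs_ae (\<lambda>x. (bub v f x * p x) *\<^sub>R A x) |p A. p \<in> face_poly v (int k - int (card f)) f \<and> A \<in> const_fields X} =
     {abs_ae (\<lambda>x. (bub v f x * p x) *\<^sub>R A) |p A. p \<in> face_poly v (int k - int (card f)) f \<and> A \<in> X}"
    using Collect_image_pair[where F = "\<lambda>p A. abs_ae (\<lambda>x. (bub v f x * p x) *\<^sub>R A x)" and h = "\<lambda>A _. A" and X = X
        and P = "\<lambda>p. p \<in> face_poly v (int k - int (card f)) f"]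
    by (simp only: const_fields_def Setcompr_eq_image)
  then have "bubble v k f (const_fields X) =
    span {abs_ae (\<lambda>x. (bub v f x * p x) *\<^sub>R A) |p A. p \<in> face_poly v (int k - int (card f)) f \<and> A \<in> X}"
    unfolding bubble_def by simp
  also have "\<dots> = span {Psi k (unitC f \<alpha> (\<lambda>m. A)) |\<alpha> A. \<alpha> \<in> expo k f \<and> A \<in> X}"
    by (rule span_bubble[OF f, where g = "\<lambda>p A x. (bub v f x * p x) *\<^sub>R A" and K = "\<lambda>A m. A"])
      (simp_all add: bub_outside[OF f])
  also have "\<dots> = {\<Sum>\<alpha>\<in>expo k f. Psi k (unitC f \<alpha> (\<lambda>m. x \<alpha>)) |x. \<forall>\<alpha>\<in>expo k f. x \<alpha> \<in> X}"
    by (rule span_linear_family[OF finite_expo_face[OF f] linear_Psi_unitC X]) (rule linear_id[unfolded id_def])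
  finally show ?thesis .
qed

lemma tn_bubble_family:
  assumes f: "f \<subseteq> {..Suc d}" "f \<noteq> {}"
  shows "tn_bubble v nu k F f =
    {\<Sum>\<alpha>\<in>expo k f. Psi k (unitC f \<alpha> (tn_coeff F f (x \<alpha>))) |x. \<forall>\<alpha>\<in>expo k f. x \<alpha> \<in> tangent v f}"
proof -
  have "tn_bubble v nu k F f = span {Psi k (unitC f \<alpha> (tn_coeff F f t)) |\<alpha> t. \<alpha> \<in> expo k f \<and> t \<in> tangent v f}"
    unfolding tn_bubble_def d_eq[symmetric]
  proof (rule span_bubble[OF f, where g = "\<lambda>p t x. \<Sum>m\<in>{m. m \<le> d \<and> F \<subseteq> J m}.
         (indicat_real (cell v m) x * bub v f x * p x) *\<^sub>R sym_tensor t (nhat v nu F f m)"])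
    fix p t m x assume m: "m \<le> d" "x \<in> ocell m"
    have cell: "x \<in> cell v m' \<longleftrightarrow> m' = m" if "m' \<le> d" for m'
      using ocell_disjoint[OF m(1) that m(2)] ocell_subset[OF m(1)] m(2) by blast
    have "(\<Sum>m\<in>{m. m \<le> d \<and> F \<subseteq> J m}. (indicat_real (cell v m) x * bub v f x * p x) *\<^sub>R sym_tensor t (nhat v nu F f m)) =
      (\<Sum>m'\<in>{m. m \<le> d \<and> F \<subseteq> J m}. if m' = m then (bub v f x * p x) *\<^sub>R sym_tensor t (nhat v nu F f m) else 0)"
      using cell by (intro sum.cong) (auto simp: indicator_def)
    then show "(\<Sum>m\<in>{m. m \<le> d \<and> F \<subseteq> J m}. (indicat_real (cell v m) x * bub v f x * p x) *\<^sub>R sym_tensor t (nhat v nu F f m)) =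
      (bub v f x * p x) *\<^sub>R tn_coeff F f t m" using m(1) by (simp add: tn_coeff_def)
  qed (simp add: bub_outside[OF f])
  also have "\<dots> = {\<Sum>\<alpha>\<in>expo k f. Psi k (unitC f \<alpha> (tn_coeff F f (x \<alpha>))) |x. \<forall>\<alpha>\<in>expo k f. x \<alpha> \<in> tangent v f}"
  proof (rule span_linear_family[OF finite_expo_face[OF f] linear_Psi_unitC subspace_tangent])
    show "linear (\<lambda>t. tn_coeff F f t m)" for m
      unfolding tn_coeff_def using linear_sym_tensor_left by (cases "F \<subseteq> J m") (auto simp: linear_iff)
  qed
  finally show ?thesis .
qed

text \<open>One real parameter for each exponent and each pair \<open>i < j\<close>, so that
  injectivity of the parametrisation is independence of the enrichment functions.\<close>

lemma enrich_bubble_family: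
  assumes f: "f \<subseteq> {..Suc d}" "f \<noteq> {}"
  shows "bubble v k f (enrich_space v z f) =
    {\<Sum>(\<alpha>, i, j)\<in>expo k f \<times> enrich_pairs f. x (\<alpha>, i, j) *\<^sub>R Psi k (unitC f \<alpha> (enrich_coeff f i j)) |x. True}"
proof -
  let ?J = "expo k f \<times> enrich_pairs f"
  let ?L = "\<lambda>(\<alpha>, i, j) r. r *\<^sub>R Psi k (unitC f \<alpha> (enrich_coeff f i j))"
  let ?K = "\<lambda>a m. \<Sum>(i, j)\<in>enrich_pairs f. a i j *\<^sub>R enrich_coeff f i j m"
  let ?g = "\<lambda>p a x. (bub v f x * p x) *\<^sub>R (\<Sum>(i, j)\<in>enrich_pairs f. a i j *\<^sub>R enrich_fun v z f i j x)"
  have "{abs_ae (\<lambda>x. (bub v f x * p x) *\<^sub>R A x) |p A. p \<in> face_poly v (int k - int (card f)) f \<and> A \<in> enrich_space v z f} =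
     {abs_ae (?g p a) |p a. p \<in> face_poly v (int k - int (card f)) f \<and> a \<in> UNIV}"
  proof -
    have "enrich_space v z f = (\<lambda>a x. \<Sum>(i, j)\<in>enrich_pairs f. a i j *\<^sub>R enrich_fun v z f i j x) ` UNIV"
      unfolding enrich_space_def enrich_pairs_def d_eq[symmetric] by auto
    then show ?thesis
      using Collect_image_pair[where F = "\<lambda>p A. abs_ae (\<lambda>x. (bub v f x * p x) *\<^sub>R A x)" and X = UNIV
        and h = "\<lambda>a x. \<Sum>(i, j)\<in>enrich_pairs f. a i j *\<^sub>R enrich_fun v z f i j x"
        and P = "\<lambda>p. p \<in> face_poly v (int k - int (card f)) f"] by (simp only:)
  qed
  then have "bubble v k f (enrich_space v z f) =
     span {abs_ae (?g p a) |p a. p \<in> face_poly v (int k - int (card f)) f \<and> a \<in> UNIV}"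
    unfolding bubble_def by simp
  also have "\<dots> = span {Psi k (unitC f \<alpha> (?K a)) |\<alpha> a. \<alpha> \<in> expo k f \<and> a \<in> UNIV}"
  proof (rule span_bubble[OF f])
    fix p a m x assume m: "m \<le> d" "x \<in> ocell m"
    have cell: "x \<in> cell v m' \<longleftrightarrow> m = m'" if "m' \<le> d" for m'
      using ocell_disjoint[OF m(1) that m(2)] ocell_subset[OF m(1)] m(2) by blast
    have "enrich_fun v z f i j x = enrich_coeff f i j m" if "(i, j) \<in> enrich_pairs f" for i j
    proof -
      have "i \<le> d" "j \<le> d" using that by (auto simp: enrich_pairs_def)
      then show ?thesis by (simp add: enrich_fun_def enrich_coeff_def indicator_def cell d_eq[symmetric])
    qed
    then have "(\<Sum>(i, j)\<in>enrich_pairs f. a i j *\<^sub>R enrich_fun v z f i j x) = ?K a m"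
      by (intro sum.cong) auto
    then show "?g p a x = (bub v f x * p x) *\<^sub>R ?K a m" by simp
  qed (simp add: bub_outside[OF f])
  also have "\<dots> = span {?L y r |y r. y \<in> ?J \<and> r \<in> UNIV}"
  proof (rule subset_antisym; rule span_minimal; clarify?)
    fix \<alpha> a assume \<alpha>: "\<alpha> \<in> expo k f"
    have "Psi k (unitC f \<alpha> (?K a)) = (\<Sum>(i, j)\<in>enrich_pairs f. a i j *\<^sub>R Psi k (unitC f \<alpha> (enrich_coeff f i j)))"
      unfolding case_prod_beta Psi_scaleR Psi_sum by (rule Psi_cong) (auto simp: unitC_def case_prod_beta)
    also have "\<dots> \<in> span {?L y r |y r. y \<in> ?J \<and> r \<in> UNIV}"
    proof (rule span_sum, clarify)
      fix i j assume ij: "(i, j) \<in> enrich_pairs f"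
      have "?L (\<alpha>, i, j) (a i j) \<in> {?L y r |y r. y \<in> ?J \<and> r \<in> UNIV}" using \<alpha> ij by blast
      then show "a i j *\<^sub>R Psi k (unitC f \<alpha> (enrich_coeff f i j)) \<in> span {?L y r |y r. y \<in> ?J \<and> r \<in> UNIV}"
        by (intro span_base) simp
    qed
    finally show "Psi k (unitC f \<alpha> (?K a)) \<in> span {?L y r |y r. y \<in> ?J \<and> r \<in> UNIV}" .
  next
    fix \<alpha> i j and r :: real assume \<alpha>: "\<alpha> \<in> expo k f" and ij: "(i, j) \<in> enrich_pairs f"
    have "?K (\<lambda>i' j'. if (i', j') = (i, j) then 1 else 0) = enrich_coeff f i j"
    proof
      fix m
      have "?K (\<lambda>i' j'. if (i', j') = (i, j) then 1 else 0) m =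
          (\<Sum>y\<in>enrich_pairs f. if y = (i, j) then enrich_coeff f i j m else 0)"
        by (intro sum.cong) (auto split: if_splits)
      then show "?K (\<lambda>i' j'. if (i', j') = (i, j) then 1 else 0) m = enrich_coeff f i j m" using ij by simp
    qed
    then have "Psi k (unitC f \<alpha> (enrich_coeff f i j)) \<in> {Psi k (unitC f \<alpha> (?K a)) |\<alpha> a. \<alpha> \<in> expo k f \<and> a \<in> UNIV}"
      using \<alpha> by (intro CollectI exI[of _ \<alpha>] exI[of _ "\<lambda>i' j'. if (i', j') = (i, j) then 1 else 0"] conjI)
        (simp_all only: UNIV_I)
    then show "r *\<^sub>R Psi k (unitC f \<alpha> (enrich_coeff f i j)) \<in> span {Psi k (unitC f \<alpha> (?K a)) |\<alpha> a. \<alpha> \<in> expo k f \<and> a \<in> UNIV}"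
      by (intro span_scale span_base)
  qed
  also have "\<dots> = {\<Sum>y\<in>?J. ?L y (x y) |x. \<forall>y\<in>?J. x y \<in> UNIV}"
    using finite_expo_face[OF f] by (intro span_linear_family) (auto simp: linear_iff scaleR_add_left)
  finally show ?thesis by (simp only: case_prod_unfold prod.collapse UNIV_I ball_triv simp_thms)
qed

section \<open>The index sets of the summands and their coefficients\<close>

lemma face_missing_index:
  assumes "f \<subseteq> {..Suc d}" "card f \<le> d"
  obtains i where "i \<le> d" "i \<notin> f"
proof -
  have "\<not> {..d} \<subseteq> f"
  proof
    assume "{..d} \<subseteq> f"
    then have "card {..d} \<le> card f" using finite_face[OF assms(1)] by (intro card_mono)
    then show False using assms(2) by simp
  qed
  then show ?thesis using that by auto
qed

lemma interior_facet_iff: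
  "F \<in> interior_subsimp d (d - 1) \<longleftrightarrow> (\<exists>i j. i \<le> d \<and> j \<le> d \<and> i \<noteq> j \<and> F = {..Suc d} - {i, j})"
proof
  assume F: "F \<in> interior_subsimp d (d - 1)"
  then obtain i where i: "i \<le> d" "F \<in> subsimp (d - 1) (J i)" by (auto simp: interior_subsimp_def split_subsimp_def)
  then obtain j where j: "F = J i - {j}" "j \<in> J i" unfolding facets_of_cell[OF i(1)] by blast
  have "\<not> F \<subseteq> {..d}" using F i by (auto simp: interior_subsimp_def subsimp_def)
  then have "j \<noteq> Suc d" using j by (auto simp: cell_idx_def)
  then have "j \<le> d" "j \<noteq> i" using j by (auto simp: cell_idx_def)
  then show "\<exists>i j. i \<le> d \<and> j \<le> d \<and> i \<noteq> j \<and> F = {..Suc d} - {i, j}"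
  proof (intro exI conjI)
    show "i \<noteq> j" using \<open>j \<noteq> i\<close> by simp
    show "F = {..Suc d} - {i, j}" unfolding j(1) by (auto simp: cell_idx_def)
  qed (use i \<open>j \<le> d\<close> in auto)
next
  assume "\<exists>i j. i \<le> d \<and> j \<le> d \<and> i \<noteq> j \<and> F = {..Suc d} - {i, j}"
  then obtain i j where ij: "i \<le> d" "j \<le> d" "i \<noteq> j" and F: "F = {..Suc d} - {i, j}" by blast
  have "F = J i - {j}" "j \<in> J i" using ij F by (auto simp: cell_idx_def)
  then have "F \<in> subsimp (d - 1) (J i)" unfolding facets_of_cell[OF ij(1)] by blast
  moreover have "Suc d \<in> F" using ij F by auto
  then have "F \<notin> subsimp (d - 1) {..d}" by (auto simp: subsimp_def)
  ultimately show "F \<in> interior_subsimp d (d - 1)"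
    using ij(1) by (auto simp: interior_subsimp_def split_subsimp_def)
qed

text \<open>For \<open>l < d\<close> a set of \<open>l + 1\<close> indices misses some vertex of the
  simplex and hence belongs to a cell.\<close>

lemma interior_subsimp_iff:
  assumes "l < d"
  shows "f \<in> interior_subsimp d l \<longleftrightarrow> Suc d \<in> f \<and> f \<subseteq> {..Suc d} \<and> card f = Suc l"
proof
  assume f: "f \<in> interior_subsimp d l"
  then obtain i where i: "i \<le> d" "f \<subseteq> J i" "card f = Suc l" "\<not> f \<subseteq> {..d}"
    by (auto simp: interior_subsimp_def split_subsimp_def subsimp_def)
  have sub: "f \<subseteq> {..Suc d}" using i by (auto simp: cell_idx_def)
  moreover obtain x where "x \<in> f" "x \<notin> {..d}" using i(4) by blast
  ultimately have "x = Suc d" by (auto simp: subset_iff)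
  then show "Suc d \<in> f \<and> f \<subseteq> {..Suc d} \<and> card f = Suc l" using \<open>x \<in> f\<close> sub i(3) by blast
next
  assume f: "Suc d \<in> f \<and> f \<subseteq> {..Suc d} \<and> card f = Suc l"
  then obtain i where "i \<le> d" "i \<notin> f" using face_missing_index[of f] assms by auto
  then show "f \<in> interior_subsimp d l"
    using f by (auto simp: interior_subsimp_def split_subsimp_def subsimp_def cell_idx_def)
qed

lemma summand_iff:
  "NormalTensors f \<in> summands d \<longleftrightarrow> f \<subseteq> {..d} \<and> f \<noteq> {} \<and> card f \<le> d"
  "Enrichment f \<in> summands d \<longleftrightarrow> f \<subseteq> {..d} \<and> f \<noteq> {} \<and> card f \<le> d"
  "InteriorNormal f \<in> summands d \<longleftrightarrow> Suc d \<in> f \<and> f \<subseteq> {..Suc d} \<and> card f \<le> d"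
  "InteriorTN F f \<in> summands d \<longleftrightarrow> F \<in> interior_subsimp d (d - 1) \<and> f \<subseteq> F \<and> f \<noteq> {}"
  "ElementBubble i \<in> summands d \<longleftrightarrow> i \<le> d"
proof -
  have l: "(\<exists>l\<in>{0..d-1}. f \<in> subsimp l g) \<longleftrightarrow> f \<subseteq> g \<and> f \<noteq> {} \<and> card f \<le> d" if "finite g" for f g
  proof
    assume "(\<exists>l\<in>{0..d-1}. f \<in> subsimp l g)"
    then show "f \<subseteq> g \<and> f \<noteq> {} \<and> card f \<le> d" using d_pos by (auto simp: subsimp_def)
  next
    assume f: "f \<subseteq> g \<and> f \<noteq> {} \<and> card f \<le> d"
    then have "card f > 0" using finite_subset[of f g] that by (simp add: card_gt_0_iff)
    then show "(\<exists>l\<in>{0..d-1}. f \<in> subsimp l g)" using f by (intro bexI[of _ "card f - 1"]) (auto simp: subsimp_def)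
  qed
  have "NormalTensors f \<in> summands d \<longleftrightarrow> (\<exists>l\<in>{0..d-1}. f \<in> subsimp l {..d})" by (auto simp: summands_def)
  then show "NormalTensors f \<in> summands d \<longleftrightarrow> f \<subseteq> {..d} \<and> f \<noteq> {} \<and> card f \<le> d" by (simp only: l finite_atMost)
  have "Enrichment f \<in> summands d \<longleftrightarrow> (\<exists>l\<in>{0..d-1}. f \<in> subsimp l {..d})" by (auto simp: summands_def)
  then show "Enrichment f \<in> summands d \<longleftrightarrow> f \<subseteq> {..d} \<and> f \<noteq> {} \<and> card f \<le> d" by (simp only: l finite_atMost)
  have "InteriorNormal f \<in> summands d \<longleftrightarrow> (\<exists>l\<in>{0..d-1}. f \<in> interior_subsimp d l)" by (auto simp: summands_def)
  also have "\<dots> \<longleftrightarrow> Suc d \<in> f \<and> f \<subseteq> {..Suc d} \<and> card f \<le> d"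
  proof
    assume "\<exists>l\<in>{0..d-1}. f \<in> interior_subsimp d l"
    then obtain l where l: "l \<in> {0..d-1}" "f \<in> interior_subsimp d l" by blast
    then have "l < d" using d_pos by auto
    then show "Suc d \<in> f \<and> f \<subseteq> {..Suc d} \<and> card f \<le> d"
      using l(2) by (auto simp: interior_subsimp_iff)
  next
    assume f: "Suc d \<in> f \<and> f \<subseteq> {..Suc d} \<and> card f \<le> d"
    then have "card f > 0" using finite_face card_gt_0_iff by blast
    then show "\<exists>l\<in>{0..d-1}. f \<in> interior_subsimp d l"
      using f d_pos by (intro bexI[of _ "card f - 1"]) (auto simp: interior_subsimp_iff)
  qed
  finally show "InteriorNormal f \<in> summands d \<longleftrightarrow> Suc d \<in> f \<and> f \<subseteq> {..Suc d} \<and> card f \<le> d" .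
  have "InteriorTN F f \<in> summands d \<longleftrightarrow> F \<in> interior_subsimp d (d - 1) \<and> (\<exists>l\<in>{0..d-1}. f \<in> subsimp l F)"
    by (auto simp: summands_def)
  also have "\<dots> \<longleftrightarrow> F \<in> interior_subsimp d (d - 1) \<and> f \<subseteq> F \<and> f \<noteq> {}"
  proof (cases "F \<in> interior_subsimp d (d - 1)")
    case True
    then have "finite F" by (rule finite_interior_face)
    moreover have "card F \<le> d"
      using True d_pos by (auto simp: interior_subsimp_def split_subsimp_def subsimp_def)
    ultimately show ?thesis using l[of F f] card_mono[of F f] True by auto
  qed simp
  finally show "InteriorTN F f \<in> summands d \<longleftrightarrow> F \<in> interior_subsimp d (d - 1) \<and> f \<subseteq> F \<and> f \<noteq> {}" .
  show "ElementBubble i \<in> summands d \<longleftrightarrow> i \<le> d" by (auto simp: summands_def)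
qed

text \<open>The sum of \<open>unitC\<close> over all exponents with support \<open>f\<close>, as an
  explicit family of coefficients.\<close>

definition fam :: "nat set \<Rightarrow> ((nat \<Rightarrow> nat) \<Rightarrow> nat \<Rightarrow> real^'n^'n) \<Rightarrow> nat \<Rightarrow> (nat \<Rightarrow> nat) \<Rightarrow> real^'n^'n" where
  "fam f K = (\<lambda>m \<beta>. if \<beta> \<in> expo k f \<and> m \<notin> f then K \<beta> m else 0)"

text \<open>Directness becomes a question about these families by \<open>summand_space_eq\<close>.
  Only the element bubbles combine exponents of different supports.\<close>

primrec coeff :: "summand \<Rightarrow> (nat \<Rightarrow> (nat \<Rightarrow> nat) \<Rightarrow> real^'n^'n) set" where
  "coeff (NormalTensors f) = {fam f (\<lambda>\<beta> m. x \<beta>) |x. \<forall>\<beta>\<in>expo k f. x \<beta> \<in> normal_tensors v f}"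
| "coeff (Enrichment f) =
     {fam f (\<lambda>\<beta> m. \<Sum>(i, j)\<in>enrich_pairs f. x (\<beta>, i, j) *\<^sub>R enrich_coeff f i j m) |x. True}"
| "coeff (InteriorNormal f) =
     {fam f (\<lambda>\<beta> m. x \<beta>) |x. \<forall>\<beta>\<in>expo k f. x \<beta> \<in> sym_space (normal_comp v f) (normal_comp v f)}"
| "coeff (InteriorTN F f) = {fam f (\<lambda>\<beta>. tn_coeff F f (x \<beta>)) |x. \<forall>\<beta>\<in>expo k f. x \<beta> \<in> tangent v f}"
| "coeff (ElementBubble i) =
     {(\<lambda>m \<beta>. if m = i then x \<beta> else 0) |x. \<forall>\<beta>\<in>Exp k i. x \<beta> \<in> tangent_tensors (supp \<beta>)}"

lemma subspace_normal_tensors: "subspace (normal_tensors v f)"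
proof -
  have "normal_tensors v f = {x + y |x y. x \<in> sym_space (normal_comp v f) (normal_comp v f) \<and> y \<in> sym_space (tangent v f) (normal_comp v f)}"
    unfolding normal_tensors_def by (auto simp: set_plus_def)
  then show ?thesis using subspace_sums[OF subspace_sym_space subspace_sym_space] by simp
qed

lemma interior_facet_subset: "F \<in> interior_subsimp d (d - 1) \<Longrightarrow> F \<subseteq> {..Suc d}"
  unfolding interior_facet_iff by auto

lemma sum_Psi_fam:
  assumes "f \<subseteq> {..Suc d}" "f \<noteq> {}"
  shows "(\<Sum>\<alpha>\<in>expo k f. Psi k (unitC f \<alpha> (K \<alpha>))) = Psi k (fam f K)"
  using sum_Psi_unitC[OF assms] by (simp add: fam_def)

lemma sum_enrich:
  assumes f: "f \<subseteq> {..Suc d}" "f \<noteq> {}"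
  shows "(\<Sum>(\<alpha>, i, j)\<in>expo k f \<times> enrich_pairs f. x (\<alpha>, i, j) *\<^sub>R Psi k (unitC f \<alpha> (enrich_coeff f i j))) =
    Psi k (fam f (\<lambda>\<beta> m. \<Sum>(i, j)\<in>enrich_pairs f. x (\<beta>, i, j) *\<^sub>R enrich_coeff f i j m))"
proof -
  have "(\<Sum>(\<alpha>, i, j)\<in>expo k f \<times> enrich_pairs f. x (\<alpha>, i, j) *\<^sub>R Psi k (unitC f \<alpha> (enrich_coeff f i j))) =
    (\<Sum>\<alpha>\<in>expo k f. \<Sum>(i, j)\<in>enrich_pairs f. x (\<alpha>, i, j) *\<^sub>R Psi k (unitC f \<alpha> (enrich_coeff f i j)))"
    by (simp add: sum.cartesian_product)
  also have "\<dots> = (\<Sum>\<alpha>\<in>expo k f. Psi k (unitC f \<alpha> (\<lambda>m. \<Sum>(i, j)\<in>enrich_pairs f. x (\<alpha>, i, j) *\<^sub>R enrich_coeff f i j m)))"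
    unfolding case_prod_unfold Psi_scaleR Psi_sum
    by (intro sum.cong refl Psi_cong) (auto simp: unitC_def case_prod_unfold)
  finally show ?thesis by (simp only: sum_Psi_fam[OF f])
qed

lemma summand_space_eq:
  assumes "a \<in> summands d"
  shows "summand_space v nu z k a = Psi k ` coeff a"
proof (cases a)
  case (NormalTensors f)
  then have f: "f \<subseteq> {..Suc d}" "f \<noteq> {}" using assms by (auto simp: summand_iff)
  show ?thesis
    by (simp add: NormalTensors const_bubble_family[OF f subspace_normal_tensors] sum_Psi_fam[OF f]) blast
next
  case (Enrichment f)
  then have f: "f \<subseteq> {..Suc d}" "f \<noteq> {}" using assms by (auto simp: summand_iff)
  show ?thesis
    unfolding Enrichment summand_space.simps coeff.simps enrich_bubble_family[OF f] sum_enrich[OF f] by blast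
next
  case (InteriorNormal f)
  then have f: "f \<subseteq> {..Suc d}" "f \<noteq> {}" using assms by (auto simp: summand_iff)
  show ?thesis
    by (simp add: InteriorNormal const_bubble_family[OF f subspace_sym_space] sum_Psi_fam[OF f]) blast
next
  case (InteriorTN F f)
  then have f: "f \<subseteq> {..Suc d}" "f \<noteq> {}" using assms interior_facet_subset by (auto simp: summand_iff)
  show ?thesis
    by (simp add: InteriorTN tn_bubble_family[OF f] sum_Psi_fam[OF f]) blast
next
  case (ElementBubble i)
  then have i: "i \<le> d" using assms by (simp add: summand_iff)
  show ?thesis by (simp add: ElementBubble div_bubble_eq[OF i k1]) blast
qed

section \<open>Cancellation of the fluxes\<close>

lemma fam_flux:
  assumes f: "f \<subseteq> {..Suc d}" and \<phi>: "C_infty \<phi>"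
  shows "(\<Sum>m\<le>d. \<Sum>\<beta>\<in>Exp k m. flux m \<beta> (fam f K m \<beta>) \<phi>) = (\<Sum>\<beta>\<in>expo k f. \<Sum>m\<in>{..d} - f. flux m \<beta> (K \<beta> m) \<phi>)"
proof -
  have f0: "flux m \<beta> 0 \<phi> = 0" for m \<beta> using linear_0[OF linear_flux[OF \<phi>]] .
  have "(\<Sum>m\<le>d. \<Sum>\<beta>\<in>Exp k m. flux m \<beta> (fam f K m \<beta>) \<phi>) = (\<Sum>m\<in>{..d} - f. \<Sum>\<beta>\<in>Exp k m. flux m \<beta> (fam f K m \<beta>) \<phi>)"
    by (intro sum.mono_neutral_right) (auto simp: fam_def f0)
  also have "\<dots> = (\<Sum>m\<in>{..d} - f. \<Sum>\<beta>\<in>expo k f. flux m \<beta> (K \<beta> m) \<phi>)"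
  proof (rule sum.cong[OF refl])
    fix m assume m: "m \<in> {..d} - f"
    then have "expo k f \<subseteq> Exp k m" using f by (intro expo_Exp) (auto simp: cell_idx_def)
    then have "(\<Sum>\<beta>\<in>Exp k m. flux m \<beta> (fam f K m \<beta>) \<phi>) = (\<Sum>\<beta>\<in>expo k f. flux m \<beta> (fam f K m \<beta>) \<phi>)"
      by (intro sum.mono_neutral_right) (auto simp: fam_def f0)
    also have "\<dots> = (\<Sum>\<beta>\<in>expo k f. flux m \<beta> (K \<beta> m) \<phi>)" using m by (intro sum.cong) (auto simp: fam_def)
    finally show "(\<Sum>\<beta>\<in>Exp k m. flux m \<beta> (fam f K m \<beta>) \<phi>) = (\<Sum>\<beta>\<in>expo k f. flux m \<beta> (K \<beta> m) \<phi>)" .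
  qed
  finally show ?thesis by (simp only: sum.swap[of _ "{..d} - f"])
qed

text \<open>On each of the two cells \<open>nhat\<close> is, up to a tangential part without flux,
  the edge to the far vertex divided by its product with \<open>nu F\<close>. By
  \<open>flux_pair\<close> the two edges have equal flux, and by
  \<open>opposite_edges_tangent\<close> the two divisors are opposite, so the contributions
  cancel.\<close>

lemma tn_coeff_flux:
  assumes F: "F \<in> interior_subsimp d (d - 1)" and f: "f \<subseteq> F" and \<beta>: "\<beta> \<in> expo k f" and t: "t \<in> tangent v f"
    and fne: "f \<noteq> {}" and \<phi>: "C_infty \<phi>" "\<And>x. x \<in> frontier T \<Longrightarrow> \<phi> x = 0"
  shows "(\<Sum>m\<in>{..d} - f. flux m \<beta> (tn_coeff F f t m) \<phi>) = 0"
proof -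
  obtain i j where ij: "i \<le> d" "j \<le> d" "i \<noteq> j" and Fij: "F = {..Suc d} - {i, j}"
    using F interior_facet_iff by blast
  obtain s where s: "s \<in> f" using fne by blast
  have \<beta>0: "\<beta> r \<noteq> 0 \<longleftrightarrow> r \<in> f" for r using \<beta> by (simp add: expo_def)
  have FJ: "F \<subseteq> J m \<longleftrightarrow> m \<in> {i, j}" if "m \<le> d" for m using that Fij ij by (auto simp: cell_idx_def)
  have fJ: "f \<subseteq> J i" "f \<subseteq> J j" "i \<notin> f" "j \<notin> f" using f Fij by (auto simp: cell_idx_def)
  have f0: "flux m \<beta> 0 \<phi> = 0" for m using linear_0[OF linear_flux[OF \<phi>(1)]] .
  have "(\<Sum>m\<in>{..d} - f. flux m \<beta> (tn_coeff F f t m) \<phi>) = (\<Sum>m\<in>{i, j}. flux m \<beta> (tn_coeff F f t m) \<phi>)"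
    using ij fJ FJ by (intro sum.mono_neutral_right) (auto simp: tn_coeff_def f0)
  also have "\<dots> = flux i \<beta> (sym_tensor t (nhat v nu F f i)) \<phi> + flux j \<beta> (sym_tensor t (nhat v nu F f j)) \<phi>"
    using ij FJ by (simp add: tn_coeff_def)
  also have "\<dots> = 0"
  proof -
    have red: "\<exists>c. flux a \<beta> (sym_tensor t (nhat v nu F f a)) \<phi> = (1 / (edge_vec v s b \<bullet> nu F)) * flux a \<beta> (sym_tensor t (edge_vec v s b)) \<phi>"
      if ab: "(a, b) = (i, j) \<or> (a, b) = (j, i)" for a b
    proof -
      have a: "a \<le> d" "b \<in> J a - f" "f \<subseteq> J a" "F = J a - {b}" using ab ij fJ Fij by (auto simp: cell_idx_def)
      obtain r where r: "r \<in> tangent v f" "nhat v nu F f a = (1 / (edge_vec v s b \<bullet> nu F)) *\<^sub>R (edge_vec v s b - r)"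
        using nhat_form[OF nu a(1,2,3) s] unfolding a(4) by blast
      interpret L: linear "\<lambda>A. flux a \<beta> A \<phi>" using linear_flux[OF \<phi>(1)] .
      interpret S: linear "sym_tensor t" by (rule linear_sym_tensor_right)
      have "flux a \<beta> (sym_tensor t r) \<phi> = 0"
        using \<beta>0 t r(1) by (intro flux_tangent_zero[OF \<phi>(1) a(1) a(3)] sym_tensor_in_sym_space) auto
      then show ?thesis unfolding r(2) by (simp add: S.scale S.diff L.scale L.diff)
    qed
    have pair: "flux i \<beta> (sym_tensor t (edge_vec v s j)) \<phi> = flux j \<beta> (sym_tensor t (edge_vec v s i)) \<phi>"
    proof (rule flux_pair[OF \<phi> _ \<beta> s ij(1) fJ(3) ij(2) fJ(4) ij(3)])
      show "f \<subseteq> {..Suc d}" using f Fij by auto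
      have "edge_vec v s ` (f - {s}) \<subseteq> {edge_vec v s r |r. r \<in> insert (Suc d) f}" by blast
      then show "t \<in> span {edge_vec v s r |r. r \<in> insert (Suc d) f}"
        using t span_mono unfolding tangent_eq_span[OF s] by blast
    qed
    have "F \<in> split_subsimp d (d - 1)" using F by (simp add: interior_subsimp_def)
    then have "nu F \<in> normal_comp v F" using nu by blast
    then have "(edge_vec v s i + edge_vec v s j) \<bullet> nu F = 0"
      using normal_comp_orthogonal'[OF _ opposite_edges_tangent[OF ij _ Fij, of s]] s f by blast
    then have "edge_vec v s i \<bullet> nu F = - (edge_vec v s j \<bullet> nu F)" by (simp add: inner_add_left)
    then show ?thesis using red[of i j] red[of j i] pair by simp
  qed
  finally show ?thesis .
qed

lemma sym_space_mono: "V \<subseteq> V' \<Longrightarrow> W \<subseteq> W' \<Longrightarrow> sym_space V W \<subseteq> sym_space V' W'"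
  unfolding sym_space_def by (rule span_mono) blast

lemma normal_tensors_sym: "normal_tensors v f \<subseteq> sym_space UNIV UNIV"
proof
  fix A assume "A \<in> normal_tensors v f"
  then show "A \<in> sym_space UNIV UNIV"
    by (elim normal_tensorsE) (simp, intro subspace_add subspace_sym_space
      subsetD[OF sym_space_mono[OF subset_UNIV subset_UNIV]])
qed

lemma coeff_weak:
  assumes a: "a \<in> summands d" and C: "C \<in> coeff a"
  shows "weakly_div_free_flux interior_tests k C"
  unfolding weakly_div_free_flux_def
proof (intro ballI)
  fix \<phi> :: "real^'n \<Rightarrow> real^'n" assume "\<phi> \<in> interior_tests"
  then have \<phi>: "C_infty \<phi>" "\<And>x. x \<in> frontier T \<Longrightarrow> \<phi> x = 0" by auto
  show "(\<Sum>m\<le>d. \<Sum>\<beta>\<in>Exp k m. flux m \<beta> (C m \<beta>) \<phi>) = 0"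
  proof (cases a)
    case (NormalTensors f)
    then have f: "f \<subseteq> {..Suc d}" using a by (auto simp: summand_iff)
    obtain x where x: "C = fam f (\<lambda>\<beta> m. x \<beta>)" "\<forall>\<beta>\<in>expo k f. x \<beta> \<in> normal_tensors v f"
      using C NormalTensors by auto
    show ?thesis unfolding x(1) fam_flux[OF f \<phi>(1)]
      by (rule sum.neutral, rule ballI, rule flux_constant_zero[OF \<phi> f], assumption, assumption)
        (use x(2) normal_tensors_sym in auto)
  next
    case (Enrichment f)
    then have f: "f \<subseteq> {..d}" "f \<noteq> {}" using a by (auto simp: summand_iff)
    then have f': "f \<subseteq> {..Suc d}" by auto
    obtain x where x: "C = fam f (\<lambda>\<beta> m. \<Sum>(i, j)\<in>enrich_pairs f. x (\<beta>, i, j) *\<^sub>R enrich_coeff f i j m)"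
      using C Enrichment by auto
    have f0: "flux m \<beta> 0 \<phi> = 0" for m \<beta> using linear_0[OF linear_flux[OF \<phi>(1)]] .
    have pair: "(\<Sum>m\<in>{..d} - f. flux m \<beta> (enrich_coeff f i j m) \<phi>) = 0"
      if \<beta>: "\<beta> \<in> expo k f" and ij: "(i, j) \<in> enrich_pairs f" for \<beta> i j
    proof -
      let ?c = "edge_vec v (z f) (Suc d)"
      have i: "i \<le> d" "i \<notin> f" and j: "j \<le> d" "j \<notin> f" and ne: "i \<noteq> j" using ij by (auto simp: enrich_pairs_def)
      have "(\<Sum>m\<in>{..d} - f. flux m \<beta> (enrich_coeff f i j m) \<phi>) = (\<Sum>m\<in>{i, j}. flux m \<beta> (enrich_coeff f i j m) \<phi>)"
        using i j by (intro sum.mono_neutral_right) (auto simp: enrich_coeff_def f0)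
      also have "\<dots> = flux i \<beta> (sym_tensor ?c (edge_vec v (z f) j)) \<phi> - flux j \<beta> (sym_tensor ?c (edge_vec v (z f) i)) \<phi>"
        using ne linear_neg[OF linear_flux[OF \<phi>(1)]] by (simp add: enrich_coeff_def)
      also have "\<dots> = 0"
      proof -
        have "?c \<in> span {edge_vec v (z f) r |r. r \<in> insert (Suc d) f}" by (rule span_base) blast
        from flux_pair[OF \<phi> f' \<beta> z[OF f] i j ne this] show ?thesis by simp
      qed
      finally show ?thesis .
    qed
    have "(\<Sum>m\<in>{..d} - f. flux m \<beta> (\<Sum>(i, j)\<in>enrich_pairs f. x (\<beta>, i, j) *\<^sub>R enrich_coeff f i j m) \<phi>) = 0"
      if \<beta>: "\<beta> \<in> expo k f" for \<beta>
    proof -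
      have "flux m \<beta> (\<Sum>(i, j)\<in>enrich_pairs f. x (\<beta>, i, j) *\<^sub>R enrich_coeff f i j m) \<phi> =
          (\<Sum>(i, j)\<in>enrich_pairs f. x (\<beta>, i, j) * flux m \<beta> (enrich_coeff f i j m) \<phi>)" for m
      proof -
        interpret L: linear "\<lambda>A. flux m \<beta> A \<phi>" using linear_flux[OF \<phi>(1)] .
        show ?thesis by (simp add: case_prod_unfold L.sum L.scale)
      qed
      then have "(\<Sum>m\<in>{..d} - f. flux m \<beta> (\<Sum>(i, j)\<in>enrich_pairs f. x (\<beta>, i, j) *\<^sub>R enrich_coeff f i j m) \<phi>) =
        (\<Sum>(i, j)\<in>enrich_pairs f. x (\<beta>, i, j) * (\<Sum>m\<in>{..d} - f. flux m \<beta> (enrich_coeff f i j m) \<phi>))"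
        by (simp only: case_prod_unfold sum_distrib_left) (rule sum.swap)
      also have "\<dots> = 0" using pair[OF \<beta>] by (intro sum.neutral) auto
      finally show ?thesis .
    qed
    then show ?thesis unfolding x fam_flux[OF f' \<phi>(1)] by (rule sum.neutral[OF ballI])
  next
    case (InteriorNormal f)
    then have f: "f \<subseteq> {..Suc d}" using a by (auto simp: summand_iff)
    obtain x where x: "C = fam f (\<lambda>\<beta> m. x \<beta>)" "\<forall>\<beta>\<in>expo k f. x \<beta> \<in> sym_space (normal_comp v f) (normal_comp v f)"
      using C InteriorNormal by auto
    show ?thesis unfolding x(1) fam_flux[OF f \<phi>(1)]
      by (rule sum.neutral, rule ballI, rule flux_constant_zero[OF \<phi> f], assumption, assumption)
        (use x(2) sym_space_mono[of "normal_comp v f" UNIV "normal_comp v f" UNIV] in auto)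
  next
    case (InteriorTN F f)
    then have F: "F \<in> interior_subsimp d (d - 1)" "f \<subseteq> F" "f \<noteq> {}" using a by (auto simp: summand_iff)
    then have f: "f \<subseteq> {..Suc d}" using interior_facet_subset by blast
    obtain x where x: "C = fam f (\<lambda>\<beta>. tn_coeff F f (x \<beta>))" "\<forall>\<beta>\<in>expo k f. x \<beta> \<in> tangent v f"
      using C InteriorTN by auto
    show ?thesis unfolding x(1) fam_flux[OF f \<phi>(1)]
      by (rule sum.neutral, rule ballI, rule tn_coeff_flux[OF F(1,2) _ _ F(3) \<phi>], assumption)
        (use x(2) in auto)
  next
    case (ElementBubble i)
    then have i: "i \<le> d" using a by (simp add: summand_iff)
    obtain x where x: "C = (\<lambda>m \<beta>. if m = i then x \<beta> else 0)" "\<forall>\<beta>\<in>Exp k i. x \<beta> \<in> tangent_tensors (supp \<beta>)"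
      using C ElementBubble by auto
    show ?thesis
    proof (intro sum.neutral ballI)
      fix m \<beta> assume "\<beta> \<in> Exp k m"
      then show "flux m \<beta> (C m \<beta>) \<phi> = 0"
        using x i linear_0[OF linear_flux[OF \<phi>(1)]] Exp_expo[of \<beta> k i]
        by (cases "m = i") (auto intro!: flux_tangent_zero[OF \<phi>(1) i, of "supp \<beta>"])
    qed
  qed
qed

lemma transpose_zero: "transpose (0 :: real^'n^'n) = 0" by (simp add: transpose_def vec_eq_iff)

lemma subspace_symmetric: "subspace {A :: real^'n^'n. transpose A = A}"
  by (auto simp: subspace_def transpose_def vec_eq_iff)

lemma coeff_sym:
  assumes C: "C \<in> coeff a" and \<beta>: "\<beta> \<in> Exp k m"
  shows "transpose (C m \<beta>) = C m \<beta>"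
proof (cases a)
  case (Enrichment f)
  then obtain x where x: "C = fam f (\<lambda>\<beta> m. \<Sum>(i, j)\<in>enrich_pairs f. x (\<beta>, i, j) *\<^sub>R enrich_coeff f i j m)"
    using C by auto
  have "enrich_coeff f i j m \<in> {A. transpose A = A}" for i j
    unfolding enrich_coeff_def by (intro subspace_diff[OF subspace_symmetric]) (auto simp: transpose_zero)
  then have "(\<Sum>(i, j)\<in>enrich_pairs f. x (\<beta>, i, j) *\<^sub>R enrich_coeff f i j m) \<in> {A. transpose A = A}"
    unfolding case_prod_unfold by (intro subspace_sum subspace_scale subspace_symmetric)
  then show ?thesis by (simp add: x fam_def transpose_zero)
next
  case (NormalTensors f)
  then obtain x where "C = fam f (\<lambda>\<beta> m. x \<beta>)" "\<forall>\<beta>\<in>expo k f. x \<beta> \<in> normal_tensors v f" using C by auto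
  then show ?thesis using transpose_normal_tensors[of "x \<beta>" f] by (simp add: fam_def transpose_zero)
next
  case (InteriorNormal f)
  then obtain x where "C = fam f (\<lambda>\<beta> m. x \<beta>)"
    "\<forall>\<beta>\<in>expo k f. x \<beta> \<in> sym_space (normal_comp v f) (normal_comp v f)" using C by auto
  then show ?thesis using transpose_sym_space[of "x \<beta>" "normal_comp v f" "normal_comp v f"] by (simp add: fam_def transpose_zero)
next
  case (InteriorTN F f)
  then show ?thesis using C by (auto simp: fam_def tn_coeff_def transpose_zero)
next
  case (ElementBubble i)
  then obtain x where "C = (\<lambda>m \<beta>. if m = i then x \<beta> else 0)"
    "\<forall>\<beta>\<in>Exp k i. x \<beta> \<in> tangent_tensors (supp \<beta>)" using C by auto
  then show ?thesis using transpose_sym_space[of "x \<beta>" "tangent v (supp \<beta>)" "tangent v (supp \<beta>)"] \<beta>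
    by (auto simp: transpose_zero)
qed

section \<open>Directness\<close>

lemma finite_summands: "finite (summands d)"
  unfolding summands_def
  by (auto simp: finite_interior_subsimp intro!: finite_subsimp dest: finite_interior_face)

lemma expo_supp: "\<beta> \<in> expo k f \<Longrightarrow> supp \<beta> = f" by (auto simp: expo_def)

text \<open>Against a normal vector \<open>y\<close> both \<open>t\<close> and the tangential
  remainder of \<open>nhat\<close> drop out, and only the edge to the vertex opposite the facet is
  left.\<close>

lemma tn_form:
  assumes m: "m \<le> d" and j: "j \<in> J m - f" and f: "f \<subseteq> J m" and s: "s \<in> f"
    and t: "t \<in> tangent v f" and y: "y \<in> normal_comp v f"
  shows "x \<bullet> (tn_coeff (J m - {j}) f t m *v y) =
    (x \<bullet> t) * ((edge_vec v s j \<bullet> y) / (edge_vec v s j \<bullet> nu (J m - {j}))) / 2"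
proof -
  obtain r where r: "r \<in> tangent v f" "nhat v nu (J m - {j}) f m =
      (1 / (edge_vec v s j \<bullet> nu (J m - {j}))) *\<^sub>R (edge_vec v s j - r)"
    using nhat_form[OF nu m j f s] by blast
  have "r \<bullet> y = 0" "t \<bullet> y = 0" using normal_comp_orthogonal'[OF y] r(1) t by auto
  then show ?thesis
    by (simp add: tn_coeff_def inner_sym_tensor_mult_vec r(2) inner_diff_left)
qed

lemma tn_form_normal:
  assumes "t \<in> tangent v f" "x \<in> normal_comp v f" "y \<in> normal_comp v f"
  shows "x \<bullet> (tn_coeff F f t m *v y) = 0"
  using assms normal_comp_orthogonal normal_comp_orthogonal'
  by (simp add: tn_coeff_def inner_sym_tensor_mult_vec)

text \<open>On the cell \<open>p\<close> the functions present are those of the pairs containing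
  \<open>p\<close>; \<open>gm q\<close> has product \<open>1 / (d + 1)\<close> with the edge to the
  center and, among the other edges, sees only the one to \<open>q\<close>. The sign is the
  orientation of the pair, and for \<open>p = q\<close> nothing remains.\<close>

lemma enrich_form:
  assumes f: "f \<subseteq> {..d}" "f \<noteq> {}" and pq: "p \<in> {..d} - f" "q \<in> {..d} - f"
  shows "gm q \<bullet> ((\<Sum>(i, j)\<in>enrich_pairs f. x (i, j) *\<^sub>R enrich_coeff f i j p) *v gm q) =
    (if p < q then x (p, q) else if q < p then - x (q, p) else 0) / (real d + 1)"
proof -
  define \<kappa> where "\<kappa> = 1 / (real d + 1)"
  have zf: "z f \<in> f" "z f \<le> d" using z[OF f] f by auto
  have qz: "q \<noteq> z f" using pq zf by auto
  have ec: "edge_vec v (z f) (Suc d) \<bullet> gm q = \<kappa>" "gm q \<bullet> edge_vec v (z f) (Suc d) = \<kappa>"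
    using gm_edge_center[of q "z f"] pq zf qz by (auto simp: inner_commute \<kappa>_def)
  have ej: "edge_vec v (z f) j \<bullet> gm q = (if q = j then 1 else 0)" "gm q \<bullet> edge_vec v (z f) j = (if q = j then 1 else 0)"
    if "j \<le> d" for j
    using gm_edge[of q "z f" j] that pq zf qz by (auto simp: inner_commute)
  note lin = linear_form[of "gm q" "gm q"]
  have one: "gm q \<bullet> (enrich_coeff f i j p *v gm q) =
     (if p = i \<and> q = j then \<kappa> else 0) - (if p = j \<and> q = i then \<kappa> else 0)" if "(i, j) \<in> enrich_pairs f" for i j
  proof -
    have ij: "i \<le> d" "j \<le> d" "i \<noteq> j" using that by (auto simp: enrich_pairs_def)
    have val: "gm q \<bullet> (sym_tensor (edge_vec v (z f) (Suc d)) (edge_vec v (z f) r) *v gm q) = (if q = r then \<kappa> else 0)"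
      if "r \<le> d" for r using ej[OF that] by (simp add: inner_sym_tensor_mult_vec ec)
    show ?thesis unfolding enrich_coeff_def linear_diff[OF lin]
      using ij val[OF ij(1)] val[OF ij(2)] by (cases "p = i"; cases "p = j") simp_all
  qed
  have "gm q \<bullet> ((\<Sum>(i, j)\<in>enrich_pairs f. x (i, j) *\<^sub>R enrich_coeff f i j p) *v gm q) =
    (\<Sum>y\<in>enrich_pairs f. x y * (gm q \<bullet> (enrich_coeff f (fst y) (snd y) p *v gm q)))"
    by (simp add: case_prod_unfold linear_sum[OF lin] linear_scale[OF lin])
  also have "\<dots> = (\<Sum>y\<in>enrich_pairs f. (if y = (p, q) then x (p, q) * \<kappa> else 0) - (if y = (q, p) then x (q, p) * \<kappa> else 0))"
  proof (rule sum.cong[OF refl])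
    fix y assume y: "y \<in> enrich_pairs f"
    obtain i j where ij: "y = (i, j)" by (cases y)
    show "x y * (gm q \<bullet> (enrich_coeff f (fst y) (snd y) p *v gm q)) =
        (if y = (p, q) then x (p, q) * \<kappa> else 0) - (if y = (q, p) then x (q, p) * \<kappa> else 0)"
    proof -
      have "i \<noteq> j" using y ij by (auto simp: enrich_pairs_def)
      consider "p = i" "q = j" | "p = j" "q = i" | "y \<noteq> (p, q)" "y \<noteq> (q, p)" using ij by blast
      then show ?thesis
      proof cases
        case 1
        then show ?thesis using one[of i j] y ij \<open>i \<noteq> j\<close> by simp
      next
        case 2
        then show ?thesis using one[of i j] y ij \<open>i \<noteq> j\<close> by simp
      next
        case 3
        have "\<not> (p = i \<and> q = j)" "\<not> (p = j \<and> q = i)" using 3 ij by auto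
        note no = this[THEN if_not_P]
        have "gm q \<bullet> (enrich_coeff f i j p *v gm q) = 0"
          using y unfolding ij by (simp only: one no diff_0_right)
        then have "x y * (gm q \<bullet> (enrich_coeff f (fst y) (snd y) p *v gm q)) = 0"
          by (simp only: ij fst_conv snd_conv mult_zero_right)
        then show ?thesis using 3 by (simp only: if_False diff_0_right)
      qed
    qed
  qed
  also have "\<dots> = (if (p, q) \<in> enrich_pairs f then x (p, q) * \<kappa> else 0) - (if (q, p) \<in> enrich_pairs f then x (q, p) * \<kappa> else 0)"
    by (simp add: sum_subtractf)
  finally show ?thesis using pq by (auto simp: enrich_pairs_def \<kappa>_def)
qed

lemma direct_coefficients:
  assumes co: "\<And>a. a \<in> summands d \<Longrightarrow> Cf a \<in> coeff a"
    and sum0: "\<And>m \<beta>. m \<le> d \<Longrightarrow> \<beta> \<in> Exp k m \<Longrightarrow> (\<Sum>a\<in>summands d. Cf a m \<beta>) = 0"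
    and a: "a \<in> summands d" and n: "n \<le> d" and \<beta>n: "\<beta> \<in> Exp k n"
  shows "Cf a n \<beta> = 0"
proof -
  define f where "f = supp \<beta>"
  have \<beta>f: "\<beta> \<in> expo k f" and fn: "f \<subseteq> J n" "n \<notin> f"
    using Exp_expo[OF \<beta>n] by (auto simp: f_def cell_idx_def)
  have fsub: "f \<subseteq> {..Suc d}" using fn by (auto simp: cell_idx_def)
  have fne: "f \<noteq> {}" using \<beta>f k1 by (auto simp: expo_def)
  then obtain s where s: "s \<in> f" by blast
  have \<beta>m: "\<beta> \<in> Exp k m" "f \<subseteq> J m" if "m \<le> d" "m \<notin> f" for m
  proof -
    show "f \<subseteq> J m" using that fsub by (auto simp: cell_idx_def)
    then show "\<beta> \<in> Exp k m" using expo_Exp[OF that(1)] \<beta>f by blast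
  qed
  \<comment> \<open>Separation principle: a pairing that kills all other summands on one cell must
    kill the chosen one too.\<close>
  have isolate: "x \<bullet> (Cf a0 m \<beta> *v y) = 0"
    if m: "m \<le> d" "m \<notin> f" and a0: "a0 \<in> summands d"
      and oth: "\<And>a. a \<in> summands d \<Longrightarrow> a \<noteq> a0 \<Longrightarrow> x \<bullet> (Cf a m \<beta> *v y) = 0" for x y a0 m
  proof -
    interpret M: linear "\<lambda>M. x \<bullet> (M *v y)" by (rule linear_form)
    have "0 = x \<bullet> ((\<Sum>a\<in>summands d. Cf a m \<beta>) *v y)" using sum0[OF m(1) \<beta>m(1)[OF m]] by simp
    also have "\<dots> = (\<Sum>a\<in>summands d. x \<bullet> (Cf a m \<beta> *v y))" by (rule M.sum)
    also have "\<dots> = x \<bullet> (Cf a0 m \<beta> *v y)" using finite_summands a0 oth by (subst sum.remove[of _ a0]) auto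
    finally show ?thesis by simp
  qed
  have fam_off: "fam f' K m \<beta> = 0" if "f' \<noteq> f" for f' K m
    using that expo_supp[of \<beta> f'] by (auto simp: fam_def f_def)
  \<comment> \<open>At a fixed exponent only the summands at its support \<open>f\<close> and the
    bubble of the current cell can contribute.\<close>
  have cases_at: "Cf a m \<beta> = 0 \<or> a = NormalTensors f \<or> a = Enrichment f \<or> a = InteriorNormal f \<or>
      (\<exists>F. a = InteriorTN F f) \<or> a = ElementBubble m" if aS: "a \<in> summands d" for a m
  proof (cases a)
    case (NormalTensors g)
    then obtain K where "Cf a = fam g K" using co[OF aS] by auto
    then show ?thesis using fam_off[of g K m] NormalTensors by (cases "g = f") auto
  next
    case (Enrichment g)
    then obtain K where "Cf a = fam g K" using co[OF aS] by auto
    then show ?thesis using fam_off[of g K m] Enrichment by (cases "g = f") auto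
  next
    case (InteriorNormal g)
    then obtain K where "Cf a = fam g K" using co[OF aS] by auto
    then show ?thesis using fam_off[of g K m] InteriorNormal by (cases "g = f") auto
  next
    case (InteriorTN F g)
    then obtain K where "Cf a = fam g K" using co[OF aS] by auto
    then show ?thesis using fam_off[of g K m] InteriorTN by (cases "g = f") auto
  next
    case (ElementBubble i)
    then obtain x where "Cf a = (\<lambda>m \<beta>. if m = i then x \<beta> else 0)" using co[OF aS] by auto
    then show ?thesis using ElementBubble by (cases "m = i") auto
  qed
  have eb: "x \<bullet> (Cf (ElementBubble m) m \<beta> *v y) = 0"
    if "m \<le> d" "m \<notin> f" "y \<in> normal_comp v f" for x y m
  proof -
    have "ElementBubble m \<in> summands d" using that by (simp add: summand_iff)
    then have "Cf (ElementBubble m) m \<beta> \<in> tangent_tensors f"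
      using co[of "ElementBubble m"] \<beta>m(1)[OF that(1,2)] by (auto simp: f_def)
    then show ?thesis using that(3) by (rule tangent_tensors_normal)
  qed
  have tnE: "\<exists>t\<in>tangent v f. \<forall>m. m \<notin> f \<longrightarrow> Cf (InteriorTN F f) m \<beta> = tn_coeff F f t m"
    if "InteriorTN F f \<in> summands d" for F
    using co[OF that] \<beta>f by (auto simp: fam_def)
  have tnN: "x \<bullet> (Cf (InteriorTN F f) m \<beta> *v y) = 0"
    if "InteriorTN F f \<in> summands d" "m \<notin> f" "x \<in> normal_comp v f" "y \<in> normal_comp v f" for F x y m
    using tnE[OF that(1)] that(2) tn_form_normal[OF _ that(3,4)] by metis
  have facet: "\<exists>j. j \<le> d \<and> j \<in> J m - f \<and> F = J m - {j}"
    if F: "InteriorTN F f \<in> summands d" and m: "m \<le> d" "F \<subseteq> J m" for F m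
  proof -
    obtain i j where ij: "i \<le> d" "j \<le> d" "i \<noteq> j" "F = {..Suc d} - {i, j}" and fF: "f \<subseteq> F"
      using F unfolding summand_iff interior_facet_iff by blast
    have "m \<in> {i, j}" using m ij by (auto simp: cell_idx_def)
    then show ?thesis
    proof (elim insertE emptyE)
      assume "m = i"
      then show ?thesis using ij fF by (intro exI[of _ j]) (auto simp: cell_idx_def)
    next
      assume "m = j"
      then show ?thesis using ij fF by (intro exI[of _ i]) (auto simp: cell_idx_def)
    qed
  qed
  have NE: "Cf (NormalTensors f) m \<beta> = 0 \<and> Cf (Enrichment f) m \<beta> = 0" if fd: "f \<subseteq> {..d}" for m
  proof -
    have "card f \<le> card ({..d} - {n})" using fd fn by (intro card_mono) auto
    then have card: "card f \<le> d" using n by simp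
    have sN: "NormalTensors f \<in> summands d" and sE: "Enrichment f \<in> summands d"
      using fd fne card by (auto simp: summand_iff)
    \<comment> \<open>A face either lies in the simplex or contains the center, so interior normal
      tensors do not compete here.\<close>
    have no_int: "InteriorNormal f \<notin> summands d" using fd by (auto simp: summand_iff)
    obtain A where A: "A \<in> normal_tensors v f" "\<And>m. m \<notin> f \<Longrightarrow> Cf (NormalTensors f) m \<beta> = A"
      using co[OF sN] \<beta>f by (auto simp: fam_def)
    obtain x where E: "\<And>m. m \<notin> f \<Longrightarrow> Cf (Enrichment f) m \<beta> =
        (\<Sum>(i, j)\<in>enrich_pairs f. x (i, j) *\<^sub>R enrich_coeff f i j m)"
    proof -
      obtain x0 where "Cf (Enrichment f) = fam f (\<lambda>\<beta> m. \<Sum>(i, j)\<in>enrich_pairs f. x0 (\<beta>, i, j) *\<^sub>R enrich_coeff f i j m)"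
        using co[OF sE] by auto
      then show ?thesis using that[of "\<lambda>y. x0 (\<beta>, y)"] \<beta>f by (simp add: fam_def case_prod_unfold)
    qed
    have gN: "gm p \<in> normal_comp v f" if "p \<in> {..d} - f" for p using gm_normal[OF fd that] .
    have diag: "gm p \<bullet> (A *v gm p) = 0" if p: "p \<in> {..d} - f" for p
    proof -
      have "gm p \<bullet> (Cf (NormalTensors f) p \<beta> *v gm p) = 0"
      proof (rule isolate[OF _ _ sN])
        fix a assume a: "a \<in> summands d" "a \<noteq> NormalTensors f"
        have "gm p \<bullet> (Cf (Enrichment f) p \<beta> *v gm p) = 0"
          using E[of p] enrich_form[OF fd fne p p] p by simp
        then show "gm p \<bullet> (Cf a p \<beta> *v gm p) = 0"
          using cases_at[OF a(1), of p] a no_int eb[of p "gm p"] tnN[of _ p] gN[OF p] p by auto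
      qed (use p in auto)
      then show ?thesis using A(2)[of p] p by simp
    qed
    \<comment> \<open>The pair \<open>gm j\<close>, \<open>gm j\<close> is tested on the cell
      \<open>i\<close>: the normal tensor is the same there as on the cell \<open>j\<close>, where
      \<open>diag\<close> has shown its value to be zero.\<close>
    have x0: "x (i, j) = 0" if ij: "(i, j) \<in> enrich_pairs f" for i j
    proof -
      have i: "i \<in> {..d} - f" and j: "j \<in> {..d} - f" and "i < j" using ij by (auto simp: enrich_pairs_def)
      have "gm j \<bullet> (Cf (Enrichment f) i \<beta> *v gm j) = 0"
      proof (rule isolate[OF _ _ sE])
        fix a assume a: "a \<in> summands d" "a \<noteq> Enrichment f"
        show "gm j \<bullet> (Cf a i \<beta> *v gm j) = 0"
          using cases_at[OF a(1), of i] a no_int eb[of i "gm j"] tnN[of _ i] gN[OF j] i diag[OF j] A(2)[of i] by auto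
      qed (use i in auto)
      then show ?thesis using E[of i] enrich_form[OF fd fne i j, of x] i \<open>i < j\<close> by simp
    qed
    have E0: "Cf (Enrichment f) m \<beta> = 0" for m
    proof (cases "m \<in> f")
      case True
      then show ?thesis using co[OF sE] by (auto simp: fam_def)
    next
      case False
      show ?thesis unfolding E[OF False] using x0 by (intro sum.neutral) auto
    qed
    have "A = 0"
    proof (rule normal_tensors_zero[OF A(1) normal_comp_span_gm[OF n fn(2) fd fne]])
      fix p q assume "p \<in> gm ` ({..d} - f)" "q \<in> gm ` ({..d} - f)"
      then have pq: "p \<in> normal_comp v f" "q \<in> normal_comp v f" using gN by auto
      have "p \<bullet> (Cf (NormalTensors f) n \<beta> *v q) = 0"
      proof (rule isolate[OF n fn(2) sN])
        fix a assume a: "a \<in> summands d" "a \<noteq> NormalTensors f"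
        show "p \<bullet> (Cf a n \<beta> *v q) = 0"
          using cases_at[OF a(1), of n] a no_int eb[of n q] tnN[of _ n] pq n fn E0 by auto
      qed
      then show "p \<bullet> (A *v q) = 0" using A(2)[OF fn(2)] by simp
    next
      fix t q assume t: "t \<in> tangent v f" and "q \<in> gm ` ({..d} - f)"
      then obtain p where p: "q = gm p" "p \<in> {..d} - f" by blast
      \<comment> \<open>The cell is chosen to match the gradient: interior facets of the cell
        \<open>p\<close> lie opposite vertices \<open>j \<noteq> p\<close> of the simplex, and the
        edge from \<open>s\<close> to such a \<open>j\<close> is orthogonal to \<open>gm p\<close>,
        which silences every tangential-normal function.\<close>
      have "t \<bullet> (Cf (NormalTensors f) p \<beta> *v gm p) = 0"
      proof (rule isolate[OF _ _ sN])
        fix a assume a: "a \<in> summands d" "a \<noteq> NormalTensors f"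
        have tn: "t \<bullet> (Cf (InteriorTN F f) p \<beta> *v gm p) = 0" if F: "InteriorTN F f \<in> summands d" for F
        proof -
          obtain t' where t': "t' \<in> tangent v f" "Cf (InteriorTN F f) p \<beta> = tn_coeff F f t' p"
            using tnE[OF F] p by auto
          show ?thesis
          proof (cases "F \<subseteq> J p")
            case True
            then obtain j where j: "j \<le> d" "j \<in> J p - f" "F = J p - {j}" using facet[OF F] p by auto
            have "edge_vec v s j \<bullet> gm p = 0"
              using gm_edge[of p s j] j p s fd by (auto simp: inner_commute cell_idx_def)
            then show ?thesis
              using tn_form[OF _ j(2) \<beta>m(2) s t'(1) gN[OF p(2)], of t] p t'(2) j(3) by auto
          qed (simp add: t'(2) tn_coeff_def)
        qed
        show "t \<bullet> (Cf a p \<beta> *v gm p) = 0"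
          using cases_at[OF a(1), of p] a no_int eb[of p "gm p"] tn gN[OF p(2)] p E0 by auto
      qed (use p in auto)
      then show "t \<bullet> (A *v q) = 0" using A(2)[of p] p by simp
    qed
    then have "Cf (NormalTensors f) m \<beta> = 0" using A(2)[of m] co[OF sN] by (cases "m \<in> f") (auto simp: fam_def)
    then show ?thesis using E0 by simp
  qed
  \<comment> \<open>For a face through the center one cell is enough: normal pairs silence the
    tangential-normal functions and the bubble, and pairs with a tangent vector vanish because both
    factors of \<open>A\<close> are normal.\<close>
  have IN: "Cf (InteriorNormal f) m \<beta> = 0" if sI: "InteriorNormal f \<in> summands d" for m
  proof -
    have no: "NormalTensors f \<notin> summands d" "Enrichment f \<notin> summands d" using sI by (auto simp: summand_iff)
    obtain A where A: "A \<in> sym_space (normal_comp v f) (normal_comp v f)"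
        "\<And>m. m \<notin> f \<Longrightarrow> Cf (InteriorNormal f) m \<beta> = A"
      using co[OF sI] \<beta>f by (auto simp: fam_def)
    have "A = 0"
    proof (rule normal_tensors_zero[OF _ normal_comp_span_cg[OF n fn(1) fne]])
      show "A \<in> normal_tensors v f" using A(1) normal_sym_subset by blast
      fix p q assume "p \<in> cg n ` (J n - f)" "q \<in> cg n ` (J n - f)"
      then have pq: "p \<in> normal_comp v f" "q \<in> normal_comp v f" using cg_normal[OF n fn(1)] by auto
      have "p \<bullet> (Cf (InteriorNormal f) n \<beta> *v q) = 0"
      proof (rule isolate[OF n fn(2) sI])
        fix a assume a: "a \<in> summands d" "a \<noteq> InteriorNormal f"
        show "p \<bullet> (Cf a n \<beta> *v q) = 0"
          using cases_at[OF a(1), of n] a no eb[of n q] tnN[of _ n] pq n fn by auto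
      qed
      then show "p \<bullet> (A *v q) = 0" using A(2)[OF fn(2)] by simp
    qed (use A(1) normal_sym_tangent in blast)
    then show ?thesis using A(2)[of m] co[OF sI] by (cases "m \<in> f") (auto simp: fam_def)
  qed
  have first: "Cf a m \<beta> = 0" if "a \<in> summands d" "a \<in> {NormalTensors f, Enrichment f, InteriorNormal f}" for a m
    using that NE IN by (auto simp: summand_iff)
  \<comment> \<open>With the normal tensors and the enrichment gone, pairing \<open>t\<close> itself
    with the gradient of the vertex opposite \<open>F\<close> sees no other facet of the cell, and
    the value is a nonzero multiple of \<open>t \<bullet> t\<close>.\<close>
  have TN: "Cf (InteriorTN F f) n \<beta> = 0" if F: "InteriorTN F f \<in> summands d" for F
  proof -
    obtain t where t: "t \<in> tangent v f" "Cf (InteriorTN F f) n \<beta> = tn_coeff F f t n"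
      using tnE[OF F] fn by auto
    show ?thesis
    proof (cases "F \<subseteq> J n")
      case True
      obtain p where p: "p \<in> J n - f" "F = J n - {p}" using facet[OF F n True] by blast
      have cgN: "cg n p \<in> normal_comp v f" using cg_normal[OF n fn(1) p(1)] .
      have edge: "edge_vec v s j \<bullet> cg n p = (if p = j then 1 else 0)" if "j \<in> J n" for j
        using cg_edge[OF n, of p s j] that p s fn by (auto simp: inner_commute)
      have "t \<bullet> (Cf (InteriorTN F f) n \<beta> *v cg n p) = 0"
      proof (rule isolate[OF n fn(2) F])
        fix a assume a: "a \<in> summands d" "a \<noteq> InteriorTN F f"
        have tn: "t \<bullet> (Cf (InteriorTN F' f) n \<beta> *v cg n p) = 0" if F': "InteriorTN F' f \<in> summands d" "F' \<noteq> F" for F'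
        proof -
          obtain t' where t': "t' \<in> tangent v f" "Cf (InteriorTN F' f) n \<beta> = tn_coeff F' f t' n"
            using tnE[OF F'(1)] fn by auto
          show ?thesis
          proof (cases "F' \<subseteq> J n")
            case True
            then obtain j where j: "j \<in> J n - f" "F' = J n - {j}" using facet[OF F'(1) n] by blast
            then have "p \<noteq> j" using F'(2) p(2) by blast
            then show ?thesis
              using tn_form[OF n j(1) fn(1) s t'(1) cgN, of t] edge[of j] j t'(2) by auto
          qed (simp add: t'(2) tn_coeff_def)
        qed
        show "t \<bullet> (Cf a n \<beta> *v cg n p) = 0"
          using cases_at[OF a(1), of n] a eb[OF n fn(2) cgN] tn first[OF a(1)] by auto
      qed
      moreover have "edge_vec v s p \<bullet> nu F \<noteq> 0" using nhat_form[OF nu n p(1) fn(1) s] p(2) by blast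
      ultimately have "t \<bullet> t = 0"
        using tn_form[OF n p(1) fn(1) s t(1) cgN, of t] edge[of p] p t(2) by auto
      then show ?thesis by (simp add: t(2) tn_coeff_def)
    qed (simp add: t(2) tn_coeff_def)
  qed
  have sB: "ElementBubble n \<in> summands d" using n by (simp add: summand_iff)
  \<comment> \<open>The bubble of the cell is the last summand left, so it vanishes because the sum
    does.\<close>
  have others: "Cf a n \<beta> = 0" if "a \<in> summands d" "a \<noteq> ElementBubble n" for a
    using cases_at[OF that(1), of n] first[OF that(1)] TN that by auto
  have "0 = (\<Sum>a\<in>summands d. Cf a n \<beta>)" using sum0[OF n \<beta>n] by simp
  also have "\<dots> = Cf (ElementBubble n) n \<beta>"
    using finite_summands sB others by (subst sum.remove[of _ "ElementBubble n"]) auto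
  finally show ?thesis using others[OF a] by (cases "a = ElementBubble n") auto
qed

end

section \<open>Dimensions\<close>

lemma real_choose_two: "real (n choose 2) = real n * (real n - 1) / 2"
  by (induction n) (simp_all add: numeral_2_eq_2 field_simps)

lemma card_subsimp: "finite f \<Longrightarrow> card (subsimp l f) = card f choose Suc l"
  unfolding subsimp_def Suc_eq_plus1 by (rule n_subsets)

lemma card_ordered_pairs:
  fixes S :: "nat set"
  assumes "finite S"
  shows "card {(i, j). i \<in> S \<and> j \<in> S \<and> i < j} = card S choose 2"
proof -
  have "bij_betw (\<lambda>(i, j). {i, j}) {(i, j). i \<in> S \<and> j \<in> S \<and> i < j} (subsimp 1 S)"
    unfolding bij_betw_def
  proof
    show "inj_on (\<lambda>(i, j). {i, j}) {(i, j). i \<in> S \<and> j \<in> S \<and> i < j}"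
      by (auto simp: inj_on_def doubleton_eq_iff)
    show "(\<lambda>(i, j). {i, j}) ` {(i, j). i \<in> S \<and> j \<in> S \<and> i < j} = subsimp 1 S"
    proof
      show "(\<lambda>(i, j). {i, j}) ` {(i, j). i \<in> S \<and> j \<in> S \<and> i < j} \<subseteq> subsimp 1 S"
        by (auto simp: subsimp_def card_2_iff)
      show "subsimp 1 S \<subseteq> (\<lambda>(i, j). {i, j}) ` {(i, j). i \<in> S \<and> j \<in> S \<and> i < j}"
      proof
        fix e assume "e \<in> subsimp 1 S"
        then have "e \<subseteq> S" "card e = 2" by (auto simp: subsimp_def)
        then obtain i j where ij: "e = {i, j}" "i \<noteq> j" "i \<in> S" "j \<in> S" by (auto simp: card_2_iff)
        then show "e \<in> (\<lambda>(i, j). {i, j}) ` {(i, j). i \<in> S \<and> j \<in> S \<and> i < j}"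
          by (intro image_eqI[of _ _ "(min i j, max i j)"]) (auto simp: min_def max_def)
      qed
    qed
  qed
  then show ?thesis using card_subsimp[OF assms, of 1] by (simp add: bij_betw_same_card numeral_2_eq_2)
qed

text \<open>The regrouping of \<open>Sigma_div_eq_sum\<close>, now for functions of the index such
  as the dimension.\<close>

lemma sum_summands:
  fixes S :: "summand \<Rightarrow> 'a::comm_monoid_add"
  shows "sum S (summands d) =
    (\<Sum>l\<in>{0..d-1}. \<Sum>f\<in>subsimp l {..d}. S (NormalTensors f)) +
    (\<Sum>l\<in>{0..d-1}. \<Sum>f\<in>subsimp l {..d}. S (Enrichment f)) +
    (\<Sum>l\<in>{0..d-1}. \<Sum>f\<in>interior_subsimp d l. S (InteriorNormal f)) +
    (\<Sum>F\<in>interior_subsimp d (d-1). \<Sum>l\<in>{0..d-1}. \<Sum>f\<in>subsimp l F. S (InteriorTN F f)) +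
    (\<Sum>i\<in>{0..d}. S (ElementBubble i))"
proof -
  let ?L = "{0..d-1}"
  let ?A = "\<Union>l\<in>?L. NormalTensors ` subsimp l {..d}" and ?B = "\<Union>l\<in>?L. Enrichment ` subsimp l {..d}"
  let ?C = "\<Union>l\<in>?L. InteriorNormal ` interior_subsimp d l"
  let ?D = "\<lambda>F. \<Union>l\<in>?L. InteriorTN F ` subsimp l F"
  let ?E = "\<Union>F\<in>interior_subsimp d (d-1). ?D F" and ?G = "ElementBubble ` {0..d}"
  have fin: "finite ?A" "finite ?B" "finite ?C" "finite ?E" "finite ?G"
    by (auto simp: finite_interior_subsimp intro!: finite_subsimp dest: finite_interior_face)
  have disj: "?A \<inter> ?B = {}" "(?A \<union> ?B) \<inter> ?C = {}" "(?A \<union> ?B \<union> ?C) \<inter> ?E = {}"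
    "(?A \<union> ?B \<union> ?C \<union> ?E) \<inter> ?G = {}" by blast+
  have "sum S (summands d) = sum S ?A + sum S ?B + sum S ?C + sum S ?E + sum S ?G"
    unfolding summands_def using fin disj by (simp only: sum.union_disjoint finite_Un simp_thms)
  also have "sum S ?A = (\<Sum>l\<in>?L. \<Sum>f\<in>subsimp l {..d}. S (NormalTensors f))"
    using subsimp_disjoint by (intro sum_UN_image) (simp_all add: inj_def finite_subsimp)
  also have "sum S ?B = (\<Sum>l\<in>?L. \<Sum>f\<in>subsimp l {..d}. S (Enrichment f))"
    using subsimp_disjoint by (intro sum_UN_image) (simp_all add: inj_def finite_subsimp)
  also have "sum S ?C = (\<Sum>l\<in>?L. \<Sum>f\<in>interior_subsimp d l. S (InteriorNormal f))"
    using interior_subsimp_disjoint by (intro sum_UN_image) (simp_all add: inj_def finite_interior_subsimp)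
  also have "sum S ?E = (\<Sum>F\<in>interior_subsimp d (d-1). sum S (?D F))"
    by (subst sum.UNION_disjoint)
      (auto simp: finite_interior_subsimp intro!: finite_subsimp dest: finite_interior_face)
  also have "\<dots> = (\<Sum>F\<in>interior_subsimp d (d-1). \<Sum>l\<in>?L. \<Sum>f\<in>subsimp l F. S (InteriorTN F f))"
  proof (rule sum.cong[OF refl])
    fix F assume "F \<in> interior_subsimp d (d-1)"
    then have "finite F" by (rule finite_interior_face)
    then show "sum S (?D F) = (\<Sum>l\<in>?L. \<Sum>f\<in>subsimp l F. S (InteriorTN F f))"
      using subsimp_disjoint by (intro sum_UN_image) (simp_all add: inj_def finite_subsimp)
  qed
  also have "sum S ?G = (\<Sum>i\<in>{0..d}. S (ElementBubble i))"
    by (simp add: sum.reindex inj_on_def)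
  finally show ?thesis .
qed

section \<open>Directness and H(div) membership of the whole sum\<close>

context split_space
begin

lemma direct_sum_summands: "direct_sum (summands d) (summand_space v nu z k)"
  unfolding direct_sum_def
proof (intro allI impI ballI)
  fix w a
  assume w: "(\<forall>a\<in>summands d. w a \<in> summand_space v nu z k a) \<and> (\<Sum>a\<in>summands d. w a) = 0"
    and a: "a \<in> summands d"
  have "\<forall>a\<in>summands d. \<exists>C. C \<in> coeff a \<and> w a = Psi k C" using w summand_space_eq by blast
  then obtain Cf where Cf: "\<And>a. a \<in> summands d \<Longrightarrow> Cf a \<in> coeff a"
      "\<And>a. a \<in> summands d \<Longrightarrow> w a = Psi k (Cf a)" by metis
  have "Psi k (\<lambda>m \<beta>. \<Sum>a\<in>summands d. Cf a m \<beta>) = (\<Sum>a\<in>summands d. w a)"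
    unfolding Psi_sum[symmetric] using Cf(2) by (intro sum.cong) auto
  then have z0: "Psi k (\<lambda>m \<beta>. \<Sum>a\<in>summands d. Cf a m \<beta>) = 0" using w by simp
  have "w a = Psi k (\<lambda>m \<beta>. 0)" unfolding Cf(2)[OF a]
  proof (rule Psi_cong)
    fix m \<beta> assume "m \<le> d" "\<beta> \<in> Exp k m"
    then show "Cf a m \<beta> = 0"
      using direct_coefficients[of Cf, OF Cf(1) Psi_eq_0[OF z0] a] by blast
  qed
  then show "w a = 0" by (simp add: Psi_zero)
qed

lemma Sigma_div_subset_Hdiv: "Sigma_div v nu z k \<subseteq> Hdiv T"
proof
  fix x assume "x \<in> Sigma_div v nu z k"
  then obtain w where w: "x = (\<Sum>a\<in>summands d. w a)" "\<forall>a\<in>summands d. w a \<in> summand_space v nu z k a"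
    unfolding Sigma_div_eq_sum d_eq[symmetric] set_sum_alt[OF finite_summands] by blast
  have "\<forall>a\<in>summands d. \<exists>C. C \<in> coeff a \<and> w a = Psi k C" using w summand_space_eq by blast
  then obtain Cf where Cf: "\<And>a. a \<in> summands d \<Longrightarrow> Cf a \<in> coeff a"
      "\<And>a. a \<in> summands d \<Longrightarrow> w a = Psi k (Cf a)" by metis
  have "x = (\<Sum>a\<in>summands d. Psi k (Cf a))" unfolding w(1) by (intro sum.cong Cf(2)) auto
  also have "\<dots> = Psi k (\<lambda>m \<beta>. \<Sum>a\<in>summands d. Cf a m \<beta>)" by (rule Psi_sum)
  also have "\<dots> \<in> Hdiv T"
  proof (rule Psi_in_Hdiv)
    fix m \<beta> assume "m \<le> d" "\<beta> \<in> Exp k m"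
    then have "transpose (Cf a m \<beta>) = Cf a m \<beta>" if "a \<in> summands d" for a
      using coeff_sym[OF Cf(1)[OF that]] by blast
    then have "(\<Sum>a\<in>summands d. Cf a m \<beta>) \<in> {A. transpose A = A}"
      by (intro subspace_sum subspace_symmetric CollectI)
    then show "transpose (\<Sum>a\<in>summands d. Cf a m \<beta>) = (\<Sum>a\<in>summands d. Cf a m \<beta>)" by simp
  next
    show "weakly_div_free_flux interior_tests k (\<lambda>m \<beta>. \<Sum>a\<in>summands d. Cf a m \<beta>)"
      unfolding weakly_div_free_flux_def
    proof
      fix \<phi> :: "real^'n \<Rightarrow> real^'n" assume \<phi>: "\<phi> \<in> interior_tests"
      then have lin: "linear (\<lambda>A. flux m \<beta> A \<phi>)" for m \<beta> by (intro linear_flux) auto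
      have "(\<Sum>i\<le>d. \<Sum>\<alpha>\<in>Exp k i. flux i \<alpha> (\<Sum>a\<in>summands d. Cf a i \<alpha>) \<phi>) =
        (\<Sum>i\<le>d. \<Sum>\<alpha>\<in>Exp k i. \<Sum>a\<in>summands d. flux i \<alpha> (Cf a i \<alpha>) \<phi>)"
        by (simp only: linear_sum[OF lin])
      also have "\<dots> = (\<Sum>i\<le>d. \<Sum>a\<in>summands d. \<Sum>\<alpha>\<in>Exp k i. flux i \<alpha> (Cf a i \<alpha>) \<phi>)"
        by (intro sum.cong refl sum.swap)
      also have "\<dots> = (\<Sum>a\<in>summands d. \<Sum>i\<le>d. \<Sum>\<alpha>\<in>Exp k i. flux i \<alpha> (Cf a i \<alpha>) \<phi>)" by (rule sum.swap)
      also have "\<dots> = 0"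
        using coeff_weak[OF _ Cf(1)] \<phi> unfolding weakly_div_free_flux_def by (intro sum.neutral) blast
      finally show "(\<Sum>i\<le>d. \<Sum>\<alpha>\<in>Exp k i. flux i \<alpha> (\<Sum>a\<in>summands d. Cf a i \<alpha>) \<phi>) = 0" .
    qed
  qed
  finally show "x \<in> Hdiv T" .
qed

section \<open>Dimensions of the single summands\<close>

definition finite_dim_subspace :: "'a::real_vector set \<Rightarrow> bool" where
  "finite_dim_subspace W \<longleftrightarrow> subspace W \<and> (\<exists>B. finite B \<and> W = span B)"

text \<open>The parameter of an exponent is the same on all cells, so injectivity of
  \<open>K\<close> on one cell outside \<open>f\<close> suffices. The number of exponents with
  support \<open>f\<close> multiplies the dimension of \<open>X\<close>.\<close>

lemma dim_bubble_family:
  fixes K :: "'e::euclidean_space \<Rightarrow> nat \<Rightarrow> real^'n^'n"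
  assumes f: "f \<subseteq> {..Suc d}" "f \<noteq> {}" and lin: "\<And>m. linear (\<lambda>t. K t m)" and X: "subspace X"
    and i: "i \<le> d" "i \<notin> f" and inj: "\<And>t. t \<in> X \<Longrightarrow> K t i = 0 \<Longrightarrow> t = 0"
    and W: "W = {\<Sum>\<alpha>\<in>expo k f. Psi k (unitC f \<alpha> (K (x \<alpha>))) |x. \<forall>\<alpha>\<in>expo k f. x \<alpha> \<in> X}"
  shows "finite_dim_subspace W \<and> dim W = ((k - 1) choose (card f - 1)) * dim X"
proof -
  have inj': "\<forall>\<alpha>\<in>expo k f. x \<alpha> = 0"
    if x: "\<And>\<alpha>. \<alpha> \<in> expo k f \<Longrightarrow> x \<alpha> \<in> X" and 0: "(\<Sum>\<alpha>\<in>expo k f. Psi k (unitC f \<alpha> (K (x \<alpha>)))) = 0" for x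
  proof
    fix \<alpha> assume \<alpha>: "\<alpha> \<in> expo k f"
    have "f \<subseteq> J i" using f i by (auto simp: cell_idx_def)
    then have "\<alpha> \<in> Exp k i" using expo_Exp[OF i(1)] \<alpha> by blast
    moreover have "Psi k (fam f (\<lambda>\<beta>. K (x \<beta>))) = 0" using 0 sum_Psi_fam[OF f, of "\<lambda>\<alpha>. K (x \<alpha>)"] by simp
    ultimately have "fam f (\<lambda>\<beta>. K (x \<beta>)) i \<alpha> = 0" using Psi_eq_0 i(1) by blast
    then have "K (x \<alpha>) i = 0" using \<alpha> i by (simp add: fam_def)
    then show "x \<alpha> = 0" using inj x \<alpha> by blast
  qed
  note * = dim_linear_family[where X = "\<lambda>_. X", OF finite_expo_face[OF f] linear_Psi_unitC[OF lin] X inj' W]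
  have "card (expo k f) = (k - 1) choose (card f - 1)" using finite_card_expo[of f k] finite_face f k1 by blast
  then show ?thesis using * by (simp add: finite_dim_subspace_def)
qed

lemma card_normal_dim:
  assumes "i \<le> d" "f \<subseteq> J i" "card f = Suc l"
  shows "dim (tangent v f) = l" "real (dim (normal_comp v f)) = real d - real l"
proof -
  have "f \<noteq> {}" using assms(3) by auto
  then show l: "dim (tangent v f) = l" using dim_tangent[OF assms(1,2)] assms(3) by simp
  then show "real (dim (normal_comp v f)) = real d - real l" using dim_normal_comp[of f] by linarith
qed

lemma missing_cell:
  assumes "f \<subseteq> {..Suc d}" "card f = Suc l" "l < d"
  obtains i where "i \<le> d" "i \<notin> f" "f \<subseteq> J i"
proof -
  obtain i where "i \<le> d" "i \<notin> f" using face_missing_index[OF assms(1)] assms by auto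
  then show ?thesis using assms(1) by (intro that) (auto simp: cell_idx_def)
qed

lemma dim_NormalTensors:
  assumes f: "f \<subseteq> {..d}" "card f = Suc l" "l < d"
  defines "W \<equiv> summand_space v nu z k (NormalTensors f)"
  shows "finite_dim_subspace W" "real (dim W) = real ((k - 1) choose l) * ((real d - real l) * (real d - real l + 1) / 2 + real l * (real d - real l))"
proof -
  have f': "f \<subseteq> {..Suc d}" "f \<noteq> {}" using f by auto
  obtain i where i: "i \<le> d" "i \<notin> f" "f \<subseteq> J i" using missing_cell[OF f'(1) f(2,3)] by blast
  have *: "finite_dim_subspace W \<and> dim W = ((k - 1) choose (card f - 1)) * dim (normal_tensors v f)"
    by (rule dim_bubble_family[OF f' _ subspace_normal_tensors i(1,2), where K = "\<lambda>A m. A"])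
      (simp_all add: W_def const_bubble_family[OF f' subspace_normal_tensors] linear_id[unfolded id_def])
  then show "finite_dim_subspace W" by blast
  have "2 * dim (normal_tensors v f) = 2 * dim (tangent v f) * dim (normal_comp v f) + dim (normal_comp v f) * (dim (normal_comp v f) + 1)"
    unfolding normal_tensors_def by (rule dim_normal_sym) (auto dest: normal_comp_orthogonal')
  then have "2 * real (dim (normal_tensors v f)) = 2 * real (dim (tangent v f)) * real (dim (normal_comp v f)) +
      real (dim (normal_comp v f)) * (real (dim (normal_comp v f)) + 1)"
    by (metis (no_types, opaque_lifting) of_nat_1 of_nat_add of_nat_mult of_nat_numeral)
  then have "real (dim (normal_tensors v f)) = (real d - real l) * (real d - real l + 1) / 2 + real l * (real d - real l)"
    unfolding card_normal_dim[OF i(1,3) f(2)] by (simp add: field_simps)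
  then show "real (dim W) = real ((k - 1) choose l) * ((real d - real l) * (real d - real l + 1) / 2 + real l * (real d - real l))"
    using * f(2) by simp
qed

lemma dim_sym_space_real:
  fixes V :: "(real^'n) set"
  assumes "subspace V"
  shows "real (dim (sym_space V V)) = real (dim V) * (real (dim V) + 1) / 2"
proof -
  have "2 * real (dim (sym_space V V)) = real (dim V) * (real (dim V) + 1)"
    using dim_sym_space[OF assms] by (metis (no_types, opaque_lifting) of_nat_1 of_nat_add of_nat_mult of_nat_numeral)
  then show ?thesis by simp
qed

lemma dim_InteriorNormal:
  assumes f: "f \<subseteq> {..Suc d}" "card f = Suc l" "l < d"
  defines "W \<equiv> summand_space v nu z k (InteriorNormal f)"
  shows "finite_dim_subspace W" "real (dim W) = real ((k - 1) choose l) * ((real d - real l) * (real d - real l + 1) / 2)"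
proof -
  have f': "f \<subseteq> {..Suc d}" "f \<noteq> {}" using f by auto
  obtain i where i: "i \<le> d" "i \<notin> f" "f \<subseteq> J i" using missing_cell[OF f] by blast
  have *: "finite_dim_subspace W \<and> dim W = ((k - 1) choose (card f - 1)) * dim (sym_space (normal_comp v f) (normal_comp v f))"
    by (rule dim_bubble_family[OF f' _ subspace_sym_space i(1,2), where K = "\<lambda>A m. A"])
      (simp_all add: W_def const_bubble_family[OF f' subspace_sym_space] linear_id[unfolded id_def])
  then show "finite_dim_subspace W" by blast
  show "real (dim W) = real ((k - 1) choose l) * ((real d - real l) * (real d - real l + 1) / 2)"
    using * f(2) by (simp add: dim_sym_space_real card_normal_dim[OF i(1,3) f(2)])
qed

lemma dim_InteriorTN:
  assumes F: "F \<in> interior_subsimp d (d - 1)" and f: "f \<subseteq> F" "card f = Suc l"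
  defines "W \<equiv> summand_space v nu z k (InteriorTN F f)"
  shows "finite_dim_subspace W" "real (dim W) = real ((k - 1) choose l) * real l"
proof -
  have f': "f \<subseteq> {..Suc d}" "f \<noteq> {}" using interior_facet_subset[OF F] f by auto
  obtain i j where ij: "i \<le> d" "j \<le> d" "i \<noteq> j" "F = {..Suc d} - {i, j}" using F interior_facet_iff by blast
  have i: "i \<le> d" "i \<notin> f" "f \<subseteq> J i" "j \<in> J i - f" "F = J i - {j}" using ij f by (auto simp: cell_idx_def)
  obtain s where s: "s \<in> f" using f' by blast
  \<comment> \<open>Pairing \<open>t\<close> with the gradient of the vertex opposite
    \<open>F\<close> gives a nonzero multiple of \<open>t \<bullet> t\<close>.\<close>
  have inj: "t = 0" if t: "t \<in> tangent v f" and 0: "tn_coeff F f t i = 0" for t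
  proof -
    have "edge_vec v s j \<bullet> cg i j = 1" using cg_edge[OF i(1), of j s j] i s by (auto simp: inner_commute)
    moreover have "edge_vec v s j \<bullet> nu F \<noteq> 0" using nhat_form[OF nu i(1,4,3) s] unfolding i(5) by blast
    ultimately have "t \<bullet> t = 0"
      using tn_form[OF i(1,4,3) s t cg_normal[OF i(1,3,4)], of t] 0 i(5) by simp
    then show ?thesis by simp
  qed
  have lin: "linear (\<lambda>t. tn_coeff F f t m)" for m
    unfolding tn_coeff_def using linear_sym_tensor_left by (cases "F \<subseteq> J m") (auto simp: linear_iff)
  have *: "finite_dim_subspace W \<and> dim W = ((k - 1) choose (card f - 1)) * dim (tangent v f)"
    by (rule dim_bubble_family[OF f' lin subspace_tangent i(1,2) inj])
      (simp_all add: W_def tn_bubble_family[OF f'])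
  then show "finite_dim_subspace W" by blast
  show "real (dim W) = real ((k - 1) choose l) * real l"
    using * f(2) card_normal_dim(1)[OF i(1,3) f(2)] by simp
qed

lemma dim_Enrichment:
  assumes f: "f \<subseteq> {..d}" "card f = Suc l" "l < d"
  defines "W \<equiv> summand_space v nu z k (Enrichment f)"
  shows "finite_dim_subspace W" "real (dim W) = real ((k - 1) choose l) * ((real d - real l) * (real d - real l - 1) / 2)"
proof -
  have f': "f \<subseteq> {..Suc d}" "f \<noteq> {}" using f by auto
  let ?J = "expo k f \<times> enrich_pairs f"
  let ?L = "\<lambda>y r. r *\<^sub>R Psi k (unitC f (fst y) (enrich_coeff f (fst (snd y)) (snd (snd y))))"
  have W: "W = {\<Sum>y\<in>?J. ?L y (x y) |x. \<forall>y\<in>?J. x y \<in> UNIV}"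
    unfolding W_def summand_space.simps enrich_bubble_family[OF f'] by (simp add: case_prod_unfold)
  have lin: "linear (?L y)" for y by (rule linearI) (simp_all add: scaleR_add_left)
  \<comment> \<open>On the cell \<open>i\<close>, the pair \<open>gm j\<close>, \<open>gm j\<close>
    reads off the single coefficient of \<open>i\<close>, \<open>j\<close>.\<close>
  have inj: "\<forall>y\<in>?J. x y = 0" if 0: "(\<Sum>y\<in>?J. ?L y (x y)) = 0" for x
  proof clarify
    fix \<alpha> i j assume \<alpha>: "\<alpha> \<in> expo k f" and ij: "(i, j) \<in> enrich_pairs f"
    have i: "i \<in> {..d} - f" "j \<in> {..d} - f" "i < j" using ij by (auto simp: enrich_pairs_def)
    have "f \<subseteq> J i" using f' i by (auto simp: cell_idx_def)
    then have \<alpha>i: "\<alpha> \<in> Exp k i" using expo_Exp[of i f] \<alpha> i by auto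
    have "Psi k (fam f (\<lambda>\<beta> m. \<Sum>(i, j)\<in>enrich_pairs f. x (\<beta>, i, j) *\<^sub>R enrich_coeff f i j m)) = 0"
      using 0 unfolding sum_enrich[OF f', symmetric] by (simp add: case_prod_unfold)
    then have "fam f (\<lambda>\<beta> m. \<Sum>(i, j)\<in>enrich_pairs f. x (\<beta>, i, j) *\<^sub>R enrich_coeff f i j m) i \<alpha> = 0"
      using Psi_eq_0[OF _ _ \<alpha>i] i by blast
    then have "(\<Sum>(i', j')\<in>enrich_pairs f. x (\<alpha>, i', j') *\<^sub>R enrich_coeff f i' j' i) = 0"
      using \<alpha> i by (simp add: fam_def)
    then show "x (\<alpha>, i, j) = 0"
      using enrich_form[OF f(1) f'(2) i(1,2), of "\<lambda>y. x (\<alpha>, y)"] i(3) by simp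
  qed
  have finJ: "finite ?J" using finite_expo_face[OF f'] by simp
  note * = dim_linear_family[where X = "\<lambda>_. UNIV", OF finJ lin subspace_UNIV inj W]
  then show "finite_dim_subspace W" by (simp add: finite_dim_subspace_def)
  have "card ({..d} - f) = d - l" using f by (simp add: card_Diff_subset finite_subset)
  then have "real (card (enrich_pairs f)) = (real d - real l) * (real d - real l - 1) / 2"
    using card_ordered_pairs[of "{..d} - f"] f(3) by (simp add: enrich_pairs_def real_choose_two of_nat_diff)
  moreover have "card (expo k f) = (k - 1) choose l"
    using finite_card_expo[of f k] finite_face f' k1 f(2) by auto
  ultimately show "real (dim W) = real ((k - 1) choose l) * ((real d - real l) * (real d - real l - 1) / 2)"
    using *(3) by (simp add: card_cartesian_product)
qed

lemma dim_ElementBubble: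
  assumes i: "i \<le> d"
  defines "W \<equiv> summand_space v nu z k (ElementBubble i)"
  shows "finite_dim_subspace W"
    "real (dim W) = (\<Sum>l\<in>{0..d}. real (Suc d choose Suc l) * (real ((k - 1) choose l) * (real l * (real l + 1) / 2)))"
proof -
  let ?L = "\<lambda>\<alpha> A. Psi k (\<lambda>m \<beta>. if m = i \<and> \<beta> = \<alpha> then A else 0)"
  have sumL: "(\<Sum>\<alpha>\<in>Exp k i. ?L \<alpha> (x \<alpha>)) = Psi k (\<lambda>m \<alpha>. if m = i then x \<alpha> else 0)" for x
    unfolding Psi_sum
  proof (rule Psi_cong)
    fix m \<beta> assume "\<beta> \<in> Exp k m"
    moreover have "(\<Sum>\<alpha>\<in>Exp k i. if m = i \<and> \<beta> = \<alpha> then x \<alpha> else 0) =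
        (\<Sum>\<alpha>\<in>Exp k i. if \<alpha> = \<beta> then (if m = i then x \<beta> else 0) else 0)" by (intro sum.cong) auto
    ultimately show "(\<Sum>\<alpha>\<in>Exp k i. if m = i \<and> \<beta> = \<alpha> then x \<alpha> else 0) = (if m = i then x \<beta> else 0)" by auto
  qed
  have W: "W = {\<Sum>\<alpha>\<in>Exp k i. ?L \<alpha> (x \<alpha>) |x. \<forall>\<alpha>\<in>Exp k i. x \<alpha> \<in> tangent_tensors (supp \<alpha>)}"
    unfolding W_def summand_space.simps div_bubble_eq[OF i k1] sumL ..
  have lin: "linear (?L \<alpha>)" for \<alpha>
    by (rule linearI) (unfold Psi_add Psi_scaleR; rule Psi_cong; simp)+
  have inj: "\<forall>\<alpha>\<in>Exp k i. x \<alpha> = 0" if "(\<Sum>\<alpha>\<in>Exp k i. ?L \<alpha> (x \<alpha>)) = 0" for x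
    using Psi_eq_0[OF that[unfolded sumL] i] by simp
  note * = dim_linear_family[where X = "\<lambda>\<alpha>. tangent_tensors (supp \<alpha>)", OF finite_Exp lin subspace_sym_space inj W]
  then show "finite_dim_subspace W" by (simp add: finite_dim_subspace_def)
  have sub: "finite f" "f \<noteq> {}" "f \<subseteq> {..Suc d}" if "f \<in> subsimp l (J i)" for f l
    using that by (auto simp: subsimp_def cell_idx_def intro: finite_face card_ge_0_finite)
  \<comment> \<open>Exponents sorted by the dimension of their support; \<open>l = d\<close> is the
    full cell, which occurs for no other kind of summand.\<close>
  have Exp: "Exp k i = (\<Union>l\<in>{0..d}. \<Union>f\<in>subsimp l (J i). expo k f)"
  proof (intro subset_antisym subsetI)
    fix \<alpha> assume \<alpha>: "\<alpha> \<in> Exp k i"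
    note s = Exp_expo[OF \<alpha>]
    have "supp \<alpha> \<noteq> {}"
    proof
      assume "supp \<alpha> = {}"
      then have "\<alpha> \<in> expo k {}" using s by simp
      then show False using k1 by (simp add: expo_def)
    qed
    moreover have "finite (supp \<alpha>)" using s finite_J finite_subset by blast
    ultimately have c0: "card (supp \<alpha>) > 0" by (simp add: card_gt_0_iff)
    have "card (supp \<alpha>) \<le> card (J i)" using s by (intro card_mono) auto
    then have "card (supp \<alpha>) - 1 \<in> {0..d}" using i by (auto simp: card_J)
    moreover have "supp \<alpha> \<in> subsimp (card (supp \<alpha>) - 1) (J i)" using s c0 by (auto simp: subsimp_def)
    ultimately show "\<alpha> \<in> (\<Union>l\<in>{0..d}. \<Union>f\<in>subsimp l (J i). expo k f)" using s by blast
  next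
    fix \<alpha> assume "\<alpha> \<in> (\<Union>l\<in>{0..d}. \<Union>f\<in>subsimp l (J i). expo k f)"
    then show "\<alpha> \<in> Exp k i" using expo_Exp[OF i] by (auto simp: subsimp_def)
  qed
  have fin: "finite (subsimp l (J i))" for l by (intro finite_subsimp) simp
  have finx: "finite (expo k f)" if "f \<in> subsimp l (J i)" for f l using finite_expo_face sub[OF that] by blast
  let ?D = "\<lambda>\<alpha>. real (dim (tangent_tensors (supp \<alpha>)))"
  have "real (dim W) = (\<Sum>\<alpha>\<in>Exp k i. ?D \<alpha>)" using *(3) by simp
  also have "\<dots> = (\<Sum>l\<in>{0..d}. sum ?D (\<Union>f\<in>subsimp l (J i). expo k f))"
    unfolding Exp
  proof (rule sum.UNION_disjoint)
    show "\<forall>l\<in>{0..d}. finite (\<Union>f\<in>subsimp l (J i). expo k f)" using fin finx by auto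
    show "\<forall>l\<in>{0..d}. \<forall>l'\<in>{0..d}. l \<noteq> l' \<longrightarrow>
        (\<Union>f\<in>subsimp l (J i). expo k f) \<inter> (\<Union>f\<in>subsimp l' (J i). expo k f) = {}"
      using subsimp_disjoint expo_supp by (metis (no_types, lifting) UN_E disjoint_iff)
  qed simp
  also have "\<dots> = (\<Sum>l\<in>{0..d}. \<Sum>f\<in>subsimp l (J i). sum ?D (expo k f))"
  proof (rule sum.cong[OF refl], rule sum.UNION_disjoint)
    fix l
    show "\<forall>f\<in>subsimp l (J i). \<forall>f'\<in>subsimp l (J i). f \<noteq> f' \<longrightarrow> expo k f \<inter> expo k f' = {}"
      using expo_supp by blast
  qed (use fin finx in auto)
  also have "\<dots> = (\<Sum>l\<in>{0..d}. real (Suc d choose Suc l) * (real ((k - 1) choose l) * (real l * (real l + 1) / 2)))"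
  proof (rule sum.cong[OF refl])
    fix l
    have "sum ?D (expo k f) = real ((k - 1) choose l) * (real l * (real l + 1) / 2)" if f: "f \<in> subsimp l (J i)" for f
    proof -
      have f': "f \<subseteq> J i" "card f = Suc l" using f by (auto simp: subsimp_def)
      have "sum ?D (expo k f) = (\<Sum>\<alpha>\<in>expo k f. real (dim (tangent_tensors f)))"
        using expo_supp by (intro sum.cong) auto
      then show ?thesis
        using finite_card_expo[of f k] sub[OF f] k1 f'(2)
        by (simp add: dim_sym_space_real card_normal_dim(1)[OF i f'])
    qed
    then have "(\<Sum>f\<in>subsimp l (J i). sum ?D (expo k f)) =
        (\<Sum>f\<in>subsimp l (J i). real ((k - 1) choose l) * (real l * (real l + 1) / 2))"
      by (rule sum.cong[OF refl])
    then show "(\<Sum>f\<in>subsimp l (J i). sum ?D (expo k f)) = real (Suc d choose Suc l) * (real ((k - 1) choose l) * (real l * (real l + 1) / 2))"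
      unfolding sum_constant card_subsimp[OF finite_J] card_J[OF i] by (simp only: Suc_eq_plus1)
  qed
  finally show "real (dim W) = (\<Sum>l\<in>{0..d}. real (Suc d choose Suc l) * (real ((k - 1) choose l) * (real l * (real l + 1) / 2)))" .
qed

text \<open>An interior face is the center joined to \<open>l\<close> of the \<open>d + 1\<close>
  vertices.\<close>

lemma card_interior_subsimp:
  assumes "l < d"
  shows "card (interior_subsimp d l) = Suc d choose l"
proof -
  have "bij_betw (insert (Suc d)) {e. e \<subseteq> {..d} \<and> card e = l} (interior_subsimp d l)"
  proof (rule bij_betw_byWitness[where f' = "\<lambda>f. f - {Suc d}"])
    show "\<forall>e\<in>{e. e \<subseteq> {..d} \<and> card e = l}. insert (Suc d) e - {Suc d} = e" by auto
    show "\<forall>f\<in>interior_subsimp d l. insert (Suc d) (f - {Suc d}) = f" using assms by (auto simp: interior_subsimp_iff)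
    show "insert (Suc d) ` {e. e \<subseteq> {..d} \<and> card e = l} \<subseteq> interior_subsimp d l"
    proof clarify
      fix e assume e: "e \<subseteq> {..d}" "l = card e"
      then have "finite e" "Suc d \<notin> e" using finite_subset by auto
      then show "insert (Suc d) e \<in> interior_subsimp d (card e)" using e assms by (auto simp: interior_subsimp_iff)
    qed
    show "(\<lambda>f. f - {Suc d}) ` interior_subsimp d l \<subseteq> {e. e \<subseteq> {..d} \<and> card e = l}"
      using assms by (auto simp: interior_subsimp_iff card_Diff_singleton le_Suc_eq subset_iff)
  qed
  then have "card (interior_subsimp d l) = card {e. e \<subseteq> {..d} \<and> card e = l}" by (simp add: bij_betw_same_card)
  then show ?thesis by (simp add: n_subsets)
qed

lemma finite_dim_summand:
  assumes "a \<in> summands d"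
  shows "finite_dim_subspace (summand_space v nu z k a)"
proof -
  have l: "\<exists>l<d. card f = Suc l" if "f \<noteq> {}" "card f \<le> d" "f \<subseteq> {..Suc d}" for f
    using that finite_face[of f] card_gt_0_iff[of f] by (intro exI[of _ "card f - 1"]) auto
  show ?thesis
  proof (cases a)
    case (NormalTensors f)
    then have f: "f \<subseteq> {..d}" "f \<noteq> {}" "card f \<le> d" using assms by (auto simp: summand_iff)
    then have "f \<subseteq> {..Suc d}" by auto
    then show ?thesis using l[OF f(2,3)] dim_NormalTensors(1)[OF f(1)] NormalTensors by blast
  next
    case (Enrichment f)
    then have f: "f \<subseteq> {..d}" "f \<noteq> {}" "card f \<le> d" using assms by (auto simp: summand_iff)
    then have "f \<subseteq> {..Suc d}" by auto
    then show ?thesis using l[OF f(2,3)] dim_Enrichment(1)[OF f(1)] Enrichment by blast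
  next
    case (InteriorNormal f)
    then have f: "f \<subseteq> {..Suc d}" "f \<noteq> {}" "card f \<le> d" using assms by (auto simp: summand_iff)
    then show ?thesis using l[OF f(2,3,1)] dim_InteriorNormal(1)[OF f(1)] InteriorNormal by blast
  next
    case (InteriorTN F f)
    then have F: "F \<in> interior_subsimp d (d - 1)" and f: "f \<subseteq> F" "f \<noteq> {}" using assms by (auto simp: summand_iff)
    have "finite f" using f finite_interior_face[OF F] finite_subset by blast
    then have "card f = Suc (card f - 1)" using f(2) card_gt_0_iff[of f] by simp
    then show ?thesis using dim_InteriorTN(1)[OF F f(1)] InteriorTN by blast
  next
    case (ElementBubble i)
    then show ?thesis using assms dim_ElementBubble(1) by (simp add: summand_iff)
  qed
qed

lemma dim_summands:
  "(\<Sum>a\<in>summands d. real (dim (summand_space v nu z k a))) =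
    real d * (real d + 1) * real ((k + d - 1) choose (d - 1))
        + 1/2 * real d * (real d + 1) * real ((k + d - 2) choose (d - 1))
        + 1/2 * real d * (real d + 1) * (real k - 1) * real ((k + d - 2) choose (d - 2))
        + 1/2 * real d * (real d + 1)^2 * real ((k + d - 2) choose d)"
proof -
  let ?D = "\<lambda>a. real (dim (summand_space v nu z k a))" and ?L = "{0..d-1}"
  have l: "l < d" if "l \<in> ?L" for l using that d_pos by auto
  have 1: "(\<Sum>l\<in>?L. \<Sum>f\<in>subsimp l {..d}. ?D (NormalTensors f)) =
    (\<Sum>l\<in>?L. real (Suc d choose Suc l) * (real ((k - 1) choose l) * ((real d - real l) * (real d - real l + 1) / 2 + real l * (real d - real l))))"
  proof (rule sum.cong[OF refl])
    fix l assume "l \<in> ?L"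
    then have "(\<Sum>f\<in>subsimp l {..d}. ?D (NormalTensors f)) = (\<Sum>f\<in>subsimp l {..d}. real ((k - 1) choose l) * ((real d - real l) * (real d - real l + 1) / 2 + real l * (real d - real l)))"
      using dim_NormalTensors(2) l by (intro sum.cong refl) (auto simp: subsimp_def)
    then show "(\<Sum>f\<in>subsimp l {..d}. ?D (NormalTensors f)) = real (Suc d choose Suc l) * (real ((k - 1) choose l) * ((real d - real l) * (real d - real l + 1) / 2 + real l * (real d - real l)))"
      unfolding sum_constant card_subsimp[OF finite_atMost] card_atMost .
  qed
  have 2: "(\<Sum>l\<in>?L. \<Sum>f\<in>subsimp l {..d}. ?D (Enrichment f)) =
    (\<Sum>l\<in>?L. real (Suc d choose Suc l) * (real ((k - 1) choose l) * ((real d - real l) * (real d - real l - 1) / 2)))"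
  proof (rule sum.cong[OF refl])
    fix l assume "l \<in> ?L"
    then have "(\<Sum>f\<in>subsimp l {..d}. ?D (Enrichment f)) = (\<Sum>f\<in>subsimp l {..d}. real ((k - 1) choose l) * ((real d - real l) * (real d - real l - 1) / 2))"
      using dim_Enrichment(2) l by (intro sum.cong refl) (auto simp: subsimp_def)
    then show "(\<Sum>f\<in>subsimp l {..d}. ?D (Enrichment f)) = real (Suc d choose Suc l) * (real ((k - 1) choose l) * ((real d - real l) * (real d - real l - 1) / 2))"
      unfolding sum_constant card_subsimp[OF finite_atMost] card_atMost .
  qed
  have 3: "(\<Sum>l\<in>?L. \<Sum>f\<in>interior_subsimp d l. ?D (InteriorNormal f)) =
    (\<Sum>l\<in>?L. real (Suc d choose l) * (real ((k - 1) choose l) * ((real d - real l) * (real d - real l + 1) / 2)))"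
  proof (rule sum.cong[OF refl])
    fix l assume "l \<in> ?L"
    then have ld: "l < d" by (rule l)
    then have "(\<Sum>f\<in>interior_subsimp d l. ?D (InteriorNormal f)) = (\<Sum>f\<in>interior_subsimp d l. real ((k - 1) choose l) * ((real d - real l) * (real d - real l + 1) / 2))"
      using dim_InteriorNormal(2) by (intro sum.cong refl) (auto simp: interior_subsimp_iff)
    then show "(\<Sum>f\<in>interior_subsimp d l. ?D (InteriorNormal f)) = real (Suc d choose l) * (real ((k - 1) choose l) * ((real d - real l) * (real d - real l + 1) / 2))"
      unfolding sum_constant card_interior_subsimp[OF ld] .
  qed
  have 4: "(\<Sum>F\<in>interior_subsimp d (d-1). \<Sum>l\<in>?L. \<Sum>f\<in>subsimp l F. ?D (InteriorTN F f)) =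
    real d * (real d + 1) / 2 * (\<Sum>l\<in>?L. real (d choose Suc l) * (real ((k - 1) choose l) * real l))"
  proof -
    have "(\<Sum>l\<in>?L. \<Sum>f\<in>subsimp l F. ?D (InteriorTN F f)) = (\<Sum>l\<in>?L. real (d choose Suc l) * (real ((k - 1) choose l) * real l))"
      if F: "F \<in> interior_subsimp d (d-1)" for F
    proof (rule sum.cong[OF refl])
      fix l
      have "card F = d" using F d_pos by (auto simp: interior_subsimp_iff)
      then have c: "card (subsimp l F) = d choose Suc l" using card_subsimp[OF finite_interior_face[OF F]] by simp
      have "(\<Sum>f\<in>subsimp l F. ?D (InteriorTN F f)) = (\<Sum>f\<in>subsimp l F. real ((k - 1) choose l) * real l)"
        using dim_InteriorTN(2)[OF F] by (intro sum.cong refl) (auto simp: subsimp_def)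
      then show "(\<Sum>f\<in>subsimp l F. ?D (InteriorTN F f)) = real (d choose Suc l) * (real ((k - 1) choose l) * real l)"
        unfolding sum_constant c .
    qed
    moreover have "real (card (interior_subsimp d (d-1))) = real d * (real d + 1) / 2"
    proof -
      \<comment> \<open>Each interior facet is the common facet of one pair of cells.\<close>
      have "Suc d choose (d - 1) = Suc d choose 2" using binomial_symmetric[of "d - 1" "Suc d"] d_pos by simp
      then show ?thesis using d_pos by (simp add: card_interior_subsimp real_choose_two mult.commute)
    qed
    ultimately show ?thesis by simp
  qed
  have 5: "(\<Sum>i\<in>{0..d}. ?D (ElementBubble i)) =
    (real d + 1) * (\<Sum>l\<in>{0..d}. real (Suc d choose Suc l) * (real ((k - 1) choose l) * (real l * (real l + 1) / 2)))"
  proof -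
    have "(\<Sum>i\<in>{0..d}. ?D (ElementBubble i)) = (\<Sum>i\<in>{0..d}. \<Sum>l\<in>{0..d}. real (Suc d choose Suc l) * (real ((k - 1) choose l) * (real l * (real l + 1) / 2)))"
      using dim_ElementBubble(2) by (intro sum.cong refl) auto
    then show ?thesis unfolding sum_constant by (simp add: add.commute)
  qed
  show ?thesis unfolding sum_summands 1 2 3 4 5 by (rule dim_count_sum[OF d2 k1])
qed

lemma Sigma_div_finite_dim:
  "subspace (Sigma_div v nu z k)"
  "\<exists>B. finite B \<and> Sigma_div v nu z k = span B"
  "real (dim (Sigma_div v nu z k)) = (\<Sum>a\<in>summands d. real (dim (summand_space v nu z k a)))"
proof -
  have S: "Sigma_div v nu z k = sum (summand_space v nu z k) (summands d)"
    unfolding Sigma_div_eq_sum d_eq[symmetric] ..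
  have sub: "subspace (summand_space v nu z k a)" and fin: "\<exists>B. finite B \<and> summand_space v nu z k a = span B"
    if "a \<in> summands d" for a using finite_dim_summand[OF that] by (auto simp: finite_dim_subspace_def)
  note * = direct_sum_dim[OF finite_summands direct_sum_summands sub fin]
  show "subspace (Sigma_div v nu z k)" unfolding S by (rule subspace_sum_set[OF finite_summands sub])
  show "\<exists>B. finite B \<and> Sigma_div v nu z k = span B" using *(1) unfolding S .
  show "real (dim (Sigma_div v nu z k)) = (\<Sum>a\<in>summands d. real (dim (summand_space v nu z k a)))"
    using *(2) unfolding S by simp
qed

end

theorem lemma4p5:
  fixes v :: "nat \<Rightarrow> real^'n"
    and nu :: "nat set \<Rightarrow> real^'n"
    and z :: "nat set \<Rightarrow> nat"
    and d k :: nat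
    and T :: "(real^'n) set"
  assumes "d = CARD('n)" and "d \<ge> 2" and "k \<ge> 1"
    and "inj_on v {..d}" and "\<not> affine_dependent (v ` {..d})"
    and "T = convex hull (v ` {..d})"
    and "\<And>F. F \<in> split_subsimp d (d - 1) \<Longrightarrow> norm (nu F) = 1 \<and> nu F \<in> normal_comp v F"
    and "\<And>f. f \<subseteq> {..d} \<Longrightarrow> f \<noteq> {} \<Longrightarrow> z f \<in> f"
  shows "direct_sum (summands d) (summand_space v nu z k)
    \<and> subspace (Sigma_div v nu z k)
    \<and> Sigma_div v nu z k \<subseteq> Hdiv T
    \<and> (\<exists>B. finite B \<and> Sigma_div v nu z k = span B)
    \<and> real (dim (Sigma_div v nu z k)) =
        real d * (real d + 1) * real ((k + d - 1) choose (d - 1))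
        + 1/2 * real d * (real d + 1) * real ((k + d - 2) choose (d - 1))
        + 1/2 * real d * (real d + 1) * (real k - 1) * real ((k + d - 2) choose (d - 2))
        + 1/2 * real d * (real d + 1)^2 * real ((k + d - 2) choose d)
    \<and> real d * (real d + 1) * real ((k + d - 1) choose (d - 1))
        + 1/2 * real d * (real d + 1) * real ((k + d - 2) choose (d - 1))
        + 1/2 * real d * (real d + 1) * (real k - 1) * real ((k + d - 2) choose (d - 2))
        + 1/2 * real d * (real d + 1)^2 * real ((k + d - 2) choose d)
      = 1/2 * (real d + 1) * real ((k + d - 1) choose k) * ((real d + 1) * real k + real d)"
proof -
  interpret split_space v d nu z k
    by unfold_locales (use assms in auto)
  have "T = convex hull (v ` {..d})" by fact
  then have T: "T = simplex.T v d" by (simp add: T_def)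
  show ?thesis
    unfolding T using direct_sum_summands Sigma_div_finite_dim Sigma_div_subset_Hdiv dim_summands dim_formula_eq[OF d2 k1]
    by simp
qed

end
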